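(* Let $M$ be a closed connected oriented three-manifold with a positive volume form $\mathrm{dvol}_M$. Let $\mathcal{V}$ be the space of positive divergence-free frames on $(M,\mathrm{dvol}_M)$ and let $\mathcal{V}^{\mathrm{reg}}\subset\mathcal{V}$ be the set of regular ones. Then $\mathcal{V}^{\mathrm{reg}}$ is open and dense in $\mathcal{V}$.
   Context: A positive divergence-free frame on $(M,\mathrm{dvol}_M)$ is a triple $v=(v_1,v_2,v_3)$ of smooth vector fields on $M$ such that $\mathcal{L}_{v_i}\mathrm{dvol}_M=0$ for $i=1,2,3$ and $\mathrm{dvol}_M(v_1,v_2,v_3)>0$ everywhere on $M$. The space $\mathcal{V}$ of all such frames carries the $C^\infty$ topology; it is an open subset of the Fréchet space of triples of divergence-free vector fields. Let $\mathbb{H}$ be the quaternions and let $J_1,J_2,J_3$ denote left multiplication by $\mathbf{i},\mathbf{j},\mathbf{k}$ on $\mathbb{H}$. The Fueter operator associated to $v\in\mathcal{V}$ is $$D_v:C^\infty(M,\mathbb{H})\to C^\infty(M,\mathbb{H}),\qquad D_vf:=J_1\partial_{v_1}f+J_2\partial_{v_2}f+J_3\partial_{v_3}f.$$ A frame $v\in\mathcal{V}$ is called regular if every solution $f:M\to\mathbb{H}$ of $D_vf=0$ is constant. *)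

theory Defs
  imports "HOL-Analysis.Analysis"
begin

definition partial_deriv :: "'n::finite \<Rightarrow> (real^'n \<Rightarrow> 'b::real_normed_vector) \<Rightarrow> real^'n \<Rightarrow> 'b" where
  "partial_deriv i f x = frechet_derivative f (at x) (axis i 1)"

fun iter_partial :: "'n::finite list \<Rightarrow> (real^'n \<Rightarrow> 'b::real_normed_vector) \<Rightarrow> real^'n \<Rightarrow> 'b" where
  "iter_partial [] f = f"
| "iter_partial (i # is) f = partial_deriv i (iter_partial is f)"

text \<open>Only used for open \<open>S\<close>. All iterated partial derivatives being (Frechet) differentiable,
  hence continuous, on \<open>S\<close> is the usual notion of a \<open>C\<^sup>\<infinity>\<close> map.\<close>

definition smooth_on :: "(real^'n::finite) set \<Rightarrow> (real^'n \<Rightarrow> 'b::real_normed_vector) \<Rightarrow> bool" where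
  "smooth_on S f \<longleftrightarrow> (\<forall>is. \<forall>x\<in>S. iter_partial is f differentiable (at x))"

text \<open>The manifold is the whole type \<open>'a\<close>. Coordinate maps are total functions, but only their
  values on the chart domain matter.\<close>

type_synonym 'a chart = "'a set \<times> ('a \<Rightarrow> real^3)"

abbreviation cdom :: "'a chart \<Rightarrow> 'a set" where
  "cdom c \<equiv> fst c"

abbreviation coord :: "'a chart \<Rightarrow> 'a \<Rightarrow> real^3" where
  "coord c \<equiv> snd c"

definition chart_inv :: "'a chart \<Rightarrow> real^3 \<Rightarrow> 'a" where
  "chart_inv c = inv_into (cdom c) (coord c)"

definition cimage :: "'a chart \<Rightarrow> (real^3) set" where
  "cimage c = coord c ` cdom c"

definition is_chart :: "'a::topological_space chart \<Rightarrow> bool" where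
  "is_chart c \<longleftrightarrow> open (cdom c) \<and> open (cimage c) \<and>
     homeomorphism (cdom c) (cimage c) (coord c) (chart_inv c)"

text \<open>The derivative, at the point \<open>p\<close>, of the change of coordinates from \<open>c\<close> to \<open>d\<close>.\<close>

definition transition_deriv :: "'a chart \<Rightarrow> 'a chart \<Rightarrow> 'a \<Rightarrow> real^3 \<Rightarrow> real^3" where
  "transition_deriv c d p = frechet_derivative (coord d \<circ> chart_inv c) (at (coord c p))"

text \<open>An oriented smooth atlas, not required to be maximal. Up to canonical identification, the
  notions below do not change when the atlas is enlarged to the maximal compatible oriented one.\<close>

definition oriented_smooth_atlas :: "'a::topological_space chart set \<Rightarrow> bool" where
  "oriented_smooth_atlas A \<longleftrightarrow>
     (\<forall>c\<in>A. is_chart c) \<and> (\<Union>c\<in>A. cdom c) = UNIV \<and>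
     (\<forall>c\<in>A. \<forall>d\<in>A. smooth_on (coord c ` (cdom c \<inter> cdom d)) (coord d \<circ> chart_inv c)) \<and>
     (\<forall>c\<in>A. \<forall>d\<in>A. \<forall>p \<in> cdom c \<inter> cdom d. det (matrix (transition_deriv c d p)) > 0)"

definition smooth_fun :: "'a chart set \<Rightarrow> ('a \<Rightarrow> 'b::real_normed_vector) \<Rightarrow> bool" where
  "smooth_fun A f \<longleftrightarrow> (\<forall>c\<in>A. smooth_on (cimage c) (f \<circ> chart_inv c))"

text \<open>A tangent vector at \<open>p\<close> is a family of coordinate vectors, one for each chart around \<open>p\<close>,
  transforming by the derivatives of the coordinate changes. A vector field \<open>X\<close> thus has the
  component vector \<open>X c p\<close> at \<open>p\<close> in the chart \<open>c\<close>; the value 0 off the chart domains makes the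
  encoding unique.\<close>

type_synonym 'a vfield = "'a chart \<Rightarrow> 'a \<Rightarrow> real^3"

definition smooth_vfields :: "'a chart set \<Rightarrow> 'a vfield set" where
  "smooth_vfields A = {X.
     (\<forall>c\<in>A. \<forall>d\<in>A. \<forall>p \<in> cdom c \<inter> cdom d. X d p = transition_deriv c d p (X c p)) \<and>
     (\<forall>c\<in>A. smooth_on (cimage c) (X c \<circ> chart_inv c)) \<and>
     (\<forall>c p. \<not> (c \<in> A \<and> p \<in> cdom c) \<longrightarrow> X c p = 0)}"

type_synonym 'a form3 = "'a chart \<Rightarrow> 'a \<Rightarrow> real^3 \<Rightarrow> real^3 \<Rightarrow> real^3 \<Rightarrow> real"

definition alternating_trilinear :: "(real^3 \<Rightarrow> real^3 \<Rightarrow> real^3 \<Rightarrow> real) \<Rightarrow> bool" where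
  "alternating_trilinear w \<longleftrightarrow>
     (\<forall>b d. linear (\<lambda>a. w a b d)) \<and> (\<forall>a d. linear (\<lambda>b. w a b d)) \<and> (\<forall>a b. linear (\<lambda>d. w a b d)) \<and>
     (\<forall>a b. w a a b = 0 \<and> w a b a = 0 \<and> w b a a = 0)"

definition smooth_3form :: "'a chart set \<Rightarrow> 'a form3 \<Rightarrow> bool" where
  "smooth_3form A \<omega> \<longleftrightarrow>
     (\<forall>c\<in>A. \<forall>p\<in>cdom c. alternating_trilinear (\<omega> c p)) \<and>
     (\<forall>c\<in>A. \<forall>d\<in>A. \<forall>p \<in> cdom c \<inter> cdom d. \<forall>u v w.
        \<omega> c p u v w =
        \<omega> d p (transition_deriv c d p u) (transition_deriv c d p v) (transition_deriv c d p w)) \<and>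
     (\<forall>c\<in>A. \<forall>u v w. smooth_on (cimage c) (\<lambda>x. \<omega> c (chart_inv c x) u v w))"

definition positive_volume_form :: "'a chart set \<Rightarrow> 'a form3 \<Rightarrow> bool" where
  "positive_volume_form A \<omega> \<longleftrightarrow> smooth_3form A \<omega> \<and>
     (\<forall>c\<in>A. \<forall>p\<in>cdom c. \<omega> c p (axis 1 1) (axis 2 1) (axis 3 1) > 0)"

definition lie_bracket :: "(real^3 \<Rightarrow> real^3) \<Rightarrow> (real^3 \<Rightarrow> real^3) \<Rightarrow> real^3 \<Rightarrow> real^3" where
  "lie_bracket F G x = frechet_derivative G (at x) (F x) - frechet_derivative F (at x) (G x)"

text \<open>The Lie derivative of a 3-form along a vector field, in a chart, by the Leibniz rule
  \<open>(L\<^sub>X \<omega>)(Y\<^sub>1,Y\<^sub>2,Y\<^sub>3) = X(\<omega>(Y\<^sub>1,Y\<^sub>2,Y\<^sub>3)) - \<omega>([X,Y\<^sub>1],Y\<^sub>2,Y\<^sub>3) - \<omega>(Y\<^sub>1,[X,Y\<^sub>2],Y\<^sub>3) - \<omega>(Y\<^sub>1,Y\<^sub>2,[X,Y\<^sub>3])\<close>.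
  The right-hand side is tensorial in the \<open>Y\<^sub>i\<close>, so its value on given tangent vectors may be computed
  with the fields \<open>Y\<^sub>i\<close> that are constant in the chart.\<close>

definition lie_derivative :: "'a vfield \<Rightarrow> 'a form3 \<Rightarrow> 'a form3" where
  "lie_derivative X \<omega> c p u v w =
     (let F = X c \<circ> chart_inv c; x = coord c p in
        frechet_derivative (\<lambda>y. \<omega> c (chart_inv c y) u v w) (at x) (F x)
        - \<omega> c p (lie_bracket F (\<lambda>_. u) x) v w
        - \<omega> c p u (lie_bracket F (\<lambda>_. v) x) w
        - \<omega> c p u v (lie_bracket F (\<lambda>_. w) x))"

definition divergence_free :: "'a chart set \<Rightarrow> 'a form3 \<Rightarrow> 'a vfield \<Rightarrow> bool" where
  "divergence_free A \<omega> X \<longleftrightarrow>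
     (\<forall>c\<in>A. \<forall>p\<in>cdom c. \<forall>u v w. lie_derivative X \<omega> c p u v w = 0)"

type_synonym 'a frame = "'a vfield \<times> 'a vfield \<times> 'a vfield"

definition div_free_frames :: "'a chart set \<Rightarrow> 'a form3 \<Rightarrow> 'a frame set" where
  "div_free_frames A \<omega> = {(v1, v2, v3).
     v1 \<in> smooth_vfields A \<and> v2 \<in> smooth_vfields A \<and> v3 \<in> smooth_vfields A \<and>
     divergence_free A \<omega> v1 \<and> divergence_free A \<omega> v2 \<and> divergence_free A \<omega> v3 \<and>
     (\<forall>c\<in>A. \<forall>p\<in>cdom c. \<omega> c p (v1 c p) (v2 c p) (v3 c p) > 0)}"

text \<open>The \<open>C\<^sup>\<infinity>\<close> topology: uniform convergence, on compact subsets of charts, of all iterated partial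
  derivatives of the components. As \<open>K\<close> is compact, the pointwise strict bound below says that the
  corresponding seminorm of \<open>Y - X\<close> is less than \<open>e\<close>.\<close>

definition vfield_nhd ::
    "'a chart set \<Rightarrow> 'a vfield \<Rightarrow> 'a chart \<Rightarrow> (real^3) set \<Rightarrow> 3 list \<Rightarrow> real \<Rightarrow> 'a vfield set" where
  "vfield_nhd A X c K is e = {Y \<in> smooth_vfields A.
     \<forall>x\<in>K. norm (iter_partial is (\<lambda>y. Y c (chart_inv c y) - X c (chart_inv c y)) x) < e}"

definition vfield_topology :: "'a chart set \<Rightarrow> 'a vfield topology" where
  "vfield_topology A = topology_generated_by
     {vfield_nhd A X c K is e | X c K is e.
        X \<in> smooth_vfields A \<and> c \<in> A \<and> compact K \<and> K \<subseteq> cimage c \<and> e > 0}"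

definition frame_topology :: "'a chart set \<Rightarrow> 'a form3 \<Rightarrow> 'a frame topology" where
  "frame_topology A \<omega> = subtopology
     (prod_topology (vfield_topology A) (prod_topology (vfield_topology A) (vfield_topology A)))
     (div_free_frames A \<omega>)"

text \<open>The vector \<open>(a, b, c, d)\<close> stands for \<open>a + b i + c j + d k\<close>.\<close>

type_synonym quat = "real^4"

definition quat_mult :: "quat \<Rightarrow> quat \<Rightarrow> quat" (infixl "*\<^sub>q" 70) where
  "x *\<^sub>q y = vector
    [x$1 * y$1 - x$2 * y$2 - x$3 * y$3 - x$4 * y$4,
     x$1 * y$2 + x$2 * y$1 + x$3 * y$4 - x$4 * y$3,
     x$1 * y$3 - x$2 * y$4 + x$3 * y$1 + x$4 * y$2,
     x$1 * y$4 + x$2 * y$3 - x$3 * y$2 + x$4 * y$1]"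

definition quat_i :: quat where "quat_i = axis 2 1"
definition quat_j :: quat where "quat_j = axis 3 1"
definition quat_k :: quat where "quat_k = axis 4 1"

lemma vector_4_nth:
  "(vector [a, b, c, d] :: real^4) $ 1 = a" "(vector [a, b, c, d] :: real^4) $ 2 = b"
  "(vector [a, b, c, d] :: real^4) $ 3 = c" "(vector [a, b, c, d] :: real^4) $ 4 = d"
  by (simp_all add: vector_def)

lemma hamilton_relations:
  "quat_i *\<^sub>q quat_i = - axis 1 1" "quat_j *\<^sub>q quat_j = - axis 1 1" "quat_k *\<^sub>q quat_k = - axis 1 1"
  "quat_i *\<^sub>q quat_j = quat_k" "quat_j *\<^sub>q quat_k = quat_i" "quat_k *\<^sub>q quat_i = quat_j"
  "axis 1 1 *\<^sub>q x = x" "x *\<^sub>q axis 1 1 = x"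
  by (simp_all add: quat_mult_def quat_i_def quat_j_def quat_k_def vec_eq_iff forall_4
      vector_4_nth axis_def)

text \<open>The derivative of \<open>f\<close> along the vector field \<open>X\<close>, computed in an arbitrary chart around the
  point; the chain rule and the transformation law of \<open>X\<close> make it independent of the choice.\<close>

definition dir_deriv ::
    "'a chart set \<Rightarrow> 'a vfield \<Rightarrow> ('a \<Rightarrow> 'b::real_normed_vector) \<Rightarrow> 'a \<Rightarrow> 'b" where
  "dir_deriv A X f p =
     (let c = SOME c. c \<in> A \<and> p \<in> cdom c in
        frechet_derivative (f \<circ> chart_inv c) (at (coord c p)) (X c p))"

definition fueter :: "'a chart set \<Rightarrow> 'a frame \<Rightarrow> ('a \<Rightarrow> quat) \<Rightarrow> 'a \<Rightarrow> quat" where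
  "fueter A = (\<lambda>(v1, v2, v3) f p.
     quat_i *\<^sub>q dir_deriv A v1 f p + quat_j *\<^sub>q dir_deriv A v2 f p + quat_k *\<^sub>q dir_deriv A v3 f p)"

definition regular_frame :: "'a chart set \<Rightarrow> 'a frame \<Rightarrow> bool" where
  "regular_frame A v \<longleftrightarrow>
     (\<forall>f. smooth_fun A f \<and> (\<forall>p. fueter A v f p = 0) \<longrightarrow> (\<exists>q. \<forall>p. f p = q))"

definition regular_div_free_frames :: "'a chart set \<Rightarrow> 'a form3 \<Rightarrow> 'a frame set" where
  "regular_div_free_frames A \<omega> = {v \<in> div_free_frames A \<omega>. regular_frame A v}"

end

theory Submission
  imports Defs "HOL-Complex_Analysis.Great_Picard"
begin

text \<open>
  For divergence-free fields \<open>w\<close> the operator \<open>D\<^sub>w\<close> is symmetric for the \<open>L\<^sup>2\<close> product given by the volume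
  form, and for a frame \<open>v\<close> integration by parts gives the elliptic estimate
  \<open>N (k+1) f \<le> C (N k (D\<^sub>v f) + \<parallel>f\<parallel>)\<close>, where \<open>N k\<close> adds up the \<open>L\<^sup>2\<close> norms of all derivatives of
  order at most \<open>k\<close> along the frame. All arguments stay within smooth functions: with a Sobolev inequality and
  Arzela--Ascoli, the kernel is finite-dimensional, and \<open>N (k+1) f \<le> C N k (D\<^sub>v f)\<close> holds for some \<open>k\<close> and
  all \<open>f\<close> orthogonal to it.

  Openness: if the kernel consists of the constants, which every \<open>D\<^sub>w\<close> annihilates, this last estimate
  survives a small perturbation of \<open>v\<close>.

  Density: let \<open>f\<close> be a nonconstant solution. The integral of \<open>\<langle>f, D\<^sub>w f\<rangle>\<close> is nonzero for some triple \<open>w\<close>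
  of divergence-free fields: testing with fields that correspond to exact 2-forms supported near a point,
  its vanishing for all \<open>w\<close> would say that all \<open>\<langle>\<partial>\<^sub>j f, J\<^sub>i \<partial>\<^sub>l f\<rangle>\<close> vanish, and with \<open>D\<^sub>v f = 0\<close> that \<open>df = 0\<close>.
  So the quadratic form of \<open>D\<^sub>w\<close> on the kernel is not zero, and the kernel of \<open>D\<close> for \<open>v + t w\<close> has
  smaller dimension for all small \<open>t > 0\<close>. A frame minimizing the dimension of the kernel in a given open
  set is therefore regular.
\<close>

section \<open>Smooth maps on Euclidean space\<close>

text \<open>By the quaternion relations the mixed terms of \<open>|D_v f|^2\<close> are products
  \<open><d_i f, J_k d_j f>\<close>. Their integrals reduce, by two integrations by parts, to
  commutators of the frame fields, which are of first order: hence the elliptic estimate. If these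
  products vanish at a point, \<open>D_v f = 0\<close> forces \<open>df = 0\<close> there. The same
  products arise in the density argument: if \<open>w_k\<close> contracted with the volume form is
  \<open>du dx\<close> up to sign and the other two fields are zero, the quadratic form of
  \<open>D_w\<close> at \<open>f\<close> is twice the integral of
  \<open>u <d_j f, J_k d_l f>\<close> with coordinate derivatives, because \<open>J_k\<close> is
  skew and second derivatives commute. The estimate off the kernel is proved by contradiction, at an
  order \<open>k\<close> that is not explicit. That suffices: a first order perturbation costs the
  one derivative that the estimate gains, so it is absorbed at the same \<open>k\<close>, and the
  smooth topology controls the coefficients to every finite order. Dimensions are counted by
  orthonormal families, and from perturbation theory only the weakest conclusion is drawn: the
  dimension cannot stay as large as it was. As dimensions are natural numbers, this is
  enough.\<close>

fun ndiff :: "nat \<Rightarrow> (real^'n::finite) set \<Rightarrow> (real^'n \<Rightarrow> 'b::real_normed_vector) \<Rightarrow> bool" where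
  "ndiff 0 S f = True"
| "ndiff (Suc k) S f = ((\<forall>x\<in>S. f differentiable at x) \<and> (\<forall>i. ndiff k S (partial_deriv i f)))"

lemma iter_partial_append: "iter_partial (is @ js) f = iter_partial is (iter_partial js f)"
  by (induction "is") auto

text \<open>Links smoothness to an inductive notion of finite order. The product, chain and quotient
  rules lead to new functions after one derivative, so they need an induction on the order.
  \<open>ndiff\<close> strips the innermost derivative while \<open>iter_partial\<close> adds the
  outermost one, hence the split of the list at its end.\<close>

lemma ndiff_iff: "ndiff k S f \<longleftrightarrow> (\<forall>is. length is < k \<longrightarrow> (\<forall>x\<in>S. iter_partial is f differentiable at x))"
proof (induction k arbitrary: f)
  case 0
  then show ?case by simp
next
  case (Suc k)
  show ?case
  proof
    assume L: "ndiff (Suc k) S f"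
    show "\<forall>is. length is < Suc k \<longrightarrow> (\<forall>x\<in>S. iter_partial is f differentiable at x)"
    proof (intro allI impI)
      fix "is" :: "'a list" assume l: "length is < Suc k"
      show "\<forall>x\<in>S. iter_partial is f differentiable at x"
      proof (cases "is" rule: rev_cases)
        case Nil
        then show ?thesis using L by simp
      next
        case (snoc js j)
        then have "length js < k" using l by simp
        moreover have "ndiff k S (partial_deriv j f)" using L by simp
        ultimately show ?thesis using Suc.IH snoc by (simp add: iter_partial_append)
      qed
    qed
  next
    assume R: "\<forall>is. length is < Suc k \<longrightarrow> (\<forall>x\<in>S. iter_partial is f differentiable at x)"
    have "\<forall>x\<in>S. f differentiable at x" using R[rule_format, of "[]"] by simp
    moreover have "ndiff k S (partial_deriv i f)" for i
      unfolding Suc.IH using R[rule_format, of "_ @ [i]"] by (simp add: iter_partial_append)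
    ultimately show "ndiff (Suc k) S f" by simp
  qed
qed

lemma smooth_on_iff_ndiff: "smooth_on S f \<longleftrightarrow> (\<forall>k. ndiff k S f)"
  unfolding smooth_on_def ndiff_iff by (meson lessI)

lemma smooth_on_differentiable: "smooth_on S f \<Longrightarrow> x \<in> S \<Longrightarrow> f differentiable at x"
  unfolding smooth_on_def by (metis iter_partial.simps(1))

lemma smooth_on_partial: "smooth_on S f \<Longrightarrow> smooth_on S (partial_deriv i f)"
  unfolding smooth_on_iff_ndiff by (metis ndiff.simps(2))

lemma smooth_on_iter_partial: "smooth_on S f \<Longrightarrow> smooth_on S (iter_partial is f)"
  by (induction "is") (auto simp: smooth_on_partial)

lemma smooth_on_subset: "smooth_on S f \<Longrightarrow> T \<subseteq> S \<Longrightarrow> smooth_on T f"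
  unfolding smooth_on_def by blast

lemma smooth_on_local: "(\<And>x. x \<in> S \<Longrightarrow> \<exists>T. x \<in> T \<and> smooth_on T f) \<Longrightarrow> smooth_on S f"
  unfolding smooth_on_def by blast

lemma smooth_on_continuous: "smooth_on S f \<Longrightarrow> continuous_on S f"
  by (meson continuous_at_imp_continuous_on differentiable_imp_continuous_within smooth_on_differentiable)

lemma ndiff_mono: "ndiff k S f \<Longrightarrow> l \<le> k \<Longrightarrow> ndiff l S f"
  unfolding ndiff_iff by (meson less_le_trans)

lemma partial_deriv_eq: "(f has_derivative f') (at x) \<Longrightarrow> partial_deriv i f x = f' (axis i 1)"
  unfolding partial_deriv_def by (metis frechet_derivative_at)

lemma frechet_cong_open:
  assumes "open S" "x \<in> S" "\<And>y. y \<in> S \<Longrightarrow> f y = g y"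
  shows "frechet_derivative f (at x) = frechet_derivative g (at x)"
proof -
  have "(f has_derivative f') (at x) \<longleftrightarrow> (g has_derivative f') (at x)" for f'
    using has_derivative_transform_within_open[of f f' x UNIV S g]
      has_derivative_transform_within_open[of g f' x UNIV S f] assms by auto
  then show ?thesis unfolding frechet_derivative_def by simp
qed

lemma differentiable_cong_open:
  assumes "open S" "x \<in> S" "\<And>y. y \<in> S \<Longrightarrow> f y = g y"
  shows "f differentiable at x \<longleftrightarrow> g differentiable at x"
  using has_derivative_transform_within_open[of f _ x UNIV S g]
      has_derivative_transform_within_open[of g _ x UNIV S f] assms
  unfolding differentiable_def by metis

lemma partial_deriv_cong_open:
  assumes "open S" "x \<in> S" "\<And>y. y \<in> S \<Longrightarrow> f y = g y"
  shows "partial_deriv i f x = partial_deriv i g x"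
  unfolding partial_deriv_def using frechet_cong_open[OF assms, of "\<lambda>x. x"] by simp

text \<open>Equality on an open set passes to all derivatives. The rules below use it to replace a
  partial derivative by its formula, which is valid on \<open>S\<close> only.\<close>

lemma ndiff_cong_imp:
  assumes "open S" "\<And>y. y \<in> S \<Longrightarrow> f y = g y" "ndiff k S f"
  shows "ndiff k S g"
  using assms(2,3)
proof (induction k arbitrary: f g)
  case (Suc k)
  have "ndiff k S (partial_deriv i g)" for i
    by (rule Suc.IH[of "partial_deriv i f"])
       (use Suc.prems partial_deriv_cong_open[OF assms(1), of _ f g] in auto)
  moreover have "g differentiable at x" if "x \<in> S" for x
    using differentiable_cong_open[OF assms(1) that, of f g] Suc.prems that by simp
  ultimately show ?case by simp
qed simp

lemma ndiff_cong:
  assumes "open S" "\<And>y. y \<in> S \<Longrightarrow> f y = g y"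
  shows "ndiff k S f = ndiff k S g"
  using ndiff_cong_imp[OF assms(1), of f g k] ndiff_cong_imp[OF assms(1), of g f k] assms(2) by auto

lemma smooth_on_cong:
  assumes "open S" "\<And>y. y \<in> S \<Longrightarrow> f y = g y"
  shows "smooth_on S f = smooth_on S g"
  unfolding smooth_on_iff_ndiff using ndiff_cong[OF assms] by auto

lemma frechet_has_derivative:
  "f differentiable at x \<Longrightarrow> (f has_derivative frechet_derivative f (at x)) (at x)"
  using frechet_derivative_works by blast

lemma axis_expansion: "(h::real^'n::finite) = (\<Sum>i\<in>UNIV. h $ i *\<^sub>R axis i 1)"
  by (simp add: basis_expansion flip: scalar_mult_eq_scaleR)

lemma linear_axis_expansion:
  assumes "linear L" shows "L (h::real^'n::finite) = (\<Sum>i\<in>UNIV. h $ i *\<^sub>R L (axis i 1))"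
  by (subst axis_expansion) (simp add: linear_sum[OF assms] linear_scale[OF assms])

lemma frechet_expansion:
  assumes "f differentiable at x"
  shows "frechet_derivative f (at x) h = (\<Sum>i\<in>UNIV. h $ i *\<^sub>R partial_deriv i f x)"
  unfolding partial_deriv_def
  by (rule linear_axis_expansion[OF linear_frechet_derivative[OF assms]])

lemma has_derivative_partial:
  assumes "f differentiable at x"
  shows "(f has_derivative (\<lambda>h. \<Sum>i\<in>UNIV. h $ i *\<^sub>R partial_deriv i f x)) (at x)"
  using frechet_has_derivative[OF assms] frechet_expansion[OF assms]
  by (metis (no_types, lifting) ext)

lemma partial_deriv_const [simp]: "partial_deriv i (\<lambda>x. c) = (\<lambda>x. 0)"
  by (rule ext) (rule partial_deriv_eq, simp)

lemma ndiff_const: "ndiff k S (\<lambda>x. c)"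
  by (induction k arbitrary: c) auto

lemma partial_deriv_add:
  "f differentiable at x \<Longrightarrow> g differentiable at x \<Longrightarrow>
   partial_deriv i (\<lambda>x. f x + g x) x = partial_deriv i f x + partial_deriv i g x"
  using partial_deriv_eq[OF has_derivative_add[OF frechet_has_derivative frechet_has_derivative], of f x g i]
  by (simp add: partial_deriv_def)

lemma partial_deriv_bounded_linear:
  "bounded_linear h \<Longrightarrow> f differentiable at x \<Longrightarrow>
   partial_deriv i (\<lambda>x. h (f x)) x = h (partial_deriv i f x)"
  using partial_deriv_eq[OF bounded_linear.has_derivative[OF _ frechet_has_derivative], of h f x i]
  by (simp add: partial_deriv_def)

lemma partial_deriv_bilinear:
  "bounded_bilinear p \<Longrightarrow> f differentiable at x \<Longrightarrow> g differentiable at x \<Longrightarrow>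
   partial_deriv i (\<lambda>x. p (f x) (g x)) x = p (f x) (partial_deriv i g x) + p (partial_deriv i f x) (g x)"
  using partial_deriv_eq[OF bounded_bilinear.FDERIV[OF _ frechet_has_derivative frechet_has_derivative], of p f x g i]
  by (simp add: partial_deriv_def)

lemma ndiff_add:
  assumes "open S" "ndiff k S f" "ndiff k S g" shows "ndiff k S (\<lambda>x. f x + g x)"
  using assms(2,3)
proof (induction k arbitrary: f g)
  case (Suc k)
  have "ndiff k S (partial_deriv i (\<lambda>x. f x + g x))" for i
    by (rule ndiff_cong_imp[OF assms(1) _ Suc.IH[of "partial_deriv i f" "partial_deriv i g"]])
      (use Suc.prems in \<open>auto simp: partial_deriv_add\<close>)
  then show ?case using Suc.prems by auto
qed simp

lemma ndiff_bounded_linear: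
  assumes "open S" "bounded_linear h" "ndiff k S f" shows "ndiff k S (\<lambda>x. h (f x))"
  using assms(3)
proof (induction k arbitrary: f)
  case (Suc k)
  have "ndiff k S (partial_deriv i (\<lambda>x. h (f x)))" for i
    by (rule ndiff_cong_imp[OF assms(1) _ Suc.IH[of "partial_deriv i f"]])
      (use Suc.prems assms(2) in \<open>auto simp: partial_deriv_bounded_linear\<close>)
  moreover have "(\<lambda>x. h (f x)) differentiable at x" if "x \<in> S" for x
  proof -
    have "f differentiable at x" using Suc.prems that by auto
    from bounded_linear.has_derivative[OF assms(2) frechet_has_derivative[OF this]]
    show ?thesis by (rule differentiableI)
  qed
  ultimately show ?case by simp
qed simp

lemma ndiff_bilinear:
  assumes "open S" "bounded_bilinear p" "ndiff k S f" "ndiff k S g" shows "ndiff k S (\<lambda>x. p (f x) (g x))"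
  using assms(3,4)
proof (induction k arbitrary: f g)
  case (Suc k)
  have lo: "ndiff k S f" "ndiff k S g"
    using ndiff_mono[OF Suc.prems(1)] ndiff_mono[OF Suc.prems(2)] by auto
  have "ndiff k S (\<lambda>x. p (f x) (partial_deriv i g x) + p (partial_deriv i f x) (g x))" for i
    by (intro ndiff_add assms(1) Suc.IH) (use Suc.prems lo in auto)
  then have "ndiff k S (partial_deriv i (\<lambda>x. p (f x) (g x)))" for i
    by (rule ndiff_cong_imp[OF assms(1), rotated])
      (use Suc.prems in \<open>auto simp: partial_deriv_bilinear[OF assms(2)]\<close>)
  moreover have "(\<lambda>x. p (f x) (g x)) differentiable at x" if "x \<in> S" for x
  proof -
    have "f differentiable at x" "g differentiable at x" using Suc.prems that by auto
    from bounded_bilinear.FDERIV[OF assms(2) frechet_has_derivative[OF this(1)] frechet_has_derivative[OF this(2)]]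
    show ?thesis by (rule differentiableI)
  qed
  ultimately show ?case by simp
qed simp

lemma partial_deriv_compose:
  assumes "g differentiable at x" "f differentiable at (g x)"
  shows "partial_deriv i (f \<circ> g) x = (\<Sum>j\<in>UNIV. (partial_deriv i g x) $ j *\<^sub>R partial_deriv j f (g x))"
proof -
  have "partial_deriv i (f \<circ> g) x = frechet_derivative f (at (g x)) (frechet_derivative g (at x) (axis i 1))"
    using partial_deriv_eq[OF diff_chain_at[OF frechet_has_derivative[OF assms(1)] frechet_has_derivative[OF assms(2)]]]
    by simp
  also have "\<dots> = (\<Sum>j\<in>UNIV. (partial_deriv i g x) $ j *\<^sub>R partial_deriv j f (g x))"
    unfolding partial_deriv_def[of i g x] by (rule frechet_expansion[OF assms(2)])
  finally show ?thesis .
qed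

lemma ndiff_sum:
  assumes "open S" "\<And>i. i \<in> I \<Longrightarrow> ndiff k S (f i)" shows "ndiff k S (\<lambda>x. \<Sum>i\<in>I. f i x)"
  using assms(2) by (induction I rule: infinite_finite_induct) (auto intro: ndiff_add ndiff_const assms(1))

text \<open>The induction varies \<open>f\<close> and fixes \<open>g\<close>: the chain rule gives
  products of components of the derivative of \<open>g\<close> with functions
  \<open>partial_deriv j f \<circ> g\<close>, and the latter fall under the induction
  hypothesis.\<close>

lemma ndiff_compose:
  assumes "open S" "open T" "ndiff k T f" "ndiff k S g" "g ` S \<subseteq> T"
  shows "ndiff k S (f \<circ> g)"
  using assms(3,4)
proof (induction k arbitrary: f)
  case (Suc k)
  have g: "ndiff k S g" using ndiff_mono[OF Suc.prems(2)] by simp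
  have "ndiff k S (\<lambda>x. \<Sum>j\<in>UNIV. (partial_deriv i g x) $ j *\<^sub>R partial_deriv j f (g x))" for i
  proof (intro ndiff_sum assms(1) ndiff_bilinear[OF assms(1) bounded_bilinear_scaleR])
    fix j
    show "ndiff k S (\<lambda>x. partial_deriv i g x $ j)"
      by (rule ndiff_bounded_linear[OF assms(1) bounded_linear_vec_nth]) (use Suc.prems in auto)
    show "ndiff k S (\<lambda>x. partial_deriv j f (g x))"
      using Suc.IH[of "partial_deriv j f"] Suc.prems g by (auto simp: comp_def)
  qed
  then have A: "ndiff k S (partial_deriv i (f \<circ> g))" for i
    by (rule ndiff_cong_imp[OF assms(1), rotated])
      (subst partial_deriv_compose, use Suc.prems assms(5) in auto)
  have B: "f \<circ> g differentiable at x" if "x \<in> S" for x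
    using Suc.prems assms(5) that by (intro differentiable_chain_at) auto
  show ?case unfolding ndiff.simps by (intro conjI ballI allI A B)
qed simp

text \<open>The derivative of \<open>1 / f\<close> is a product of \<open>1 / f\<close> twice with
  the derivative of \<open>f\<close>, so the induction closes with \<open>f\<close> fixed.\<close>

lemma ndiff_inverse:
  fixes f :: "real^'n::finite \<Rightarrow> real"
  assumes "open S" "ndiff k S f" "\<And>x. x \<in> S \<Longrightarrow> f x \<noteq> 0" shows "ndiff k S (\<lambda>x. inverse (f x))"
  using assms(2)
proof (induction k)
  case (Suc k)
  have der: "((\<lambda>x. inverse (f x)) has_derivative
      (\<lambda>h. - (inverse (f x) * frechet_derivative f (at x) h * inverse (f x)))) (at x)" if "x \<in> S" for x
    using assms(3)[OF that] Suc.prems that by (intro Deriv.has_derivative_inverse frechet_has_derivative) auto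
  have I: "ndiff k S (\<lambda>x. inverse (f x))" using Suc.IH ndiff_mono[OF Suc.prems] by simp
  have "ndiff k S (partial_deriv i (\<lambda>x. inverse (f x)))" for i
  proof (rule ndiff_cong_imp[OF assms(1)])
    show "ndiff k S (\<lambda>x. - (inverse (f x) * partial_deriv i f x * inverse (f x)))"
      using I Suc.prems
      by (intro ndiff_bounded_linear[OF assms(1) bounded_linear_minus[OF bounded_linear_ident]]
        ndiff_bilinear[OF assms(1) bounded_bilinear_mult]) auto
    show "- (inverse (f x) * partial_deriv i f x * inverse (f x)) = partial_deriv i (\<lambda>x. inverse (f x)) x"
      if "x \<in> S" for x
      using partial_deriv_eq[OF der[OF that], of i] by (simp add: partial_deriv_def)
  qed
  moreover have "\<forall>x\<in>S. (\<lambda>x. inverse (f x)) differentiable at x"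
    using der unfolding differentiable_def by blast
  ultimately show ?case unfolding ndiff.simps by (intro conjI allI)
qed simp

lemma smooth_on_const [simp]: "smooth_on S (\<lambda>x. c)"
  by (simp add: smooth_on_iff_ndiff ndiff_const)

lemma smooth_on_add: "open S \<Longrightarrow> smooth_on S f \<Longrightarrow> smooth_on S g \<Longrightarrow> smooth_on S (\<lambda>x. f x + g x)"
  by (simp add: smooth_on_iff_ndiff ndiff_add)

lemma smooth_on_sum: "open S \<Longrightarrow> (\<And>i. i \<in> I \<Longrightarrow> smooth_on S (f i)) \<Longrightarrow> smooth_on S (\<lambda>x. \<Sum>i\<in>I. f i x)"
  by (simp add: smooth_on_iff_ndiff ndiff_sum)

lemma smooth_on_linear: "open S \<Longrightarrow> bounded_linear h \<Longrightarrow> smooth_on S f \<Longrightarrow> smooth_on S (\<lambda>x. h (f x))"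
  by (simp add: smooth_on_iff_ndiff ndiff_bounded_linear)

lemma smooth_on_bilinear:
  "open S \<Longrightarrow> bounded_bilinear p \<Longrightarrow> smooth_on S f \<Longrightarrow> smooth_on S g \<Longrightarrow> smooth_on S (\<lambda>x. p (f x) (g x))"
  by (simp add: smooth_on_iff_ndiff ndiff_bilinear)

lemma smooth_on_compose:
  "open S \<Longrightarrow> open T \<Longrightarrow> smooth_on T f \<Longrightarrow> smooth_on S g \<Longrightarrow> g ` S \<subseteq> T \<Longrightarrow> smooth_on S (f \<circ> g)"
  unfolding smooth_on_iff_ndiff by (intro allI ndiff_compose[of S T]) simp_all

lemma smooth_on_inverse:
  fixes f :: "real^'n::finite \<Rightarrow> real"
  shows "open S \<Longrightarrow> smooth_on S f \<Longrightarrow> (\<And>x. x \<in> S \<Longrightarrow> f x \<noteq> 0) \<Longrightarrow> smooth_on S (\<lambda>x. inverse (f x))"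
  by (simp add: smooth_on_iff_ndiff ndiff_inverse)

lemmas smooth_on_mult = smooth_on_bilinear[OF _ bounded_bilinear_mult]
lemmas smooth_on_scaleR = smooth_on_bilinear[OF _ bounded_bilinear_scaleR]
lemmas smooth_on_inner = smooth_on_bilinear[OF _ bounded_bilinear_inner]
lemmas smooth_on_nth = smooth_on_linear[OF _ bounded_linear_vec_nth]
lemmas smooth_on_minus = smooth_on_linear[OF _ bounded_linear_minus[OF bounded_linear_ident]]

lemma smooth_on_diff:
  "open S \<Longrightarrow> smooth_on S f \<Longrightarrow> smooth_on S g \<Longrightarrow> smooth_on S (\<lambda>x. f x - g x)"
  using smooth_on_add[of S f "\<lambda>x. - g x"] smooth_on_minus[of S g] by simp

lemma smooth_on_ident [simp]: "smooth_on S (\<lambda>x. x)"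
proof -
  have "ndiff k S (\<lambda>x. x)" for k
  proof (cases k)
    case (Suc l)
    have "partial_deriv i (\<lambda>x. x) = (\<lambda>x. axis i 1)" for i :: 'a
      by (rule ext) (rule partial_deriv_eq, rule has_derivative_ident)
    then show ?thesis using Suc ndiff_const by auto
  qed simp
  then show ?thesis by (simp add: smooth_on_iff_ndiff)
qed

lemma smooth_on_frechet:
  assumes "open S" "smooth_on S f" "smooth_on S F"
  shows "smooth_on S (\<lambda>x. frechet_derivative f (at x) (F x))"
proof -
  have "smooth_on S (\<lambda>x. \<Sum>i\<in>UNIV. F x $ i *\<^sub>R partial_deriv i f x)"
    by (intro smooth_on_sum smooth_on_scaleR smooth_on_nth assms smooth_on_partial)
  then show ?thesis
    by (rule smooth_on_cong[OF assms(1), THEN iffD1, rotated])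
      (rule frechet_expansion[OF smooth_on_differentiable[OF assms(2)], symmetric])
qed

section \<open>Symmetry of second partial derivatives\<close>

lemma line_has_vector_derivative:
  assumes "f differentiable at (y + s *\<^sub>R axis i 1)"
  shows "((\<lambda>s. f (y + s *\<^sub>R axis i 1)) has_vector_derivative partial_deriv i f (y + s *\<^sub>R axis i 1)) (at s)"
proof -
  have "((\<lambda>s. y + s *\<^sub>R axis i 1) has_derivative (\<lambda>h. h *\<^sub>R axis i 1)) (at s)"
    by (auto intro!: derivative_eq_intros)
  from has_derivative_compose[OF this frechet_has_derivative[OF assms]]
  have "((\<lambda>s. f (y + s *\<^sub>R axis i 1)) has_derivative
      (\<lambda>h. frechet_derivative f (at (y + s *\<^sub>R axis i 1)) (h *\<^sub>R axis i 1))) (at s)" .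
  then show ?thesis unfolding has_vector_derivative_def partial_deriv_def
    by (simp add: linear_scale[OF linear_frechet_derivative[OF assms]])
qed

text \<open>Two applications of the mean value theorem, first along \<open>i\<close>, then along
  \<open>j\<close>. Up to the order of its summands the second difference is symmetric in
  \<open>i\<close> and \<open>j\<close>, so it equals \<open>t^2\<close> times either mixed
  derivative at nearby points.\<close>

lemma second_difference:
  fixes f :: "real^'n::finite \<Rightarrow> real"
  assumes "ndiff 2 S f" "cball x (2*t) \<subseteq> S" "t > 0"
  shows "\<exists>y\<in>cball x (2*t). f (x + t *\<^sub>R axis i 1 + t *\<^sub>R axis j 1) - f (x + t *\<^sub>R axis i 1)
      - f (x + t *\<^sub>R axis j 1) + f x = t^2 * partial_deriv j (partial_deriv i f) y"
proof -
  have mem: "x + a *\<^sub>R axis i 1 + b *\<^sub>R axis j 1 \<in> cball x (2*t)" if "0 \<le> a" "a \<le> t" "0 \<le> b" "b \<le> t" for a b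
  proof -
    have "norm (a *\<^sub>R axis i 1 + b *\<^sub>R axis j 1 :: real^'n) \<le> \<bar>a\<bar> * 1 + \<bar>b\<bar> * 1"
      by (rule norm_triangle_le) (simp add: norm_axis_1)
    moreover have "dist x (x + a *\<^sub>R axis i 1 + b *\<^sub>R axis j 1) = norm (a *\<^sub>R axis i 1 + b *\<^sub>R axis j 1 :: real^'n)"
      unfolding dist_norm add.assoc by (subst norm_minus_commute) simp
    ultimately show ?thesis using that unfolding mem_cball by linarith
  qed
  have nd: "\<forall>y\<in>S. f differentiable at y" "\<forall>y\<in>S. partial_deriv i f differentiable at y"
    using assms(1) by (auto simp: numeral_2_eq_2)
  \<comment> \<open>The difference in direction \<open>j\<close> as a function of the displacement
    in direction \<open>i\<close>; its increment is the second difference.\<close>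
  define \<phi> where "\<phi> s = f ((x + t *\<^sub>R axis j 1) + s *\<^sub>R axis i 1) - f (x + s *\<^sub>R axis i 1)" for s
  have "\<exists>z. 0 < z \<and> z < t \<and> \<phi> t - \<phi> 0 = (t - 0) * (partial_deriv i f ((x + t *\<^sub>R axis j 1) + z *\<^sub>R axis i 1) - partial_deriv i f (x + z *\<^sub>R axis i 1))"
  proof (rule MVT2[OF assms(3)])
    fix s assume s: "0 \<le> s" "s \<le> t"
    have "(x + t *\<^sub>R axis j 1) + s *\<^sub>R axis i 1 \<in> S" "x + s *\<^sub>R axis i 1 \<in> S"
      using mem[of s t] mem[of s 0] s assms by (auto simp: algebra_simps)
    then show "DERIV \<phi> s :> partial_deriv i f ((x + t *\<^sub>R axis j 1) + s *\<^sub>R axis i 1) - partial_deriv i f (x + s *\<^sub>R axis i 1)"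
      unfolding \<phi>_def using nd
      by (intro DERIV_diff) (auto simp: has_real_derivative_iff_has_vector_derivative intro!: line_has_vector_derivative)
  qed
  then obtain z where z: "0 < z" "z < t" and e1: "\<phi> t - \<phi> 0 = t * (partial_deriv i f ((x + z *\<^sub>R axis i 1) + t *\<^sub>R axis j 1) - partial_deriv i f ((x + z *\<^sub>R axis i 1) + 0 *\<^sub>R axis j 1))"
    by (auto simp: algebra_simps)
  have "\<exists>w. 0 < w \<and> w < t \<and> partial_deriv i f ((x + z *\<^sub>R axis i 1) + t *\<^sub>R axis j 1) - partial_deriv i f ((x + z *\<^sub>R axis i 1) + 0 *\<^sub>R axis j 1)
     = (t - 0) * partial_deriv j (partial_deriv i f) ((x + z *\<^sub>R axis i 1) + w *\<^sub>R axis j 1)"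
  proof (rule MVT2[OF assms(3)])
    fix s assume s: "0 \<le> s" "s \<le> t"
    have "(x + z *\<^sub>R axis i 1) + s *\<^sub>R axis j 1 \<in> S"
      using mem[of z s] s z assms by auto
    then show "DERIV (\<lambda>s. partial_deriv i f ((x + z *\<^sub>R axis i 1) + s *\<^sub>R axis j 1)) s :> partial_deriv j (partial_deriv i f) ((x + z *\<^sub>R axis i 1) + s *\<^sub>R axis j 1)"
      using nd by (auto simp: has_real_derivative_iff_has_vector_derivative intro!: line_has_vector_derivative)
  qed
  then obtain w where w: "0 < w" "w < t" and e2: "partial_deriv i f ((x + z *\<^sub>R axis i 1) + t *\<^sub>R axis j 1) - partial_deriv i f ((x + z *\<^sub>R axis i 1) + 0 *\<^sub>R axis j 1)
     = t * partial_deriv j (partial_deriv i f) ((x + z *\<^sub>R axis i 1) + w *\<^sub>R axis j 1)" by auto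
  have "f (x + t *\<^sub>R axis i 1 + t *\<^sub>R axis j 1) - f (x + t *\<^sub>R axis i 1) - f (x + t *\<^sub>R axis j 1) + f x = \<phi> t - \<phi> 0"
    by (simp add: \<phi>_def algebra_simps)
  also have "\<dots> = t^2 * partial_deriv j (partial_deriv i f) ((x + z *\<^sub>R axis i 1) + w *\<^sub>R axis j 1)"
    unfolding e1 e2 by (simp add: power2_eq_square)
  finally show ?thesis using mem[of z w] z w by auto
qed

lemma partial_deriv_commute_real:
  fixes f :: "real^'n::finite \<Rightarrow> real"
  assumes "open S" "ndiff 3 S f" "x \<in> S"
  shows "partial_deriv i (partial_deriv j f) x = partial_deriv j (partial_deriv i f) x"
proof (rule ccontr)
  assume neq: "\<not> ?thesis"
  \<comment> \<open>Half the gap between the two mixed derivatives: if each moves by less than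
    \<open>e\<close> near \<open>x\<close>, they cannot take a common value there.\<close>
  define e where "e = \<bar>partial_deriv i (partial_deriv j f) x - partial_deriv j (partial_deriv i f) x\<bar> / 2"
  have e: "e > 0" using neq by (simp add: e_def)
  have nd2: "ndiff 2 S f" using ndiff_mono[OF assms(2)] by simp
  have cont: "continuous (at x) (partial_deriv a (partial_deriv b f))" for a b
    using assms(2,3) by (intro differentiable_imp_continuous_within) (auto simp: numeral_3_eq_3)
  obtain d1 where d1: "d1 > 0" "\<And>y. dist y x < d1 \<Longrightarrow> \<bar>partial_deriv i (partial_deriv j f) y - partial_deriv i (partial_deriv j f) x\<bar> < e"
    using cont[of i j] e unfolding continuous_at_eps_delta dist_real_def by metis
  obtain d2 where d2: "d2 > 0" "\<And>y. dist y x < d2 \<Longrightarrow> \<bar>partial_deriv j (partial_deriv i f) y - partial_deriv j (partial_deriv i f) x\<bar> < e"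
    using cont[of j i] e unfolding continuous_at_eps_delta dist_real_def by metis
  obtain d3 where d3: "d3 > 0" "cball x d3 \<subseteq> S" using assms open_contains_cball by blast
  \<comment> \<open>The second difference explores a ball of radius \<open>2 * t\<close>, so the
    factor 4 keeps it strictly inside all three radii.\<close>
  define t where "t = min (min d1 d2) d3 / 4"
  have t: "t > 0" "2*t < d1" "2*t < d2" "cball x (2*t) \<subseteq> S"
    using d1 d2 d3 by (auto simp: t_def min_def)
  obtain y where y: "y \<in> cball x (2*t)" "f (x + t *\<^sub>R axis i 1 + t *\<^sub>R axis j 1) - f (x + t *\<^sub>R axis i 1)
      - f (x + t *\<^sub>R axis j 1) + f x = t^2 * partial_deriv j (partial_deriv i f) y"
    using second_difference[OF nd2 t(4) t(1)] by blast
  obtain z where z: "z \<in> cball x (2*t)" "f (x + t *\<^sub>R axis j 1 + t *\<^sub>R axis i 1) - f (x + t *\<^sub>R axis j 1)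
      - f (x + t *\<^sub>R axis i 1) + f x = t^2 * partial_deriv i (partial_deriv j f) z"
    using second_difference[OF nd2 t(4) t(1)] by blast
  have "t^2 * partial_deriv j (partial_deriv i f) y = t^2 * partial_deriv i (partial_deriv j f) z"
    using y(2) z(2) by (simp add: algebra_simps)
  then have "partial_deriv j (partial_deriv i f) y = partial_deriv i (partial_deriv j f) z" using t(1) by simp
  moreover have "\<bar>partial_deriv j (partial_deriv i f) y - partial_deriv j (partial_deriv i f) x\<bar> < e"
    using d2(2)[of y] y(1) t by (simp add: dist_commute)
  moreover have "\<bar>partial_deriv i (partial_deriv j f) z - partial_deriv i (partial_deriv j f) x\<bar> < e"
    using d1(2)[of z] z(1) t by (simp add: dist_commute)
  ultimately show False unfolding e_def by (smt (verit) field_sum_of_halves)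
qed

lemma partial_deriv_commute:
  fixes f :: "real^'n::finite \<Rightarrow> real^'m::finite"
  assumes "open S" "smooth_on S f" "x \<in> S"
  shows "partial_deriv i (partial_deriv j f) x = partial_deriv j (partial_deriv i f) x"
proof (subst vec_eq_iff, rule allI)
  fix k :: 'm
  have nth: "partial_deriv a (\<lambda>x. g x $ k) y = partial_deriv a g y $ k" if "smooth_on S g" "y \<in> S" for a g y
    by (rule partial_deriv_bounded_linear[OF bounded_linear_vec_nth smooth_on_differentiable[OF that]])
  have "partial_deriv a (partial_deriv b (\<lambda>x. f x $ k)) x = partial_deriv a (partial_deriv b f) x $ k" for a b
    using partial_deriv_cong_open[OF assms(1,3), of "partial_deriv b (\<lambda>x. f x $ k)" "\<lambda>y. partial_deriv b f y $ k"]
      nth[OF assms(2)] nth[OF smooth_on_partial[OF assms(2)] assms(3)] by auto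
  moreover have "smooth_on S (\<lambda>x. f x $ k)" using smooth_on_nth assms by blast
  ultimately show "partial_deriv i (partial_deriv j f) x $ k = partial_deriv j (partial_deriv i f) x $ k"
    using partial_deriv_commute_real[OF assms(1) _ assms(3), of "\<lambda>x. f x $ k"] smooth_on_iff_ndiff by metis
qed

section \<open>A smooth function that vanishes on a half-line\<close>

definition flat_exp :: "nat \<Rightarrow> real \<Rightarrow> real" where
  "flat_exp m s = (if s > 0 then inverse s ^ m * exp (- inverse s) else 0)"

lemma flat_exp_nonneg: "flat_exp m s \<ge> 0" and flat_exp_pos: "s > 0 \<Longrightarrow> flat_exp m s > 0"
  and flat_exp_zero: "s \<le> 0 \<Longrightarrow> flat_exp m s = 0"
  by (auto simp: flat_exp_def)

lemma flat_exp_tendsto: "(flat_exp m \<longlongrightarrow> 0) (at 0)"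
proof -
  have "((\<lambda>s. inverse s ^ m / exp (inverse s)) \<longlongrightarrow> (0::real)) (at_right 0)"
    by (rule filterlim_compose[OF tendsto_power_div_exp_0 filterlim_inverse_at_top_right])
  then have r: "(flat_exp m \<longlongrightarrow> 0) (at_right 0)"
    by (rule Lim_transform_eventually)
      (auto simp: flat_exp_def eventually_at_right_field exp_minus divide_inverse intro!: exI[of _ 1])
  have l: "(flat_exp m \<longlongrightarrow> 0) (at_left 0)"
    by (rule Lim_transform_eventually[OF tendsto_const])
      (auto simp: flat_exp_def eventually_at_left_field intro!: exI[of _ "-1"])
  show ?thesis using l r filterlim_split_at by blast
qed

text \<open>The reason for the parameter \<open>m\<close>: the derivative of a member of the family
  is a combination of members, so that one induction on the order proves smoothness for all of them
  at once.\<close>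

lemma flat_exp_DERIV:
  "DERIV (flat_exp m) s :> - real m * flat_exp (Suc m) s + flat_exp (Suc (Suc m)) s"
proof (cases s "0::real" rule: linorder_cases)
  case less
  have "DERIV (\<lambda>s. 0) s :> (0::real)" by simp
  then have "DERIV (flat_exp m) s :> 0"
    by (rule DERIV_cong_ev[THEN iffD1, rotated -1])
      (auto simp: flat_exp_def eventually_nhds less intro!: exI[of _ "{..<0}"])
  then show ?thesis using less by (simp add: flat_exp_def)
next
  case greater
  have "DERIV (\<lambda>s. inverse s ^ m * exp (- inverse s)) s :> - real m * flat_exp (Suc m) s + flat_exp (Suc (Suc m)) s"
  proof (cases m)
    case 0
    then show ?thesis using greater by (auto intro!: derivative_eq_intros simp: flat_exp_def field_simps)
  next
    case (Suc n)
    have pow: "s ^ k \<noteq> s * s ^ (k - Suc 0) \<Longrightarrow> k = 0" for k by (cases k) auto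
    show ?thesis using greater Suc
      by (cases n) (auto intro!: derivative_eq_intros dest: pow simp: flat_exp_def field_simps)
  qed
  then show ?thesis
    by (rule DERIV_cong_ev[THEN iffD1, rotated -1])
      (auto simp: flat_exp_def eventually_nhds greater intro!: exI[of _ "{0<..}"])
next
  case equal
  \<comment> \<open>At 0 the difference quotient of \<open>flat_exp m\<close> is itself
    \<open>flat_exp (Suc m)\<close>, which tends to 0.\<close>
  have "((\<lambda>h. (flat_exp m (0 + h) - flat_exp m 0) / h) \<longlongrightarrow> 0) (at 0)"
    by (rule Lim_transform_eventually[OF flat_exp_tendsto[of "Suc m"]])
      (auto simp: flat_exp_def eventually_at_filter field_simps)
  then show ?thesis using equal by (simp add: DERIV_def flat_exp_def)
qed

lemma smooth_on_flat_exp: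
  assumes "open S" "smooth_on S q" shows "smooth_on S (\<lambda>x. flat_exp m (q x))"
proof -
  have "ndiff k S (\<lambda>x. flat_exp m (q x))" for k
  proof (induction k arbitrary: m)
    case (Suc k)
    have der: "((\<lambda>x. flat_exp m (q x)) has_derivative (\<lambda>h. frechet_derivative q (at x) h *
       (- real m * flat_exp (Suc m) (q x) + flat_exp (Suc (Suc m)) (q x)))) (at x)" if "x \<in> S" for x
      using has_derivative_compose[OF frechet_has_derivative[OF smooth_on_differentiable[OF assms(2) that]]
          flat_exp_DERIV[of m "q x", unfolded has_field_derivative_def]]
      by (simp add: mult.commute)
    have "ndiff k S (partial_deriv i (\<lambda>x. flat_exp m (q x)))" for i
    proof (rule ndiff_cong_imp[OF assms(1)])
      show "ndiff k S (\<lambda>x. partial_deriv i q x * (- real m * flat_exp (Suc m) (q x) + flat_exp (Suc (Suc m)) (q x)))"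
        using Suc.IH smooth_on_partial[OF assms(2)]
        by (intro ndiff_bilinear[OF assms(1) bounded_bilinear_mult] ndiff_add[OF assms(1)] ndiff_const)
          (auto simp: smooth_on_iff_ndiff)
      show "partial_deriv i q x * (- real m * flat_exp (Suc m) (q x) + flat_exp (Suc (Suc m)) (q x))
          = partial_deriv i (\<lambda>x. flat_exp m (q x)) x" if "x \<in> S" for x
        using partial_deriv_eq[OF der[OF that], of i] by (simp add: partial_deriv_def)
    qed
    moreover have "\<forall>x\<in>S. (\<lambda>x. flat_exp m (q x)) differentiable at x"
      using der unfolding differentiable_def by blast
    ultimately show ?case unfolding ndiff.simps by (intro conjI allI)
  qed simp
  then show ?thesis by (simp add: smooth_on_iff_ndiff)
qed

section \<open>Smooth functions and vector fields on a compact manifold\<close>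

text \<open>The value 0 off the chart image turns a function supported in the chart into a compactly
  supported function on all of \<open>real^3\<close>, ready for integration over the whole
  space.\<close>

definition local_rep :: "'a chart \<Rightarrow> ('a \<Rightarrow> 'b::real_normed_vector) \<Rightarrow> real^3 \<Rightarrow> 'b" where
  "local_rep c g x = (if x \<in> cimage c then g (chart_inv c x) else 0)"

definition extend_zero :: "'a chart \<Rightarrow> (real^3 \<Rightarrow> 'b::real_normed_vector) \<Rightarrow> 'a \<Rightarrow> 'b" where
  "extend_zero c h p = (if p \<in> cdom c then h (coord c p) else 0)"

definition supported_in :: "'a::topological_space chart \<Rightarrow> ('a \<Rightarrow> 'b::real_normed_vector) \<Rightarrow> bool" where
  "supported_in c g \<longleftrightarrow> (\<exists>Z. compact Z \<and> Z \<subseteq> cdom c \<and> (\<forall>p. p \<notin> Z \<longrightarrow> g p = 0))"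

lemma supported_in_mult_left: "supported_in c f \<Longrightarrow> supported_in c (\<lambda>p. f p *\<^sub>R g p)"
  unfolding supported_in_def by (metis scaleR_eq_0_iff)

locale atlas =
  fixes A :: "'a::{t2_space,second_countable_topology} chart set"
  assumes compact_M: "compact (UNIV :: 'a set)"
    and atlas: "oriented_smooth_atlas A"
begin

lemma chart: "c \<in> A \<Longrightarrow> is_chart c"
  using atlas by (simp add: oriented_smooth_atlas_def)

lemma charts_cover: "\<exists>c\<in>A. p \<in> cdom c"
  using atlas by (auto simp: oriented_smooth_atlas_def)

lemma open_cdom: "c \<in> A \<Longrightarrow> open (cdom c)" and open_cimage: "c \<in> A \<Longrightarrow> open (cimage c)"
  using chart by (auto simp: is_chart_def)

lemma continuous_coord: "c \<in> A \<Longrightarrow> continuous_on (cdom c) (coord c)"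
  and continuous_chart_inv: "c \<in> A \<Longrightarrow> continuous_on (cimage c) (chart_inv c)"
  using chart by (auto simp: is_chart_def homeomorphism_def)

lemma chart_inv_coord [simp]: "c \<in> A \<Longrightarrow> p \<in> cdom c \<Longrightarrow> chart_inv c (coord c p) = p"
  and coord_chart_inv [simp]: "c \<in> A \<Longrightarrow> x \<in> cimage c \<Longrightarrow> coord c (chart_inv c x) = x"
  using chart unfolding is_chart_def homeomorphism_def by blast+

lemma coord_in_cimage [simp]: "p \<in> cdom c \<Longrightarrow> coord c p \<in> cimage c"
  by (simp add: cimage_def)

lemma chart_inv_in_cdom [simp]: "c \<in> A \<Longrightarrow> x \<in> cimage c \<Longrightarrow> chart_inv c x \<in> cdom c"
  using chart unfolding is_chart_def homeomorphism_def by blast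

lemma coord_image_iff:
  assumes "c \<in> A" "Z \<subseteq> cdom c"
  shows "coord c ` Z = {x \<in> cimage c. chart_inv c x \<in> Z}"
  using assms by (auto simp: image_iff) (metis coord_chart_inv)

lemma open_coord_image:
  assumes "c \<in> A" "open U" "U \<subseteq> cdom c" shows "open (coord c ` U)"
proof -
  have "open (cimage c \<inter> chart_inv c -` U)"
    by (rule continuous_open_preimage[OF continuous_chart_inv open_cimage]) (use assms in auto)
  moreover have "cimage c \<inter> chart_inv c -` U = coord c ` U"
    by (subst coord_image_iff) (use assms in auto)
  ultimately show ?thesis by simp
qed

lemma compact_coord_image: "c \<in> A \<Longrightarrow> compact Z \<Longrightarrow> Z \<subseteq> cdom c \<Longrightarrow> compact (coord c ` Z)"
  by (metis compact_continuous_image continuous_coord continuous_on_subset)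

lemma compact_chart_inv_image: "c \<in> A \<Longrightarrow> compact K \<Longrightarrow> K \<subseteq> cimage c \<Longrightarrow> compact (chart_inv c ` K)"
  by (metis compact_continuous_image continuous_chart_inv continuous_on_subset)

lemma open_overlap: "c \<in> A \<Longrightarrow> d \<in> A \<Longrightarrow> open (coord c ` (cdom c \<inter> cdom d))"
  by (intro open_coord_image) (auto simp: open_cdom)

lemma smooth_transition:
  "c \<in> A \<Longrightarrow> d \<in> A \<Longrightarrow> smooth_on (coord c ` (cdom c \<inter> cdom d)) (coord d \<circ> chart_inv c)"
  using atlas by (simp add: oriented_smooth_atlas_def)

section \<open>Smooth functions on the manifold\<close>

lemma smooth_fun_chart: "smooth_fun A f \<Longrightarrow> c \<in> A \<Longrightarrow> smooth_on (cimage c) (f \<circ> chart_inv c)"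
  by (simp add: smooth_fun_def)

lemma smooth_fun_chart': "smooth_fun A f \<Longrightarrow> c \<in> A \<Longrightarrow> smooth_on (cimage c) (\<lambda>x. f (chart_inv c x))"
  using smooth_fun_chart by (simp add: comp_def)

text \<open>Smoothness is demanded in every chart of the atlas; the smooth coordinate changes carry
  it over from one conveniently chosen chart around each point.\<close>

lemma smooth_funI_local:
  assumes "\<And>p. \<exists>c\<in>A. \<exists>U. open U \<and> p \<in> cdom c \<and> coord c p \<in> U \<and> U \<subseteq> cimage c \<and> smooth_on U (f \<circ> chart_inv c)"
  shows "smooth_fun A f"
  unfolding smooth_fun_def
proof (intro ballI smooth_on_local)
  fix d x assume d: "d \<in> A" and x: "x \<in> cimage d"
  obtain c U where c: "c \<in> A" "open U" "chart_inv d x \<in> cdom c" "coord c (chart_inv d x) \<in> U"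
    "U \<subseteq> cimage c" "smooth_on U (f \<circ> chart_inv c)" using assms by blast
  define W where "W = coord d ` (cdom d \<inter> cdom c)"
  have W: "open W" "smooth_on W (coord c \<circ> chart_inv d)"
    using open_overlap smooth_transition c d by (auto simp: W_def)
  define V where "V = W \<inter> (coord c \<circ> chart_inv d) -` U"
  have V: "open V" unfolding V_def
    by (rule continuous_open_preimage[OF smooth_on_continuous[OF W(2)] W(1) c(2)])
  have "x \<in> V" unfolding V_def W_def using c d x
    by (auto simp: image_iff) (metis IntI chart_inv_in_cdom coord_chart_inv)
  moreover have "smooth_on V ((f \<circ> chart_inv c) \<circ> (coord c \<circ> chart_inv d))"
    by (rule smooth_on_compose[OF V c(2,6)]) (use smooth_on_subset[OF W(2)] in \<open>auto simp: V_def\<close>)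
  moreover have "((f \<circ> chart_inv c) \<circ> (coord c \<circ> chart_inv d)) y = (f \<circ> chart_inv d) y" if "y \<in> V" for y
    using that c d by (auto simp: V_def W_def)
  ultimately show "\<exists>T. x \<in> T \<and> smooth_on T (f \<circ> chart_inv d)"
    using smooth_on_cong[OF V] by metis
qed

lemma smooth_fun_const [simp]: "smooth_fun A (\<lambda>p. q)"
  by (simp add: smooth_fun_def comp_def)

lemma smooth_fun_add: "smooth_fun A f \<Longrightarrow> smooth_fun A g \<Longrightarrow> smooth_fun A (\<lambda>p. f p + g p)"
  unfolding smooth_fun_def comp_def by (intro ballI smooth_on_add open_cimage) auto

lemma smooth_fun_diff: "smooth_fun A f \<Longrightarrow> smooth_fun A g \<Longrightarrow> smooth_fun A (\<lambda>p. f p - g p)"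
  unfolding smooth_fun_def comp_def by (intro ballI smooth_on_diff open_cimage) auto

lemma smooth_fun_sum: "(\<And>i. i \<in> I \<Longrightarrow> smooth_fun A (f i)) \<Longrightarrow> smooth_fun A (\<lambda>p. \<Sum>i\<in>I. f i p)"
  unfolding smooth_fun_def comp_def by (intro ballI smooth_on_sum open_cimage) auto

lemma smooth_fun_linear: "bounded_linear h \<Longrightarrow> smooth_fun A f \<Longrightarrow> smooth_fun A (\<lambda>p. h (f p))"
  unfolding smooth_fun_def comp_def by (intro ballI, rule smooth_on_linear[OF open_cimage, where h=h]) auto

lemma smooth_fun_bilinear:
  "bounded_bilinear h \<Longrightarrow> smooth_fun A f \<Longrightarrow> smooth_fun A g \<Longrightarrow> smooth_fun A (\<lambda>p. h (f p) (g p))"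
  unfolding smooth_fun_def comp_def by (intro ballI, rule smooth_on_bilinear[OF open_cimage, where p=h]) auto

lemmas smooth_fun_mult = smooth_fun_bilinear[OF bounded_bilinear_mult]
lemmas smooth_fun_scaleR = smooth_fun_bilinear[OF bounded_bilinear_scaleR]
lemmas smooth_fun_inner = smooth_fun_bilinear[OF bounded_bilinear_inner]
lemmas smooth_fun_minus = smooth_fun_linear[OF bounded_linear_minus[OF bounded_linear_ident]]

lemma smooth_fun_power:
  fixes f :: "'a \<Rightarrow> real" shows "smooth_fun A f \<Longrightarrow> smooth_fun A (\<lambda>p. f p ^ n)"
  by (induction n) (auto intro: smooth_fun_mult)

lemma smooth_fun_inverse:
  fixes f :: "'a \<Rightarrow> real"
  shows "smooth_fun A f \<Longrightarrow> (\<And>p. f p \<noteq> 0) \<Longrightarrow> smooth_fun A (\<lambda>p. inverse (f p))"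
  unfolding smooth_fun_def comp_def by (intro ballI smooth_on_inverse open_cimage) auto

lemma smooth_fun_continuous: "smooth_fun A f \<Longrightarrow> continuous_on UNIV f"
proof (rule continuous_at_imp_continuous_on, rule ballI)
  fix p assume f: "smooth_fun A f"
  obtain c where c: "c \<in> A" "p \<in> cdom c" using charts_cover by blast
  have "continuous_on (cdom c) ((f \<circ> chart_inv c) \<circ> coord c)"
    by (rule continuous_on_compose[OF continuous_coord[OF c(1)]])
      (use smooth_on_continuous[OF smooth_fun_chart[OF f c(1)]] in \<open>simp add: cimage_def\<close>)
  then have "continuous_on (cdom c) f"
    by (rule continuous_on_cong[THEN iffD1, rotated 2]) (use c in auto)
  then show "isCont f p" using c open_cdom continuous_on_eq_continuous_at by blast
qed

lemma continuous_bounded: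
  fixes f :: "'a \<Rightarrow> 'b::real_normed_vector"
  assumes "continuous_on UNIV f" shows "\<exists>C>0. \<forall>p. norm (f p) \<le> C"
proof -
  have "bounded (range f)" using compact_imp_bounded[OF compact_continuous_image[OF assms compact_M]] .
  then show ?thesis unfolding bounded_pos by auto
qed

lemmas smooth_fun_bounded = continuous_bounded[OF smooth_fun_continuous]

text \<open>Two open sets cover the space: the chart image, where the function is the given one, and
  the complement of the compact support, where it is 0.\<close>

lemma smooth_local_rep:
  assumes "c \<in> A" "smooth_on (cimage c) (g \<circ> chart_inv c)" "supported_in c g"
  shows "smooth_on UNIV (local_rep c g)"
    and "\<exists>K. compact K \<and> K \<subseteq> cimage c \<and> (\<forall>x. x \<notin> K \<longrightarrow> local_rep c g x = 0)"
proof -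
  obtain Z where Z: "compact Z" "Z \<subseteq> cdom c" "\<And>p. p \<notin> Z \<Longrightarrow> g p = 0"
    using assms(3) unfolding supported_in_def by blast
  have K: "compact (coord c ` Z)" "coord c ` Z \<subseteq> cimage c"
    using compact_coord_image[OF assms(1) Z(1,2)] Z(2) by auto
  have 0: "local_rep c g x = 0" if "x \<notin> coord c ` Z" for x
    using that Z(3)[of "chart_inv c x"] coord_image_iff[OF assms(1) Z(2)] by (auto simp: local_rep_def)
  show "\<exists>K. compact K \<and> K \<subseteq> cimage c \<and> (\<forall>x. x \<notin> K \<longrightarrow> local_rep c g x = 0)" using K 0 by blast
  show "smooth_on UNIV (local_rep c g)"
  proof (rule smooth_on_local)
    fix x
    show "\<exists>T. x \<in> T \<and> smooth_on T (local_rep c g)"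
    proof (cases "x \<in> cimage c")
      case True
      have "smooth_on (cimage c) (local_rep c g)"
        by (subst smooth_on_cong[OF open_cimage[OF assms(1)], of _ "g \<circ> chart_inv c"])
          (use assms(2) in \<open>auto simp: local_rep_def\<close>)
      then show ?thesis using True by blast
    next
      case False
      have "open (- coord c ` Z)" using compact_imp_closed[OF K(1)] by (simp add: open_Compl)
      then have "smooth_on (- coord c ` Z) (local_rep c g)"
        by (subst smooth_on_cong[of _ _ "\<lambda>x. 0"]) (use 0 in auto)
      then show ?thesis using False K by blast
    qed
  qed
qed

lemma smooth_extend_zero:
  assumes "c \<in> A" "smooth_on (cimage c) h" "compact K" "K \<subseteq> cimage c"
    "\<And>x. x \<in> cimage c \<Longrightarrow> x \<notin> K \<Longrightarrow> h x = 0"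
  shows "smooth_fun A (extend_zero c h)" and "supported_in c (extend_zero c h)"
proof -
  have Z: "compact (chart_inv c ` K)" "chart_inv c ` K \<subseteq> cdom c"
    using compact_chart_inv_image assms by auto
  have 0: "extend_zero c h p = 0" if "p \<notin> chart_inv c ` K" for p
    using that assms(1) assms(5)[of "coord c p"] by (force simp: extend_zero_def image_iff)
  show "supported_in c (extend_zero c h)" unfolding supported_in_def using Z 0 by blast
  show "smooth_fun A (extend_zero c h)"
  proof (rule smooth_funI_local)
    fix p
    show "\<exists>c'\<in>A. \<exists>U. open U \<and> p \<in> cdom c' \<and> coord c' p \<in> U \<and> U \<subseteq> cimage c' \<and> smooth_on U (extend_zero c h \<circ> chart_inv c')"
    proof (cases "p \<in> cdom c")
      case True
      have "smooth_on (cimage c) (extend_zero c h \<circ> chart_inv c)"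
        by (subst smooth_on_cong[OF open_cimage[OF assms(1)], of _ h])
          (use assms in \<open>auto simp: extend_zero_def\<close>)
      then show ?thesis using assms(1) open_cimage True by (meson coord_in_cimage subset_refl)
    next
      case False
      obtain d where d: "d \<in> A" "p \<in> cdom d" using charts_cover by blast
      define U where "U = coord d ` (cdom d - chart_inv c ` K)"
      have U: "open U" unfolding U_def
        by (intro open_coord_image d open_Diff open_cdom compact_imp_closed Z) auto
      have "smooth_on U (extend_zero c h \<circ> chart_inv d)"
        by (subst smooth_on_cong[OF U, of _ "\<lambda>x. 0"]) (use 0 d in \<open>auto simp: U_def\<close>)
      moreover have "coord d p \<in> U" "U \<subseteq> cimage d" using d False Z(2) by (auto simp: U_def)
      ultimately show ?thesis using d U by blast
    qed
  qed
qed

section \<open>Coordinate changes, vector fields and directional derivatives\<close>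

lemma transition_has_derivative:
  assumes "c \<in> A" "d \<in> A" "p \<in> cdom c \<inter> cdom d"
  shows "(coord d \<circ> chart_inv c has_derivative transition_deriv c d p) (at (coord c p))"
  unfolding transition_deriv_def using assms smooth_on_differentiable[OF smooth_transition[OF assms(1,2)]]
  by (intro frechet_has_derivative) auto

lemma linear_transition:
  assumes "c \<in> A" "d \<in> A" "p \<in> cdom c \<inter> cdom d" shows "linear (transition_deriv c d p)"
  using has_derivative_linear[OF transition_has_derivative[OF assms]] .

lemma transition_frechet:
  assumes "c \<in> A" "d \<in> A" "p \<in> cdom c \<inter> cdom d" "smooth_on (cimage d) (f \<circ> chart_inv d)"
  shows "((f \<circ> chart_inv c) has_derivative
    (\<lambda>h. frechet_derivative (f \<circ> chart_inv d) (at (coord d p)) (transition_deriv c d p h))) (at (coord c p))"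
proof -
  have W: "open (coord c ` (cdom c \<inter> cdom d))" using open_overlap assms by auto
  have "((f \<circ> chart_inv d) \<circ> (coord d \<circ> chart_inv c) has_derivative
    frechet_derivative (f \<circ> chart_inv d) (at (coord d p)) \<circ> transition_deriv c d p) (at (coord c p))"
  proof (rule diff_chain_at[OF transition_has_derivative[OF assms(1-3)]])
    have "(coord d \<circ> chart_inv c) (coord c p) = coord d p" using assms by auto
    then show "((f \<circ> chart_inv d) has_derivative frechet_derivative (f \<circ> chart_inv d) (at (coord d p)))
       (at ((coord d \<circ> chart_inv c) (coord c p)))"
      using frechet_has_derivative[OF smooth_on_differentiable[OF assms(4)], of "coord d p"] assms(3) by simp
  qed
  then have "((f \<circ> chart_inv c) has_derivative
    frechet_derivative (f \<circ> chart_inv d) (at (coord d p)) \<circ> transition_deriv c d p) (at (coord c p))"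
    by (rule has_derivative_transform_within_open[OF _ W]) (use assms in auto)
  then show ?thesis by (simp add: comp_def)
qed

text \<open>The cocycle rule. It makes the components that \<open>vfield_extend\<close> transports
  from one chart to all others obey the transformation law.\<close>

lemma transition_compose:
  assumes "c \<in> A" "d \<in> A" "e \<in> A" "p \<in> cdom c" "p \<in> cdom d" "p \<in> cdom e"
  shows "transition_deriv d e p (transition_deriv c d p h) = transition_deriv c e p h"
proof -
  have W: "open (coord c ` (cdom c \<inter> cdom d))" using open_overlap assms by auto
  have eq: "(coord d \<circ> chart_inv c) (coord c p) = coord d p" using assms by auto
  have "((coord e \<circ> chart_inv d) \<circ> (coord d \<circ> chart_inv c) has_derivative
    transition_deriv d e p \<circ> transition_deriv c d p) (at (coord c p))"
    by (rule diff_chain_at) (use transition_has_derivative assms eq in auto)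
  then have "((coord e \<circ> chart_inv c) has_derivative
    transition_deriv d e p \<circ> transition_deriv c d p) (at (coord c p))"
    by (rule has_derivative_transform_within_open[OF _ W]) (use assms in auto)
  then show ?thesis
    using has_derivative_unique[OF _ transition_has_derivative[of c e p]] assms by (metis IntI comp_apply)
qed

lemma transition_refl:
  assumes "c \<in> A" "p \<in> cdom c" shows "transition_deriv c c p h = h"
proof -
  have "((\<lambda>x. x) has_derivative (\<lambda>h. h)) (at (coord c p))" by simp
  then have "((coord c \<circ> chart_inv c) has_derivative (\<lambda>h. h)) (at (coord c p))"
    by (rule has_derivative_transform_within_open[OF _ open_cimage[OF assms(1)]]) (use assms in auto)
  then show ?thesis
    using has_derivative_unique[OF _ transition_has_derivative[of c c p]] assms by (metis IntI)
qed

lemma vfield_transition: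
  "X \<in> smooth_vfields A \<Longrightarrow> c \<in> A \<Longrightarrow> d \<in> A \<Longrightarrow> p \<in> cdom c \<Longrightarrow> p \<in> cdom d \<Longrightarrow>
   transition_deriv c d p (X c p) = X d p"
  unfolding smooth_vfields_def mem_Collect_eq by (metis IntI)

lemma vfield_smooth: "X \<in> smooth_vfields A \<Longrightarrow> c \<in> A \<Longrightarrow> smooth_on (cimage c) (\<lambda>x. X c (chart_inv c x))"
  by (simp add: smooth_vfields_def comp_def)

lemma dir_deriv_chart:
  assumes "X \<in> smooth_vfields A" "smooth_fun A f" "c \<in> A" "p \<in> cdom c"
  shows "dir_deriv A X f p = frechet_derivative (f \<circ> chart_inv c) (at (coord c p)) (X c p)"
proof -
  define d where "d = (SOME c. c \<in> A \<and> p \<in> cdom c)"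
  have d: "d \<in> A" "p \<in> cdom d"
    using someI[of "\<lambda>c. c \<in> A \<and> p \<in> cdom c" c] assms by (auto simp: d_def)
  have "dir_deriv A X f p = frechet_derivative (f \<circ> chart_inv d) (at (coord d p)) (X d p)"
    by (simp add: dir_deriv_def d_def Let_def)
  also have "\<dots> = frechet_derivative (f \<circ> chart_inv c) (at (coord c p)) (transition_deriv d c p (X d p))"
    using frechet_derivative_at[OF transition_frechet[of d c p f]] d assms smooth_fun_chart
    by (metis IntI)
  also have "\<dots> = frechet_derivative (f \<circ> chart_inv c) (at (coord c p)) (X c p)"
    using vfield_transition assms d by metis
  finally show ?thesis .
qed

lemma dir_deriv_partial:
  assumes "X \<in> smooth_vfields A" "smooth_fun A f" "c \<in> A" "p \<in> cdom c"
  shows "dir_deriv A X f p = (\<Sum>i\<in>UNIV. X c p $ i *\<^sub>R partial_deriv i (f \<circ> chart_inv c) (coord c p))"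
  unfolding dir_deriv_chart[OF assms]
  by (rule frechet_expansion[OF smooth_on_differentiable[OF smooth_fun_chart[OF assms(2,3)]]]) (use assms in auto)

lemma smooth_dir_deriv:
  assumes "X \<in> smooth_vfields A" "smooth_fun A f" shows "smooth_fun A (dir_deriv A X f)"
  unfolding smooth_fun_def
proof
  fix c assume c: "c \<in> A"
  have "smooth_on (cimage c) (\<lambda>x. frechet_derivative (f \<circ> chart_inv c) (at x) (X c (chart_inv c x)))"
    by (intro smooth_on_frechet open_cimage c smooth_fun_chart assms vfield_smooth)
  then show "smooth_on (cimage c) (dir_deriv A X f \<circ> chart_inv c)"
    by (rule smooth_on_cong[THEN iffD1, rotated 2])
      (use c open_cimage dir_deriv_chart[OF assms c] in auto)
qed

lemma differentiable_chart:
  assumes "smooth_fun A f" "c \<in> A" "p \<in> cdom c"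
  shows "(f \<circ> chart_inv c) differentiable at (coord c p)"
  using smooth_on_differentiable[OF smooth_fun_chart[OF assms(1,2)]] assms by auto

lemma dir_deriv_eqI:
  assumes "X \<in> smooth_vfields A" "smooth_fun A f" "c \<in> A" "p \<in> cdom c"
    "((f \<circ> chart_inv c) has_derivative f') (at (coord c p))"
  shows "dir_deriv A X f p = f' (X c p)"
  using dir_deriv_chart[OF assms(1-4)] frechet_derivative_at[OF assms(5)] by simp

lemma dir_deriv_const [simp]:
  assumes "X \<in> smooth_vfields A" shows "dir_deriv A X (\<lambda>p. q) p = 0"
proof -
  obtain c where "c \<in> A" "p \<in> cdom c" using charts_cover by blast
  then show ?thesis using dir_deriv_eqI[OF assms, of "\<lambda>p. q" c p "\<lambda>h. 0"] by (simp add: comp_def)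
qed

lemma dir_deriv_add:
  assumes "X \<in> smooth_vfields A" "smooth_fun A f" "smooth_fun A g"
  shows "dir_deriv A X (\<lambda>p. f p + g p) p = dir_deriv A X f p + dir_deriv A X g p"
proof -
  obtain c where c: "c \<in> A" "p \<in> cdom c" using charts_cover by blast
  have "((\<lambda>x. (f \<circ> chart_inv c) x + (g \<circ> chart_inv c) x) has_derivative
      (\<lambda>h. frechet_derivative (f \<circ> chart_inv c) (at (coord c p)) h + frechet_derivative (g \<circ> chart_inv c) (at (coord c p)) h)) (at (coord c p))"
    by (intro has_derivative_add frechet_has_derivative differentiable_chart assms c)
  then show ?thesis using dir_deriv_eqI[OF assms(1) smooth_fun_add[OF assms(2,3)] c]
      dir_deriv_chart[OF assms(1,2) c] dir_deriv_chart[OF assms(1,3) c] by (simp add: comp_def)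
qed

lemma dir_deriv_linear:
  assumes "X \<in> smooth_vfields A" "smooth_fun A f" "bounded_linear h"
  shows "dir_deriv A X (\<lambda>p. h (f p)) p = h (dir_deriv A X f p)"
proof -
  obtain c where c: "c \<in> A" "p \<in> cdom c" using charts_cover by blast
  have "((\<lambda>x. h ((f \<circ> chart_inv c) x)) has_derivative
      (\<lambda>v. h (frechet_derivative (f \<circ> chart_inv c) (at (coord c p)) v))) (at (coord c p))"
    by (intro bounded_linear.has_derivative[OF assms(3)] frechet_has_derivative differentiable_chart assms c)
  then show ?thesis using dir_deriv_eqI[OF assms(1) smooth_fun_linear[OF assms(3,2)] c]
      dir_deriv_chart[OF assms(1,2) c] by (simp add: comp_def)
qed

lemma dir_deriv_bilinear:
  assumes "X \<in> smooth_vfields A" "smooth_fun A f" "smooth_fun A g" "bounded_bilinear h"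
  shows "dir_deriv A X (\<lambda>p. h (f p) (g p)) p = h (f p) (dir_deriv A X g p) + h (dir_deriv A X f p) (g p)"
proof -
  obtain c where c: "c \<in> A" "p \<in> cdom c" using charts_cover by blast
  have "((\<lambda>x. h ((f \<circ> chart_inv c) x) ((g \<circ> chart_inv c) x)) has_derivative
      (\<lambda>v. h ((f \<circ> chart_inv c) (coord c p)) (frechet_derivative (g \<circ> chart_inv c) (at (coord c p)) v) +
       h (frechet_derivative (f \<circ> chart_inv c) (at (coord c p)) v) ((g \<circ> chart_inv c) (coord c p)))) (at (coord c p))"
    by (intro bounded_bilinear.FDERIV[OF assms(4)] frechet_has_derivative differentiable_chart assms c)
  then show ?thesis using dir_deriv_eqI[OF assms(1) smooth_fun_bilinear[OF assms(4,2,3)] c]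
      dir_deriv_chart[OF assms(1,2) c] dir_deriv_chart[OF assms(1,3) c] c by (simp add: comp_def)
qed

lemma dir_deriv_diff:
  assumes "X \<in> smooth_vfields A" "smooth_fun A f" "smooth_fun A g"
  shows "dir_deriv A X (\<lambda>p. f p - g p) p = dir_deriv A X f p - dir_deriv A X g p"
  using dir_deriv_add[OF assms(1,2) smooth_fun_minus[OF assms(3)], of p]
    dir_deriv_linear[OF assms(1,3) bounded_linear_minus[OF bounded_linear_ident], of p] by simp

lemma dir_deriv_sum:
  assumes "X \<in> smooth_vfields A" "\<And>i. i \<in> I \<Longrightarrow> smooth_fun A (f i)"
  shows "dir_deriv A X (\<lambda>p. \<Sum>i\<in>I. f i p) p = (\<Sum>i\<in>I. dir_deriv A X (f i) p)"
  using assms(2) by (induction I rule: infinite_finite_induct)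
    (auto simp: assms(1) dir_deriv_add[OF assms(1)] smooth_fun_sum)

lemma dir_deriv_zero_off:
  assumes "X \<in> smooth_vfields A" "smooth_fun A f" "closed Z" "\<And>p. p \<notin> Z \<Longrightarrow> f p = 0" "p \<notin> Z"
  shows "dir_deriv A X f p = 0"
proof -
  obtain c where c: "c \<in> A" "p \<in> cdom c" using charts_cover by blast
  have U: "open (coord c ` (cdom c - Z))" by (intro open_coord_image c open_Diff open_cdom assms(3)) auto
  have "((\<lambda>x. 0) has_derivative (\<lambda>h. 0)) (at (coord c p))" by simp
  then have "((f \<circ> chart_inv c) has_derivative (\<lambda>h. 0)) (at (coord c p))"
    by (rule has_derivative_transform_within_open[OF _ U]) (use assms c in auto)
  then show ?thesis using dir_deriv_eqI[OF assms(1,2) c] by simp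
qed

lemma supported_in_dir_deriv:
  assumes "X \<in> smooth_vfields A" "smooth_fun A f" "supported_in c f"
  shows "supported_in c (dir_deriv A X f)"
  using assms(3) dir_deriv_zero_off[OF assms(1,2)] compact_imp_closed unfolding supported_in_def by meson

lemma vfield_lincomb:
  assumes "X \<in> smooth_vfields A" "Y \<in> smooth_vfields A"
  shows "(\<lambda>c p. X c p + t *\<^sub>R Y c p) \<in> smooth_vfields A"
  unfolding smooth_vfields_def mem_Collect_eq
proof (intro conjI ballI allI impI)
  fix c d p assume c: "c \<in> A" "d \<in> A" "p \<in> cdom c \<inter> cdom d"
  show "X d p + t *\<^sub>R Y d p = transition_deriv c d p (X c p + t *\<^sub>R Y c p)"
    using linear_add[OF linear_transition[OF c]] linear_scale[OF linear_transition[OF c]]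
      vfield_transition[OF assms(1) c(1,2)] vfield_transition[OF assms(2) c(1,2)] c(3) by simp
next
  fix c assume c: "c \<in> A"
  show "smooth_on (cimage c) ((\<lambda>p. X c p + t *\<^sub>R Y c p) \<circ> chart_inv c)"
    unfolding comp_def by (intro smooth_on_add smooth_on_scaleR open_cimage c vfield_smooth assms smooth_on_const)
next
  fix c p assume "\<not> (c \<in> A \<and> p \<in> cdom c)"
  then have "X c p = 0" "Y c p = 0" using assms unfolding smooth_vfields_def by blast+
  then show "X c p + t *\<^sub>R Y c p = 0" by simp
qed

lemma dir_deriv_lincomb:
  assumes "X \<in> smooth_vfields A" "Y \<in> smooth_vfields A" "smooth_fun A f"
  shows "dir_deriv A (\<lambda>c p. X c p + t *\<^sub>R Y c p) f p = dir_deriv A X f p + t *\<^sub>R dir_deriv A Y f p"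
proof -
  obtain c where c: "c \<in> A" "p \<in> cdom c" using charts_cover by blast
  show ?thesis
    using dir_deriv_partial[OF _ assms(3) c] vfield_lincomb[OF assms(1,2)] assms(1,2)
    by (simp add: scaleR_add_left sum.distrib scaleR_sum_right)
qed

definition vfield_extend :: "'a chart \<Rightarrow> (real^3 \<Rightarrow> real^3) \<Rightarrow> 'a vfield" where
  "vfield_extend a F = (\<lambda>c p. if c \<in> A \<and> p \<in> cdom c \<and> p \<in> cdom a then transition_deriv a c p (F (coord a p)) else 0)"

text \<open>On the overlap with \<open>a\<close> the components are given by the derivative of a
  smooth coordinate change; off \<open>cdom a\<close> the compact support stays away, so the field
  is 0 in a neighbourhood.\<close>

lemma vfield_extend_smooth:
  assumes "a \<in> A" "smooth_on (cimage a) F" "compact K" "K \<subseteq> cimage a"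
    "\<And>x. x \<in> cimage a \<Longrightarrow> x \<notin> K \<Longrightarrow> F x = 0"
  shows "vfield_extend a F \<in> smooth_vfields A"
  unfolding smooth_vfields_def mem_Collect_eq
proof (intro conjI ballI allI impI)
  fix c d p assume c: "c \<in> A" "d \<in> A" "p \<in> cdom c \<inter> cdom d"
  show "vfield_extend a F d p = transition_deriv c d p (vfield_extend a F c p)"
    using transition_compose[OF assms(1) c(1,2)] c(3) linear_0[OF linear_transition[OF c]] c(1,2)
    by (auto simp: vfield_extend_def)
next
  fix c assume c: "c \<in> A"
  have Z: "compact (chart_inv a ` K)" "chart_inv a ` K \<subseteq> cdom a"
    using compact_chart_inv_image assms by auto
  show "smooth_on (cimage c) (vfield_extend a F c \<circ> chart_inv c)"
  proof (rule smooth_on_local)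
    fix x assume x: "x \<in> cimage c"
    show "\<exists>T. x \<in> T \<and> smooth_on T (vfield_extend a F c \<circ> chart_inv c)"
    proof (cases "chart_inv c x \<in> cdom a")
      case True
      have oa: "open (coord a ` (cdom a \<inter> cdom c))" and oc: "open (coord c ` (cdom c \<inter> cdom a))"
        using open_overlap assms c by auto
      have "smooth_on (coord a ` (cdom a \<inter> cdom c)) (\<lambda>z. frechet_derivative (coord c \<circ> chart_inv a) (at z) (F z))"
        by (intro smooth_on_frechet oa smooth_transition assms c smooth_on_subset[OF assms(2)]) auto
      moreover have "(coord a \<circ> chart_inv c) ` coord c ` (cdom c \<inter> cdom a) \<subseteq> coord a ` (cdom a \<inter> cdom c)"
        using c by auto
      ultimately
      have "smooth_on (coord c ` (cdom c \<inter> cdom a)) ((\<lambda>z. frechet_derivative (coord c \<circ> chart_inv a) (at z) (F z)) \<circ> (coord a \<circ> chart_inv c))"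
        using smooth_on_compose[OF oc oa _ smooth_transition[OF c assms(1)]] by blast
      then have "smooth_on (coord c ` (cdom c \<inter> cdom a)) (vfield_extend a F c \<circ> chart_inv c)"
        by (rule smooth_on_cong[OF oc, THEN iffD1, rotated])
          (use c assms(1) in \<open>auto simp: vfield_extend_def transition_deriv_def\<close>)
      moreover have "x \<in> coord c ` (cdom c \<inter> cdom a)"
        using True x c by (subst coord_image_iff) auto
      ultimately show ?thesis by (intro exI[of _ "coord c ` (cdom c \<inter> cdom a)"] conjI)
    next
      case False
      have U: "open (coord c ` (cdom c - chart_inv a ` K))"
        by (intro open_coord_image c open_Diff open_cdom compact_imp_closed Z) auto
      have "F (coord a p) = 0" if "p \<in> cdom a" "p \<notin> chart_inv a ` K" for p
        using assms(1) assms(5)[of "coord a p"] that by (force simp: image_iff)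
      then have "smooth_on (coord c ` (cdom c - chart_inv a ` K)) (vfield_extend a F c \<circ> chart_inv c)"
        by (subst smooth_on_cong[OF U, of _ "\<lambda>x. 0"])
          (use c assms(1) linear_0[OF linear_transition[OF assms(1) c]] in \<open>auto simp: vfield_extend_def\<close>)
      moreover have "x \<in> coord c ` (cdom c - chart_inv a ` K)"
        using False x c Z(2) by (subst coord_image_iff) auto
      ultimately show ?thesis by (intro exI[of _ "coord c ` (cdom c - chart_inv a ` K)"] conjI)
    qed
  qed
next
  fix c p assume "\<not> (c \<in> A \<and> p \<in> cdom c)"
  then show "vfield_extend a F c p = 0" by (auto simp: vfield_extend_def)
qed

lemma vfield_extend_self: "a \<in> A \<Longrightarrow> p \<in> cdom a \<Longrightarrow> vfield_extend a F a p = F (coord a p)"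
  by (simp add: vfield_extend_def transition_refl)

lemma dir_deriv_vfield_extend:
  assumes "a \<in> A" "vfield_extend a F \<in> smooth_vfields A" "smooth_fun A f"
  shows "dir_deriv A (vfield_extend a F) f p =
    extend_zero a (\<lambda>x. frechet_derivative (f \<circ> chart_inv a) (at x) (F x)) p"
proof (cases "p \<in> cdom a")
  case True
  then show ?thesis using dir_deriv_chart[OF assms(2,3,1)] vfield_extend_self assms(1)
    by (simp add: extend_zero_def)
next
  case False
  obtain c where c: "c \<in> A" "p \<in> cdom c" using charts_cover by blast
  then show ?thesis using dir_deriv_partial[OF assms(2,3) c] False
    by (simp add: extend_zero_def vfield_extend_def)
qed

section \<open>Bump functions and a finite partition of unity\<close>

lemma bump_exists:
  assumes "c \<in> A" "p \<in> cdom c"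
  shows "\<exists>\<eta> :: 'a \<Rightarrow> real. smooth_fun A \<eta> \<and> (\<forall>q. \<eta> q \<ge> 0) \<and> \<eta> p > 0 \<and> supported_in c \<eta>"
proof -
  obtain r where r: "r > 0" "cball (coord c p) r \<subseteq> cimage c"
    using open_cimage[OF assms(1)] assms(2) open_contains_cball coord_in_cimage by metis
  \<comment> \<open>The argument of \<open>flat_exp\<close> is positive exactly in the open ball of
    radius \<open>r\<close>.\<close>
  define h where "h x = flat_exp 0 (r^2 - (x - coord c p) \<bullet> (x - coord c p))" for x
  have "smooth_on (cimage c) h" unfolding h_def
    by (intro smooth_on_flat_exp smooth_on_diff smooth_on_inner open_cimage assms) auto
  moreover have "h x = 0" if "x \<notin> cball (coord c p) r" for x
  proof -
    have "r < norm (x - coord c p)" using that by (simp add: dist_norm norm_minus_commute)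
    then have "r^2 \<le> (x - coord c p) \<bullet> (x - coord c p)"
      using r(1) by (simp add: dot_square_norm power_mono)
    then show ?thesis by (simp add: h_def flat_exp_zero)
  qed
  ultimately have "smooth_fun A (extend_zero c h)" "supported_in c (extend_zero c h)"
    using smooth_extend_zero[OF assms(1) _ compact_cball r(2)] by auto
  moreover have "extend_zero c h q \<ge> 0" for q by (simp add: extend_zero_def h_def flat_exp_nonneg)
  moreover have "extend_zero c h p > 0" using assms r(1) by (simp add: extend_zero_def h_def flat_exp_pos)
  ultimately show ?thesis by blast
qed

text \<open>Compactness selects finitely many bumps that are nowhere all zero; division by their sum
  normalizes them. Each weight is paired with its chart, and the set of pairs serves as index
  set.\<close>

lemma partition_of_unity:
  "\<exists>P :: ('a chart \<times> ('a \<Rightarrow> real)) set. finite P \<and>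
    (\<forall>q\<in>P. fst q \<in> A \<and> smooth_fun A (snd q) \<and> (\<forall>p. snd q p \<ge> 0) \<and> supported_in (fst q) (snd q)) \<and>
    (\<forall>p. (\<Sum>q\<in>P. snd q p) = 1)"
proof -
  have "\<exists>q. fst q \<in> A \<and> smooth_fun A (snd q :: 'a \<Rightarrow> real) \<and> (\<forall>p. snd q p \<ge> 0) \<and> supported_in (fst q) (snd q) \<and> snd q p > 0" for p
    using charts_cover[of p] bump_exists[of _ p] by (metis fst_conv snd_conv)
  then obtain b where b: "\<And>p. fst (b p) \<in> A" "\<And>p. smooth_fun A (snd (b p) :: 'a \<Rightarrow> real)"
    "\<And>p r. snd (b p) r \<ge> 0" "\<And>p. supported_in (fst (b p)) (snd (b p))" "\<And>p. snd (b p) p > 0" by metis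
  have op: "open {r. snd (b p) r > 0}" for p
    using open_Collect_less[OF continuous_on_const smooth_fun_continuous[OF b(2)]] .
  obtain D where D: "finite D" "UNIV \<subseteq> (\<Union>p\<in>D. {r. snd (b p) r > 0})"
  proof (rule compactE_image[OF compact_M, of UNIV "\<lambda>p. {r. snd (b p) r > 0}"])
    show "UNIV \<subseteq> (\<Union>p\<in>UNIV. {r. 0 < snd (b p) r})" using b(5) by blast
  qed (use op in auto)
  define Q where "Q = b ` D"
  define s where "s r = (\<Sum>q\<in>Q. snd q r)" for r
  have s: "s r > 0" for r
  proof -
    obtain p where "p \<in> D" "snd (b p) r > 0" using D(2) by blast
    then show ?thesis unfolding s_def Q_def using D(1) b(3) by (intro sum_pos2[of _ "b p"]) auto
  qed
  have ss: "smooth_fun A s" unfolding s_def Q_def using b(2) by (auto intro: smooth_fun_sum)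
  define g where "g q = (fst q, \<lambda>r. inverse (s r) * snd q r)" for q :: "'a chart \<times> ('a \<Rightarrow> real)"
  \<comment> \<open>Sums run over a set of pairs, so normalization must not identify two of
    them.\<close>
  have inj: "inj_on g Q"
  proof (rule inj_onI)
    fix x y assume xy: "g x = g y"
    then have "snd x r = snd y r" for r using s[of r] unfolding g_def by (auto dest!: fun_cong[of _ _ r])
    then show "x = y" using xy by (auto simp: g_def prod_eq_iff)
  qed
  have "(\<Sum>q\<in>g ` Q. snd q r) = 1" for r
  proof -
    have "(\<Sum>q\<in>g ` Q. snd q r) = (\<Sum>q\<in>Q. inverse (s r) * snd q r)"
      by (subst sum.reindex[OF inj]) (simp add: g_def)
    also have "\<dots> = 1" using s[of r] by (simp add: s_def flip: sum_distrib_left)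
    finally show ?thesis .
  qed
  moreover have "fst q \<in> A \<and> smooth_fun A (snd q) \<and> (\<forall>p. snd q p \<ge> 0) \<and> supported_in (fst q) (snd q)"
    if q: "q \<in> g ` Q" for q
  proof -
    obtain p where p: "q = g (b p)" using q by (auto simp: Q_def)
    have "supported_in (fst q) (snd q)"
      using b(4)[of p] unfolding p g_def supported_in_def by (metis fst_conv snd_conv mult_zero_right)
    moreover have "smooth_fun A (snd q)" unfolding p g_def snd_conv
      using s by (intro smooth_fun_mult smooth_fun_inverse ss b(2)) (metis less_irrefl)
    moreover have "0 \<le> snd q r" for r
      using b(3)[of p r] s[of r] by (simp add: p g_def)
    ultimately show ?thesis using b(1)[of p] by (simp add: p g_def)
  qed
  moreover have "finite (g ` Q)" using D(1) by (simp add: Q_def)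
  ultimately show ?thesis by blast
qed

end

section \<open>Integration of compactly supported functions\<close>

definition cont_csupp :: "('a::euclidean_space \<Rightarrow> 'b::real_normed_vector) \<Rightarrow> bool" where
  "cont_csupp f \<longleftrightarrow> continuous_on UNIV f \<and> (\<exists>K. compact K \<and> (\<forall>x. x \<notin> K \<longrightarrow> f x = 0))"

lemma cont_csuppI: "continuous_on UNIV f \<Longrightarrow> compact K \<Longrightarrow> (\<And>x. x \<notin> K \<Longrightarrow> f x = 0) \<Longrightarrow> cont_csupp f"
  unfolding cont_csupp_def by blast

lemma integrable_csupp:
  fixes f :: "'a::euclidean_space \<Rightarrow> 'b::{banach, second_countable_topology}"
  assumes "cont_csupp f" shows "integrable lborel f"
proof -
  obtain K where K: "compact K" "\<And>x. x \<notin> K \<Longrightarrow> f x = 0" and c: "continuous_on UNIV f"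
    using assms unfolding cont_csupp_def by blast
  have "integrable lborel (\<lambda>x. indicator K x *\<^sub>R f x)"
    by (rule borel_integrable_compact[OF K(1) continuous_on_subset[OF c]]) simp
  moreover have "(\<lambda>x. indicator K x *\<^sub>R f x) = f" using K(2) by (auto simp: indicator_def fun_eq_iff)
  ultimately show ?thesis by simp
qed

lemma csupp_partial:
  assumes "smooth_on UNIV f" "compact K" "\<And>x. x \<notin> K \<Longrightarrow> f x = 0" "x \<notin> K"
  shows "partial_deriv i f x = 0"
  using partial_deriv_cong_open[of "- K" x f "\<lambda>x. 0" i] assms compact_imp_closed[OF assms(2)]
  by (simp add: open_Compl)

lemma cont_csupp_bounded:
  assumes "cont_csupp f" shows "\<exists>B>0. \<forall>x. norm (f x) \<le> B"
proof -
  obtain K where K: "compact K" "\<And>x. x \<notin> K \<Longrightarrow> f x = 0" and c: "continuous_on UNIV f"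
    using assms unfolding cont_csupp_def by blast
  have "bounded (f ` K)" using compact_continuous_image[OF continuous_on_subset[OF c] K(1)] compact_imp_bounded by blast
  then obtain B where "B > 0" "\<forall>x\<in>K. norm (f x) \<le> B" unfolding bounded_pos by auto
  then have "norm (f x) \<le> B" for x using K(2)[of x] by (cases "x \<in> K") auto
  then show ?thesis using \<open>B > 0\<close> by blast
qed

lemma cont_csupp_partial:
  assumes "smooth_on UNIV f" "compact K" "\<And>x. x \<notin> K \<Longrightarrow> f x = 0"
  shows "cont_csupp (partial_deriv i f)"
  by (rule cont_csuppI[OF smooth_on_continuous[OF smooth_on_partial[OF assms(1)]] assms(2)])
    (rule csupp_partial[OF assms])

text \<open>Translation invariance makes the integral of each difference quotient vanish, and
  dominated convergence passes to the derivative.\<close>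

lemma integral_partial_zero:
  fixes f :: "real^'n::finite \<Rightarrow> real"
  assumes f: "smooth_on UNIV f" and K: "compact K" "\<And>x. x \<notin> K \<Longrightarrow> f x = 0"
  shows "(LINT x|lborel. partial_deriv i f x) = 0"
proof -
  obtain B where B: "B > 0" "\<And>x. norm (partial_deriv i f x) \<le> B"
    using cont_csupp_bounded[OF cont_csupp_partial[OF f K]] by blast
  define e where "e = (axis i 1 :: real^'n)"
  have ne: "norm e = 1" by (simp add: e_def norm_axis_1)
  define t where "t n = inverse (real (Suc n))" for n
  have t: "0 < t n" "t n \<le> 1" for n by (auto simp: t_def inverse_le_1_iff)
  have tlim: "t \<longlonglongrightarrow> 0" unfolding t_def by (rule LIMSEQ_inverse_real_of_nat)
  define g where "g n x = (f (x + t n *\<^sub>R e) - f x) / t n" for n x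
  obtain R where R: "K \<subseteq> cball 0 R" using compact_imp_bounded[OF K(1)] by (auto simp: bounded_iff subset_iff)
  \<comment> \<open>The enlarged ball of radius \<open>R + 1\<close> used below contains the
    supports of all difference quotients, as the steps \<open>t n\<close> are at most 1.\<close>
  have csf: "cont_csupp f" using cont_csuppI[OF smooth_on_continuous[OF f] K] .
  have dif: "f differentiable at x" for x using smooth_on_differentiable[OF f] by simp
  have bound: "norm (g n x) \<le> indicator (cball 0 (R + 1)) x *\<^sub>R B" for n x
  proof (cases "x \<in> cball 0 (R + 1)")
    case True
    have "\<exists>z. 0 < z \<and> z < t n \<and> f (x + t n *\<^sub>R e) - f (x + 0 *\<^sub>R e) = (t n - 0) * partial_deriv i f (x + z *\<^sub>R e)"
      by (rule MVT2[OF t(1)])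
        (use dif in \<open>auto simp: e_def has_real_derivative_iff_has_vector_derivative intro!: line_has_vector_derivative\<close>)
    then obtain z where z: "f (x + t n *\<^sub>R e) - f x = t n * partial_deriv i f (x + z *\<^sub>R e)" by auto
    have "g n x = partial_deriv i f (x + z *\<^sub>R e)" unfolding g_def z using t(1)[of n] by simp
    then show ?thesis using B(2) True by simp
  next
    case False
    have "norm (t n *\<^sub>R e) \<le> 1" using t[of n] by (simp add: ne)
    moreover have "norm x - norm (t n *\<^sub>R e) \<le> norm (x + t n *\<^sub>R e)" by (rule norm_diff_ineq)
    ultimately have "norm (x + t n *\<^sub>R e) > R" "norm x > R" using False by auto
    then have "x + t n *\<^sub>R e \<notin> K" "x \<notin> K" using R by (auto simp: subset_iff)
    then show ?thesis using K(2) B(1) by (simp add: g_def)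
  qed
  have lim: "(\<lambda>n. g n x) \<longlonglongrightarrow> partial_deriv i f x" for x
  proof -
    have "DERIV (\<lambda>s. f (x + s *\<^sub>R e)) 0 :> partial_deriv i f (x + 0 *\<^sub>R axis i 1)"
      unfolding has_real_derivative_iff_has_vector_derivative e_def
      by (rule line_has_vector_derivative) (rule dif)
    then have L: "((\<lambda>h. (f (x + (0 + h) *\<^sub>R e) - f (x + 0 *\<^sub>R e)) / h) \<longlongrightarrow> partial_deriv i f x) (at 0)"
      unfolding DERIV_def by simp
    have "t n \<noteq> 0" for n using t(1)[of n] by simp
    then have "filterlim t (at 0) sequentially" using tlim by (simp add: filterlim_at)
    from filterlim_compose[OF L this] show ?thesis by (simp add: g_def)
  qed
  have fshift: "integrable lborel (\<lambda>x. f (x + v))" "(LINT x|lborel. f (x + v)) = (LINT x|lborel. f x)" for v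
  proof -
    have "integrable (distr lborel borel ((+) v)) f" using integrable_csupp[OF csf] by (simp add: lborel_distr_plus)
    then show "integrable lborel (\<lambda>x. f (x + v))"
      by (subst (asm) integrable_distr_eq) (use smooth_on_continuous[OF f] in \<open>auto simp: add.commute borel_measurable_continuous_onI\<close>)
    have "(LINT x|lborel. f x) = (LINT x|distr lborel borel ((+) v). f x)" by (simp add: lborel_distr_plus)
    also have "\<dots> = (LINT x|lborel. f (v + x))"
      by (subst integral_distr) (use smooth_on_continuous[OF f] in \<open>auto simp: borel_measurable_continuous_onI\<close>)
    finally show "(LINT x|lborel. f (x + v)) = (LINT x|lborel. f x)" by (simp add: add.commute)
  qed
  have zero: "(LINT x|lborel. g n x) = 0" for n
    unfolding g_def using fshift[of "t n *\<^sub>R e"] integrable_csupp[OF csf] by simp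
  have "(\<lambda>n. LINT x|lborel. g n x) \<longlonglongrightarrow> (LINT x|lborel. partial_deriv i f x)"
  proof (rule integral_dominated_convergence)
    show "integrable lborel (\<lambda>x. indicator (cball 0 (R + 1)) x *\<^sub>R B :: real)"
      by (rule borel_integrable_compact) auto
    show "partial_deriv i f \<in> borel_measurable lborel"
      using smooth_on_continuous[OF smooth_on_partial[OF f]] by (auto intro: borel_measurable_continuous_onI)
    show "g n \<in> borel_measurable lborel" for n
      unfolding g_def using fshift(1)[of "t n *\<^sub>R e"] integrable_csupp[OF csf] by measurable
  qed (use lim bound in auto)
  then show ?thesis unfolding zero by (simp add: LIMSEQ_const_iff)
qed

lemma integral_nonneg_zero_imp:
  fixes f :: "'a::euclidean_space \<Rightarrow> real"
  assumes "cont_csupp f" "\<And>x. f x \<ge> 0" "(LINT x|lborel. f x) = 0"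
  shows "f x = 0"
proof (rule ccontr)
  assume nz: "f x \<noteq> 0"
  have c: "continuous_on UNIV f" using assms(1) by (simp add: cont_csupp_def)
  have "AE x in lborel. f x = 0"
    using integral_nonneg_eq_0_iff_AE[OF integrable_csupp[OF assms(1)]] assms(2,3) by auto
  moreover have o: "open {x. f x \<noteq> 0}"
    using open_Collect_neq[OF c continuous_on_const] by simp
  ultimately have "{x. f x \<noteq> 0} \<in> null_sets lborel"
    using AE_iff_null[of lborel "\<lambda>x. f x = 0"] by simp
  then have "negligible {x. f x \<noteq> 0}"
    using null_sets_completionI negligible_iff_null_sets by blast
  then show False using open_not_negligible[OF o] nz by blast
qed

section \<open>A pointwise bound by integrals of derivatives, and change of variables\<close>

lemma prod_UNIV_3: "prod f (UNIV :: 3 set) = f 1 * f 2 * (f 3 :: 'a::comm_monoid_mult)"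
  unfolding UNIV_3 by (simp add: mult.assoc)

definition vec3 :: "real \<times> real \<times> real \<Rightarrow> real^3" where
  "vec3 = (\<lambda>(a, b, c). a *\<^sub>R axis 1 1 + b *\<^sub>R axis 2 1 + c *\<^sub>R axis 3 1)"

lemma vec3_nth: "vec3 (a, b, c) $ 1 = a" "vec3 (a, b, c) $ 2 = b" "vec3 (a, b, c) $ 3 = c"
  by (simp_all add: vec3_def axis_def)

lemma continuous_vec3: "continuous_on UNIV vec3"
  unfolding vec3_def split_beta by (intro continuous_intros)

text \<open>Lebesgue measure is determined by boxes. The identification with a product of three
  lines makes iterated integration available for functions on \<open>real^3\<close>.\<close>

lemma lborel_vec3: "distr lborel borel vec3 = lborel"
proof (rule sym, rule lborel_eqI)
  fix l u :: "real^3" assume le: "\<And>b. b \<in> Basis \<Longrightarrow> l \<bullet> b \<le> u \<bullet> b"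
  have le': "l $ i \<le> u $ i" for i
    using le[of "axis i 1"] by (auto simp: Basis_vec_def inner_axis)
  have m: "vec3 \<in> borel_measurable borel" using continuous_vec3 by (rule borel_measurable_continuous_onI)
  have "emeasure (distr lborel borel vec3) (box l u) = emeasure lborel (vec3 -` box l u \<inter> space lborel)"
    by (rule emeasure_distr) (use m in auto)
  also have "vec3 -` box l u \<inter> space lborel = box (l$1, l$2, l$3) (u$1, u$2, u$3)"
  proof -
    have "vec3 (a, b, c) \<in> box l u \<longleftrightarrow> (a, b, c) \<in> box (l$1, l$2, l$3) (u$1, u$2, u$3)" for a b c
      by (auto simp: mem_box_cart forall_3 vec3_nth mem_box Basis_prod_def)
    then show ?thesis by auto
  qed
  also have "emeasure lborel (box (l$1, l$2, l$3) (u$1, u$2, u$3)) = (\<Prod>b\<in>Basis. ((u$1, u$2, u$3) - (l$1, l$2, l$3)) \<bullet> b)"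
    by (rule emeasure_lborel_box) (use le' in \<open>auto simp: Basis_prod_def\<close>)
  also have "(\<Prod>b\<in>Basis. ((u$1, u$2, u$3) - (l$1, l$2, l$3)) \<bullet> b) = (\<Prod>i\<in>UNIV. (u - l) $ i)"
    by (simp add: prod_UNIV_3 Basis_prod_def prod.union_disjoint prod.reindex inj_on_def)
  also have "(\<Prod>i\<in>UNIV. (u - l) $ i) = (\<Prod>b\<in>Basis. (u - l) \<bullet> b)"
    by (simp add: Basis_vec_def UNION_singleton_eq_range prod.reindex axis_eq_axis inj_on_def inner_axis)
  finally show "emeasure (distr lborel borel vec3) (box l u) = (\<Prod>b\<in>Basis. (u - l) \<bullet> b)" .
qed simp

lemma norm_le_line_integral:
  fixes u :: "real^'n::finite \<Rightarrow> 'b::euclidean_space"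
  assumes u: "smooth_on UNIV u" and K: "compact K" "\<And>x. x \<notin> K \<Longrightarrow> u x = 0"
  shows "ennreal (norm (u (y + s *\<^sub>R axis i 1))) \<le> (\<integral>\<^sup>+t. ennreal (norm (partial_deriv i u (y + t *\<^sub>R axis i 1))) \<partial>lborel)"
proof -
  define e where "e = (axis i 1 :: real^'n)"
  have ne: "norm e = 1" by (simp add: e_def norm_axis_1)
  obtain R where R: "K \<subseteq> cball 0 R" using compact_imp_bounded[OF K(1)] by (auto simp: bounded_iff subset_iff)
  \<comment> \<open>A starting point on the line so far out that
    \<open>norm (y + a *\<^sub>R e) > R\<close>; there \<open>u\<close> is 0, and it lies below
    \<open>s\<close>.\<close>
  define a where "a = - (\<bar>s\<bar> + \<bar>R\<bar> + norm y + 1)"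
  have as: "a \<le> s" using norm_ge_zero[of y] unfolding a_def by linarith
  have "norm (a *\<^sub>R e) - norm y \<le> norm (a *\<^sub>R e + y)" by (rule norm_diff_ineq)
  then have "norm (y + a *\<^sub>R e) > R" by (simp add: ne a_def add.commute)
  then have "y + a *\<^sub>R e \<notin> K" using R by (meson mem_cball_0 not_le subsetD)
  then have ua: "u (y + a *\<^sub>R e) = 0" by (rule K(2))
  have dif: "u differentiable at x" for x using smooth_on_differentiable[OF u] by simp
  have cont: "continuous_on X (\<lambda>t. partial_deriv i u (y + t *\<^sub>R e))" for X
    by (rule continuous_on_compose2[OF smooth_on_continuous[OF smooth_on_partial[OF u]]])
      (auto intro!: continuous_intros)
  have der: "((\<lambda>s. u (y + s *\<^sub>R e)) has_vector_derivative partial_deriv i u (y + x *\<^sub>R e)) (at x within {a..s})" for x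
    unfolding e_def by (rule has_vector_derivative_at_within[OF line_has_vector_derivative[OF dif]])
  have I: "(\<integral>t. indicator {a..s} t *\<^sub>R partial_deriv i u (y + t *\<^sub>R e) \<partial>lborel) = u (y + s *\<^sub>R e) - u (y + a *\<^sub>R e)"
    by (rule integral_FTC_atLeastAtMost[OF as der cont])
  have "ennreal (norm (\<integral>t. indicator {a..s} t *\<^sub>R partial_deriv i u (y + t *\<^sub>R e) \<partial>lborel))
      \<le> (\<integral>\<^sup>+t. norm (indicator {a..s} t *\<^sub>R partial_deriv i u (y + t *\<^sub>R e)) \<partial>lborel)"
    by (rule integral_norm_bound_ennreal) (rule borel_integrable_compact[OF compact_Icc cont])
  also have "\<dots> \<le> (\<integral>\<^sup>+t. ennreal (norm (partial_deriv i u (y + t *\<^sub>R e))) \<partial>lborel)"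
    by (intro nn_integral_mono) (auto simp: indicator_def)
  finally show ?thesis unfolding I ua by (simp add: e_def)
qed

text \<open>One integration along each axis, then Tonelli: a crude Sobolev embedding that costs
  three derivatives. Nonnegative integrals in \<open>ennreal\<close> keep integrability out of the
  iteration.\<close>

lemma sup_le_integral_third_partial:
  fixes u :: "real^3 \<Rightarrow> 'b::euclidean_space"
  assumes u: "smooth_on UNIV u" and K: "compact K" "\<And>x. x \<notin> K \<Longrightarrow> u x = 0"
  shows "norm (u x) \<le> (LINT y|lborel. norm (partial_deriv 3 (partial_deriv 2 (partial_deriv 1 u)) y))"
proof -
  define u1 u2 u3 where "u1 = partial_deriv 1 u" and "u2 = partial_deriv 2 u1" and "u3 = partial_deriv 3 u2"
  have s: "smooth_on UNIV u1" "smooth_on UNIV u2" "smooth_on UNIV u3"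
    unfolding u1_def u2_def u3_def by (intro smooth_on_partial u)+
  have k1: "x \<notin> K \<Longrightarrow> u1 x = 0" for x unfolding u1_def by (rule csupp_partial[OF u K])
  have k2: "x \<notin> K \<Longrightarrow> u2 x = 0" for x unfolding u2_def by (rule csupp_partial[OF s(1) K(1) k1])
  have k3: "x \<notin> K \<Longrightarrow> u3 x = 0" for x unfolding u3_def by (rule csupp_partial[OF s(2) K(1) k2])
  have 1: "ennreal (norm (u (vec3 (a, b, c)))) \<le> (\<integral>\<^sup>+t. ennreal (norm (u1 (vec3 (t, b, c)))) \<partial>lborel)" for a b c
    using norm_le_line_integral[OF u K, of "vec3 (0, b, c)" a 1] by (simp add: vec3_def u1_def algebra_simps)
  have 2: "ennreal (norm (u1 (vec3 (a, b, c)))) \<le> (\<integral>\<^sup>+t. ennreal (norm (u2 (vec3 (a, t, c)))) \<partial>lborel)" for a b c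
    using norm_le_line_integral[OF s(1) K(1) k1, of "vec3 (a, 0, c)" b 2] by (simp add: vec3_def u2_def algebra_simps)
  have 3: "ennreal (norm (u2 (vec3 (a, b, c)))) \<le> (\<integral>\<^sup>+t. ennreal (norm (u3 (vec3 (a, b, t)))) \<partial>lborel)" for a b c
    using norm_le_line_integral[OF s(2) K(1) k2, of "vec3 (a, b, 0)" c 3] by (simp add: vec3_def u3_def algebra_simps)
  have m3: "(\<lambda>x. ennreal (norm (u3 x))) \<in> borel_measurable borel"
    using borel_measurable_continuous_onI[OF smooth_on_continuous[OF s(3)]] by measurable
  have mv: "vec3 \<in> borel_measurable borel" using continuous_vec3 by (rule borel_measurable_continuous_onI)
  have mm: "(\<lambda>x. ennreal (norm (u3 (vec3 x)))) \<in> borel_measurable borel"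
    using measurable_compose[OF mv m3] .
  have x: "x = vec3 (x$1, x$2, x$3)" by (simp add: vec_eq_iff forall_3 vec3_nth)
  have "ennreal (norm (u x)) \<le> (\<integral>\<^sup>+a. ennreal (norm (u1 (vec3 (a, x$2, x$3)))) \<partial>lborel)"
    using 1[of "x$1" "x$2" "x$3"] x by simp
  also have "\<dots> \<le> (\<integral>\<^sup>+a. \<integral>\<^sup>+b. ennreal (norm (u2 (vec3 (a, b, x$3)))) \<partial>lborel \<partial>lborel)"
    by (intro nn_integral_mono 2)
  also have "\<dots> \<le> (\<integral>\<^sup>+a. \<integral>\<^sup>+b. \<integral>\<^sup>+c. ennreal (norm (u3 (vec3 (a, b, c)))) \<partial>lborel \<partial>lborel \<partial>lborel)"
    by (intro nn_integral_mono 3)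
  also have "\<dots> = (\<integral>\<^sup>+a. \<integral>\<^sup>+bc. ennreal (norm (u3 (vec3 (a, bc)))) \<partial>lborel \<partial>lborel)"
  proof (rule nn_integral_cong)
    fix a :: real
    have "(\<lambda>bc. ennreal (norm (u3 (vec3 (a, bc))))) \<in> borel_measurable (lborel \<Otimes>\<^sub>M lborel)"
      unfolding lborel_prod using measurable_compose[OF _ mm, of "\<lambda>bc. (a, bc)" borel] by simp
    from lborel.nn_integral_fst[OF this]
    show "(\<integral>\<^sup>+b. \<integral>\<^sup>+c. ennreal (norm (u3 (vec3 (a, b, c)))) \<partial>lborel \<partial>lborel) = (\<integral>\<^sup>+bc. ennreal (norm (u3 (vec3 (a, bc)))) \<partial>lborel)"
      by (simp add: lborel_prod)
  qed
  also have "\<dots> = (\<integral>\<^sup>+abc. ennreal (norm (u3 (vec3 abc))) \<partial>lborel)"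
    using lborel.nn_integral_fst[of "\<lambda>x. ennreal (norm (u3 (vec3 x)))" lborel] mm by (simp add: lborel_prod)
  also have "\<dots> = (\<integral>\<^sup>+y. ennreal (norm (u3 y)) \<partial>distr lborel borel vec3)"
    by (rule nn_integral_distr[symmetric]) (use mv m3 in auto)
  also have "\<dots> = ennreal (LINT y|lborel. norm (u3 y))"
    unfolding lborel_vec3
    by (rule nn_integral_eq_integral) (use integrable_csupp[OF cont_csuppI[OF smooth_on_continuous[OF s(3)] K(1) k3]] in auto)
  finally show ?thesis unfolding u3_def u2_def u1_def by (simp add: ennreal_le_iff integral_nonneg)
qed

text \<open>\<open>h\<close> is the pulled back density extended by 0. It is a separate function
  with its own continuity assumption because \<open>g\<close> is controlled on \<open>S\<close>
  only.\<close>

lemma integral_change_variables: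
  fixes f h :: "real^3 \<Rightarrow> real"
  assumes S: "open S" and der: "\<And>x. x \<in> S \<Longrightarrow> (g has_derivative g' x) (at x)" and inj: "inj_on g S"
    and f: "cont_csupp f" "\<And>y. y \<notin> g ` S \<Longrightarrow> f y = 0"
    and h: "cont_csupp h" "\<And>x. x \<notin> S \<Longrightarrow> h x = 0"
    and eq: "\<And>x. x \<in> S \<Longrightarrow> h x = \<bar>det (matrix (g' x))\<bar> * f (g x)"
  shows "(LINT x|lborel. h x) = (LINT y|lborel. f y)"
proof -
  have Sl: "S \<in> sets lebesgue" using S by auto
  have restr: "integral T k = (LINT x|lborel. k x)" if "integrable lborel k" "\<And>x. x \<notin> T \<Longrightarrow> k x = 0" for T and k :: "real^3 \<Rightarrow> real"
  proof -
    have "integral T k = integral UNIV (\<lambda>x. if x \<in> T then k x else 0)" by (rule integral_restrict_UNIV[symmetric])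
    also have "(\<lambda>x. if x \<in> T then k x else 0) = k" using that(2) by auto
    finally show ?thesis using integral_lborel[OF that(1)] by simp
  qed
  have ai: "h absolutely_integrable_on S"
  proof -
    have "integrable lebesgue (\<lambda>x. indicator S x *\<^sub>R h x)"
    proof -
      have "(\<lambda>x. indicator S x *\<^sub>R h x) = h" using h(2) by (auto simp: indicator_def fun_eq_iff)
      then show ?thesis using integrable_completion[of h lborel] integrable_csupp[OF h(1)] by simp
    qed
    then show ?thesis by (simp add: set_integrable_def)
  qed
  have "(\<lambda>x. \<bar>det (matrix (g' x))\<bar> * f (g x)) absolutely_integrable_on S"
    by (rule absolutely_integrable_spike[OF ai negligible_empty]) (use eq in auto)
  \<comment> \<open>The transformation theorem is applied to functions with values in
    \<open>real^1\<close>; its single component is read off at the end.\<close>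
  then have ai': "(\<lambda>x. \<bar>det (matrix (g' x))\<bar> *\<^sub>R (vec (f (g x)) :: real^1)) absolutely_integrable_on S"
    by (subst absolutely_integrable_componentwise_iff) (auto simp: Basis_vec_def inner_axis)
  have "integral (g ` S) (\<lambda>y. vec (f y) :: real^1) = integral S (\<lambda>x. \<bar>det (matrix (g' x))\<bar> *\<^sub>R (vec (f (g x)) :: real^1))"
    by (rule integral_change_of_variables[OF Sl has_derivative_at_withinI[OF der] inj]) (use ai' in auto)
  moreover have "(\<lambda>x. \<bar>det (matrix (g' x))\<bar> *\<^sub>R (vec (f (g x)) :: real^1)) = (\<lambda>x. vec (\<bar>det (matrix (g' x))\<bar> * f (g x)))"
    by (auto simp: vec_eq_iff)
  ultimately have v: "integral (g ` S) (\<lambda>y. vec (f y) :: real^1) = integral S (\<lambda>x. vec (\<bar>det (matrix (g' x))\<bar> * f (g x)))"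
    and "(\<lambda>x. vec (\<bar>det (matrix (g' x))\<bar> * f (g x)) :: real^1) absolutely_integrable_on S"
    using ai' by simp_all
  then have i1: "(\<lambda>x. vec (\<bar>det (matrix (g' x))\<bar> * f (g x)) :: real^1) integrable_on S"
    by (simp add: absolutely_integrable_on_def)
  have "(\<lambda>y. vec (f y) :: real^1) absolutely_integrable_on (g ` S)"
    by (rule absolutely_integrable_change_of_variables[OF Sl has_derivative_at_withinI[OF der] inj, THEN iffD2]) (use ai' in auto)
  then have i2: "(\<lambda>y. vec (f y) :: real^1) integrable_on (g ` S)"
    by (simp add: absolutely_integrable_on_def)
  have "integral (g ` S) f = integral S (\<lambda>x. \<bar>det (matrix (g' x))\<bar> * f (g x))"
    using integral_component_eq_cart[OF i2, of 1] integral_component_eq_cart[OF i1, of 1] v by simp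
  also have "\<dots> = integral S h" by (rule integral_cong) (use eq in auto)
  finally show ?thesis using restr[OF integrable_csupp[OF f(1)]] f(2) restr[OF integrable_csupp[OF h(1)]] h(2) by simp
qed

section \<open>The volume integral and divergence\<close>

definition det3 :: "real^3 \<Rightarrow> real^3 \<Rightarrow> real^3 \<Rightarrow> real" where
  "det3 u v w = u$1 * (v$2 * w$3 - v$3 * w$2) - u$2 * (v$1 * w$3 - v$3 * w$1) + u$3 * (v$1 * w$2 - v$2 * w$1)"

lemma axis3_nth [simp]:
  "(axis 1 1 :: real^3) $ 1 = 1" "(axis 1 1 :: real^3) $ 2 = 0" "(axis 1 1 :: real^3) $ 3 = 0"
  "(axis 2 1 :: real^3) $ 1 = 0" "(axis 2 1 :: real^3) $ 2 = 1" "(axis 2 1 :: real^3) $ 3 = 0"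
  "(axis 3 1 :: real^3) $ 1 = 0" "(axis 3 1 :: real^3) $ 2 = 0" "(axis 3 1 :: real^3) $ 3 = 1"
  by (simp_all add: axis_def)

text \<open>Expanding all three arguments in the axes leaves only the six permutations of
  \<open>e1\<close>, \<open>e2\<close>, \<open>e3\<close>. So in a chart a volume form is a density
  \<open>rho\<close> times the determinant.\<close>

lemma alternating_det3:
  assumes w: "alternating_trilinear w"
  shows "w a b d = w (axis 1 1) (axis 2 1) (axis 3 1) * det3 a b d"
proof -
  have lin: "linear (\<lambda>a. w a b d)" "linear (\<lambda>b. w a b d)" "linear (\<lambda>d. w a b d)" for a b d
    using w unfolding alternating_trilinear_def by auto
  have z: "w a a b = 0" "w a b a = 0" "w b a a = 0" for a b
    using w unfolding alternating_trilinear_def by auto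
  have s1: "w a b d = - w b a d" for a b d
  proof -
    have "w (a + b) (a + b) d = w a b d + w b a d" by (simp only: linear_add[OF lin(1)] linear_add[OF lin(2)]) (simp add: z)
    then show ?thesis unfolding z(1) eq_neg_iff_add_eq_0 by (rule sym)
  qed
  have s2: "w a b d = - w a d b" for a b d
  proof -
    have "w a (b + d) (b + d) = w a b d + w a d b" by (simp only: linear_add[OF lin(3)] linear_add[OF lin(2)]) (simp add: z)
    then show ?thesis unfolding z(3) eq_neg_iff_add_eq_0 by (rule sym)
  qed
  define e1 e2 e3 where "e1 = (axis 1 1 :: real^3)" and "e2 = (axis 2 1 :: real^3)" and "e3 = (axis 3 1 :: real^3)"
  have x1: "w a b d = a$1 * w e1 b d + a$2 * w e2 b d + a$3 * w e3 b d" for a b d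
    using linear_axis_expansion[OF lin(1), of a b d] by (simp add: sum_3 e1_def e2_def e3_def)
  have x2: "w a b d = b$1 * w a e1 d + b$2 * w a e2 d + b$3 * w a e3 d" for a b d
    using linear_axis_expansion[OF lin(2), of a b d] by (simp add: sum_3 e1_def e2_def e3_def)
  have x3: "w a b d = d$1 * w a b e1 + d$2 * w a b e2 + d$3 * w a b e3" for a b d
    using linear_axis_expansion[OF lin(3), of a b d] by (simp add: sum_3 e1_def e2_def e3_def)
  have p: "w e2 e1 e3 = - w e1 e2 e3" "w e1 e3 e2 = - w e1 e2 e3" "w e2 e3 e1 = w e1 e2 e3"
     "w e3 e1 e2 = w e1 e2 e3" "w e3 e2 e1 = - w e1 e2 e3"
    using s1[of e2 e1 e3] s2[of e1 e3 e2] s1[of e3 e1 e2] s2[of e2 e3 e1] s1[of e3 e2 e1] by simp_all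
  have "w a b d = w e1 e2 e3 * det3 a b d"
    unfolding x1[of a b d] x2[of e1 b d] x2[of e2 b d] x2[of e3 b d]
      x3[of e1 e2 d] x3[of e1 e3 d] x3[of e2 e1 d] x3[of e2 e3 d] x3[of e3 e1 d] x3[of e3 e2 d]
    by (simp add: z p det3_def algebra_simps)
  then show ?thesis by (simp add: e1_def e2_def e3_def)
qed

lemma det3_matrix: "det3 (T (axis 1 1)) (T (axis 2 1)) (T (axis 3 1)) = det (matrix T)"
  by (simp add: det_3 matrix_def det3_def algebra_simps)

text \<open>The infinitesimal form of multiplicativity of the determinant. It turns the three
  bracket terms of a Lie derivative into a divergence.\<close>

lemma det3_trace:
  assumes "linear L"
  shows "det3 (L u) v w + det3 u (L v) w + det3 u v (L w) = (\<Sum>i\<in>UNIV. L (axis i 1) $ i) * det3 u v w"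
proof -
  have x: "L u $ k = u$1 * L (axis 1 1) $ k + u$2 * L (axis 2 1) $ k + u$3 * L (axis 3 1) $ k" for u k
    by (subst linear_axis_expansion[OF assms, of u]) (simp add: sum_3)
  show ?thesis unfolding det3_def sum_3 x[of u] x[of v] x[of w] by (simp add: algebra_simps)
qed

locale volume_manifold = atlas A for A :: "'a::{t2_space,second_countable_topology} chart set" +
  fixes dvol :: "'a form3"
  assumes pvf: "positive_volume_form A dvol"
begin

definition rho :: "'a chart \<Rightarrow> 'a \<Rightarrow> real" where
  "rho c p = dvol c p (axis 1 1) (axis 2 1) (axis 3 1)"

lemma dvol_rho: "c \<in> A \<Longrightarrow> p \<in> cdom c \<Longrightarrow> dvol c p u v w = rho c p * det3 u v w"
  unfolding rho_def
  by (rule alternating_det3) (use pvf in \<open>unfold positive_volume_form_def smooth_3form_def, blast\<close>)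

lemma rho_pos: "c \<in> A \<Longrightarrow> p \<in> cdom c \<Longrightarrow> rho c p > 0"
  using pvf by (simp add: positive_volume_form_def rho_def)

lemma smooth_rho: "c \<in> A \<Longrightarrow> smooth_on (cimage c) (\<lambda>x. rho c (chart_inv c x))"
  using pvf by (simp add: positive_volume_form_def smooth_3form_def rho_def)

lemma continuous_from_chart:
  assumes "c \<in> A" "continuous_on (cimage c) (\<lambda>x. g (chart_inv c x))" shows "continuous_on (cdom c) g"
proof -
  have "continuous_on (cdom c) (\<lambda>p. g (chart_inv c (coord c p)))"
    by (rule continuous_on_compose2[OF assms(2) continuous_coord[OF assms(1)]]) auto
  then show ?thesis by (rule continuous_on_cong[THEN iffD1, rotated 2]) (use assms in auto)
qed

lemma continuous_rho: "c \<in> A \<Longrightarrow> continuous_on (cdom c) (rho c)"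
  using continuous_from_chart smooth_on_continuous[OF smooth_rho] by blast

text \<open>Orientation enters here: the coordinate changes have positive determinant, so the
  density transforms with the absolute value that the change of variables formula requires.\<close>

lemma rho_transition:
  assumes "c \<in> A" "d \<in> A" "p \<in> cdom c" "p \<in> cdom d"
  shows "rho c p = \<bar>det (matrix (transition_deriv c d p))\<bar> * rho d p"
proof -
  have "dvol c p u v w = dvol d p (transition_deriv c d p u) (transition_deriv c d p v) (transition_deriv c d p w)" for u v w
    using pvf assms unfolding positive_volume_form_def smooth_3form_def by (metis IntI)
  then have "rho c p = rho d p * det (matrix (transition_deriv c d p))"
    unfolding rho_def[of c p] by (simp add: dvol_rho assms det3_matrix)
  moreover have "det (matrix (transition_deriv c d p)) > 0"
    using atlas assms unfolding oriented_smooth_atlas_def by (metis IntI)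
  ultimately show ?thesis by simp
qed

lemma cont_csupp_local_rep:
  assumes "c \<in> A" "continuous_on (cdom c) g" "supported_in c g"
  shows "cont_csupp (local_rep c g)"
proof -
  obtain Z where Z: "compact Z" "Z \<subseteq> cdom c" "\<And>p. p \<notin> Z \<Longrightarrow> g p = 0"
    using assms(3) unfolding supported_in_def by blast
  have K: "compact (coord c ` Z)" "coord c ` Z \<subseteq> cimage c"
    using compact_coord_image[OF assms(1) Z(1,2)] Z(2) by auto
  have 0: "local_rep c g x = 0" if "x \<notin> coord c ` Z" for x
    using that Z(3)[of "chart_inv c x"] coord_image_iff[OF assms(1) Z(2)] by (auto simp: local_rep_def)
  have "continuous_on (cimage c) (\<lambda>x. g (chart_inv c x))"
    by (rule continuous_on_compose2[OF assms(2) continuous_chart_inv[OF assms(1)]]) (use assms in auto)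
  then have "continuous_on (cimage c) (local_rep c g)"
    by (rule continuous_on_cong[THEN iffD1, rotated 2]) (auto simp: local_rep_def)
  moreover have "continuous_on (- coord c ` Z) (local_rep c g)"
    by (rule continuous_on_cong[THEN iffD1, rotated 2, OF continuous_on_const[of _ 0]]) (use 0 in auto)
  ultimately have "continuous_on (cimage c \<union> - coord c ` Z) (local_rep c g)"
    using open_cimage[OF assms(1)] compact_imp_closed[OF K(1)] by (intro continuous_on_open_Un) (auto simp: open_Compl)
  moreover have "cimage c \<union> - coord c ` Z = UNIV" using K by auto
  ultimately have "continuous_on UNIV (local_rep c g)" by simp
  then show ?thesis by (rule cont_csuppI[OF _ K(1) 0])
qed

section \<open>The volume integral\<close>

definition pou :: "('a chart \<times> ('a \<Rightarrow> real)) set" where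
  "pou = (SOME P. finite P \<and>
    (\<forall>q\<in>P. fst q \<in> A \<and> smooth_fun A (snd q) \<and> (\<forall>p. snd q p \<ge> 0) \<and> supported_in (fst q) (snd q)) \<and>
    (\<forall>p. (\<Sum>q\<in>P. snd q p) = 1))"

lemma pou: "finite pou" "q \<in> pou \<Longrightarrow> fst q \<in> A" "q \<in> pou \<Longrightarrow> smooth_fun A (snd q)"
  "q \<in> pou \<Longrightarrow> snd q p \<ge> 0" "q \<in> pou \<Longrightarrow> supported_in (fst q) (snd q)" "(\<Sum>q\<in>pou. snd q p) = 1"
  using someI_ex[OF partition_of_unity] unfolding pou_def[symmetric] by blast+

lemma pou_sum: "(\<Sum>q\<in>pou. snd q p *\<^sub>R (v :: 'b::real_vector)) = v"
  using pou(6)[of p] by (simp flip: scaleR_sum_left)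

definition vint :: "('a \<Rightarrow> real) \<Rightarrow> real" where
  "vint f = (\<Sum>q\<in>pou. LINT x|lborel. local_rep (fst q) (\<lambda>p. snd q p * f p * rho (fst q) p) x)"

lemma cont_csupp_weighted:
  assumes "c \<in> A" "continuous_on UNIV f" "supported_in c f"
  shows "cont_csupp (local_rep c (\<lambda>p. f p * rho c p))"
proof (rule cont_csupp_local_rep[OF assms(1)])
  show "continuous_on (cdom c) (\<lambda>p. f p * rho c p)"
    by (intro continuous_on_mult continuous_rho assms continuous_on_subset[OF assms(2)]) auto
  show "supported_in c (\<lambda>p. f p * rho c p)"
    using assms(3) unfolding supported_in_def by (metis mult_zero_left)
qed

lemma pou_mult:
  assumes "q \<in> pou" "continuous_on UNIV (f :: 'a \<Rightarrow> real)"
  shows "continuous_on UNIV (\<lambda>p. snd q p * f p)" "supported_in (fst q) (\<lambda>p. snd q p * f p)"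
  using continuous_on_mult[OF smooth_fun_continuous[OF pou(3)[OF assms(1)]] assms(2)]
    supported_in_mult_left[OF pou(5)[OF assms(1)], of f] by simp_all

lemma pou_csupp:
  assumes "q \<in> pou" "continuous_on UNIV f"
  shows "cont_csupp (local_rep (fst q) (\<lambda>p. snd q p * f p * rho (fst q) p))"
  by (rule cont_csupp_weighted[OF pou(2) pou_mult]) (use assms in auto)

lemma vint_add:
  assumes "continuous_on UNIV f" "continuous_on UNIV g"
  shows "vint (\<lambda>p. f p + g p) = vint f + vint g"
proof -
  have "(LINT x|lborel. local_rep (fst q) (\<lambda>p. snd q p * (f p + g p) * rho (fst q) p) x) =
     (LINT x|lborel. local_rep (fst q) (\<lambda>p. snd q p * f p * rho (fst q) p) x) +
     (LINT x|lborel. local_rep (fst q) (\<lambda>p. snd q p * g p * rho (fst q) p) x)" if "q \<in> pou" for q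
    by (subst Bochner_Integration.integral_add[symmetric])
      (use pou_csupp[OF that] assms integrable_csupp in \<open>auto simp: local_rep_def algebra_simps intro!: Bochner_Integration.integral_cong\<close>)
  then show ?thesis by (simp add: vint_def sum.distrib)
qed

lemma vint_cmult: "vint (\<lambda>p. a * f p) = a * vint f"
proof -
  have "local_rep c (\<lambda>p. snd q p * (a * f p) * rho c p) = (\<lambda>x. a * local_rep c (\<lambda>p. snd q p * f p * rho c p) x)"
    for c and q :: "'a chart \<times> ('a \<Rightarrow> real)" by (auto simp: local_rep_def)
  then show ?thesis by (simp add: vint_def sum_distrib_left)
qed

lemma vint_zero [simp]: "vint (\<lambda>p. 0) = 0"
  using vint_cmult[of 0 "\<lambda>p. 0"] by simp

lemma vint_minus: "vint (\<lambda>p. - f p) = - vint f"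
  using vint_cmult[of "-1" f] by simp

lemma vint_diff:
  assumes "continuous_on UNIV f" "continuous_on UNIV g"
  shows "vint (\<lambda>p. f p - g p) = vint f - vint g"
  using vint_add[OF assms(1) continuous_on_minus[OF assms(2)]] by (simp add: vint_minus)

lemma vint_sum:
  assumes "\<And>i. i \<in> I \<Longrightarrow> continuous_on UNIV (f i)"
  shows "vint (\<lambda>p. \<Sum>i\<in>I. f i p) = (\<Sum>i\<in>I. vint (f i))"
  using assms
proof (induction I rule: infinite_finite_induct)
  case (insert x F)
  then show ?case using vint_add[of "f x" "\<lambda>p. \<Sum>i\<in>F. f i p"] by (simp add: continuous_on_sum)
qed simp_all

lemma local_rep_pou_nonneg:
  assumes "q \<in> pou" "\<And>p. f p \<ge> 0" shows "local_rep (fst q) (\<lambda>p. snd q p * f p * rho (fst q) p) x \<ge> 0"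
  using assms pou(4)[OF assms(1)] less_imp_le[OF rho_pos[OF pou(2)[OF assms(1)]]] pou(2)[OF assms(1)]
  by (auto simp: local_rep_def intro!: mult_nonneg_nonneg)

lemma vint_nonneg: "(\<And>p. f p \<ge> 0) \<Longrightarrow> vint f \<ge> 0"
  unfolding vint_def by (intro sum_nonneg Bochner_Integration.integral_nonneg local_rep_pou_nonneg)

lemma vint_mono:
  assumes "continuous_on UNIV f" "continuous_on UNIV g" "\<And>p. f p \<le> g p"
  shows "vint f \<le> vint g"
  using vint_nonneg[of "\<lambda>p. g p - f p"] vint_diff[OF assms(2,1)] assms(3) by simp

text \<open>Every weighted integral is nonnegative, so each of them vanishes and with it the
  integrand of each chart; summing the weights recovers \<open>f\<close>.\<close>

lemma vint_zero_imp:
  assumes "continuous_on UNIV f" "\<And>p. f p \<ge> 0" "vint f = 0" shows "f p = 0"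
proof -
  have z: "(LINT x|lborel. local_rep (fst q) (\<lambda>p. snd q p * f p * rho (fst q) p) x) = 0" if "q \<in> pou" for q
    using assms(3) that unfolding vint_def
    by (subst (asm) sum_nonneg_eq_0_iff[OF pou(1)])
      (auto intro!: Bochner_Integration.integral_nonneg local_rep_pou_nonneg assms(2))
  have "snd q p * f p = 0" if q: "q \<in> pou" for q
  proof (cases "p \<in> cdom (fst q)")
    case True
    have "local_rep (fst q) (\<lambda>p. snd q p * f p * rho (fst q) p) (coord (fst q) p) = 0"
      by (rule integral_nonneg_zero_imp[OF pou_csupp[OF q assms(1)] local_rep_pou_nonneg[OF q assms(2)] z[OF q]])
    then show ?thesis using True pou(2)[OF q] rho_pos[OF pou(2)[OF q] True]
      by (simp add: local_rep_def)
  next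
    case False
    then show ?thesis using pou(5)[OF q] unfolding supported_in_def by auto
  qed
  then have "(\<Sum>q\<in>pou. snd q p * f p) = 0" by (intro sum.neutral) auto
  then show ?thesis using pou(6)[of p] by (simp flip: sum_distrib_right)
qed

text \<open>The transformation of \<open>rho\<close> cancels the Jacobian of the coordinate change,
  so the two chart integrals are one integral in two coordinates.\<close>

lemma local_integral_overlap:
  assumes c: "c \<in> A" and d: "d \<in> A" and f: "continuous_on UNIV f"
    and Z: "compact Z" "Z \<subseteq> cdom c \<inter> cdom d" "\<And>p. p \<notin> Z \<Longrightarrow> f p = 0"
  shows "(LINT x|lborel. local_rep c (\<lambda>p. f p * rho c p) x) = (LINT x|lborel. local_rep d (\<lambda>p. f p * rho d p) x)"
proof (rule integral_change_variables)
  define S where "S = coord c ` (cdom c \<inter> cdom d)"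
  show S: "open (coord c ` (cdom c \<inter> cdom d))" using open_overlap c d by blast
  show "((coord d \<circ> chart_inv c) has_derivative transition_deriv c d (chart_inv c x)) (at x)"
    if "x \<in> coord c ` (cdom c \<inter> cdom d)" for x
    using that transition_has_derivative[OF c d] c by auto
  show "inj_on (coord d \<circ> chart_inv c) (coord c ` (cdom c \<inter> cdom d))"
  proof (rule inj_onI)
    fix x y assume xy: "x \<in> coord c ` (cdom c \<inter> cdom d)" "y \<in> coord c ` (cdom c \<inter> cdom d)"
      "(coord d \<circ> chart_inv c) x = (coord d \<circ> chart_inv c) y"
    then obtain p q where pq: "p \<in> cdom c \<inter> cdom d" "q \<in> cdom c \<inter> cdom d" "x = coord c p" "y = coord c q" by auto
    then have "coord d p = coord d q" using xy(3) c by auto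
    then have "p = q" using chart_inv_coord[OF d] pq by (metis IntD2)
    then show "x = y" using pq by simp
  qed
  have supp: "supported_in c f" "supported_in d f" unfolding supported_in_def using Z by blast+
  show "cont_csupp (local_rep c (\<lambda>p. f p * rho c p))" "cont_csupp (local_rep d (\<lambda>p. f p * rho d p))"
    using cont_csupp_weighted f supp c d by blast+
  show "local_rep d (\<lambda>p. f p * rho d p) y = 0" if "y \<notin> (coord d \<circ> chart_inv c) ` coord c ` (cdom c \<inter> cdom d)" for y
  proof (cases "y \<in> cimage d \<and> chart_inv d y \<in> Z")
    case True
    then have "y = (coord d \<circ> chart_inv c) (coord c (chart_inv d y))" using Z(2) c d by auto
    then have "y \<in> (coord d \<circ> chart_inv c) ` coord c ` (cdom c \<inter> cdom d)" using True Z(2) by blast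
    then show ?thesis using that by blast
  qed (auto simp: local_rep_def Z(3))
  show "local_rep c (\<lambda>p. f p * rho c p) x = 0" if "x \<notin> coord c ` (cdom c \<inter> cdom d)" for x
  proof (cases "x \<in> cimage c \<and> chart_inv c x \<in> Z")
    case True
    then have "x = coord c (chart_inv c x)" using c by auto
    then have "x \<in> coord c ` (cdom c \<inter> cdom d)" using True Z(2) by blast
    then show ?thesis using that by blast
  qed (auto simp: local_rep_def Z(3))
  show "local_rep c (\<lambda>p. f p * rho c p) x = \<bar>det (matrix (transition_deriv c d (chart_inv c x)))\<bar> *
      local_rep d (\<lambda>p. f p * rho d p) ((coord d \<circ> chart_inv c) x)"
    if "x \<in> coord c ` (cdom c \<inter> cdom d)" for x
    using that rho_transition[OF c d] c d by (auto simp: local_rep_def)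
qed

text \<open>Each weighted piece lives in an overlap with \<open>c\<close> and can be moved there;
  then the weights add up to 1. This removes the partition from the definition of the
  integral.\<close>

lemma vint_chart:
  assumes c: "c \<in> A" and f: "continuous_on UNIV f" and s: "supported_in c f"
  shows "vint f = (LINT x|lborel. local_rep c (\<lambda>p. f p * rho c p) x)"
proof -
  obtain Z where Z: "compact Z" "Z \<subseteq> cdom c" "\<And>p. p \<notin> Z \<Longrightarrow> f p = 0"
    using s unfolding supported_in_def by blast
  have cs: "cont_csupp (local_rep c (\<lambda>p. snd q p * f p * rho c p))" if "q \<in> pou" for q
    by (rule cont_csupp_weighted[OF c pou_mult(1)[OF that f]])
      (use s in \<open>auto simp: supported_in_def\<close>)
  have "vint f = (\<Sum>q\<in>pou. LINT x|lborel. local_rep c (\<lambda>p. snd q p * f p * rho c p) x)"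
    unfolding vint_def
  proof (rule sum.cong[OF refl])
    fix q assume q: "q \<in> pou"
    obtain Y where Y: "compact Y" "Y \<subseteq> cdom (fst q)" "\<And>p. p \<notin> Y \<Longrightarrow> snd q p = 0"
      using pou(5)[OF q] unfolding supported_in_def by blast
    show "(LINT x|lborel. local_rep (fst q) (\<lambda>p. snd q p * f p * rho (fst q) p) x) = (LINT x|lborel. local_rep c (\<lambda>p. snd q p * f p * rho c p) x)"
    proof (rule local_integral_overlap[OF pou(2)[OF q] c pou_mult(1)[OF q f]])
      show "compact (Y \<inter> Z)" using Y Z by (intro compact_Int)
    qed (use Y Z in auto)
  qed
  also have "\<dots> = (LINT x|lborel. (\<Sum>q\<in>pou. local_rep c (\<lambda>p. snd q p * f p * rho c p) x))"
    by (rule Bochner_Integration.integral_sum[symmetric]) (use integrable_csupp cs in blast)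
  also have "(\<lambda>x. \<Sum>q\<in>pou. local_rep c (\<lambda>p. snd q p * f p * rho c p) x) = local_rep c (\<lambda>p. f p * rho c p)"
  proof
    fix x
    show "(\<Sum>q\<in>pou. local_rep c (\<lambda>p. snd q p * f p * rho c p) x) = local_rep c (\<lambda>p. f p * rho c p) x"
      using pou(6)[of "chart_inv c x"] by (simp add: local_rep_def flip: sum_distrib_right)
  qed
  finally show ?thesis .
qed

text \<open>The divergence multiplied by the density \<open>rho\<close>. The factor is kept because
  only vanishing and integrals against functions matter, and for these this form has no
  denominators.\<close>

definition divg :: "'a chart \<Rightarrow> 'a vfield \<Rightarrow> real^3 \<Rightarrow> real" where
  "divg c X x = (\<Sum>i\<in>UNIV. partial_deriv i (\<lambda>y. rho c (chart_inv c y) * X c (chart_inv c y) $ i) x)"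

lemma smooth_rho_comp:
  "c \<in> A \<Longrightarrow> X \<in> smooth_vfields A \<Longrightarrow> smooth_on (cimage c) (\<lambda>y. rho c (chart_inv c y) * X c (chart_inv c y) $ i)"
  by (intro smooth_on_mult open_cimage smooth_rho smooth_on_nth vfield_smooth)

lemma smooth_divg: "c \<in> A \<Longrightarrow> X \<in> smooth_vfields A \<Longrightarrow> smooth_on (cimage c) (divg c X)"
  unfolding divg_def by (intro smooth_on_sum smooth_on_partial smooth_rho_comp open_cimage)

text \<open>The bracket with a constant field is minus the derivative of the field, so the bracket
  terms sum to its trace times the volume; the product rule for \<open>rho\<close> times the field
  does the rest.\<close>

lemma lie_derivative_divg:
  assumes X: "X \<in> smooth_vfields A" and c: "c \<in> A" and p: "p \<in> cdom c"
  shows "lie_derivative X dvol c p u v w = divg c X (coord c p) * det3 u v w"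
proof -
  define F where "F = X c \<circ> chart_inv c"
  define x where "x = coord c p"
  define r where "r = (\<lambda>y. rho c (chart_inv c y))"
  have x: "x \<in> cimage c" "chart_inv c x = p" using c p by (auto simp: x_def)
  have sF: "smooth_on (cimage c) F" using vfield_smooth[OF X c] by (simp add: F_def comp_def)
  have dF: "F differentiable at x" using smooth_on_differentiable[OF sF x(1)] .
  have sr: "smooth_on (cimage c) r" using smooth_rho[OF c] by (simp add: r_def)
  have dr: "r differentiable at x" using smooth_on_differentiable[OF sr x(1)] .
  define L where "L = frechet_derivative F (at x)"
  have L: "linear L" unfolding L_def by (rule linear_frechet_derivative[OF dF])
  have lb: "lie_bracket F (\<lambda>_. u) x = - L u" for u
    by (simp add: lie_bracket_def L_def frechet_derivative_const)
  have d0: "det3 (- a) b d = - det3 a b d" "det3 a (- b) d = - det3 a b d" "det3 a b (- d) = - det3 a b d" for a b d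
    by (simp_all add: det3_def algebra_simps)
  have fd: "frechet_derivative (\<lambda>y. dvol c (chart_inv c y) u v w) (at x) (F x) = frechet_derivative r (at x) (F x) * det3 u v w"
  proof -
    have "frechet_derivative (\<lambda>y. dvol c (chart_inv c y) u v w) (at x) = frechet_derivative (\<lambda>y. r y * det3 u v w) (at x)"
      by (rule frechet_cong_open[OF open_cimage[OF c] x(1)]) (use c in \<open>simp add: dvol_rho r_def\<close>)
    also have "\<dots> = (\<lambda>h. frechet_derivative r (at x) h * det3 u v w)"
      by (rule frechet_derivative_at[symmetric]) (intro has_derivative_mult_left frechet_has_derivative dr)
    finally show ?thesis by simp
  qed
  have pd: "partial_deriv i (\<lambda>y. r y * F y $ i) x = r x * L (axis i 1) $ i + partial_deriv i r x * F x $ i" for i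
  proof -
    have "(\<lambda>y. F y $ i) differentiable at x" using smooth_on_differentiable[OF smooth_on_nth[OF open_cimage[OF c] sF] x(1)] .
    then have "partial_deriv i (\<lambda>y. r y * F y $ i) x = r x * partial_deriv i (\<lambda>y. F y $ i) x + partial_deriv i r x * F x $ i"
      using partial_deriv_bilinear[OF bounded_bilinear_mult dr] by blast
    also have "partial_deriv i (\<lambda>y. F y $ i) x = L (axis i 1) $ i"
      using partial_deriv_bounded_linear[OF bounded_linear_vec_nth dF] by (simp add: L_def partial_deriv_def)
    finally show ?thesis .
  qed
  have "lie_derivative X dvol c p u v w = frechet_derivative r (at x) (F x) * det3 u v w
      + r x * (det3 (L u) v w + det3 u (L v) w + det3 u v (L w))"
    unfolding lie_derivative_def Let_def F_def[symmetric] x_def[symmetric] fd lb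
    by (simp add: dvol_rho c p d0 r_def x algebra_simps)
  also have "\<dots> = (frechet_derivative r (at x) (F x) + r x * (\<Sum>i\<in>UNIV. L (axis i 1) $ i)) * det3 u v w"
    unfolding det3_trace[OF L] by (simp add: algebra_simps)
  also have "frechet_derivative r (at x) (F x) + r x * (\<Sum>i\<in>UNIV. L (axis i 1) $ i) = (\<Sum>i\<in>UNIV. partial_deriv i (\<lambda>y. r y * F y $ i) x)"
    unfolding frechet_expansion[OF dr] pd by (simp add: sum.distrib sum_distrib_left mult.commute)
  also have "\<dots> = divg c X x" by (simp add: divg_def r_def F_def)
  finally show ?thesis by (simp add: x_def)
qed

lemma divergence_free_iff:
  assumes X: "X \<in> smooth_vfields A"
  shows "divergence_free A dvol X \<longleftrightarrow> (\<forall>c\<in>A. \<forall>x\<in>cimage c. divg c X x = 0)"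
proof
  assume L: "divergence_free A dvol X"
  show "\<forall>c\<in>A. \<forall>x\<in>cimage c. divg c X x = 0"
  proof (intro ballI)
    fix c x assume c: "c \<in> A" and x: "x \<in> cimage c"
    have p: "chart_inv c x \<in> cdom c" using c x by simp
    have "lie_derivative X dvol c (chart_inv c x) (axis 1 1) (axis 2 1) (axis 3 1) = 0"
      using L c p unfolding divergence_free_def by blast
    then show "divg c X x = 0" using lie_derivative_divg[OF X c p] c x by (simp add: det3_def)
  qed
next
  assume "\<forall>c\<in>A. \<forall>x\<in>cimage c. divg c X x = 0"
  then show "divergence_free A dvol X" unfolding divergence_free_def using lie_derivative_divg[OF X] by simp
qed

text \<open>The divergence theorem in one chart: the components \<open>H i\<close> of
  \<open>h * rho * X\<close> have compact support, and the integrals of their derivatives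
  vanish.\<close>

lemma vint_dir_deriv_chart:
  assumes c: "c \<in> A" and X: "X \<in> smooth_vfields A" and h: "smooth_fun A h" and s: "supported_in c h"
  shows "vint (dir_deriv A X h) = - (LINT x|lborel. local_rep c (\<lambda>p. h p * divg c X (coord c p)) x)"
proof -
  define H where "H i = local_rep c (\<lambda>p. h p * (rho c p * X c p $ i))" for i
  define h' where "h' = h \<circ> chart_inv c"
  define G where "G = local_rep c (\<lambda>p. h p * divg c X (coord c p))"
  have sh: "smooth_on (cimage c) h'" unfolding h'_def by (rule smooth_fun_chart[OF h c])
  have supp: "supported_in c (\<lambda>p. h p * g p)" for g
    using s unfolding supported_in_def by (metis mult_zero_left)
  have smH: "smooth_on (cimage c) (\<lambda>x. h' x * (rho c (chart_inv c x) * X c (chart_inv c x) $ i))" for i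
    by (intro smooth_on_mult open_cimage c sh smooth_rho_comp[OF c X, unfolded])
  have H: "smooth_on UNIV (H i)" for i unfolding H_def
    by (rule smooth_local_rep(1)[OF c _ supp]) (use smH in \<open>simp add: comp_def h'_def\<close>)
  have HK: "\<exists>K. compact K \<and> K \<subseteq> cimage c \<and> (\<forall>x. x \<notin> K \<longrightarrow> H i x = 0)" for i unfolding H_def
    by (rule smooth_local_rep(2)[OF c _ supp]) (use smH in \<open>simp add: comp_def h'_def\<close>)
  have smG: "smooth_on (cimage c) ((\<lambda>p. h p * divg c X (coord c p)) \<circ> chart_inv c)"
  proof (rule smooth_on_cong[OF open_cimage[OF c], THEN iffD1])
    show "smooth_on (cimage c) (\<lambda>x. h' x * divg c X x)"
      by (intro smooth_on_mult open_cimage c sh smooth_divg X)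
  qed (use c in \<open>simp add: h'_def\<close>)
  have G: "cont_csupp G"
  proof -
    obtain K where "compact K" "\<forall>x. x \<notin> K \<longrightarrow> G x = 0"
      using smooth_local_rep(2)[OF c smG supp] unfolding G_def by blast
    then show ?thesis
      using smooth_on_continuous[OF smooth_local_rep(1)[OF c smG supp]] unfolding cont_csupp_def G_def by blast
  qed
  have Z: "(LINT x|lborel. partial_deriv i (H i) x) = 0" and Hi: "integrable lborel (partial_deriv i (H i))" for i
  proof -
    obtain K where K: "compact K" "\<And>x. x \<notin> K \<Longrightarrow> H i x = 0" using HK[of i] by blast
    show "(LINT x|lborel. partial_deriv i (H i) x) = 0" by (rule integral_partial_zero[OF H K])
    show "integrable lborel (partial_deriv i (H i))" by (rule integrable_csupp[OF cont_csupp_partial[OF H K]])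
  qed
  have key: "local_rep c (\<lambda>p. dir_deriv A X h p * rho c p) x = (\<Sum>i\<in>UNIV. partial_deriv i (H i) x) - G x" for x
  proof (cases "x \<in> cimage c")
    case True
    have "partial_deriv i (H i) x = h' x * partial_deriv i (\<lambda>x. rho c (chart_inv c x) * X c (chart_inv c x) $ i) x
        + partial_deriv i h' x * (rho c (chart_inv c x) * X c (chart_inv c x) $ i)" for i
    proof -
      have "partial_deriv i (H i) x = partial_deriv i (\<lambda>x. h' x * (rho c (chart_inv c x) * X c (chart_inv c x) $ i)) x"
        by (rule partial_deriv_cong_open[OF open_cimage[OF c] True]) (simp add: H_def local_rep_def h'_def)
      also have "\<dots> = h' x * partial_deriv i (\<lambda>x. rho c (chart_inv c x) * X c (chart_inv c x) $ i) x
        + partial_deriv i h' x * (rho c (chart_inv c x) * X c (chart_inv c x) $ i)"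
        by (rule partial_deriv_bilinear[OF bounded_bilinear_mult smooth_on_differentiable[OF sh True] smooth_on_differentiable[OF smooth_rho_comp[OF c X] True]])
      finally show ?thesis .
    qed
    then have "(\<Sum>i\<in>UNIV. partial_deriv i (H i) x) = h' x * divg c X x
       + (\<Sum>i\<in>UNIV. partial_deriv i h' x * (rho c (chart_inv c x) * X c (chart_inv c x) $ i))"
      by (simp add: sum.distrib divg_def sum_distrib_left)
    also have "(\<Sum>i\<in>UNIV. partial_deriv i h' x * (rho c (chart_inv c x) * X c (chart_inv c x) $ i))
       = dir_deriv A X h (chart_inv c x) * rho c (chart_inv c x)"
      using dir_deriv_partial[OF X h c, of "chart_inv c x"] True c
      by (simp add: h'_def sum_distrib_left mult_ac)
    finally show ?thesis using True c by (simp add: local_rep_def G_def h'_def)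
  next
    case False
    have "partial_deriv i (H i) x = 0" for i
    proof -
      obtain K where K: "compact K" "K \<subseteq> cimage c" "\<And>x. x \<notin> K \<Longrightarrow> H i x = 0" using HK[of i] by blast
      show ?thesis by (rule csupp_partial[OF H K(1,3)]) (use False K in auto)
    qed
    then show ?thesis using False by (simp add: local_rep_def G_def)
  qed
  have "vint (dir_deriv A X h) = (LINT x|lborel. local_rep c (\<lambda>p. dir_deriv A X h p * rho c p) x)"
    by (rule vint_chart[OF c smooth_fun_continuous[OF smooth_dir_deriv[OF X h]] supported_in_dir_deriv[OF X h s]])
  also have "\<dots> = - (LINT x|lborel. G x)"
    unfolding key using Hi integrable_csupp[OF G] Z by simp
  finally show ?thesis by (simp add: G_def)
qed

lemma vint_dir_deriv_zero:
  assumes X: "X \<in> smooth_vfields A" "divergence_free A dvol X" and f: "smooth_fun A f"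
  shows "vint (dir_deriv A X f) = 0"
proof -
  have sq: "smooth_fun A (\<lambda>p. snd q p * f p)" if "q \<in> pou" for q by (intro smooth_fun_mult pou that f)
  have z: "vint (dir_deriv A X (\<lambda>p. snd q p * f p)) = 0" if q: "q \<in> pou" for q
  proof -
    have "local_rep (fst q) (\<lambda>p. snd q p * f p * divg (fst q) X (coord (fst q) p)) = (\<lambda>x. 0)"
      using X(2) divergence_free_iff[OF X(1)] pou(2)[OF q] by (auto simp: local_rep_def fun_eq_iff)
    then show ?thesis
      using vint_dir_deriv_chart[OF pou(2)[OF q] X(1) sq[OF q] pou_mult(2)[OF q smooth_fun_continuous[OF f]]] by simp
  qed
  have "f = (\<lambda>p. \<Sum>q\<in>pou. snd q p * f p)" using pou(6) by (auto simp: fun_eq_iff simp flip: sum_distrib_right)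
  then have "dir_deriv A X f p = (\<Sum>q\<in>pou. dir_deriv A X (\<lambda>p. snd q p * f p) p)" for p
    using dir_deriv_sum[OF X(1), of pou "\<lambda>q p. snd q p * f p" p] sq by simp
  then have "vint (dir_deriv A X f) = vint (\<lambda>p. \<Sum>q\<in>pou. dir_deriv A X (\<lambda>p. snd q p * f p) p)"
    by (intro arg_cong[of _ _ vint] ext)
  also have "\<dots> = (\<Sum>q\<in>pou. vint (dir_deriv A X (\<lambda>p. snd q p * f p)))"
    by (rule vint_sum) (rule smooth_fun_continuous[OF smooth_dir_deriv[OF X(1) sq]])
  also have "\<dots> = 0" using z by simp
  finally show ?thesis .
qed

text \<open>The weak form of being divergence-free. It lets the fields constructed later be checked
  by integration instead of by computing Lie derivatives in every chart.\<close>

lemma divergence_freeI: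
  assumes X: "X \<in> smooth_vfields A" and z: "\<And>f. smooth_fun A f \<Longrightarrow> vint (dir_deriv A X f) = 0"
  shows "divergence_free A dvol X"
  unfolding divergence_free_iff[OF X]
proof (intro ballI)
  fix c x assume cx: "c \<in> A" "x \<in> cimage c"
  define p where "p = chart_inv c x"
  have c: "c \<in> A" "p \<in> cdom c" using cx by (auto simp: p_def)
  obtain b :: "'a \<Rightarrow> real" where b: "smooth_fun A b" "\<And>q. b q \<ge> 0" "b p > 0" "supported_in c b"
    using bump_exists[OF c] by blast
  \<comment> \<open>A bump times the divergence: tested against the divergence it becomes a bump
    times a square, whose vanishing integral forces the value at \<open>p\<close> to be 0.\<close>
  define g where "g = (\<lambda>x. b (chart_inv c x) * divg c X x)"
  define h where "h = extend_zero c g"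
  have sg: "smooth_on (cimage c) g" unfolding g_def
    by (intro smooth_on_mult open_cimage c smooth_fun_chart' b smooth_divg X)
  obtain K where K: "compact K" "K \<subseteq> cimage c" "\<And>x. x \<notin> K \<Longrightarrow> local_rep c b x = 0"
    using smooth_local_rep(2)[OF c(1) smooth_fun_chart[OF b(1) c(1)] b(4)] by blast
  have g0: "g x = 0" if "x \<in> cimage c" "x \<notin> K" for x
    using K(3)[OF that(2)] that(1) by (simp add: g_def local_rep_def)
  have h: "smooth_fun A h" "supported_in c h"
    unfolding h_def using smooth_extend_zero[OF c(1) sg K(1,2) g0] by auto
  define G where "G = local_rep c (\<lambda>p. h p * divg c X (coord c p))"
  have "(LINT x|lborel. G x) = 0"
    unfolding G_def using vint_dir_deriv_chart[OF c(1) X h] z[OF h(1)] by simp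
  moreover have "G x \<ge> 0" for x
    using b(2) c by (auto simp: G_def h_def g_def local_rep_def extend_zero_def mult.assoc intro!: mult_nonneg_nonneg)
  moreover have "cont_csupp G" unfolding G_def
  proof (rule cont_csupp_local_rep[OF c(1)])
    show "supported_in c (\<lambda>p. h p * divg c X (coord c p))"
      using h(2) unfolding supported_in_def by (metis mult_zero_left)
    have "continuous_on (cdom c) (\<lambda>p. divg c X (coord c p))"
      by (rule continuous_on_compose2[OF smooth_on_continuous[OF smooth_divg[OF c(1) X]] continuous_coord[OF c(1)]]) auto
    then show "continuous_on (cdom c) (\<lambda>p. h p * divg c X (coord c p))"
      by (intro continuous_on_mult continuous_on_subset[OF smooth_fun_continuous[OF h(1)]]) auto
  qed
  ultimately have "G (coord c p) = 0" using integral_nonneg_zero_imp by blast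
  then have "divg c X (coord c p) = 0" using b(3) c by (simp add: G_def h_def g_def local_rep_def extend_zero_def)
  then show "divg c X x = 0" using cx by (simp add: p_def)
qed

end

section \<open>The inner product, and commutators of vector fields\<close>

context volume_manifold
begin

definition ip :: "('a \<Rightarrow> quat) \<Rightarrow> ('a \<Rightarrow> quat) \<Rightarrow> real" where
  "ip f g = vint (\<lambda>p. f p \<bullet> g p)"

definition nrm :: "('a \<Rightarrow> quat) \<Rightarrow> real" where
  "nrm f = sqrt (ip f f)"

abbreviation cont :: "('a \<Rightarrow> 'b::topological_space) \<Rightarrow> bool" where
  "cont f \<equiv> continuous_on UNIV f"

lemma ip_commute: "ip f g = ip g f"
  by (simp add: ip_def inner_commute)

lemma ip_add_left: "cont f \<Longrightarrow> cont g \<Longrightarrow> cont h \<Longrightarrow> ip (\<lambda>p. f p + g p) h = ip f h + ip g h"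
  unfolding ip_def inner_add_left by (intro vint_add continuous_on_inner)

lemma ip_add_right: "cont f \<Longrightarrow> cont g \<Longrightarrow> cont h \<Longrightarrow> ip h (\<lambda>p. f p + g p) = ip h f + ip h g"
  using ip_add_left[of f g h] by (simp add: ip_commute[of h])

lemma ip_scale_left: "ip (\<lambda>p. t *\<^sub>R f p) h = t * ip f h"
  unfolding ip_def by (simp add: vint_cmult)

lemma ip_scale_right: "ip h (\<lambda>p. t *\<^sub>R f p) = t * ip h f"
  unfolding ip_def by (simp add: vint_cmult)

lemma ip_diff_left: "cont f \<Longrightarrow> cont g \<Longrightarrow> cont h \<Longrightarrow> ip (\<lambda>p. f p - g p) h = ip f h - ip g h"
  unfolding ip_def inner_diff_left by (intro vint_diff continuous_on_inner)

lemma ip_diff_right: "cont f \<Longrightarrow> cont g \<Longrightarrow> cont h \<Longrightarrow> ip h (\<lambda>p. f p - g p) = ip h f - ip h g"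
  using ip_diff_left[of f g h] by (simp add: ip_commute[of h])

lemma ip_sum_left:
  "(\<And>i. i \<in> I \<Longrightarrow> cont (f i)) \<Longrightarrow> cont h \<Longrightarrow> ip (\<lambda>p. \<Sum>i\<in>I. f i p) h = (\<Sum>i\<in>I. ip (f i) h)"
  unfolding ip_def inner_sum_left by (intro vint_sum continuous_on_inner)

lemma ip_sum_right:
  "(\<And>i. i \<in> I \<Longrightarrow> cont (f i)) \<Longrightarrow> cont h \<Longrightarrow> ip h (\<lambda>p. \<Sum>i\<in>I. f i p) = (\<Sum>i\<in>I. ip h (f i))"
  using ip_sum_left[of I f h] by (simp add: ip_commute[of h])

lemma ip_nonneg: "ip f f \<ge> 0"
  unfolding ip_def by (intro vint_nonneg) simp

lemma nrm_nonneg [simp]: "nrm f \<ge> 0"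
  by (simp add: nrm_def ip_nonneg)

lemma nrm_sq: "nrm f ^ 2 = ip f f"
  by (simp add: nrm_def ip_nonneg)

lemma nrm_zero_imp: "cont f \<Longrightarrow> nrm f = 0 \<Longrightarrow> f p = 0"
  using vint_zero_imp[of "\<lambda>p. f p \<bullet> f p" p] by (simp add: nrm_def ip_def continuous_on_inner)

lemma nrm_scale: "nrm (\<lambda>p. t *\<^sub>R f p) = \<bar>t\<bar> * nrm f"
  by (simp add: nrm_def ip_scale_left ip_scale_right real_sqrt_mult flip: mult.assoc power2_eq_square)

lemma ip_Cauchy_Schwarz:
  assumes f: "cont f" and g: "cont g" shows "\<bar>ip f g\<bar> \<le> nrm f * nrm g"
proof (cases "nrm g = 0")
  case True
  then have "g p = 0" for p by (rule nrm_zero_imp[OF g])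
  then have "ip f g = 0" by (simp add: ip_def)
  then show ?thesis by simp
next
  case False
  \<comment> \<open>The coefficient of the orthogonal projection of \<open>f\<close> to the line of
    \<open>g\<close>.\<close>
  define t where "t = ip f g / ip g g"
  have gg: "ip g g > 0" using False nrm_sq[of g] ip_nonneg[of g] by (metis less_eq_real_def nrm_def real_sqrt_zero)
  have "0 \<le> ip (\<lambda>p. f p - t *\<^sub>R g p) (\<lambda>p. f p - t *\<^sub>R g p)" by (rule ip_nonneg)
  also have "\<dots> = ip f f - 2 * t * ip f g + t^2 * ip g g"
    using f g by (simp add: ip_diff_left ip_diff_right ip_scale_left ip_scale_right continuous_on_diff
      continuous_on_scaleR ip_commute[of g f] power2_eq_square algebra_simps)
  also have "\<dots> = ip f f - (ip f g)^2 / ip g g" using gg by (simp add: t_def power2_eq_square field_simps)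
  finally have "(ip f g)^2 \<le> ip f f * ip g g" using gg by (simp add: field_simps)
  then have "\<bar>ip f g\<bar>^2 \<le> (nrm f * nrm g)^2" by (simp add: power_mult_distrib nrm_sq)
  then show ?thesis by (rule power2_le_imp_le) simp
qed

lemma nrm_triangle:
  assumes f: "cont f" and g: "cont g" shows "nrm (\<lambda>p. f p + g p) \<le> nrm f + nrm g"
proof (rule power2_le_imp_le)
  have "nrm (\<lambda>p. f p + g p) ^ 2 = ip f f + 2 * ip f g + ip g g"
    using f g by (simp add: nrm_sq ip_add_left ip_add_right continuous_on_add ip_commute[of g f])
  also have "\<dots> \<le> ip f f + 2 * (nrm f * nrm g) + ip g g" using ip_Cauchy_Schwarz[OF f g] by simp
  also have "\<dots> = (nrm f + nrm g)^2" by (simp add: power2_sum nrm_sq)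
  finally show "nrm (\<lambda>p. f p + g p) ^ 2 \<le> (nrm f + nrm g)^2" .
qed simp

lemma nrm_pointwise:
  assumes "cont f" "cont g" "B \<ge> 0" "\<And>p. norm (f p) \<le> B * norm (g p)"
  shows "nrm f \<le> B * nrm g"
proof (rule power2_le_imp_le)
  have "norm (f p)^2 \<le> (B * norm (g p))^2" for p by (rule power_mono[OF assms(4)]) simp
  then have "f p \<bullet> f p \<le> B^2 * (g p \<bullet> g p)" for p by (simp add: dot_square_norm power_mult_distrib)
  then have "ip f f \<le> vint (\<lambda>p. B^2 * (g p \<bullet> g p))" unfolding ip_def
    using assms(1,2) by (intro vint_mono continuous_on_inner continuous_on_mult continuous_on_const)
  then show "nrm f ^ 2 \<le> (B * nrm g)^2" by (simp add: nrm_sq vint_cmult ip_def power_mult_distrib)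
qed (use assms in simp)

lemma vint_one_nonneg: "vint (\<lambda>p. 1) \<ge> 0"
  by (intro vint_nonneg) simp

lemma vint_norm_le:
  assumes "cont f" shows "vint (\<lambda>p. norm (f p)) \<le> sqrt (vint (\<lambda>p. 1)) * nrm (f :: 'a \<Rightarrow> quat)"
proof -
  \<comment> \<open>The pointwise norm of \<open>f\<close>, placed in the real direction so that the
    quaternion-valued Cauchy--Schwarz inequality applies.\<close>
  define g :: "'a \<Rightarrow> quat" where "g p = norm (f p) *\<^sub>R axis 1 1" for p
  have cg: "cont g" unfolding g_def using assms by (intro continuous_intros)
  have "vint (\<lambda>p. norm (f p)) = ip (\<lambda>p. axis 1 1) g" by (simp add: ip_def g_def inner_axis_axis)
  also have "\<dots> \<le> nrm (\<lambda>p. axis 1 1) * nrm g"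
    using ip_Cauchy_Schwarz[OF continuous_on_const cg, of "axis 1 1"] by linarith
  also have "nrm (\<lambda>p. axis 1 1) = sqrt (vint (\<lambda>p. 1))" by (simp add: nrm_def ip_def inner_axis_axis)
  also have "nrm g = nrm f" by (simp add: nrm_def ip_def g_def inner_axis_axis dot_square_norm power2_eq_square)
  finally show ?thesis .
qed

lemma nrm_le_sup:
  assumes "cont f" "\<And>p. norm (f p) \<le> B" shows "nrm f \<le> sqrt (vint (\<lambda>p. 1)) * B"
proof -
  have B: "B \<ge> 0" using assms(2) norm_ge_zero order_trans by blast
  have "norm (f p) \<le> B * norm (axis 1 1 :: quat)" for p using assms(2) by (simp add: norm_axis_1)
  then have "nrm f \<le> B * nrm (\<lambda>p. axis 1 1)"
    using nrm_pointwise[OF assms(1) continuous_on_const B] by blast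
  also have "nrm (\<lambda>p. axis 1 1) = sqrt (vint (\<lambda>p. 1))" by (simp add: nrm_def ip_def inner_axis_axis)
  finally show ?thesis by (simp add: mult.commute)
qed

text \<open>For a divergence-free field integration by parts leaves no term of order zero. The
  symmetry of the Fueter operators rests on this.\<close>

lemma ip_dir_deriv:
  assumes X: "X \<in> smooth_vfields A" "divergence_free A dvol X" and f: "smooth_fun A f" and g: "smooth_fun A g"
  shows "ip (dir_deriv A X f) g = - ip f (dir_deriv A X g)"
proof -
  have c: "cont f" "cont g" "cont (dir_deriv A X f)" "cont (dir_deriv A X g)"
    by (intro smooth_fun_continuous smooth_dir_deriv X f g)+
  have "0 = vint (dir_deriv A X (\<lambda>p. f p \<bullet> g p))"
    using vint_dir_deriv_zero[OF X smooth_fun_inner[OF f g]] by simp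
  also have "dir_deriv A X (\<lambda>p. f p \<bullet> g p) = (\<lambda>p. f p \<bullet> dir_deriv A X g p + dir_deriv A X f p \<bullet> g p)"
    by (rule ext) (rule dir_deriv_bilinear[OF X(1) f g bounded_bilinear_inner])
  also have "vint \<dots> = ip f (dir_deriv A X g) + ip (dir_deriv A X f) g"
    unfolding ip_def by (intro vint_add continuous_on_inner c)
  finally show ?thesis by simp
qed

section \<open>Volumes of triples of fields, and commutators\<close>

definition vol3 :: "'a vfield \<Rightarrow> 'a vfield \<Rightarrow> 'a vfield \<Rightarrow> 'a \<Rightarrow> real" where
  "vol3 X Y Z p = (let c = SOME c. c \<in> A \<and> p \<in> cdom c in dvol c p (X c p) (Y c p) (Z c p))"

lemma vol3_chart:
  assumes X: "X \<in> smooth_vfields A" and Y: "Y \<in> smooth_vfields A" and Z: "Z \<in> smooth_vfields A" and c: "c \<in> A" "p \<in> cdom c"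
  shows "vol3 X Y Z p = dvol c p (X c p) (Y c p) (Z c p)"
proof -
  define d where "d = (SOME c. c \<in> A \<and> p \<in> cdom c)"
  have d: "d \<in> A" "p \<in> cdom d"
    using someI[of "\<lambda>c. c \<in> A \<and> p \<in> cdom c" c] c by (auto simp: d_def)
  have "dvol d p u v w = dvol c p (transition_deriv d c p u) (transition_deriv d c p v) (transition_deriv d c p w)" for u v w
    using pvf c d unfolding positive_volume_form_def smooth_3form_def by (metis IntI)
  then show ?thesis
    using vfield_transition[OF X d(1) c(1) d(2) c(2)] vfield_transition[OF Y d(1) c(1) d(2) c(2)]
      vfield_transition[OF Z d(1) c(1) d(2) c(2)]
    by (simp add: vol3_def Let_def flip: d_def)
qed

lemma vol3_rho:
  assumes "X \<in> smooth_vfields A" "Y \<in> smooth_vfields A" "Z \<in> smooth_vfields A" "c \<in> A" "p \<in> cdom c"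
  shows "vol3 X Y Z p = rho c p * det3 (X c p) (Y c p) (Z c p)"
  using vol3_chart[OF assms] dvol_rho assms by simp

lemma smooth_vol3:
  assumes X: "X \<in> smooth_vfields A" and Y: "Y \<in> smooth_vfields A" and Z: "Z \<in> smooth_vfields A"
  shows "smooth_fun A (vol3 X Y Z)"
  unfolding smooth_fun_def
proof
  fix c assume c: "c \<in> A"
  have "smooth_on (cimage c) (\<lambda>x. rho c (chart_inv c x) * det3 (X c (chart_inv c x)) (Y c (chart_inv c x)) (Z c (chart_inv c x)))"
    unfolding det3_def
    by (intro smooth_on_mult smooth_on_add smooth_on_diff open_cimage c smooth_rho smooth_on_nth vfield_smooth X Y Z)
  then show "smooth_on (cimage c) (vol3 X Y Z \<circ> chart_inv c)"
    by (rule smooth_on_cong[OF open_cimage[OF c], THEN iffD1, rotated])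
      (use c vol3_rho[OF X Y Z c] in simp)
qed

text \<open>The second order terms are symmetric in the two fields and cancel by equality of mixed
  derivatives; what remains is the derivative along the bracket in the chart.\<close>

lemma dir_deriv_commutator_chart:
  fixes f :: "'a \<Rightarrow> real^'m::finite"
  assumes X: "X \<in> smooth_vfields A" and Y: "Y \<in> smooth_vfields A" and f: "smooth_fun A f"
    and c: "c \<in> A" "p \<in> cdom c"
  shows "dir_deriv A X (dir_deriv A Y f) p - dir_deriv A Y (dir_deriv A X f) p =
    frechet_derivative (f \<circ> chart_inv c) (at (coord c p)) (lie_bracket (X c \<circ> chart_inv c) (Y c \<circ> chart_inv c) (coord c p))"
proof -
  define x where "x = coord c p"
  define g where "g = f \<circ> chart_inv c"
  have x: "x \<in> cimage c" "chart_inv c x = p" using c by (auto simp: x_def)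
  have sg: "smooth_on (cimage c) g" unfolding g_def by (rule smooth_fun_chart[OF f c(1)])
  have dg: "g differentiable at x" using smooth_on_differentiable[OF sg x(1)] .
  have *: "dir_deriv A V (dir_deriv A W f) p =
      (\<Sum>l\<in>UNIV. frechet_derivative (W c \<circ> chart_inv c) (at x) (V c p) $ l *\<^sub>R partial_deriv l g x)
      + (\<Sum>m\<in>UNIV. \<Sum>l\<in>UNIV. (V c p $ m * W c p $ l) *\<^sub>R partial_deriv m (partial_deriv l g) x)"
    if V: "V \<in> smooth_vfields A" and W: "W \<in> smooth_vfields A" for V W
  proof -
    define G where "G = W c \<circ> chart_inv c"
    have sG: "smooth_on (cimage c) G" using vfield_smooth[OF W c(1)] by (simp add: G_def comp_def)
    have dG: "G differentiable at x" using smooth_on_differentiable[OF sG x(1)] .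
    have 1: "partial_deriv m (dir_deriv A W f \<circ> chart_inv c) x =
       (\<Sum>l\<in>UNIV. G x $ l *\<^sub>R partial_deriv m (partial_deriv l g) x + partial_deriv m G x $ l *\<^sub>R partial_deriv l g x)" for m
    proof -
      have "partial_deriv m (dir_deriv A W f \<circ> chart_inv c) x = partial_deriv m (\<lambda>y. \<Sum>l\<in>UNIV. G y $ l *\<^sub>R partial_deriv l g y) x"
        by (rule partial_deriv_cong_open[OF open_cimage[OF c(1)] x(1)])
          (use dir_deriv_partial[OF W f c(1)] c in \<open>simp add: G_def g_def\<close>)
      also have "\<dots> = (\<Sum>l\<in>UNIV. partial_deriv m (\<lambda>y. G y $ l *\<^sub>R partial_deriv l g y) x)"
      proof -
        have "((\<lambda>y. \<Sum>l\<in>UNIV. G y $ l *\<^sub>R partial_deriv l g y) has_derivative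
          (\<lambda>h. \<Sum>l\<in>UNIV. frechet_derivative (\<lambda>y. G y $ l *\<^sub>R partial_deriv l g y) (at x) h)) (at x)"
          by (intro has_derivative_sum frechet_has_derivative smooth_on_differentiable[OF _ x(1)]
              smooth_on_scaleR smooth_on_nth smooth_on_partial open_cimage c sG sg)
        then show ?thesis using partial_deriv_eq by (fastforce simp: partial_deriv_def)
      qed
      also have "\<dots> = (\<Sum>l\<in>UNIV. G x $ l *\<^sub>R partial_deriv m (partial_deriv l g) x + partial_deriv m G x $ l *\<^sub>R partial_deriv l g x)"
      proof (rule sum.cong[OF refl])
        fix l
        have "partial_deriv m (\<lambda>y. G y $ l *\<^sub>R partial_deriv l g y) x
          = G x $ l *\<^sub>R partial_deriv m (partial_deriv l g) x + partial_deriv m (\<lambda>y. G y $ l) x *\<^sub>R partial_deriv l g x"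
          by (rule partial_deriv_bilinear[OF bounded_bilinear_scaleR];
              rule smooth_on_differentiable[OF _ x(1)]; intro smooth_on_nth smooth_on_partial open_cimage c sG sg)
        then show "partial_deriv m (\<lambda>y. G y $ l *\<^sub>R partial_deriv l g y) x
          = G x $ l *\<^sub>R partial_deriv m (partial_deriv l g) x + partial_deriv m G x $ l *\<^sub>R partial_deriv l g x"
          using partial_deriv_bounded_linear[OF bounded_linear_vec_nth dG] by simp
      qed
      finally show ?thesis .
    qed
    have 2: "frechet_derivative G (at x) h $ l = (\<Sum>m\<in>UNIV. h $ m * partial_deriv m G x $ l)" for h l
      by (simp add: frechet_expansion[OF dG])
    have "dir_deriv A V (dir_deriv A W f) p = (\<Sum>m\<in>UNIV. V c p $ m *\<^sub>R partial_deriv m (dir_deriv A W f \<circ> chart_inv c) x)"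
      using dir_deriv_partial[OF V smooth_dir_deriv[OF W f] c] by (simp add: x_def)
    also have "\<dots> = (\<Sum>m\<in>UNIV. \<Sum>l\<in>UNIV. (V c p $ m * partial_deriv m G x $ l) *\<^sub>R partial_deriv l g x)
       + (\<Sum>m\<in>UNIV. \<Sum>l\<in>UNIV. (V c p $ m * W c p $ l) *\<^sub>R partial_deriv m (partial_deriv l g) x)"
      unfolding 1 by (simp add: scaleR_sum_right scaleR_add_right sum.distrib G_def x)
    also have "(\<Sum>m\<in>UNIV. \<Sum>l\<in>UNIV. (V c p $ m * partial_deriv m G x $ l) *\<^sub>R partial_deriv l g x)
       = (\<Sum>l\<in>UNIV. frechet_derivative G (at x) (V c p) $ l *\<^sub>R partial_deriv l g x)"
      unfolding 2 by (subst sum.swap) (simp add: scaleR_sum_left)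
    finally show ?thesis by (simp add: G_def)
  qed
  have sym: "(\<Sum>m\<in>UNIV. \<Sum>l\<in>UNIV. (Y c p $ m * X c p $ l) *\<^sub>R partial_deriv m (partial_deriv l g) x)
     = (\<Sum>m\<in>UNIV. \<Sum>l\<in>UNIV. (X c p $ m * Y c p $ l) *\<^sub>R partial_deriv m (partial_deriv l g) x)"
    by (subst sum.swap)
      (simp add: partial_deriv_commute[OF open_cimage[OF c(1)] sg x(1)] mult.commute)
  have "dir_deriv A X (dir_deriv A Y f) p - dir_deriv A Y (dir_deriv A X f) p =
     (\<Sum>l\<in>UNIV. lie_bracket (X c \<circ> chart_inv c) (Y c \<circ> chart_inv c) x $ l *\<^sub>R partial_deriv l g x)"
    unfolding *[OF X Y] *[OF Y X] sym
    by (simp add: lie_bracket_def x scaleR_diff_left sum_subtractf)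
  then show ?thesis unfolding g_def[symmetric] x_def[symmetric] frechet_expansion[OF dg] .
qed

lemma vfield_extend_weighted:
  assumes a: "a \<in> A" and b: "smooth_fun A b" "supported_in a (b :: 'a \<Rightarrow> real)" and F: "smooth_on (cimage a) F"
  shows "vfield_extend a (\<lambda>x. b (chart_inv a x) *\<^sub>R F x) \<in> smooth_vfields A"
    and "smooth_fun A f \<Longrightarrow> dir_deriv A (vfield_extend a (\<lambda>x. b (chart_inv a x) *\<^sub>R F x)) f p =
      (if p \<in> cdom a then b p *\<^sub>R frechet_derivative (f \<circ> chart_inv a) (at (coord a p)) (F (coord a p)) else 0)"
proof -
  obtain K where K: "compact K" "K \<subseteq> cimage a" "\<And>x. x \<notin> K \<Longrightarrow> local_rep a b x = 0"
    using smooth_local_rep(2)[OF a smooth_fun_chart[OF b(1) a] b(2)] by blast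
  show v: "vfield_extend a (\<lambda>x. b (chart_inv a x) *\<^sub>R F x) \<in> smooth_vfields A"
  proof (rule vfield_extend_smooth[OF a _ K(1,2)])
    show "smooth_on (cimage a) (\<lambda>x. b (chart_inv a x) *\<^sub>R F x)"
      by (intro smooth_on_scaleR open_cimage a smooth_fun_chart' b F)
    show "b (chart_inv a x) *\<^sub>R F x = 0" if "x \<in> cimage a" "x \<notin> K" for x
      using K(3)[OF that(2)] that(1) by (simp add: local_rep_def)
  qed
  assume f: "smooth_fun A f"
  show "dir_deriv A (vfield_extend a (\<lambda>x. b (chart_inv a x) *\<^sub>R F x)) f p =
      (if p \<in> cdom a then b p *\<^sub>R frechet_derivative (f \<circ> chart_inv a) (at (coord a p)) (F (coord a p)) else 0)"
    unfolding dir_deriv_vfield_extend[OF a v f] extend_zero_def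
    using linear_scale[OF linear_frechet_derivative[OF differentiable_chart[OF f a]]] a by simp
qed

text \<open>The bracket is known chart by chart. Instead of gluing it to one global field, each
  partition weight times its chart expression is extended by 0, and the weights sum to 1.\<close>

lemma commutator_vfields:
  assumes X: "X \<in> smooth_vfields A" and Y: "Y \<in> smooth_vfields A"
  shows "\<exists>B :: 'a chart \<times> ('a \<Rightarrow> real) \<Rightarrow> 'a vfield. (\<forall>q\<in>pou. B q \<in> smooth_vfields A) \<and>
    (\<forall>f :: 'a \<Rightarrow> quat. \<forall>p. smooth_fun A f \<longrightarrow>
      dir_deriv A X (dir_deriv A Y f) p - dir_deriv A Y (dir_deriv A X f) p = (\<Sum>q\<in>pou. dir_deriv A (B q) f p))"
proof -
  define L where "L c = lie_bracket (X c \<circ> chart_inv c) (Y c \<circ> chart_inv c)" for c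
  have sL: "smooth_on (cimage c) (L c)" if c: "c \<in> A" for c
  proof -
    have s: "smooth_on (cimage c) (X c \<circ> chart_inv c)" "smooth_on (cimage c) (Y c \<circ> chart_inv c)"
      using vfield_smooth[OF X c] vfield_smooth[OF Y c] by (simp_all add: comp_def)
    show ?thesis unfolding L_def lie_bracket_def
      by (intro smooth_on_diff smooth_on_frechet open_cimage c s)
  qed
  define B where "B q = vfield_extend (fst q) (\<lambda>x. snd q (chart_inv (fst q) x) *\<^sub>R L (fst q) x)" for q :: "'a chart \<times> ('a \<Rightarrow> real)"
  have "B q \<in> smooth_vfields A" if "q \<in> pou" for q
    unfolding B_def by (rule vfield_extend_weighted(1)) (intro pou that sL)+
  moreover have "dir_deriv A X (dir_deriv A Y f) p - dir_deriv A Y (dir_deriv A X f) p = (\<Sum>q\<in>pou. dir_deriv A (B q) f p)"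
    if f: "smooth_fun A f" for f :: "'a \<Rightarrow> quat" and p
  proof -
    have "dir_deriv A (B q) f p = snd q p *\<^sub>R (dir_deriv A X (dir_deriv A Y f) p - dir_deriv A Y (dir_deriv A X f) p)"
      if q: "q \<in> pou" for q
    proof (cases "p \<in> cdom (fst q)")
      case True
      then show ?thesis unfolding B_def
        using vfield_extend_weighted(2)[OF pou(2)[OF q] pou(3)[OF q] pou(5)[OF q] sL[OF pou(2)[OF q]] f]
          dir_deriv_commutator_chart[OF X Y f pou(2)[OF q] True] by (simp add: L_def)
    next
      case False
      then have "snd q p = 0" using pou(5)[OF q] unfolding supported_in_def by auto
      with False show ?thesis unfolding B_def
        using vfield_extend_weighted(2)[OF pou(2)[OF q] pou(3)[OF q] pou(5)[OF q] sL[OF pou(2)[OF q]] f] by simp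
    qed
    then show ?thesis by (simp add: pou_sum)
  qed
  ultimately show ?thesis by blast
qed

end

section \<open>Frames and the elliptic estimate\<close>

definition unit_mult :: "3 \<Rightarrow> quat \<Rightarrow> quat" where
  "unit_mult i x = (if i = 1 then quat_i else if i = 2 then quat_j else quat_k) *\<^sub>q x"

lemma unit_mult_nth:
  "unit_mult 1 x $ 1 = - x$2" "unit_mult 1 x $ 2 = x$1" "unit_mult 1 x $ 3 = - x$4" "unit_mult 1 x $ 4 = x$3"
  "unit_mult 2 x $ 1 = - x$3" "unit_mult 2 x $ 2 = x$4" "unit_mult 2 x $ 3 = x$1" "unit_mult 2 x $ 4 = - x$2"
  "unit_mult 3 x $ 1 = - x$4" "unit_mult 3 x $ 2 = - x$3" "unit_mult 3 x $ 3 = x$2" "unit_mult 3 x $ 4 = x$1"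
  by (simp_all add: unit_mult_def quat_mult_def quat_i_def quat_j_def quat_k_def vector_4_nth axis_def)

lemma bounded_linear_unit_mult: "bounded_linear (unit_mult i)"
proof -
  have "linear (unit_mult i)"
    using exhaust_3[of i]
    by (auto intro!: linearI simp: vec_eq_iff forall_4 unit_mult_nth)
  then show ?thesis by (rule linear_conv_bounded_linear[THEN iffD1])
qed

lemma inner_4: "(x::real^4) \<bullet> y = x$1 * y$1 + x$2 * y$2 + x$3 * y$3 + x$4 * y$4"
  by (simp add: inner_vec_def sum_4)

lemma unit_mult_skew: "unit_mult i a \<bullet> b = - (a \<bullet> unit_mult i b)"
  using exhaust_3[of i] by (auto simp: inner_4 unit_mult_nth)

lemma unit_mult_mult:
  "unit_mult 1 (unit_mult 2 x) = unit_mult 3 x" "unit_mult 1 (unit_mult 3 x) = - unit_mult 2 x"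
  "unit_mult 2 (unit_mult 3 x) = unit_mult 1 x" "unit_mult i (unit_mult i x) = - x"
  using exhaust_3[of i] by (auto simp: vec_eq_iff forall_4 unit_mult_nth)

lemma norm_unit_mult [simp]: "norm (unit_mult i x) = norm x"
  by (simp add: norm_eq_sqrt_inner unit_mult_skew unit_mult_mult)

text \<open>Since the units are skew and multiply to one another, each mixed term involves just one
  unit. These are the terms that \<open>cross_term\<close> integrates and that
  \<open>ker_detected\<close> makes vanish.\<close>

lemma norm_sq_sum_unit_mult:
  "(unit_mult 1 a + unit_mult 2 b + unit_mult 3 c) \<bullet> (unit_mult 1 a + unit_mult 2 b + unit_mult 3 c) =
    a \<bullet> a + b \<bullet> b + c \<bullet> c - 2 * (a \<bullet> unit_mult 3 b) + 2 * (a \<bullet> unit_mult 2 c) - 2 * (b \<bullet> unit_mult 1 c)"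
  unfolding inner_4 vector_add_component unit_mult_nth by (simp add: algebra_simps)

text \<open>Cramer's rule without division.\<close>

lemma det3_Cramer:
  "det3 a b c *\<^sub>R x = det3 x b c *\<^sub>R a + det3 a x c *\<^sub>R b + det3 a b x *\<^sub>R c"
  by (simp add: vec_eq_iff forall_3 det3_def algebra_simps)

context volume_manifold
begin

text \<open>Defined for any triple of fields, since the operator is also applied to perturbation
  directions and to differences of frames, which need not be frames.\<close>

definition fueter_op :: "(3 \<Rightarrow> 'a vfield) \<Rightarrow> ('a \<Rightarrow> quat) \<Rightarrow> 'a \<Rightarrow> quat" where
  "fueter_op w f p = (\<Sum>i\<in>UNIV. unit_mult i (dir_deriv A (w i) f p))"

lemma fueter_eq_fueter_op: "fueter A (w 1, w 2, w 3) f p = fueter_op w f p"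
  by (simp add: fueter_def fueter_op_def sum_3 unit_mult_def)

lemma smooth_unit_mult: "smooth_fun A f \<Longrightarrow> smooth_fun A (\<lambda>p. unit_mult i (f p))"
  by (rule smooth_fun_linear[OF bounded_linear_unit_mult])

lemma unit_mult_add: "unit_mult i (x + y) = unit_mult i x + unit_mult i y"
  and unit_mult_scaleR: "unit_mult i (t *\<^sub>R x) = t *\<^sub>R unit_mult i x"
  and unit_mult_diff: "unit_mult i (x - y) = unit_mult i x - unit_mult i y"
  and unit_mult_zero: "unit_mult i 0 = 0"
  using bounded_linear.linear[OF bounded_linear_unit_mult[of i]]
  by (simp_all add: linear_add linear_scale linear_diff linear_0)

lemma ip_unit_mult: "ip (\<lambda>p. unit_mult i (f p)) g = - ip f (\<lambda>p. unit_mult i (g p))"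
  unfolding ip_def unit_mult_skew by (rule vint_minus)

context
  fixes w :: "3 \<Rightarrow> 'a vfield"
  assumes w: "\<And>i. w i \<in> smooth_vfields A"
begin

lemma smooth_fueter_op: "smooth_fun A f \<Longrightarrow> smooth_fun A (fueter_op w f)"
  unfolding fueter_op_def[abs_def] by (intro smooth_fun_sum smooth_unit_mult smooth_dir_deriv w)

lemma fueter_op_add:
  "smooth_fun A f \<Longrightarrow> smooth_fun A g \<Longrightarrow> fueter_op w (\<lambda>p. f p + g p) = (\<lambda>p. fueter_op w f p + fueter_op w g p)"
  by (auto simp: fueter_op_def dir_deriv_add w unit_mult_add sum.distrib)

lemma fueter_op_diff:
  "smooth_fun A f \<Longrightarrow> smooth_fun A g \<Longrightarrow> fueter_op w (\<lambda>p. f p - g p) = (\<lambda>p. fueter_op w f p - fueter_op w g p)"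
  by (auto simp: fueter_op_def dir_deriv_diff w unit_mult_diff sum_subtractf)

lemma fueter_op_scale: "smooth_fun A f \<Longrightarrow> fueter_op w (\<lambda>p. t *\<^sub>R f p) = (\<lambda>p. t *\<^sub>R fueter_op w f p)"
  by (auto simp: fueter_op_def dir_deriv_linear[OF w _ bounded_linear_scaleR_right] unit_mult_scaleR scaleR_sum_right)

lemma fueter_op_const: "fueter_op w (\<lambda>p. q) = (\<lambda>p. 0)"
  by (auto simp: fueter_op_def w unit_mult_zero)

text \<open>Two signs cancel: one from the skewness of the unit, one from integration by parts; the
  constant unit commutes with the derivative.\<close>

lemma fueter_op_symmetric:
  assumes div: "\<And>i. divergence_free A dvol (w i)" and f: "smooth_fun A f" and g: "smooth_fun A g"
  shows "ip (fueter_op w f) g = ip f (fueter_op w g)"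
proof -
  have "ip (fueter_op w f) g = (\<Sum>i\<in>UNIV. ip (\<lambda>p. unit_mult i (dir_deriv A (w i) f p)) g)"
    unfolding fueter_op_def[abs_def] by (intro ip_sum_left smooth_fun_continuous smooth_unit_mult smooth_dir_deriv w f g)
  also have "\<dots> = (\<Sum>i\<in>UNIV. ip f (\<lambda>p. unit_mult i (dir_deriv A (w i) g p)))"
  proof (rule sum.cong[OF refl])
    fix i
    have "ip (\<lambda>p. unit_mult i (dir_deriv A (w i) f p)) g = - ip (dir_deriv A (w i) f) (\<lambda>p. unit_mult i (g p))" by (rule ip_unit_mult)
    also have "\<dots> = ip f (dir_deriv A (w i) (\<lambda>p. unit_mult i (g p)))"
      using ip_dir_deriv[OF w div f smooth_unit_mult[OF g]] by simp
    also have "dir_deriv A (w i) (\<lambda>p. unit_mult i (g p)) = (\<lambda>p. unit_mult i (dir_deriv A (w i) g p))"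
      by (rule ext) (rule dir_deriv_linear[OF w g bounded_linear_unit_mult])
    finally show "ip (\<lambda>p. unit_mult i (dir_deriv A (w i) f p)) g = ip f (\<lambda>p. unit_mult i (dir_deriv A (w i) g p))" .
  qed
  also have "\<dots> = ip f (fueter_op w g)"
    unfolding fueter_op_def[abs_def] by (intro ip_sum_right[symmetric] smooth_fun_continuous smooth_unit_mult smooth_dir_deriv w f g)
  finally show ?thesis .
qed

end

end

locale frame = volume_manifold A dvol for A :: "'a::{t2_space,second_countable_topology} chart set" and dvol +
  fixes v :: "3 \<Rightarrow> 'a vfield"
  assumes v_smooth [simp]: "v i \<in> smooth_vfields A"
    and v_div [simp]: "divergence_free A dvol (v i)"
    and v_pos: "c \<in> A \<Longrightarrow> p \<in> cdom c \<Longrightarrow> dvol c p (v 1 c p) (v 2 c p) (v 3 c p) > 0"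
begin

abbreviation d :: "3 \<Rightarrow> ('a \<Rightarrow> 'b::real_normed_vector) \<Rightarrow> 'a \<Rightarrow> 'b" where
  "d i \<equiv> dir_deriv A (v i)"

lemma smooth_d: "smooth_fun A f \<Longrightarrow> smooth_fun A (d i f)"
  by (simp add: smooth_dir_deriv)

lemma vol3_frame_pos: "vol3 (v 1) (v 2) (v 3) p > 0"
  using charts_cover[of p] v_pos vol3_chart[OF v_smooth v_smooth v_smooth] by force

text \<open>The coefficient of \<open>X\<close> along \<open>v j\<close> by Cramer's rule. As a
  quotient of volumes it is a globally defined smooth function.\<close>

definition cof :: "'a vfield \<Rightarrow> 3 \<Rightarrow> 'a \<Rightarrow> real" where
  "cof X j p = vol3 (if j = 1 then X else v 1) (if j = 2 then X else v 2) (if j = 3 then X else v 3) p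
     * inverse (vol3 (v 1) (v 2) (v 3) p)"

lemma smooth_cof: "X \<in> smooth_vfields A \<Longrightarrow> smooth_fun A (cof X j)"
  unfolding cof_def using vol3_frame_pos
  by (intro smooth_fun_mult smooth_fun_inverse smooth_vol3) (auto simp: less_imp_neq[symmetric])

lemma vfield_cof:
  assumes X: "X \<in> smooth_vfields A" and c: "c \<in> A" "p \<in> cdom c"
  shows "X c p = (\<Sum>j\<in>UNIV. cof X j p *\<^sub>R v j c p)"
proof -
  have r: "rho c p > 0" using rho_pos c by blast
  have D: "det3 (v 1 c p) (v 2 c p) (v 3 c p) > 0"
    using vol3_frame_pos[of p] vol3_rho[OF v_smooth v_smooth v_smooth c] r by (simp add: zero_less_mult_iff)
  have "X c p = inverse (det3 (v 1 c p) (v 2 c p) (v 3 c p)) *\<^sub>R (det3 (v 1 c p) (v 2 c p) (v 3 c p) *\<^sub>R X c p)"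
    using D by simp
  also have "\<dots> = (\<Sum>j\<in>UNIV. cof X j p *\<^sub>R v j c p)"
  proof -
    have k: "rho c p * a * inverse (rho c p * b) = inverse b * a" for a b
      using r by (cases "b = 0") (simp_all add: field_simps)
    have "cof X 1 p = inverse (det3 (v 1 c p) (v 2 c p) (v 3 c p)) * det3 (X c p) (v 2 c p) (v 3 c p)"
      "cof X 2 p = inverse (det3 (v 1 c p) (v 2 c p) (v 3 c p)) * det3 (v 1 c p) (X c p) (v 3 c p)"
      "cof X 3 p = inverse (det3 (v 1 c p) (v 2 c p) (v 3 c p)) * det3 (v 1 c p) (v 2 c p) (X c p)"
      unfolding k[symmetric] by (simp_all add: cof_def vol3_rho[OF X v_smooth v_smooth c] vol3_rho[OF v_smooth X v_smooth c]
        vol3_rho[OF v_smooth v_smooth X c] vol3_rho[OF v_smooth v_smooth v_smooth c])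
    then show ?thesis unfolding det3_Cramer[of _ _ _ "X c p"] by (simp add: sum_3 scaleR_add_right)
  qed
  finally show ?thesis .
qed

lemma dir_deriv_cof:
  assumes X: "X \<in> smooth_vfields A" and f: "smooth_fun A f"
  shows "dir_deriv A X f p = (\<Sum>j\<in>UNIV. cof X j p *\<^sub>R d j f p)"
proof -
  obtain c where c: "c \<in> A" "p \<in> cdom c" using charts_cover by blast
  have lin: "linear (frechet_derivative (f \<circ> chart_inv c) (at (coord c p)))"
    by (rule linear_frechet_derivative[OF differentiable_chart[OF f c]])
  show ?thesis
    unfolding dir_deriv_chart[OF X f c] vfield_cof[OF X c]
    by (simp add: linear_sum[OF lin] linear_scale[OF lin] dir_deriv_chart[OF v_smooth f c])
qed

text \<open>A commutator of frame fields is again of first order, with smooth coefficients along the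
  frame. All lower order errors in the elliptic estimate have this origin.\<close>

lemma commutator:
  "\<exists>C :: 3 \<Rightarrow> 'a \<Rightarrow> real. (\<forall>k. smooth_fun A (C k)) \<and>
    (\<forall>(f :: 'a \<Rightarrow> quat) p. smooth_fun A f \<longrightarrow> d i (d j f) p - d j (d i f) p = (\<Sum>k\<in>UNIV. C k p *\<^sub>R d k f p))"
proof -
  obtain B :: "'a chart \<times> ('a \<Rightarrow> real) \<Rightarrow> 'a vfield" where B: "\<forall>q\<in>pou. B q \<in> smooth_vfields A"
    "\<And>(f :: 'a \<Rightarrow> quat) p. smooth_fun A f \<Longrightarrow> d i (d j f) p - d j (d i f) p = (\<Sum>q\<in>pou. dir_deriv A (B q) f p)"
    using commutator_vfields[OF v_smooth v_smooth, of i j] by blast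
  define C where "C k p = (\<Sum>q\<in>pou. cof (B q) k p)" for k p
  have "smooth_fun A (C k)" for k
    unfolding C_def using B(1) by (intro smooth_fun_sum smooth_cof) auto
  moreover have "d i (d j f) p - d j (d i f) p = (\<Sum>k\<in>UNIV. C k p *\<^sub>R d k f p)" if f: "smooth_fun A f" for f :: "'a \<Rightarrow> quat" and p
  proof -
    have "d i (d j f) p - d j (d i f) p = (\<Sum>q\<in>pou. \<Sum>k\<in>UNIV. cof (B q) k p *\<^sub>R d k f p)"
      unfolding B(2)[OF f] using B(1) by (intro sum.cong refl dir_deriv_cof f) auto
    also have "\<dots> = (\<Sum>k\<in>UNIV. C k p *\<^sub>R d k f p)"
      by (subst sum.swap) (simp add: C_def scaleR_sum_left)
    finally show ?thesis .
  qed
  ultimately show ?thesis by blast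
qed

text \<open>A Sobolev norm of order \<open>k\<close> formed with the frame instead of charts.
  Derivatives of lower order are counted repeatedly, which is harmless, and in exchange every
  estimate is an induction on \<open>k\<close>.\<close>

primrec N :: "nat \<Rightarrow> ('a \<Rightarrow> quat) \<Rightarrow> real" where
  "N 0 f = nrm f"
| "N (Suc k) f = N k f + (\<Sum>i\<in>UNIV. N k (d i f))"

lemma N_nonneg [simp]: "N k f \<ge> 0"
  by (induction k arbitrary: f) (auto intro!: add_nonneg_nonneg sum_nonneg)

lemma N_Suc: "N k f \<le> N (Suc k) f"
  by (simp add: sum_nonneg)

lemma N_mono: "k \<le> l \<Longrightarrow> N k f \<le> N l f"
  by (rule lift_Suc_mono_le[of "\<lambda>k. N k f"]) (rule N_Suc)

lemma nrm_le_N: "nrm f \<le> N k f"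
  using N_mono[of 0 k f] by simp

lemma N_d: "N k (d i f) \<le> N (Suc k) f"
proof -
  have "N k (d i f) \<le> (\<Sum>i\<in>UNIV. N k (d i f))" by (rule member_le_sum) auto
  then show ?thesis using N_nonneg[of k f] unfolding N.simps by linarith
qed

lemma N_add:
  assumes "smooth_fun A f" "smooth_fun A g" shows "N k (\<lambda>p. f p + g p) \<le> N k f + N k g"
  using assms
proof (induction k arbitrary: f g)
  case 0
  then show ?case by (simp add: nrm_triangle smooth_fun_continuous)
next
  case (Suc k)
  have "d i (\<lambda>p. f p + g p) = (\<lambda>p. d i f p + d i g p)" for i
    by (rule ext) (rule dir_deriv_add[OF v_smooth Suc.prems])
  then have "N k (d i (\<lambda>p. f p + g p)) \<le> N k (d i f) + N k (d i g)" for i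
    using Suc.IH[OF smooth_d smooth_d, of f g] Suc.prems by simp
  then have "(\<Sum>i\<in>UNIV. N k (d i (\<lambda>p. f p + g p))) \<le> (\<Sum>i\<in>UNIV. N k (d i f)) + (\<Sum>i\<in>UNIV. N k (d i g))"
    unfolding sum.distrib[symmetric] by (intro sum_mono)
  then show ?case using Suc.IH[OF Suc.prems] by simp
qed

lemma nrm_linear:
  assumes "bounded_linear L" "B \<ge> 0" "\<And>x. norm (L x) \<le> B * norm x" "cont f"
  shows "nrm (\<lambda>p. L (f p)) \<le> B * nrm f"
  by (rule nrm_pointwise)
    (use assms bounded_linear.continuous_on[OF assms(1,4)] in auto)

lemma N_linear:
  assumes L: "bounded_linear L" "B \<ge> 0" "\<And>x. norm (L x) \<le> B * norm x" and f: "smooth_fun A f"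
  shows "N k (\<lambda>p. L (f p)) \<le> B * N k f"
  using f
proof (induction k arbitrary: f)
  case 0
  then show ?case using nrm_linear[OF L] by (simp add: smooth_fun_continuous)
next
  case (Suc k)
  have "d i (\<lambda>p. L (f p)) = (\<lambda>p. L (d i f p))" for i
    by (rule ext) (rule dir_deriv_linear[OF v_smooth Suc.prems L(1)])
  then have "N k (d i (\<lambda>p. L (f p))) \<le> B * N k (d i f)" for i
    using Suc.IH[OF smooth_d, of f] Suc.prems by simp
  then have "(\<Sum>i\<in>UNIV. N k (d i (\<lambda>p. L (f p)))) \<le> B * (\<Sum>i\<in>UNIV. N k (d i f))"
    unfolding sum_distrib_left by (intro sum_mono)
  then show ?case using Suc.IH[OF Suc.prems] by (simp add: distrib_left)
qed

lemma N_scale: "smooth_fun A f \<Longrightarrow> N k (\<lambda>p. t *\<^sub>R f p) \<le> \<bar>t\<bar> * N k f"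
  by (rule N_linear[OF bounded_linear_scaleR_right]) auto

lemma N_minus: "smooth_fun A f \<Longrightarrow> N k (\<lambda>p. - f p) \<le> N k f"
  using N_scale[of f k "-1"] by simp

lemma N_diff:
  assumes "smooth_fun A f" "smooth_fun A g" shows "N k (\<lambda>p. f p - g p) \<le> N k f + N k g"
  using N_add[OF assms(1) smooth_fun_minus[OF assms(2)], of k] N_minus[OF assms(2), of k] by simp

lemma N_unit_mult: "smooth_fun A f \<Longrightarrow> N k (\<lambda>p. unit_mult i (f p)) \<le> N k f"
  using N_linear[OF bounded_linear_unit_mult, of 1 i f k] by simp

lemma N_zero [simp]: "N k (\<lambda>p. 0) = 0"
  using N_scale[of "\<lambda>p. 0" k 0] N_nonneg[of k "\<lambda>p. 0"] by simp

lemma N_sum: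
  assumes "\<And>i. i \<in> I \<Longrightarrow> smooth_fun A (f i)" shows "N k (\<lambda>p. \<Sum>i\<in>I. f i p) \<le> (\<Sum>i\<in>I. N k (f i))"
  using assms
proof (induction I rule: infinite_finite_induct)
  case (insert x I)
  then have "N k (\<lambda>p. f x p + (\<Sum>i\<in>I. f i p)) \<le> N k (f x) + N k (\<lambda>p. \<Sum>i\<in>I. f i p)"
    by (intro N_add smooth_fun_sum) auto
  then show ?case using insert by simp
qed simp_all

text \<open>A bound \<open>e\<close> in the \<open>k\<close> times differentiable sense along the
  frame; for coefficients of operators, where smallness has to be measured.\<close>

primrec cbound :: "nat \<Rightarrow> real \<Rightarrow> ('a \<Rightarrow> real) \<Rightarrow> bool" where
  "cbound 0 e b = (\<forall>p. \<bar>b p\<bar> \<le> e)"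
| "cbound (Suc k) e b = (cbound k e b \<and> (\<forall>i. cbound k e (d i b)))"

lemma cbound_mono: "cbound k e b \<Longrightarrow> e \<le> e' \<Longrightarrow> cbound k e' b"
  by (induction k arbitrary: b) (auto intro: order_trans)

lemma cbound_exists: "smooth_fun A b \<Longrightarrow> \<exists>e\<ge>0. cbound k e b"
proof (induction k arbitrary: b)
  case 0
  then show ?case using smooth_fun_bounded[of b] by (auto intro: less_imp_le)
next
  case (Suc k)
  obtain e0 where e0: "e0 \<ge> 0" "cbound k e0 b" using Suc by blast
  have "\<exists>e\<ge>0. cbound k e (d i b)" for i using Suc.IH[OF smooth_d[OF Suc.prems]] .
  then obtain e where e: "\<And>i. e i \<ge> 0" "\<And>i. cbound k (e i) (d i b)" by metis
  define E where "E = e0 + (\<Sum>i\<in>UNIV. e i)"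
  have "e i \<le> E" for i
    using member_le_sum[of i UNIV e] e(1) e0(1) by (simp add: E_def)
  moreover have "e0 \<le> E" "0 \<le> E" using e0(1) e(1) by (auto simp: E_def intro!: sum_nonneg add_nonneg_nonneg)
  ultimately show ?case using e0(2) e(2) cbound_mono by (metis cbound.simps(2))
qed

text \<open>The Leibniz rule. The factor \<open>e\<close> is explicit because small coefficients
  must yield a small operator.\<close>

lemma N_mult_cbound:
  assumes "cbound k e b" "smooth_fun A b" "smooth_fun A f" "e \<ge> 0"
  shows "N k (\<lambda>p. b p *\<^sub>R f p) \<le> 4 ^ k * e * N k f"
  using assms(1-3)
proof (induction k arbitrary: b f)
  case 0
  have "cont (\<lambda>p. b p *\<^sub>R f p)" using 0 by (intro smooth_fun_continuous smooth_fun_scaleR)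
  moreover have "norm (b p *\<^sub>R f p) \<le> e * norm (f p)" for p
    using 0(1) by (simp add: mult_right_mono)
  ultimately show ?case using nrm_pointwise[OF _ smooth_fun_continuous[OF 0(3)] assms(4)] by simp
next
  case (Suc k)
  define K where "K = 4 ^ k * e"
  have K: "K \<ge> 0" using assms(4) by (simp add: K_def)
  have 0: "N k (\<lambda>p. b p *\<^sub>R f p) \<le> K * N k f" using Suc by (simp add: K_def)
  have i: "N k (d i (\<lambda>p. b p *\<^sub>R f p)) \<le> K * N k (d i f) + K * N k f" for i
  proof -
    have "d i (\<lambda>p. b p *\<^sub>R f p) = (\<lambda>p. b p *\<^sub>R d i f p + d i b p *\<^sub>R f p)"
      by (rule ext) (rule dir_deriv_bilinear[OF v_smooth Suc.prems(2,3) bounded_bilinear_scaleR])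
    then have "N k (d i (\<lambda>p. b p *\<^sub>R f p)) \<le> N k (\<lambda>p. b p *\<^sub>R d i f p) + N k (\<lambda>p. d i b p *\<^sub>R f p)"
      using N_add[OF smooth_fun_scaleR[OF Suc.prems(2) smooth_d[OF Suc.prems(3)]] smooth_fun_scaleR[OF smooth_d[OF Suc.prems(2)] Suc.prems(3)], of k i i] by simp
    also have "N k (\<lambda>p. b p *\<^sub>R d i f p) \<le> K * N k (d i f)"
      using Suc.IH[OF _ Suc.prems(2) smooth_d[OF Suc.prems(3)]] Suc.prems by (simp add: K_def)
    also have "N k (\<lambda>p. d i b p *\<^sub>R f p) \<le> K * N k f"
      using Suc.IH[OF _ smooth_d[OF Suc.prems(2)] Suc.prems(3)] Suc.prems by (simp add: K_def)
    finally show ?thesis by simp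
  qed
  \<comment> \<open>The undifferentiated product and the Leibniz terms with derivatives of
    \<open>b\<close> in three directions give the factor 4 = 1 + 3.\<close>
  have "N (Suc k) (\<lambda>p. b p *\<^sub>R f p) \<le> K * N k f + (\<Sum>i\<in>UNIV. K * N k (d i f) + K * N k f)"
    unfolding N.simps using i by (intro add_mono 0 sum_mono)
  also have "\<dots> = K * (4 * N k f + (\<Sum>i\<in>UNIV. N k (d i f)))"
    by (simp add: sum.distrib sum_distrib_left algebra_simps)
  also have "\<dots> \<le> K * (4 * N (Suc k) f)"
    using K by (intro mult_left_mono) (auto intro!: sum_nonneg)
  finally show ?case by (simp add: K_def mult_ac del: N.simps)
qed

lemma N_mult:
  assumes "smooth_fun A b"
  shows "\<exists>C\<ge>0. \<forall>f. smooth_fun A f \<longrightarrow> N k (\<lambda>p. b p *\<^sub>R f p) \<le> C * N k f"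
proof -
  obtain e where "e \<ge> 0" "cbound k e b" using cbound_exists[OF assms] by blast
  then show ?thesis using N_mult_cbound[OF _ assms] by (intro exI[of _ "4 ^ k * e"]) auto
qed

lemma N_first_order:
  assumes "\<And>j :: 3. smooth_fun A (b j)"
  shows "\<exists>C\<ge>0. \<forall>f. smooth_fun A f \<longrightarrow> N k (\<lambda>p. \<Sum>j\<in>UNIV. b j p *\<^sub>R d j f p) \<le> C * (\<Sum>j\<in>UNIV. N k (d j f))"
proof -
  have "\<exists>C\<ge>0. \<forall>f. smooth_fun A f \<longrightarrow> N k (\<lambda>p. b j p *\<^sub>R f p) \<le> C * N k f" for j
    by (rule N_mult[OF assms])
  then obtain C where C: "\<And>j. C j \<ge> 0" "\<And>j f. smooth_fun A f \<Longrightarrow> N k (\<lambda>p. b j p *\<^sub>R f p) \<le> C j * N k f"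
    by metis
  show ?thesis
  proof (intro exI[of _ "\<Sum>j\<in>UNIV. C j"] conjI allI impI)
    show "(\<Sum>j\<in>UNIV. C j) \<ge> 0" using C(1) by (intro sum_nonneg)
    fix f :: "'a \<Rightarrow> quat" assume f: "smooth_fun A f"
    have "N k (\<lambda>p. \<Sum>j\<in>UNIV. b j p *\<^sub>R d j f p) \<le> (\<Sum>j\<in>UNIV. N k (\<lambda>p. b j p *\<^sub>R d j f p))"
      by (intro N_sum smooth_fun_scaleR assms smooth_d f)
    also have "\<dots> \<le> (\<Sum>j\<in>UNIV. (\<Sum>j\<in>UNIV. C j) * N k (d j f))"
    proof (rule sum_mono)
      fix j
      have "N k (\<lambda>p. b j p *\<^sub>R d j f p) \<le> C j * N k (d j f)" using C(2)[OF smooth_d[OF f]] .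
      also have "\<dots> \<le> (\<Sum>j\<in>UNIV. C j) * N k (d j f)"
        using C(1) by (intro mult_right_mono member_le_sum) auto
      finally show "N k (\<lambda>p. b j p *\<^sub>R d j f p) \<le> (\<Sum>j\<in>UNIV. C j) * N k (d j f)" .
    qed
    finally show "N k (\<lambda>p. \<Sum>j\<in>UNIV. b j p *\<^sub>R d j f p) \<le> (\<Sum>j\<in>UNIV. C j) * (\<Sum>j\<in>UNIV. N k (d j f))"
      by (simp add: sum_distrib_left)
  qed
qed

lemma N_dir_deriv:
  assumes "X \<in> smooth_vfields A"
  shows "\<exists>C\<ge>0. \<forall>f. smooth_fun A f \<longrightarrow> N k (dir_deriv A X f) \<le> C * N (Suc k) f"
proof -
  obtain C where C: "C \<ge> 0" "\<And>f. smooth_fun A f \<Longrightarrow> N k (\<lambda>p. \<Sum>j\<in>UNIV. cof X j p *\<^sub>R d j f p) \<le> C * (\<Sum>j\<in>UNIV. N k (d j f))"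
    using N_first_order[of "cof X" k] smooth_cof[OF assms] by blast
  have "N k (dir_deriv A X f) \<le> C * N (Suc k) f" if f: "smooth_fun A f" for f
  proof -
    have "dir_deriv A X f = (\<lambda>p. \<Sum>j\<in>UNIV. cof X j p *\<^sub>R d j f p)"
      by (rule ext) (rule dir_deriv_cof[OF assms f])
    then have "N k (dir_deriv A X f) \<le> C * (\<Sum>j\<in>UNIV. N k (d j f))" using C(2)[OF f] by simp
    also have "\<dots> \<le> C * N (Suc k) f" using C(1) by (intro mult_left_mono) auto
    finally show ?thesis .
  qed
  then show ?thesis using C(1) by blast
qed

lemma N_commutator:
  "\<exists>C\<ge>0. \<forall>f. smooth_fun A f \<longrightarrow> N k (\<lambda>p. d i (d j f) p - d j (d i f) p) \<le> C * (\<Sum>l\<in>UNIV. N k (d l f))"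
proof -
  obtain c :: "3 \<Rightarrow> 'a \<Rightarrow> real" where c: "\<And>k. smooth_fun A (c k)"
    "\<And>(f :: 'a \<Rightarrow> quat) p. smooth_fun A f \<Longrightarrow> d i (d j f) p - d j (d i f) p = (\<Sum>k\<in>UNIV. c k p *\<^sub>R d k f p)"
    using commutator[of i j] by blast
  obtain C where C: "C \<ge> 0" "\<And>f. smooth_fun A f \<Longrightarrow> N k (\<lambda>p. \<Sum>j\<in>UNIV. c j p *\<^sub>R d j f p) \<le> C * (\<Sum>j\<in>UNIV. N k (d j f))"
    using N_first_order[of c k] c(1) by blast
  show ?thesis using C c(2) by (intro exI[of _ C]) simp
qed

section \<open>The elliptic estimate\<close>

definition dirac :: "('a \<Rightarrow> quat) \<Rightarrow> 'a \<Rightarrow> quat" where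
  "dirac = fueter_op v"

lemma dirac_eq: "dirac f p = (\<Sum>i\<in>UNIV. unit_mult i (d i f p))"
  by (simp add: dirac_def fueter_op_def)

lemmas smooth_dirac = smooth_fueter_op[where w = v, OF v_smooth, folded dirac_def]
  and dirac_add = fueter_op_add[where w = v, OF v_smooth, folded dirac_def]
  and dirac_diff = fueter_op_diff[where w = v, OF v_smooth, folded dirac_def]
  and dirac_scale = fueter_op_scale[where w = v, OF v_smooth, folded dirac_def]
  and dirac_const = fueter_op_const[where w = v, OF v_smooth, folded dirac_def]
  and dirac_symmetric = fueter_op_symmetric[where w = v, OF v_smooth v_div, folded dirac_def]

text \<open>The product is integrated by parts once through \<open>d i\<close> and, after moving the
  unit to the other factor, once through \<open>d j\<close>. The second order terms of the two
  results combine to a commutator.\<close>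

lemma cross_term:
  assumes f: "smooth_fun A f"
  shows "2 * ip (d i f) (\<lambda>p. unit_mult l (d j f p)) = - ip f (\<lambda>p. unit_mult l (d i (d j f) p - d j (d i f) p))"
proof -
  have c: "cont f" "cont (\<lambda>p. unit_mult l (d i (d j f) p))" "cont (\<lambda>p. unit_mult l (d j (d i f) p))" for i j
    by (intro smooth_fun_continuous smooth_unit_mult smooth_d f)+
  have lin: "d i (\<lambda>p. unit_mult l (d j f p)) = (\<lambda>p. unit_mult l (d i (d j f) p))" for i j
    by (rule ext) (rule dir_deriv_linear[OF v_smooth smooth_d[OF f] bounded_linear_unit_mult])
  have 1: "ip (d i f) (\<lambda>p. unit_mult l (d j f p)) = - ip f (\<lambda>p. unit_mult l (d i (d j f) p))"
    using ip_dir_deriv[OF v_smooth v_div f smooth_unit_mult[OF smooth_d[OF f]]] lin by simp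
  have "ip (d i f) (\<lambda>p. unit_mult l (d j f p)) = - ip (\<lambda>p. unit_mult l (d i f p)) (d j f)"
    using ip_unit_mult[of l "d i f" "d j f"] by simp
  also have "\<dots> = - ip (d j f) (\<lambda>p. unit_mult l (d i f p))" by (simp add: ip_commute)
  also have "\<dots> = ip f (\<lambda>p. unit_mult l (d j (d i f) p))"
    using ip_dir_deriv[OF v_smooth v_div f smooth_unit_mult[OF smooth_d[OF f]]] lin by simp
  finally have 2: "ip (d i f) (\<lambda>p. unit_mult l (d j f p)) = ip f (\<lambda>p. unit_mult l (d j (d i f) p))" .
  have "ip f (\<lambda>p. unit_mult l (d i (d j f) p - d j (d i f) p)) =
    ip f (\<lambda>p. unit_mult l (d i (d j f) p)) - ip f (\<lambda>p. unit_mult l (d j (d i f) p))"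
    unfolding unit_mult_diff by (rule ip_diff_right) (use c in auto)
  then show ?thesis using 1 2 by simp
qed

lemma Garding: "\<exists>C\<ge>0. \<forall>f. smooth_fun A f \<longrightarrow> N 1 f \<le> C * (nrm (dirac f) + nrm f)"
proof -
  define C where "C i j = (SOME C. C \<ge> 0 \<and> (\<forall>f. smooth_fun A f \<longrightarrow>
    N 0 (\<lambda>p. d i (d j f) p - d j (d i f) p) \<le> C * (\<Sum>l\<in>UNIV. N 0 (d l f))))" for i j
  have C: "C i j \<ge> 0" "\<And>f. smooth_fun A f \<Longrightarrow> nrm (\<lambda>p. d i (d j f) p - d j (d i f) p) \<le> C i j * (\<Sum>l\<in>UNIV. nrm (d l f))" for i j
    using someI_ex[OF N_commutator[of 0 i j]] unfolding C_def[symmetric] by simp_all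
  define c where "c = C 1 2 + C 1 3 + C 2 3"
  have c: "c \<ge> 0" using C(1) by (simp add: c_def)
  \<comment> \<open>\<open>c\<close> collects the commutator constants of the three mixed terms; the
    final bound is \<open>nrm f + 2 * a + 3 * c * nrm f\<close>.\<close>
  have "N 1 f \<le> (3 * c + 2 + 1) * (nrm (dirac f) + nrm f)" if f: "smooth_fun A f" for f
  proof -
    define s where "s = (\<Sum>l\<in>UNIV. nrm (d l f))"
    define a where "a = nrm (dirac f)"
    have s0: "s \<ge> 0" by (simp add: s_def sum_nonneg)
    have cd: "cont (d i f)" for i by (intro smooth_fun_continuous smooth_d f)
    have cross: "\<bar>2 * ip (d i f) (\<lambda>p. unit_mult l (d j f p))\<bar> \<le> nrm f * (C i j * s)" for i j l
    proof -
      have sm: "smooth_fun A (\<lambda>p. d i (d j f) p - d j (d i f) p)" by (intro smooth_fun_diff smooth_d f)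
      have "\<bar>2 * ip (d i f) (\<lambda>p. unit_mult l (d j f p))\<bar> \<le> nrm f * nrm (\<lambda>p. unit_mult l (d i (d j f) p - d j (d i f) p))"
        unfolding cross_term[OF f] abs_minus_cancel
        by (intro ip_Cauchy_Schwarz smooth_fun_continuous f smooth_unit_mult sm)
      also have "\<dots> \<le> nrm f * nrm (\<lambda>p. d i (d j f) p - d j (d i f) p)"
        using nrm_linear[OF bounded_linear_unit_mult, of 1 l] smooth_fun_continuous[OF sm] by (intro mult_left_mono) auto
      also have "\<dots> \<le> nrm f * (C i j * s)" unfolding s_def by (intro mult_left_mono C(2) f) simp
      finally show ?thesis .
    qed
    have "a^2 = vint (\<lambda>p. (d 1 f p \<bullet> d 1 f p + d 2 f p \<bullet> d 2 f p + d 3 f p \<bullet> d 3 f p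
        - 2 * (d 1 f p \<bullet> unit_mult 3 (d 2 f p)) + 2 * (d 1 f p \<bullet> unit_mult 2 (d 3 f p)) - 2 * (d 2 f p \<bullet> unit_mult 1 (d 3 f p))))"
      unfolding a_def nrm_sq ip_def dirac_eq sum_3 norm_sq_sum_unit_mult ..
    also have "\<dots> = nrm (d 1 f)^2 + nrm (d 2 f)^2 + nrm (d 3 f)^2
       - 2 * ip (d 1 f) (\<lambda>p. unit_mult 3 (d 2 f p)) + 2 * ip (d 1 f) (\<lambda>p. unit_mult 2 (d 3 f p)) - 2 * ip (d 2 f) (\<lambda>p. unit_mult 1 (d 3 f p))"
      unfolding nrm_sq ip_def
      by (subst vint_diff vint_add vint_cmult;
          (intro continuous_on_add continuous_on_diff continuous_on_mult continuous_on_const continuous_on_inner cd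
            bounded_linear.continuous_on[OF bounded_linear_unit_mult])?)+ simp
    finally have "nrm (d 1 f)^2 + nrm (d 2 f)^2 + nrm (d 3 f)^2 \<le> a^2 + nrm f * (C 1 2 * s) + nrm f * (C 1 3 * s) + nrm f * (C 2 3 * s)"
      using cross[of 1 3 2] cross[of 1 2 3] cross[of 2 1 3] by linarith
    moreover have "s^2 \<le> 3 * (nrm (d 1 f)^2 + nrm (d 2 f)^2 + nrm (d 3 f)^2)"
    proof -
      have "(x + y + z)^2 \<le> 3 * (x^2 + y^2 + z^2)" for x y z :: real
        using sum_squares_ge_zero[of "x - y" "y - z"] zero_le_power2[of "x - z"] by (simp add: power2_eq_square algebra_simps)
      then show ?thesis by (simp add: s_def sum_3)
    qed
    ultimately have s2: "s^2 \<le> 3 * a^2 + 3 * c * nrm f * s" by (simp add: c_def algebra_simps)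
    \<comment> \<open>Solves the quadratic inequality \<open>s2\<close>: beyond this value,
      \<open>s^2\<close> would exceed \<open>4 * a^2 + 3 * c * nrm f * s\<close>.\<close>
    have "s \<le> 2 * a + 3 * c * nrm f"
    proof (rule ccontr)
      assume "\<not> ?thesis"
      then have lt: "2 * a + 3 * c * nrm f < s" by simp
      have a0: "a \<ge> 0" by (simp add: a_def)
      have b0: "3 * c * nrm f \<ge> 0" using c by simp
      have spos: "0 < s" using lt a0 b0 by linarith
      have "(2 * a + 3 * c * nrm f) * s < s * s" using lt spos by (intro mult_strict_right_mono)
      moreover have "2 * a * (2 * a) \<le> 2 * a * s" using lt a0 b0 by (intro mult_left_mono) auto
      ultimately have "4 * a^2 + 3 * c * nrm f * s < s^2" by (simp add: power2_eq_square algebra_simps)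
      moreover have "a^2 \<ge> 0" by simp
      ultimately show False using s2 by linarith
    qed
    then have "N 1 f \<le> nrm f + (2 * a + 3 * c * nrm f)" by (simp add: s_def)
    also have "\<dots> \<le> (3 * c + 2 + 1) * (a + nrm f)"
      using c by (simp add: a_def algebra_simps add_increasing)
    finally show ?thesis by (simp add: a_def)
  qed
  then show ?thesis using c by (intro exI[of _ "3 * c + 2 + 1"]) auto
qed

text \<open>Commuting a frame derivative with the operator only produces commutators of frame
  fields, so one order is saved.\<close>

lemma N_dirac_commutator:
  "\<exists>C\<ge>0. \<forall>f. smooth_fun A f \<longrightarrow> N k (\<lambda>p. dirac (d i f) p - d i (dirac f) p) \<le> C * N (Suc k) f"
proof -
  define C where "C j = (SOME C. C \<ge> 0 \<and> (\<forall>f. smooth_fun A f \<longrightarrow>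
    N k (\<lambda>p. d j (d i f) p - d i (d j f) p) \<le> C * (\<Sum>l\<in>UNIV. N k (d l f))))" for j
  have C: "C j \<ge> 0" "\<And>f. smooth_fun A f \<Longrightarrow> N k (\<lambda>p. d j (d i f) p - d i (d j f) p) \<le> C j * (\<Sum>l\<in>UNIV. N k (d l f))" for j
    using someI_ex[OF N_commutator[of k j i]] unfolding C_def[symmetric] by simp_all
  have "N k (\<lambda>p. dirac (d i f) p - d i (dirac f) p) \<le> (\<Sum>j\<in>UNIV. C j) * N (Suc k) f" if f: "smooth_fun A f" for f
  proof -
    have sm: "smooth_fun A (\<lambda>p. d j (d i f) p - d i (d j f) p)" for j by (intro smooth_fun_diff smooth_d f)
    have "d i (dirac f) p = (\<Sum>j\<in>UNIV. unit_mult j (d i (d j f) p))" for p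
      unfolding dirac_eq[abs_def]
      by (subst dir_deriv_sum[OF v_smooth smooth_unit_mult[OF smooth_d[OF f]]])
        (simp add: dir_deriv_linear[OF v_smooth smooth_d[OF f] bounded_linear_unit_mult])
    then have "(\<lambda>p. dirac (d i f) p - d i (dirac f) p) = (\<lambda>p. \<Sum>j\<in>UNIV. unit_mult j (d j (d i f) p - d i (d j f) p))"
      by (simp add: dirac_eq unit_mult_diff sum_subtractf)
    then have "N k (\<lambda>p. dirac (d i f) p - d i (dirac f) p) \<le> (\<Sum>j\<in>UNIV. N k (\<lambda>p. unit_mult j (d j (d i f) p - d i (d j f) p)))"
      using N_sum[of UNIV "\<lambda>j p. unit_mult j (d j (d i f) p - d i (d j f) p)" k] smooth_unit_mult[OF sm] by simp
    also have "\<dots> \<le> (\<Sum>j\<in>UNIV. C j * N (Suc k) f)"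
    proof (rule sum_mono)
      fix j
      have "N k (\<lambda>p. unit_mult j (d j (d i f) p - d i (d j f) p)) \<le> N k (\<lambda>p. d j (d i f) p - d i (d j f) p)"
        by (rule N_unit_mult[OF sm])
      also have "\<dots> \<le> C j * (\<Sum>l\<in>UNIV. N k (d l f))" by (rule C(2)[OF f])
      also have "\<dots> \<le> C j * N (Suc k) f" using C(1) by (intro mult_left_mono) auto
      finally show "N k (\<lambda>p. unit_mult j (d j (d i f) p - d i (d j f) p)) \<le> C j * N (Suc k) f" .
    qed
    finally show ?thesis by (simp add: sum_distrib_right)
  qed
  then show ?thesis using C(1) by (intro exI[of _ "\<Sum>j\<in>UNIV. C j"]) (auto intro: sum_nonneg)
qed

text \<open>The estimate of order \<open>k\<close> is applied to each \<open>d i f\<close>. Moving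
  \<open>d i\<close> past the operator costs a multiple of \<open>N (Suc k) f\<close>, which the
  next estimate allows on its right-hand side.\<close>

lemma elliptic_step: "\<exists>C\<ge>0. \<forall>f. smooth_fun A f \<longrightarrow> N (Suc k) f \<le> C * (N k (dirac f) + N k f)"
proof (induction k)
  case 0
  then show ?case using Garding by simp
next
  case (Suc k)
  obtain C where C: "C \<ge> 0" "\<And>f. smooth_fun A f \<Longrightarrow> N (Suc k) f \<le> C * (N k (dirac f) + N k f)"
    using Suc.IH by blast
  define B where "B i = (SOME C. C \<ge> 0 \<and> (\<forall>f. smooth_fun A f \<longrightarrow>
    N k (\<lambda>p. dirac (d i f) p - d i (dirac f) p) \<le> C * N (Suc k) f))" for i
  have B: "B i \<ge> 0" "\<And>f. smooth_fun A f \<Longrightarrow> N k (\<lambda>p. dirac (d i f) p - d i (dirac f) p) \<le> B i * N (Suc k) f" for i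
    using someI_ex[OF N_dirac_commutator[of k i]] unfolding B_def[symmetric] by simp_all
  \<comment> \<open>The 1 pays for \<open>N (Suc k) f\<close> itself, and
    \<open>C * (2 + B i)\<close> for the derivative in direction \<open>i\<close>.\<close>
  define E where "E = 1 + (\<Sum>i\<in>UNIV. C * (2 + B i))"
  have Bs: "(\<Sum>i\<in>UNIV. C * (2 + B i)) \<ge> 0" using B(1) C(1) by (intro sum_nonneg mult_nonneg_nonneg) (auto intro: add_nonneg_nonneg)
  have "N (Suc (Suc k)) f \<le> E * (N (Suc k) (dirac f) + N (Suc k) f)" if f: "smooth_fun A f" for f
  proof -
    define a where "a = N (Suc k) (dirac f)"
    define b where "b = N (Suc k) f"
    have ab: "a \<ge> 0" "b \<ge> 0" unfolding a_def b_def by (rule N_nonneg)+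
    have "N (Suc k) (d i f) \<le> C * (2 + B i) * (a + b)" for i
    proof -
      have "N (Suc k) (d i f) \<le> C * (N k (dirac (d i f)) + N k (d i f))" by (rule C(2)[OF smooth_d[OF f]])
      moreover have "N k (d i f) \<le> b" unfolding b_def by (rule N_d)
      moreover have "N k (dirac (d i f)) \<le> a + B i * b"
      proof -
        have "dirac (d i f) = (\<lambda>p. d i (dirac f) p + (dirac (d i f) p - d i (dirac f) p))" by simp
        then have "N k (dirac (d i f)) \<le> N k (d i (dirac f)) + N k (\<lambda>p. dirac (d i f) p - d i (dirac f) p)"
          using N_add[OF smooth_d[OF smooth_dirac[OF f]] smooth_fun_diff[OF smooth_dirac[OF smooth_d[OF f]] smooth_d[OF smooth_dirac[OF f]]], of k i i i] by simp
        then show ?thesis using N_d[of k i "dirac f"] B(2)[OF f, of i] unfolding a_def b_def by linarith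
      qed
      ultimately have "N (Suc k) (d i f) \<le> C * (a + B i * b + b)" using C(1) by (meson add_mono mult_left_mono order_trans)
      also have "\<dots> \<le> C * ((2 + B i) * (a + b))"
      proof (rule mult_left_mono[OF _ C(1)])
        have "B i * a \<ge> 0" using B(1) ab by simp
        then show "a + B i * b + b \<le> (2 + B i) * (a + b)" using ab by (simp add: algebra_simps)
      qed
      finally show ?thesis by (simp add: mult.assoc)
    qed
    then have "(\<Sum>i\<in>UNIV. N (Suc k) (d i f)) \<le> (\<Sum>i\<in>UNIV. C * (2 + B i) * (a + b))" by (intro sum_mono)
    also have "\<dots> = (\<Sum>i\<in>UNIV. C * (2 + B i)) * (a + b)" by (rule sum_distrib_right[symmetric])
    finally have "N (Suc (Suc k)) f \<le> b + (\<Sum>i\<in>UNIV. C * (2 + B i)) * (a + b)"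
      unfolding N.simps(2)[of "Suc k"] b_def by simp
    then show ?thesis unfolding E_def a_def[symmetric] b_def[symmetric] using ab by (simp add: distrib_right)
  qed
  then show ?case using Bs by (intro exI[of _ E]) (auto simp: E_def)
qed

text \<open>Iterating \<open>elliptic_step\<close> lowers the error term from order \<open>k\<close>
  to the plain \<open>nrm f\<close>, which is what compactness can control.\<close>

lemma elliptic: "\<exists>C\<ge>0. \<forall>f. smooth_fun A f \<longrightarrow> N (Suc k) f \<le> C * (N k (dirac f) + nrm f)"
proof (induction k)
  case 0
  then show ?case using elliptic_step[of 0] by simp
next
  case (Suc k)
  obtain C where C: "C \<ge> 0" "\<And>f. smooth_fun A f \<Longrightarrow> N (Suc k) f \<le> C * (N k (dirac f) + nrm f)"
    using Suc.IH by blast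
  obtain B where B: "B \<ge> 0" "\<And>f. smooth_fun A f \<Longrightarrow> N (Suc (Suc k)) f \<le> B * (N (Suc k) (dirac f) + N (Suc k) f)"
    using elliptic_step[of "Suc k"] by blast
  have "N (Suc (Suc k)) f \<le> B * (1 + C) * (N (Suc k) (dirac f) + nrm f)" if f: "smooth_fun A f" for f
  proof -
    define a where "a = N (Suc k) (dirac f)"
    define b where "b = nrm f"
    define e where "e = N (Suc k) f"
    have "N k (dirac f) \<le> a" unfolding a_def by (rule N_Suc)
    then have "C * (N k (dirac f) + b) \<le> C * (a + b)" using C(1) by (intro mult_left_mono) auto
    then have "e \<le> C * (a + b)" using C(2)[OF f] unfolding e_def b_def by (rule order_trans[rotated])
    moreover have "b \<ge> 0" by (simp add: b_def)
    ultimately have "a + e \<le> (1 + C) * (a + b)" unfolding distrib_right by simp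
    then have "N (Suc k) (dirac f) + N (Suc k) f \<le> (1 + C) * (N (Suc k) (dirac f) + nrm f)"
      by (simp only: a_def b_def e_def)
    then show ?thesis using B(2)[OF f] mult_left_mono[OF _ B(1)] by (metis mult.assoc order_trans)
  qed
  then show ?case using B(1) C(1) by (intro exI[of _ "B * (1 + C)"]) auto
qed

end

section \<open>Sobolev inequality and compactness\<close>

lemma lipschitz_from_partials:
  fixes g :: "real^3 \<Rightarrow> 'b::real_normed_vector"
  assumes "smooth_on UNIV g" "\<And>i x. norm (partial_deriv i g x) \<le> B"
  shows "norm (g x - g y) \<le> 3 * B * norm (x - y)"
proof (rule differentiable_bound[of UNIV])
  fix x :: "real^3"
  have dx: "g differentiable at x" using smooth_on_differentiable[OF assms(1)] by simp
  show "(g has_derivative frechet_derivative g (at x)) (at x within UNIV)" using frechet_has_derivative[OF dx] by simp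
  show "onorm (frechet_derivative g (at x)) \<le> 3 * B"
  proof (rule onorm_le)
    fix h :: "real^3"
    have "norm (frechet_derivative g (at x) h) \<le> (\<Sum>i\<in>UNIV. norm (h $ i *\<^sub>R partial_deriv i g x))"
      unfolding frechet_expansion[OF dx] by (rule norm_sum)
    also have "\<dots> \<le> (\<Sum>i\<in>(UNIV::3 set). norm h * B)"
      by (intro sum_mono) (simp add: assms(2) component_le_norm_cart mult_mono)
    also have "\<dots> = 3 * B * norm h" by simp
    finally show "norm (frechet_derivative g (at x) h) \<le> 3 * B * norm h" .
  qed
qed auto

text \<open>Stated without a limit, so that subsequences can be thinned out repeatedly before any
  limit is formed.\<close>

definition uniformly_Cauchy :: "(nat \<Rightarrow> 'a \<Rightarrow> 'b::real_normed_vector) \<Rightarrow> bool" where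
  "uniformly_Cauchy f \<longleftrightarrow> (\<forall>e>0. \<exists>M. \<forall>m\<ge>M. \<forall>n\<ge>M. \<forall>p. norm (f m p - f n p) < e)"

lemma uniformly_Cauchy_subseq:
  assumes "uniformly_Cauchy f" "strict_mono r" shows "uniformly_Cauchy (\<lambda>n. f (r n))"
  unfolding uniformly_Cauchy_def
proof (intro allI impI)
  fix e :: real assume "e > 0"
  then obtain M where M: "\<And>m n p. m \<ge> M \<Longrightarrow> n \<ge> M \<Longrightarrow> norm (f m p - f n p) < e"
    using assms(1) unfolding uniformly_Cauchy_def by blast
  have "M \<le> r n" if "M \<le> n" for n using seq_suble[OF assms(2), of n] that by simp
  then show "\<exists>M. \<forall>m\<ge>M. \<forall>n\<ge>M. \<forall>p. norm (f (r m) p - f (r n) p) < e" using M by blast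
qed

context frame
begin

text \<open>A coordinate field multiplied by its partition weight: the cutoff makes it a global
  smooth field to which frame estimates apply.\<close>

definition coord_field :: "'a chart \<times> ('a \<Rightarrow> real) \<Rightarrow> 3 \<Rightarrow> 'a vfield" where
  "coord_field q i = vfield_extend (fst q) (\<lambda>x. snd q (chart_inv (fst q) x) *\<^sub>R axis i 1)"

lemma coord_field_smooth: "q \<in> pou \<Longrightarrow> coord_field q i \<in> smooth_vfields A"
  unfolding coord_field_def by (intro vfield_extend_weighted pou smooth_on_const)

lemma dir_deriv_coord_field:
  assumes "q \<in> pou" "smooth_fun A f"
  shows "dir_deriv A (coord_field q i) f p =
    (if p \<in> cdom (fst q) then snd q p *\<^sub>R partial_deriv i (f \<circ> chart_inv (fst q)) (coord (fst q) p) else 0)"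
  unfolding coord_field_def partial_deriv_def
  using vfield_extend_weighted(2)[OF pou(2,3,5)[OF assms(1)] smooth_on_const assms(2)] assms(1) by simp

definition weight_deriv :: "'a chart \<times> ('a \<Rightarrow> real) \<Rightarrow> 3 \<Rightarrow> 'a \<Rightarrow> real" where
  "weight_deriv q i = extend_zero (fst q) (partial_deriv i (local_rep (fst q) (snd q)))"

lemma smooth_weight_deriv:
  assumes q: "q \<in> pou" shows "smooth_fun A (weight_deriv q i)"
proof -
  have s: "smooth_on UNIV (local_rep (fst q) (snd q))"
    by (rule smooth_local_rep(1)[OF pou(2)[OF q] smooth_fun_chart[OF pou(3)[OF q] pou(2)[OF q]] pou(5)[OF q]])
  obtain K where K: "compact K" "K \<subseteq> cimage (fst q)" "\<And>x. x \<notin> K \<Longrightarrow> local_rep (fst q) (snd q) x = 0"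
    using smooth_local_rep(2)[OF pou(2)[OF q] smooth_fun_chart[OF pou(3)[OF q] pou(2)[OF q]] pou(5)[OF q]] by blast
  show ?thesis unfolding weight_deriv_def
    by (rule smooth_extend_zero(1)[OF pou(2)[OF q] _ K(1,2)])
      (use csupp_partial[OF s K(1,3)] smooth_on_subset[OF smooth_on_partial[OF s]] in auto)
qed

text \<open>Obtained from the product rule for the power \<open>Suc m\<close> of the weight times
  \<open>f\<close> after taking out \<open>m\<close> factors; the remaining one is spent in turning
  the coordinate derivative into a derivative along \<open>coord_field\<close>.\<close>

definition Z :: "'a chart \<times> ('a \<Rightarrow> real) \<Rightarrow> 3 \<Rightarrow> nat \<Rightarrow> ('a \<Rightarrow> quat) \<Rightarrow> 'a \<Rightarrow> quat" where
  "Z q i m f p = (real (Suc m) * weight_deriv q i p) *\<^sub>R f p + dir_deriv A (coord_field q i) f p"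

lemma smooth_Z: "q \<in> pou \<Longrightarrow> smooth_fun A f \<Longrightarrow> smooth_fun A (Z q i m f)"
  unfolding Z_def[abs_def]
  by (intro smooth_fun_add smooth_fun_scaleR smooth_fun_mult smooth_fun_const smooth_weight_deriv smooth_dir_deriv coord_field_smooth)

lemma supported_in_power_weight:
  "q \<in> pou \<Longrightarrow> supported_in (fst q) (\<lambda>p. snd q p ^ Suc m *\<^sub>R (f p :: quat))"
  using pou(5)[of q] unfolding supported_in_def by (metis power_0_Suc scaleR_zero_left)

lemma smooth_power_weight:
  "q \<in> pou \<Longrightarrow> smooth_fun A f \<Longrightarrow> smooth_fun A (\<lambda>p. snd q p ^ m *\<^sub>R (f p :: quat))"
  by (intro smooth_fun_scaleR smooth_fun_power pou)

lemma smooth_local_rep_weight: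
  assumes "q \<in> pou" "smooth_fun A f"
  shows "smooth_on UNIV (local_rep (fst q) (\<lambda>p. snd q p ^ Suc m *\<^sub>R (f p :: quat)))"
  by (intro smooth_local_rep(1) smooth_fun_chart pou assms smooth_power_weight supported_in_power_weight)

lemma weight_compact_support:
  assumes q: "q \<in> pou"
  shows "\<exists>K. compact K \<and> K \<subseteq> cimage (fst q) \<and> (\<forall>(f :: 'a \<Rightarrow> quat) m x. x \<notin> K \<longrightarrow> local_rep (fst q) (\<lambda>p. snd q p ^ Suc m *\<^sub>R f p) x = 0)"
proof -
  obtain K where K: "compact K" "K \<subseteq> cimage (fst q)" "\<And>x. x \<notin> K \<Longrightarrow> local_rep (fst q) (snd q) x = 0"
    using smooth_local_rep(2)[OF pou(2)[OF q] smooth_fun_chart[OF pou(3)[OF q] pou(2)[OF q]] pou(5)[OF q]] by blast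
  have "local_rep (fst q) (\<lambda>p. snd q p ^ Suc m *\<^sub>R f p) x = 0" if "x \<notin> K" for x m and f :: "'a \<Rightarrow> quat"
    using K(3)[OF that] by (auto simp: local_rep_def split: if_splits)
  then show ?thesis using K(1,2) by blast
qed

text \<open>The factor \<open>snd q ^ m\<close> that survives is what makes the derivative again a compactly supported
  expression in globally defined operators, so no second, larger cutoff function is needed.\<close>

lemma partial_local_rep_weight:
  assumes q: "q \<in> pou" and f: "smooth_fun A f"
  shows "partial_deriv i (local_rep (fst q) (\<lambda>p. snd q p ^ Suc m *\<^sub>R f p)) = local_rep (fst q) (\<lambda>p. snd q p ^ m *\<^sub>R Z q i m f p)"
proof
  fix x
  define a where "a = fst q"
  define w where "w = snd q"
  have a: "a \<in> A" and w: "smooth_fun A w" using pou q by (auto simp: a_def w_def)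
  obtain K where K: "compact K" "K \<subseteq> cimage a" "\<And>x. x \<notin> K \<Longrightarrow> local_rep a (\<lambda>p. w p ^ Suc m *\<^sub>R f p) x = 0"
    using weight_compact_support[OF q] unfolding a_def w_def by blast
  show "partial_deriv i (local_rep (fst q) (\<lambda>p. snd q p ^ Suc m *\<^sub>R f p)) x = local_rep (fst q) (\<lambda>p. snd q p ^ m *\<^sub>R Z q i m f p) x"
  proof (cases "x \<in> cimage a")
    case True
    define p where "p = chart_inv a x"
    have p: "p \<in> cdom a" "coord a p = x" using True a by (auto simp: p_def)
    define t where "t = w \<circ> chart_inv a"
    define g where "g = f \<circ> chart_inv a"
    have dt: "t differentiable at x" and dg: "g differentiable at x"
      using differentiable_chart[OF w a p(1)] differentiable_chart[OF f a p(1)] p(2) by (auto simp: t_def g_def)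
    have pow: "((\<lambda>x. t x ^ Suc m) has_derivative (\<lambda>h. real (Suc m) * frechet_derivative t (at x) h * t x ^ (Suc m - 1))) (at x)"
      by (rule has_derivative_power[OF frechet_has_derivative[OF dt]])
    have "partial_deriv i (local_rep a (\<lambda>p. w p ^ Suc m *\<^sub>R f p)) x = partial_deriv i (\<lambda>x. t x ^ Suc m *\<^sub>R g x) x"
      by (rule partial_deriv_cong_open[OF open_cimage[OF a] True]) (simp add: local_rep_def t_def g_def)
    also have "\<dots> = t x ^ Suc m *\<^sub>R partial_deriv i g x + partial_deriv i (\<lambda>x. t x ^ Suc m) x *\<^sub>R g x"
      by (rule partial_deriv_bilinear[OF bounded_bilinear_scaleR differentiableI[OF pow] dg])
    also have "partial_deriv i (\<lambda>x. t x ^ Suc m) x = real (Suc m) * partial_deriv i t x * t x ^ m"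
      using partial_deriv_eq[OF pow, of i] by (simp add: partial_deriv_def)
    also have "partial_deriv i t x = weight_deriv q i p"
    proof -
      have "partial_deriv i t x = partial_deriv i (local_rep a w) x"
        by (rule partial_deriv_cong_open[OF open_cimage[OF a] True]) (simp add: local_rep_def t_def)
      then show ?thesis using p by (simp add: weight_deriv_def extend_zero_def a_def w_def)
    qed
    finally have L: "partial_deriv i (local_rep a (\<lambda>p. w p ^ Suc m *\<^sub>R f p)) x
      = t x ^ Suc m *\<^sub>R partial_deriv i g x + (real (Suc m) * weight_deriv q i p * t x ^ m) *\<^sub>R g x" .
    have gx: "g x = f p" by (simp add: g_def p_def)
    have "Z q i m f p = (real (Suc m) * weight_deriv q i p) *\<^sub>R f p + w p *\<^sub>R partial_deriv i g x"
      using p by (simp add: Z_def dir_deriv_coord_field[OF q f] a_def w_def g_def)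
    moreover have "local_rep a (\<lambda>p. w p ^ m *\<^sub>R Z q i m f p) x = w p ^ m *\<^sub>R Z q i m f p"
      using True by (simp add: local_rep_def p_def)
    moreover have "t x = w p" by (simp add: t_def p_def)
    ultimately show ?thesis
      unfolding a_def[symmetric] w_def[symmetric] L gx by (simp add: scaleR_add_right mult_ac)
  next
    case False
    have "partial_deriv i (local_rep a (\<lambda>p. w p ^ Suc m *\<^sub>R f p)) x = 0"
      by (rule csupp_partial[OF _ K(1,3)]) (use smooth_local_rep_weight[OF q f] False K in \<open>auto simp: a_def w_def\<close>)
    then show ?thesis using False by (simp add: a_def w_def local_rep_def)
  qed
qed

lemma N_Z:
  assumes q: "q \<in> pou"
  shows "\<exists>C\<ge>0. \<forall>f. smooth_fun A f \<longrightarrow> N k (Z q i m f) \<le> C * N (Suc k) f"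
proof -
  have sw: "smooth_fun A (\<lambda>p. real (Suc m) * weight_deriv q i p)"
    by (intro smooth_fun_mult smooth_fun_const smooth_weight_deriv q)
  obtain C1 where C1: "C1 \<ge> 0" "\<And>f. smooth_fun A f \<Longrightarrow> N k (\<lambda>p. (real (Suc m) * weight_deriv q i p) *\<^sub>R f p) \<le> C1 * N k f"
    using N_mult[OF sw] by blast
  obtain C2 where C2: "C2 \<ge> 0" "\<And>f. smooth_fun A f \<Longrightarrow> N k (dir_deriv A (coord_field q i) f) \<le> C2 * N (Suc k) f"
    using N_dir_deriv[OF coord_field_smooth[OF q]] by blast
  have "N k (Z q i m f) \<le> (C1 + C2) * N (Suc k) f" if f: "smooth_fun A f" for f
  proof -
    have "N k (Z q i m f) \<le> N k (\<lambda>p. (real (Suc m) * weight_deriv q i p) *\<^sub>R f p) + N k (dir_deriv A (coord_field q i) f)"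
      unfolding Z_def[abs_def] by (intro N_add smooth_fun_scaleR sw f smooth_dir_deriv coord_field_smooth q)
    moreover have "C1 * N k f \<le> C1 * N (Suc k) f" using C1(1) N_Suc by (intro mult_left_mono)
    ultimately show ?thesis using C1(2)[OF f] C2(2)[OF f] unfolding distrib_right by linarith
  qed
  then show ?thesis using C1(1) C2(1) by (intro exI[of _ "C1 + C2"]) auto
qed

text \<open>Compares Lebesgue measure in a chart with the volume on the support of the weight, then
  applies Cauchy--Schwarz on a space of finite volume.\<close>

lemma weighted_integral_le_nrm:
  assumes q: "q \<in> pou"
  shows "\<exists>C\<ge>0. \<forall>g. smooth_fun A g \<longrightarrow> (LINT y|lborel. norm (local_rep (fst q) (\<lambda>p. snd q p *\<^sub>R (g p :: quat)) y)) \<le> C * nrm g"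
proof -
  define a where "a = fst q"
  define w where "w = snd q"
  have a: "a \<in> A" and w: "smooth_fun A w" and w0: "\<And>p. w p \<ge> 0" and sw: "supported_in a w"
    using pou q by (auto simp: a_def w_def)
  have rp: "rho a (chart_inv a x) > 0" if "x \<in> cimage a" for x using rho_pos a that by simp
  \<comment> \<open>The weight divided by the density: its volume integral against a function is the
    Lebesgue integral of the weighted function.\<close>
  define h where "h = extend_zero a (\<lambda>x. w (chart_inv a x) * inverse (rho a (chart_inv a x)))"
  obtain K where K: "compact K" "K \<subseteq> cimage a" "\<And>x. x \<notin> K \<Longrightarrow> local_rep a w x = 0"
    using smooth_local_rep(2)[OF a smooth_fun_chart[OF w a] sw] by blast
  have sm: "smooth_on (cimage a) (\<lambda>x. w (chart_inv a x) * inverse (rho a (chart_inv a x)))"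
    using rp by (intro smooth_on_mult smooth_on_inverse open_cimage a smooth_fun_chart' w smooth_rho) force
  have z: "w (chart_inv a x) * inverse (rho a (chart_inv a x)) = 0" if "x \<in> cimage a" "x \<notin> K" for x
    using K(3)[OF that(2)] that(1) by (simp add: local_rep_def)
  have h: "smooth_fun A h" "supported_in a h" unfolding h_def
    using smooth_extend_zero[OF a sm K(1,2) z] by blast+
  obtain C where C: "C > 0" "\<And>p. \<bar>h p\<bar> \<le> C" using smooth_fun_bounded[OF h(1)] by auto
  have "(LINT y|lborel. norm (local_rep a (\<lambda>p. w p *\<^sub>R g p) y)) \<le> C * sqrt (vint (\<lambda>p. 1)) * nrm g"
    if g: "smooth_fun A g" for g :: "'a \<Rightarrow> quat"
  proof -
    have cg: "cont g" and ch: "cont h" by (intro smooth_fun_continuous g h)+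
    have cn: "cont (\<lambda>p. norm (g p))" using cg by (rule continuous_on_norm)
    have chn: "cont (\<lambda>p. h p * norm (g p))" by (intro continuous_on_mult ch cn)
    have "(\<lambda>y. norm (local_rep a (\<lambda>p. w p *\<^sub>R g p) y)) = local_rep a (\<lambda>p. h p * norm (g p) * rho a p)"
    proof
      fix y
      show "norm (local_rep a (\<lambda>p. w p *\<^sub>R g p) y) = local_rep a (\<lambda>p. h p * norm (g p) * rho a p) y"
        using rp[of y] w0[of "chart_inv a y"] a
        by (cases "y \<in> cimage a") (simp_all add: local_rep_def h_def extend_zero_def)
    qed
    then have "(LINT y|lborel. norm (local_rep a (\<lambda>p. w p *\<^sub>R g p) y)) = vint (\<lambda>p. h p * norm (g p))"
      using vint_chart[OF a chn] h(2) supported_in_mult_left[OF h(2), of "\<lambda>p. norm (g p)"] by simp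
    also have "\<dots> \<le> vint (\<lambda>p. C * norm (g p))"
    proof (rule vint_mono[OF chn])
      show "h p * norm (g p) \<le> C * norm (g p)" for p
        using C(2)[of p] by (intro mult_right_mono) auto
    qed (intro continuous_on_mult continuous_on_const cn)
    also have "\<dots> = C * vint (\<lambda>p. norm (g p))" by (rule vint_cmult)
    also have "\<dots> \<le> C * (sqrt (vint (\<lambda>p. 1)) * nrm g)" using C(1) vint_norm_le[OF cg] by simp
    finally show ?thesis by (simp add: mult.assoc)
  qed
  then show ?thesis using C(1) vint_one_nonneg unfolding a_def w_def
    by (intro exI[of _ "C * sqrt (vint (\<lambda>p. 1))"]) auto
qed

text \<open>Power 4 = 3 + 1: each of the three derivatives in
  \<open>sup_le_integral_third_partial\<close> consumes one factor, and the last one still cuts off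
  the integrand in the chart.\<close>

lemma Sobolev_weighted:
  assumes q: "q \<in> pou"
  shows "\<exists>C\<ge>0. \<forall>f p. smooth_fun A f \<longrightarrow> norm (snd q p ^ 4 *\<^sub>R f p) \<le> C * N 3 f"
proof -
  obtain C0 where C0: "C0 \<ge> 0" "\<And>g. smooth_fun A g \<Longrightarrow> (LINT y|lborel. norm (local_rep (fst q) (\<lambda>p. snd q p *\<^sub>R (g p :: quat)) y)) \<le> C0 * nrm g"
    using weighted_integral_le_nrm[OF q] by blast
  obtain C1 where C1: "C1 \<ge> 0" "\<And>f. smooth_fun A f \<Longrightarrow> N 0 (Z q 3 1 f) \<le> C1 * N 1 f"
    using N_Z[OF q, of 0 3 1] by auto
  obtain C2 where C2: "C2 \<ge> 0" "\<And>f. smooth_fun A f \<Longrightarrow> N 1 (Z q 2 2 f) \<le> C2 * N 2 f"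
    using N_Z[OF q, of 1 2 2] by (auto simp: numeral_2_eq_2)
  obtain C3 where C3: "C3 \<ge> 0" "\<And>f. smooth_fun A f \<Longrightarrow> N 2 (Z q 1 3 f) \<le> C3 * N 3 f"
    using N_Z[OF q, of 2 1 3] by (auto simp: numeral_3_eq_3 numeral_2_eq_2)
  have "norm (snd q p ^ 4 *\<^sub>R f p) \<le> C0 * (C1 * (C2 * C3)) * N 3 f" if f: "smooth_fun A f" for f p
  proof (cases "p \<in> cdom (fst q)")
    case True
    define f1 where "f1 = Z q 1 3 f"
    define f2 where "f2 = Z q 2 2 f1"
    define f3 where "f3 = Z q 3 1 f2"
    have s: "smooth_fun A f1" "smooth_fun A f2" "smooth_fun A f3"
      unfolding f1_def f2_def f3_def by (intro smooth_Z q f)+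
    define u where "u = local_rep (fst q) (\<lambda>p. snd q p ^ Suc 3 *\<^sub>R f p)"
    obtain K where K: "compact K" "\<And>x. x \<notin> K \<Longrightarrow> u x = 0"
      using weight_compact_support[OF q] unfolding u_def by blast
    have "partial_deriv 1 u = local_rep (fst q) (\<lambda>p. snd q p ^ Suc 2 *\<^sub>R f1 p)"
      unfolding u_def partial_local_rep_weight[OF q f] f1_def[symmetric] by (simp add: numeral_3_eq_3 numeral_2_eq_2)
    moreover have "partial_deriv 2 (local_rep (fst q) (\<lambda>p. snd q p ^ Suc 2 *\<^sub>R f1 p)) = local_rep (fst q) (\<lambda>p. snd q p ^ Suc 1 *\<^sub>R f2 p)"
      unfolding partial_local_rep_weight[OF q s(1)] f2_def[symmetric] by (simp add: numeral_2_eq_2)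
    moreover have "partial_deriv 3 (local_rep (fst q) (\<lambda>p. snd q p ^ Suc 1 *\<^sub>R f2 p)) = local_rep (fst q) (\<lambda>p. snd q p *\<^sub>R f3 p)"
      unfolding partial_local_rep_weight[OF q s(2)] f3_def[symmetric] by simp
    ultimately have d3: "partial_deriv 3 (partial_deriv 2 (partial_deriv 1 u)) = local_rep (fst q) (\<lambda>p. snd q p *\<^sub>R f3 p)" by simp
    have su: "smooth_on UNIV u" unfolding u_def by (rule smooth_local_rep_weight[OF q f])
    have "norm (u (coord (fst q) p)) \<le> (LINT y|lborel. norm (local_rep (fst q) (\<lambda>p. snd q p *\<^sub>R f3 p) y))"
      using sup_le_integral_third_partial[OF su K, of "coord (fst q) p"] unfolding d3 by simp
    also have "\<dots> \<le> C0 * nrm f3" by (rule C0(2)[OF s(3)])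
    also have "\<dots> \<le> C0 * (C1 * (C2 * (C3 * N 3 f)))"
    proof (rule mult_left_mono[OF _ C0(1)])
      have "nrm f3 \<le> C1 * N 1 f2" using C1(2)[OF s(2)] by (simp add: f3_def)
      also have "\<dots> \<le> C1 * (C2 * N 2 f1)" using C2(2)[OF s(1)] C1(1) unfolding f2_def by (rule mult_left_mono)
      also have "\<dots> \<le> C1 * (C2 * (C3 * N 3 f))" using C3(2)[OF f] C1(1) C2(1) unfolding f1_def by (intro mult_left_mono)
      finally show "nrm f3 \<le> C1 * (C2 * (C3 * N 3 f))" .
    qed
    finally show ?thesis using True pou(2)[OF q] by (simp add: u_def local_rep_def mult_ac eval_nat_numeral)
  next
    case False
    then have "snd q p = 0" using pou(5)[OF q] unfolding supported_in_def by auto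
    then show ?thesis using C0(1) C1(1) C2(1) C3(1) by simp
  qed
  then show ?thesis using C0(1) C1(1) C2(1) C3(1) by (intro exI[of _ "C0 * (C1 * (C2 * C3))"]) auto
qed

lemma pou_large: "\<exists>q\<in>pou. snd q p \<ge> 1 / real (card pou)"
proof (rule ccontr)
  assume "\<not> ?thesis"
  then have lt: "\<And>q. q \<in> pou \<Longrightarrow> snd q p < 1 / real (card pou)" by auto
  have ne: "pou \<noteq> ({} :: ('a chart \<times> ('a \<Rightarrow> real)) set)" using pou(6)[of p] by auto
  have "(\<Sum>q\<in>pou. snd q p) < (\<Sum>q\<in>(pou :: ('a chart \<times> ('a \<Rightarrow> real)) set). 1 / real (card (pou :: ('a chart \<times> ('a \<Rightarrow> real)) set)))"
    by (rule sum_strict_mono[OF pou(1) ne lt])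
  also have "\<dots> = 1" using ne pou(1) by simp
  finally show False using pou(6)[of p] by simp
qed

text \<open>At every point some weight is at least its average \<open>1 / card pou\<close>, so a
  bound on all weighted values can be divided by a power of it.\<close>

lemma sup_from_weighted:
  fixes u :: quat
  assumes "\<And>q. q \<in> pou \<Longrightarrow> norm (snd q p ^ m *\<^sub>R u) \<le> B"
  shows "norm u \<le> real (card pou) ^ m * B"
proof -
  obtain q where q: "q \<in> pou" "snd q p \<ge> 1 / real (card pou)" using pou_large by blast
  have n: "real (card (pou :: ('a chart \<times> ('a \<Rightarrow> real)) set)) > 0" using q(1) pou(1) by (simp add: card_gt_0_iff) auto
  have "(1 / real (card pou)) ^ m * norm u \<le> snd q p ^ m * norm u"
    using q(2) n by (intro mult_right_mono power_mono) auto
  also have "\<dots> \<le> B" using assms[OF q(1)] pou(4)[OF q(1), of p] by simp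
  finally show ?thesis using n by (simp add: power_divide field_simps)
qed

lemma Sobolev: "\<exists>C\<ge>0. \<forall>f p. smooth_fun A f \<longrightarrow> norm (f p) \<le> C * N 3 f"
proof -
  define C where "C q = (SOME C. C \<ge> 0 \<and> (\<forall>f p. smooth_fun A f \<longrightarrow> norm (snd q p ^ 4 *\<^sub>R f p) \<le> C * N 3 f))"
    for q :: "'a chart \<times> ('a \<Rightarrow> real)"
  have C: "C q \<ge> 0" "\<And>f p. smooth_fun A f \<Longrightarrow> norm (snd q p ^ 4 *\<^sub>R f p) \<le> C q * N 3 f" if "q \<in> pou" for q
    using someI_ex[OF Sobolev_weighted[OF that]] unfolding C_def[symmetric] by blast+
  define B where "B = (\<Sum>q\<in>pou. C q)"
  have B: "B \<ge> 0" unfolding B_def using C(1) by (rule sum_nonneg)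
  have CB: "C q \<le> B" if "q \<in> pou" for q unfolding B_def using pou(1) C(1) that by (intro member_le_sum) auto
  have "norm (f p) \<le> real (card (pou :: ('a chart \<times> ('a \<Rightarrow> real)) set)) ^ 4 * B * N 3 f" if f: "smooth_fun A f" for f p
    unfolding mult.assoc
  proof (rule sup_from_weighted)
    fix q :: "'a chart \<times> ('a \<Rightarrow> real)" assume q: "q \<in> pou"
    have "norm (snd q p ^ 4 *\<^sub>R f p) \<le> C q * N 3 f" by (rule C(2)[OF q f])
    also have "\<dots> \<le> B * N 3 f" using CB[OF q] by (intro mult_right_mono) auto
    finally show "norm (snd q p ^ 4 *\<^sub>R f p) \<le> B * N 3 f" .
  qed
  then show ?thesis using B
    by (intro exI[of _ "real (card (pou :: ('a chart \<times> ('a \<Rightarrow> real)) set)) ^ 4 * B"]) auto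
qed

section \<open>Iterated frame derivatives and compactness\<close>

primrec dI :: "3 list \<Rightarrow> ('a \<Rightarrow> quat) \<Rightarrow> 'a \<Rightarrow> quat" where
  "dI [] f = f"
| "dI (i # is) f = d i (dI is f)"

lemma smooth_dI: "smooth_fun A f \<Longrightarrow> smooth_fun A (dI is f)"
  by (induction "is") (auto intro: smooth_d)

lemma dI_diff:
  assumes "smooth_fun A f" "smooth_fun A g" shows "dI is (\<lambda>p. f p - g p) = (\<lambda>p. dI is f p - dI is g p)"
  by (induction "is") (auto simp: dir_deriv_diff[OF v_smooth smooth_dI[OF assms(1)] smooth_dI[OF assms(2)]])

lemma N_dI: "N k (dI is f) \<le> N (length is + k) f"
proof (induction "is" arbitrary: k)
  case (Cons i "is")
  have "N k (dI (i # is) f) \<le> N (Suc k) (dI is f)" unfolding dI.simps by (rule N_d)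
  also have "\<dots> \<le> N (length is + Suc k) f" by (rule Cons.IH)
  finally show ?case by simp
qed simp

lemma sup_dI: "\<exists>C\<ge>0. \<forall>f p. smooth_fun A f \<longrightarrow> norm (dI is f p) \<le> C * N (length is + 3) f"
proof -
  obtain C where C: "C \<ge> 0" "\<And>f p. smooth_fun A f \<Longrightarrow> norm (f p) \<le> C * N 3 f" using Sobolev by blast
  have "norm (dI is f p) \<le> C * N (length is + 3) f" if "smooth_fun A f" for f p
    using C(2)[OF smooth_dI[OF that], of "is" p] mult_left_mono[OF N_dI[of 3 "is" f] C(1)] by linarith
  then show ?thesis using C(1) by blast
qed

lemma Z_pointwise:
  assumes q: "q \<in> pou"
  shows "\<exists>C\<ge>0. \<forall>f p. smooth_fun A f \<longrightarrow> norm (Z q i m f p) \<le> C * (norm (f p) + (\<Sum>j\<in>UNIV. norm (d j f p)))"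
proof -
  obtain C0 where C0: "C0 > 0" "\<And>p. \<bar>weight_deriv q i p\<bar> \<le> C0"
    using smooth_fun_bounded[OF smooth_weight_deriv[OF q, of i]] by auto
  define C where "C j = (SOME C. C > 0 \<and> (\<forall>p. norm (cof (coord_field q i) j p) \<le> C))" for j
  have C: "C j > 0" "\<And>p. norm (cof (coord_field q i) j p) \<le> C j" for j
    using someI_ex[OF smooth_fun_bounded[OF smooth_cof[OF coord_field_smooth[OF q, of i], of j]]]
    unfolding C_def[symmetric] by blast+
  define B where "B = real (Suc m) * C0 + (\<Sum>j\<in>UNIV. C j)"
  have Bj: "C j \<le> B" and B0: "real (Suc m) * C0 \<le> B" "B \<ge> 0" for j
    using member_le_sum[of j UNIV C] C(1) C0(1)
    by (auto simp: B_def less_imp_le intro!: add_nonneg_nonneg sum_nonneg add_increasing)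
  have "norm (Z q i m f p) \<le> B * (norm (f p) + (\<Sum>j\<in>UNIV. norm (d j f p)))" if f: "smooth_fun A f" for f p
  proof -
    have "norm (Z q i m f p) \<le> norm ((real (Suc m) * weight_deriv q i p) *\<^sub>R f p) + norm (\<Sum>j\<in>UNIV. cof (coord_field q i) j p *\<^sub>R d j f p)"
      unfolding Z_def dir_deriv_cof[OF coord_field_smooth[OF q] f] by (rule norm_triangle_ineq)
    also have "norm ((real (Suc m) * weight_deriv q i p) *\<^sub>R f p) \<le> B * norm (f p)"
    proof -
      have "norm ((real (Suc m) * weight_deriv q i p) *\<^sub>R f p) = real (Suc m) * \<bar>weight_deriv q i p\<bar> * norm (f p)"
        by (simp add: abs_mult)
      also have "\<dots> \<le> real (Suc m) * C0 * norm (f p)" using C0(2) by (intro mult_right_mono mult_left_mono) auto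
      also have "\<dots> \<le> B * norm (f p)" using B0(1) by (intro mult_right_mono) auto
      finally show ?thesis .
    qed
    also have "norm (\<Sum>j\<in>UNIV. cof (coord_field q i) j p *\<^sub>R d j f p) \<le> (\<Sum>j\<in>UNIV. B * norm (d j f p))"
    proof (rule sum_norm_le)
      fix j
      have "norm (cof (coord_field q i) j p *\<^sub>R d j f p) \<le> C j * norm (d j f p)"
        using C(2)[of j p] by (simp add: mult_right_mono)
      also have "\<dots> \<le> B * norm (d j f p)" using Bj by (intro mult_right_mono) auto
      finally show "norm (cof (coord_field q i) j p *\<^sub>R d j f p) \<le> B * norm (d j f p)" .
    qed
    finally show ?thesis by (simp add: distrib_left sum_distrib_left)
  qed
  then show ?thesis using B0(2) by blast
qed

text \<open>Arzela--Ascoli in one chart. The square of the weight is used because a derivative takes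
  one factor away and the other must remain as a cutoff.\<close>

lemma weighted_compactness:
  fixes f :: "nat \<Rightarrow> 'a \<Rightarrow> quat"
  assumes q: "q \<in> pou" and f: "\<And>n. smooth_fun A (f n)"
    and bd: "\<And>n p. norm (f n p) \<le> B" "\<And>n i p. norm (d i (f n) p) \<le> B"
  shows "\<exists>r. strict_mono r \<and> uniformly_Cauchy (\<lambda>n p. snd q p ^ 2 *\<^sub>R f (r n) p)"
proof -
  define g where "g n = local_rep (fst q) (\<lambda>p. snd q p ^ Suc 1 *\<^sub>R f n p)" for n
  have B: "B \<ge> 0" using bd(1) norm_ge_zero order_trans by blast
  obtain K where K0: "compact K"
    "\<And>(f :: 'a \<Rightarrow> quat) m x. x \<notin> K \<Longrightarrow> local_rep (fst q) (\<lambda>p. snd q p ^ Suc m *\<^sub>R f p) x = 0"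
    using weight_compact_support[OF q] by blast
  have K: "compact K" "x \<notin> K \<Longrightarrow> g n x = 0" for n x
    using K0(1) K0(2)[of x 1 "f n"] unfolding g_def by blast+
  have sg: "smooth_on UNIV (g n)" for n unfolding g_def by (rule smooth_local_rep_weight[OF q f])
  obtain W where W: "W > 0" "\<And>p. \<bar>snd q p\<bar> \<le> W" using smooth_fun_bounded[OF pou(3)[OF q]] by auto
  define C where "C i = (SOME C. C \<ge> 0 \<and> (\<forall>f p. smooth_fun A f \<longrightarrow> norm (Z q i 1 f p) \<le> C * (norm (f p) + (\<Sum>j\<in>UNIV. norm (d j f p)))))" for i
  have C: "C i \<ge> 0" "\<And>f p. smooth_fun A f \<Longrightarrow> norm (Z q i 1 f p) \<le> C i * (norm (f p) + (\<Sum>j\<in>UNIV. norm (d j f p)))" for i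
    using someI_ex[OF Z_pointwise[OF q, of i 1]] unfolding C_def[symmetric] by blast+
  \<comment> \<open>A bound on the partial derivatives, where \<open>4 * B\<close> accounts for the
    function and its three frame derivatives.\<close>
  define L where "L = W * ((\<Sum>i\<in>UNIV. C i) * (4 * B))"
  have L0: "L \<ge> 0" unfolding L_def using W(1) C(1) B by (intro mult_nonneg_nonneg sum_nonneg) auto
  have pg: "norm (partial_deriv i (g n) x) \<le> L" for i n x
  proof (cases "x \<in> cimage (fst q)")
    case True
    define p where "p = chart_inv (fst q) x"
    have "norm (partial_deriv i (g n) x) = \<bar>snd q p\<bar> * norm (Z q i 1 (f n) p)"
      unfolding g_def partial_local_rep_weight[OF q f] using True by (simp add: local_rep_def p_def)
    also have "\<dots> \<le> W * ((\<Sum>i\<in>UNIV. C i) * (4 * B))"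
    proof (intro mult_mono W(2))
      have "norm (f n p) + (\<Sum>j\<in>UNIV. norm (d j (f n) p)) \<le> B + (\<Sum>j\<in>(UNIV::3 set). B)"
        by (intro add_mono sum_mono bd)
      then have le: "norm (f n p) + (\<Sum>j\<in>UNIV. norm (d j (f n) p)) \<le> 4 * B" by simp
      have "norm (Z q i 1 (f n) p) \<le> C i * (norm (f n p) + (\<Sum>j\<in>UNIV. norm (d j (f n) p)))" by (rule C(2)[OF f])
      also have "\<dots> \<le> (\<Sum>i\<in>UNIV. C i) * (4 * B)"
        using C(1) by (intro mult_mono le member_le_sum sum_nonneg add_nonneg_nonneg) auto
      finally show "norm (Z q i 1 (f n) p) \<le> (\<Sum>i\<in>UNIV. C i) * (4 * B)" .
    qed (use W in auto)
    finally show ?thesis by (simp add: L_def)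
  next
    case False
    then show ?thesis unfolding g_def partial_local_rep_weight[OF q f] using L0 by (simp add: local_rep_def)
  qed
  have lip: "norm (g n x - g n y) \<le> 3 * L * norm (x - y)" for n x y
    by (rule lipschitz_from_partials[OF sg pg])
  have gb: "norm (g n x) \<le> W^2 * B" for n x
  proof (cases "x \<in> cimage (fst q)")
    case True
    have "\<bar>snd q p\<bar>^2 * norm (f n p) \<le> W^2 * B" for p
      using W bd(1) by (intro mult_mono power_mono) auto
    then show ?thesis using True by (simp add: g_def local_rep_def flip: power2_eq_square)
  next
    case False
    then show ?thesis using B by (simp add: g_def local_rep_def)
  qed
  obtain G r where r: "strict_mono (r :: nat \<Rightarrow> nat)" and conv: "\<And>e. 0 < e \<Longrightarrow> \<exists>M. \<forall>n x. n \<ge> M \<and> x \<in> K \<longrightarrow> norm (g (r n) x - G x) < e"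
  proof (rule Arzela_Ascoli[OF K(1), of g "W^2 * B"])
    fix x :: "real^3" and e :: real assume e: "0 < e"
    \<comment> \<open>The summand 1 avoids division by zero and makes the final inequality
      strict.\<close>
    define \<delta> where "\<delta> = e / (3 * L + 1)"
    have pos: "3 * L + 1 > 0" using L0 by simp
    have dpos: "\<delta> > 0" unfolding \<delta>_def using e pos by (rule divide_pos_pos)
    have "norm (g n x - g n y) < e" if "norm (x - y) < \<delta>" for n y
    proof -
      have "norm (g n x - g n y) \<le> 3 * L * norm (x - y)" by (rule lip)
      also have "\<dots> \<le> 3 * L * \<delta>" using that L0 by (intro mult_left_mono) auto
      also have "\<dots> < (3 * L + 1) * \<delta>" using dpos by (simp add: distrib_right)
      also have "\<dots> = e" using pos by (simp add: \<delta>_def)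
      finally show ?thesis .
    qed
    then show "\<exists>d>0. \<forall>n y. y \<in> K \<and> norm (x - y) < d \<longrightarrow> norm (g n x - g n y) < e" using dpos by blast
  qed (use gb in auto)
  have "uniformly_Cauchy (\<lambda>n p. snd q p ^ 2 *\<^sub>R f (r n) p)"
    unfolding uniformly_Cauchy_def
  proof (intro allI impI)
    fix e :: real assume e: "0 < e"
    obtain M where M: "\<And>n x. n \<ge> M \<Longrightarrow> x \<in> K \<Longrightarrow> norm (g (r n) x - G x) < e / 2"
      using conv[of "e / 2"] e by auto
    have gM: "norm (g (r m) x - g (r n) x) < e" if "m \<ge> M" "n \<ge> M" for m n x
    proof (cases "x \<in> K")
      case True
      show ?thesis using norm_diff_triangle_less[OF M[OF that(1) True], of "g (r n) x" "e / 2"] M[OF that(2) True]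
        by (simp add: norm_minus_commute)
    qed (use K(2) e in auto)
    have "norm (snd q p ^ 2 *\<^sub>R f (r m) p - snd q p ^ 2 *\<^sub>R f (r n) p) < e" if "m \<ge> M" "n \<ge> M" for m n p
    proof (cases "p \<in> cdom (fst q)")
      case True
      then show ?thesis using gM[OF that, of "coord (fst q) p"] pou(2)[OF q]
        by (simp add: g_def local_rep_def power2_eq_square)
    next
      case False
      then have "snd q p = 0" using pou(5)[OF q] unfolding supported_in_def by auto
      then show ?thesis using e by simp
    qed
    then show "\<exists>M. \<forall>m\<ge>M. \<forall>n\<ge>M. \<forall>p. norm (snd q p ^ 2 *\<^sub>R f (r m) p - snd q p ^ 2 *\<^sub>R f (r n) p) < e" by blast
  qed
  then show ?thesis using r by blast
qed

text \<open>Subsequences are chosen for one partition member after another; the partition is finite,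
  and \<open>sup_from_weighted\<close> removes the weights.\<close>

lemma compactness:
  fixes f :: "nat \<Rightarrow> 'a \<Rightarrow> quat"
  assumes f: "\<And>n. smooth_fun A (f n)"
    and bd: "\<And>n p. norm (f n p) \<le> B" "\<And>n i p. norm (d i (f n) p) \<le> B"
  shows "\<exists>r. strict_mono r \<and> uniformly_Cauchy (\<lambda>n. f (r n))"
proof -
  have "\<exists>r. strict_mono r \<and> (\<forall>q\<in>Q. uniformly_Cauchy (\<lambda>n p. snd q p ^ 2 *\<^sub>R f (r n) p))" if "finite Q" "Q \<subseteq> pou" for Q
    using that
  proof (induction Q)
    case empty
    show ?case by (intro exI[of _ "\<lambda>n. n"]) (simp add: strict_mono_def)
  next
    case (insert q Q)
    then obtain r where r: "strict_mono r" "\<And>q. q \<in> Q \<Longrightarrow> uniformly_Cauchy (\<lambda>n p. snd q p ^ 2 *\<^sub>R f (r n) p)" by auto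
    obtain s where s: "strict_mono s" "uniformly_Cauchy (\<lambda>n p. snd q p ^ 2 *\<^sub>R f (r (s n)) p)"
      using weighted_compactness[of q "\<lambda>n. f (r n)" B] insert.prems f bd by auto
    have "uniformly_Cauchy (\<lambda>n p. snd q' p ^ 2 *\<^sub>R f (r (s n)) p)" if "q' \<in> Q" for q'
      using uniformly_Cauchy_subseq[OF r(2)[OF that] s(1)] .
    then show ?case using s strict_mono_o[OF r(1) s(1)]
      by (intro exI[of _ "\<lambda>n. r (s n)"]) (auto simp: comp_def)
  qed
  from this[OF pou(1) order_refl] obtain r where r: "strict_mono r"
    "\<And>q. q \<in> pou \<Longrightarrow> uniformly_Cauchy (\<lambda>n p. snd q p ^ 2 *\<^sub>R f (r n) p)" by blast
  define c where "c = real (card (pou :: ('a chart \<times> ('a \<Rightarrow> real)) set))"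
  have "uniformly_Cauchy (\<lambda>n. f (r n))" unfolding uniformly_Cauchy_def
  proof (intro allI impI)
    fix e :: real assume e: "0 < e"
    define e' where "e' = e / (c^2 + 1)"
    have c: "c^2 + 1 > 0" by (simp add: add_nonneg_pos)
    then have e': "e' > 0" using e by (simp add: e'_def)
    define M where "M q = (SOME M. \<forall>m\<ge>M. \<forall>n\<ge>M. \<forall>p. norm (snd q p ^ 2 *\<^sub>R f (r m) p - snd q p ^ 2 *\<^sub>R f (r n) p) < e')"
      for q :: "'a chart \<times> ('a \<Rightarrow> real)"
    have M: "norm (snd q p ^ 2 *\<^sub>R f (r m) p - snd q p ^ 2 *\<^sub>R f (r n) p) < e'" if "q \<in> pou" "m \<ge> M q" "n \<ge> M q" for q m n p
    proof -
      have "\<exists>M. \<forall>m\<ge>M. \<forall>n\<ge>M. \<forall>p. norm (snd q p ^ 2 *\<^sub>R f (r m) p - snd q p ^ 2 *\<^sub>R f (r n) p) < e'"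
        using r(2)[OF that(1)] e' unfolding uniformly_Cauchy_def by blast
      from someI_ex[OF this] show ?thesis using that unfolding M_def by blast
    qed
    define M0 where "M0 = Max (M ` pou)"
    have M0: "M q \<le> M0" if "q \<in> pou" for q using that pou(1) by (simp add: M0_def)
    have "norm (f (r m) p - f (r n) p) < e" if mn: "m \<ge> M0" "n \<ge> M0" for m n p
    proof -
      have "norm (f (r m) p - f (r n) p) \<le> c ^ 2 * e'" unfolding c_def
      proof (rule sup_from_weighted)
        fix q :: "'a chart \<times> ('a \<Rightarrow> real)" assume q: "q \<in> pou"
        show "norm (snd q p ^ 2 *\<^sub>R (f (r m) p - f (r n) p)) \<le> e'"
          using M[OF q, of m n p] M0[OF q] mn by (simp add: scaleR_diff_right less_imp_le)
      qed
      also have "\<dots> < (c^2 + 1) * e'" using e' by (simp add: distrib_right)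
      also have "\<dots> = e" using c by (simp add: e'_def)
      finally show ?thesis .
    qed
    then show "\<exists>M. \<forall>m\<ge>M. \<forall>n\<ge>M. \<forall>p. norm (f (r m) p - f (r n) p) < e" by blast
  qed
  then show ?thesis using r(1) by blast
qed

end

section \<open>The kernel and the spectral gap\<close>

context volume_manifold
begin

text \<open>Only the entries with index below \<open>m\<close> count. The lengths of such families
  inside a space stand in for its dimension.\<close>

definition orthonormal :: "(nat \<Rightarrow> 'a \<Rightarrow> quat) \<Rightarrow> nat \<Rightarrow> bool" where
  "orthonormal e m \<longleftrightarrow> (\<forall>i<m. \<forall>j<m. ip (e i) (e j) = (if i = j then 1 else 0))"

lemma ip_lincomb_left:
  "(\<And>i. i < m \<Longrightarrow> cont (e i)) \<Longrightarrow> cont g \<Longrightarrow> ip (\<lambda>p. \<Sum>i<m. c i *\<^sub>R e i p) g = (\<Sum>i<m. c i * ip (e i) g)"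
  by (subst ip_sum_left) (auto intro!: continuous_on_scaleR simp: ip_scale_left)

lemma ip_lincomb_right:
  "(\<And>i. i < m \<Longrightarrow> cont (e i)) \<Longrightarrow> cont g \<Longrightarrow> ip g (\<lambda>p. \<Sum>i<m. c i *\<^sub>R e i p) = (\<Sum>i<m. c i * ip g (e i))"
  using ip_lincomb_left[of m e g c] by (simp add: ip_commute[of g])

lemma cont_lincomb: "(\<And>i. i < m \<Longrightarrow> cont (e i)) \<Longrightarrow> cont (\<lambda>p. \<Sum>i<m. c i *\<^sub>R (e i p :: quat))"
  by (intro continuous_on_sum continuous_on_scaleR continuous_on_const) auto

lemma orthonormal_coeff:
  assumes "orthonormal e m" "\<And>i. i < m \<Longrightarrow> cont (e i)" "j < m"
  shows "ip (\<lambda>p. \<Sum>i<m. c i *\<^sub>R e i p) (e j) = c j"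
proof -
  have "ip (\<lambda>p. \<Sum>i<m. c i *\<^sub>R e i p) (e j) = (\<Sum>i<m. c i * ip (e i) (e j))"
    by (rule ip_lincomb_left) (use assms in auto)
  also have "\<dots> = (\<Sum>i<m. if i = j then c i else 0)"
    using assms(1,3) by (intro sum.cong) (auto simp: orthonormal_def)
  also have "\<dots> = c j" using assms(3) by simp
  finally show ?thesis .
qed

lemma nrm_sq_lincomb:
  assumes "orthonormal e m" "\<And>i. i < m \<Longrightarrow> cont (e i)"
  shows "nrm (\<lambda>p. \<Sum>i<m. c i *\<^sub>R e i p) ^ 2 = (\<Sum>i<m. c i ^ 2)"
proof -
  have "nrm (\<lambda>p. \<Sum>i<m. c i *\<^sub>R e i p) ^ 2 = (\<Sum>j<m. c j * ip (\<lambda>p. \<Sum>i<m. c i *\<^sub>R e i p) (e j))"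
    unfolding nrm_sq by (rule ip_lincomb_right) (use assms cont_lincomb in auto)
  also have "\<dots> = (\<Sum>i<m. c i ^ 2)"
    by (intro sum.cong refl) (simp add: orthonormal_coeff[OF assms] power2_eq_square)
  finally show ?thesis .
qed

text \<open>Pythagoras for the projection to the span of \<open>e\<close>. It is used in both
  directions between two kernels.\<close>

lemma nrm_sq_diff_proj:
  assumes "orthonormal e m" "\<And>i. i < m \<Longrightarrow> cont (e i)" "cont g"
  shows "nrm (\<lambda>p. g p - (\<Sum>i<m. ip g (e i) *\<^sub>R e i p)) ^ 2 = nrm g ^ 2 - (\<Sum>i<m. ip g (e i) ^ 2)"
proof -
  define h where "h = (\<lambda>p. \<Sum>i<m. ip g (e i) *\<^sub>R e i p)"
  have ch: "cont h" unfolding h_def by (rule cont_lincomb[OF assms(2)])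
  have gh: "ip g h = (\<Sum>i<m. ip g (e i) ^ 2)"
    unfolding h_def by (subst ip_lincomb_right) (use assms in \<open>auto simp: power2_eq_square\<close>)
  have hh: "ip h h = (\<Sum>i<m. ip g (e i) ^ 2)"
    using nrm_sq_lincomb[OF assms(1,2), of "\<lambda>i. ip g (e i)"] by (simp add: h_def nrm_sq)
  have "nrm (\<lambda>p. g p - h p) ^ 2 = ip g g - ip g h - ip h g + ip h h"
    unfolding nrm_sq using assms(3) ch by (simp add: ip_diff_left ip_diff_right continuous_on_diff)
  then have "nrm (\<lambda>p. g p - h p) ^ 2 = nrm g ^ 2 - (\<Sum>i<m. ip g (e i) ^ 2)"
    using gh hh ip_commute[of h g] nrm_sq[of g] by linarith
  then show ?thesis by (simp only: h_def)
qed

end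

context frame
begin

text \<open>Cramer's rule for the coordinate axes in terms of the frame. It is formed in the chart,
  as coordinate fields are not global.\<close>

definition frame_coeff :: "'a chart \<Rightarrow> 3 \<Rightarrow> 3 \<Rightarrow> real^3 \<Rightarrow> real" where
  "frame_coeff c l j x = det3 (if j = 1 then axis l 1 else v 1 c (chart_inv c x))
     (if j = 2 then axis l 1 else v 2 c (chart_inv c x)) (if j = 3 then axis l 1 else v 3 c (chart_inv c x))
     * inverse (det3 (v 1 c (chart_inv c x)) (v 2 c (chart_inv c x)) (v 3 c (chart_inv c x)))"

lemma det3_frame_pos:
  assumes "c \<in> A" "x \<in> cimage c"
  shows "det3 (v 1 c (chart_inv c x)) (v 2 c (chart_inv c x)) (v 3 c (chart_inv c x)) > 0"
proof -
  have p: "chart_inv c x \<in> cdom c" using assms by simp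
  show ?thesis using v_pos[OF assms(1) p] rho_pos[OF assms(1) p] dvol_rho[OF assms(1) p]
    by (simp add: zero_less_mult_iff)
qed

lemma smooth_frame_coeff:
  assumes c: "c \<in> A" shows "smooth_on (cimage c) (frame_coeff c l j)"
proof -
  have s: "smooth_on (cimage c) (\<lambda>x. (if b then axis l 1 else v i c (chart_inv c x)) $ k)" for b i k
    using smooth_on_nth[OF open_cimage[OF c] vfield_smooth[OF v_smooth c]] by (cases b) auto
  have s': "smooth_on (cimage c) (\<lambda>x. v i c (chart_inv c x) $ k)" for i k
    using smooth_on_nth[OF open_cimage[OF c] vfield_smooth[OF v_smooth c]] by auto
  have det: "smooth_on (cimage c) (\<lambda>x. det3 (v 1 c (chart_inv c x)) (v 2 c (chart_inv c x)) (v 3 c (chart_inv c x)))"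
    unfolding det3_def by (intro smooth_on_mult smooth_on_add smooth_on_diff open_cimage c s')
  have num: "smooth_on (cimage c) (\<lambda>x. det3 (if j = 1 then axis l 1 else v 1 c (chart_inv c x))
     (if j = 2 then axis l 1 else v 2 c (chart_inv c x)) (if j = 3 then axis l 1 else v 3 c (chart_inv c x)))"
    unfolding det3_def by (intro smooth_on_mult smooth_on_add smooth_on_diff open_cimage c s)
  show ?thesis unfolding frame_coeff_def[abs_def]
    using det3_frame_pos[OF c] by (intro smooth_on_mult smooth_on_inverse open_cimage c num det) force
qed

lemma axis_frame:
  assumes "c \<in> A" "x \<in> cimage c"
  shows "axis l 1 = (\<Sum>j\<in>UNIV. frame_coeff c l j x *\<^sub>R v j c (chart_inv c x))"
proof -
  define D where "D = det3 (v 1 c (chart_inv c x)) (v 2 c (chart_inv c x)) (v 3 c (chart_inv c x))"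
  have D: "D > 0" using det3_frame_pos[OF assms] by (simp add: D_def)
  have "axis l 1 = inverse D *\<^sub>R (D *\<^sub>R axis l 1)" using D by simp
  also have "\<dots> = (\<Sum>j\<in>UNIV. frame_coeff c l j x *\<^sub>R v j c (chart_inv c x))"
    unfolding D_def det3_Cramer[of _ _ _ "axis l 1"]
    by (simp add: sum_3 frame_coeff_def scaleR_add_right mult.commute)
  finally show ?thesis .
qed

lemma partial_frame:
  assumes c: "c \<in> A" and x: "x \<in> cimage c" and f: "smooth_fun A f"
  shows "partial_deriv l (f \<circ> chart_inv c) x = (\<Sum>j\<in>UNIV. frame_coeff c l j x *\<^sub>R d j f (chart_inv c x))"
proof -
  have p: "chart_inv c x \<in> cdom c" "coord c (chart_inv c x) = x" using c x by auto
  have lin: "linear (frechet_derivative (f \<circ> chart_inv c) (at x))"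
    using linear_frechet_derivative[OF differentiable_chart[OF f c p(1)]] p(2) by simp
  have "partial_deriv l (f \<circ> chart_inv c) x = frechet_derivative (f \<circ> chart_inv c) (at x) (\<Sum>j\<in>UNIV. frame_coeff c l j x *\<^sub>R v j c (chart_inv c x))"
    unfolding partial_deriv_def axis_frame[OF c x] ..
  then show ?thesis
    using dir_deriv_chart[OF v_smooth f c p(1)] p(2) by (simp add: linear_sum[OF lin] linear_scale[OF lin])
qed

text \<open>The limits \<open>F is\<close> of all iterated frame derivatives form a family that is
  closed under partial derivatives up to smooth coefficients. So differentiability of every member
  already gives smoothness of each.\<close>

lemma smooth_limit:
  fixes f :: "nat \<Rightarrow> 'a \<Rightarrow> quat"
  assumes f: "\<And>n. smooth_fun A (f n)" and UC: "\<And>is. uniformly_Cauchy (\<lambda>n. dI is (f n))"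
  shows "\<exists>g. smooth_fun A g \<and> (\<forall>e>0. \<exists>M. \<forall>n\<ge>M. \<forall>p. norm (f n p - g p) < e) \<and>
    (\<forall>i p. (\<lambda>n. d i (f n) p) \<longlonglongrightarrow> d i g p)"
proof -
  have "\<exists>F. \<forall>e>0. \<exists>M. \<forall>n\<ge>M. \<forall>p. norm (dI is (f n) p - F p) < e" for "is"
  proof -
    have "\<forall>e>0. \<exists>M. \<forall>m n p. M \<le> m \<and> M \<le> n \<and> True \<longrightarrow> dist (dI is (f m) p) (dI is (f n) p) < e"
    proof (intro allI impI)
      fix e :: real assume "e > 0"
      then obtain M where M: "\<And>m n p. m \<ge> M \<Longrightarrow> n \<ge> M \<Longrightarrow> norm (dI is (f m) p - dI is (f n) p) < e"
        using UC[of "is"] unfolding uniformly_Cauchy_def by blast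
      then show "\<exists>M. \<forall>m n p. M \<le> m \<and> M \<le> n \<and> True \<longrightarrow> dist (dI is (f m) p) (dI is (f n) p) < e"
        unfolding dist_norm by (intro exI[of _ M]) auto
    qed
    then have "\<exists>F. \<forall>e>0. \<exists>M. \<forall>n p. M \<le> n \<and> True \<longrightarrow> dist (dI is (f n) p) (F p) < e"
      unfolding uniformly_convergent_eq_cauchy .
    then show ?thesis unfolding dist_norm by simp
  qed
  then have "\<forall>is. \<exists>F. \<forall>e>0. \<exists>M. \<forall>n\<ge>M. \<forall>p. norm (dI is (f n) p - F p) < e" by blast
  from choice[OF this] obtain F where U: "\<And>is e. e > 0 \<Longrightarrow> \<exists>M. \<forall>n\<ge>M. \<forall>p. norm (dI is (f n) p - F is p) < e" by blast
  have L: "(\<lambda>n. dI is (f n) p) \<longlonglongrightarrow> F is p" for "is" p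
  proof (rule LIMSEQ_I)
    fix e :: real assume "e > 0"
    then show "\<exists>M. \<forall>n\<ge>M. norm (dI is (f n) p - F is p) < e" using U[of e "is"] by blast
  qed
  \<comment> \<open>The candidate derivative of \<open>F is\<close>: the limit of the derivatives of
    the sequence, rewritten in frame derivatives.\<close>
  define G where "G c is x h = (\<Sum>l\<in>UNIV. h $ l *\<^sub>R (\<Sum>j\<in>UNIV. frame_coeff c l j x *\<^sub>R F (j # is) (chart_inv c x)))"
    for c "is" x and h :: "real^3"
  have D: "((F is \<circ> chart_inv c) has_derivative G c is x) (at x)" if c: "c \<in> A" and x: "x \<in> cimage c" for c "is" x
  proof -
    obtain r where r: "r > 0" "cball x r \<subseteq> cimage c" using open_cimage[OF c] x open_contains_cball by blast
    define B where "B l j = (SOME B. B > 0 \<and> (\<forall>y\<in>cball x r. norm (frame_coeff c l j y) \<le> B))" for l j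
    have B: "B l j > 0" "\<And>y. y \<in> cball x r \<Longrightarrow> \<bar>frame_coeff c l j y\<bar> \<le> B l j" for l j
    proof -
      have "bounded (frame_coeff c l j ` cball x r)"
        by (intro compact_imp_bounded compact_continuous_image compact_cball
          continuous_on_subset[OF smooth_on_continuous[OF smooth_frame_coeff[OF c]] r(2)])
      then have "\<exists>B>0. \<forall>y\<in>cball x r. norm (frame_coeff c l j y) \<le> B" unfolding bounded_pos by auto
      from someI_ex[OF this]
      show "B l j > 0" "\<And>y. y \<in> cball x r \<Longrightarrow> \<bar>frame_coeff c l j y\<bar> \<le> B l j" unfolding B_def[symmetric] by auto
    qed
    \<comment> \<open>Bounds the coefficients on a closed ball; it converts uniform convergence of
      frame derivatives into uniform convergence of coordinate derivatives.\<close>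
    define BB where "BB = (\<Sum>l\<in>UNIV. \<Sum>j\<in>UNIV. B l j)"
    have BB: "BB > 0" unfolding BB_def using B(1) by (intro sum_pos) auto
    define f' where "f' n y h = (\<Sum>l\<in>UNIV. h $ l *\<^sub>R (\<Sum>j\<in>UNIV. frame_coeff c l j y *\<^sub>R dI (j # is) (f n) (chart_inv c y)))"
      for n y and h :: "real^3"
    have "\<exists>g. \<forall>y\<in>ball x r. (\<lambda>n. (dI is (f n) \<circ> chart_inv c) y) \<longlonglongrightarrow> g y \<and> (g has_derivative G c is y) (at y within ball x r)"
    proof (rule has_derivative_sequence[OF convex_ball])
      fix n y assume y: "y \<in> ball x r"
      then have yc: "y \<in> cimage c" using r(2) by (auto simp: subset_iff)
      have "(dI is (f n) \<circ> chart_inv c) differentiable at y"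
        using smooth_on_differentiable[OF smooth_fun_chart[OF smooth_dI[OF f] c] yc] .
      from has_derivative_partial[OF this]
      have "((dI is (f n) \<circ> chart_inv c) has_derivative f' n y) (at y)"
        unfolding f'_def[abs_def] by (simp only: partial_frame[OF c yc smooth_dI[OF f]] dI.simps)
      then show "((dI is (f n) \<circ> chart_inv c) has_derivative f' n y) (at y within ball x r)"
        by (rule has_derivative_at_withinI)
    next
      fix e :: real assume e: "e > 0"
      have e': "e / BB > 0" using e BB by simp
      define M where "M j = (SOME M. \<forall>n\<ge>M. \<forall>p. norm (dI (j # is) (f n) p - F (j # is) p) < e / BB)" for j
      have M: "norm (dI (j # is) (f n) p - F (j # is) p) < e / BB" if "n \<ge> M j" for n j p
        using someI_ex[OF U[OF e', of "j # is"]] that unfolding M_def[symmetric] by blast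
      have "norm (f' n y h - G c is y h) \<le> e * norm h" if n: "n \<ge> M 1 + M 2 + M 3" and y: "y \<in> ball x r" for n y h
      proof -
        have nj: "n \<ge> M j" for j using n exhaust_3[of j] by auto
        have "norm (f' n y h - G c is y h) = norm (\<Sum>l\<in>UNIV. h $ l *\<^sub>R (\<Sum>j\<in>UNIV. frame_coeff c l j y *\<^sub>R
            (dI (j # is) (f n) (chart_inv c y) - F (j # is) (chart_inv c y))))"
          unfolding f'_def G_def by (simp add: scaleR_diff_right sum_subtractf)
        also have "\<dots> \<le> (\<Sum>l\<in>UNIV. norm h * (\<Sum>j\<in>UNIV. B l j * (e / BB)))"
        proof (rule sum_norm_le)
          fix l
          have "norm (\<Sum>j\<in>UNIV. frame_coeff c l j y *\<^sub>R (dI (j # is) (f n) (chart_inv c y) - F (j # is) (chart_inv c y)))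
             \<le> (\<Sum>j\<in>UNIV. B l j * (e / BB))"
          proof (rule sum_norm_le)
            fix j
            have "\<bar>frame_coeff c l j y\<bar> * norm (dI (j # is) (f n) (chart_inv c y) - F (j # is) (chart_inv c y)) \<le> B l j * (e / BB)"
              using B(2)[of y l j] y M[OF nj] by (intro mult_mono less_imp_le[OF M[OF nj]]) (auto intro: less_imp_le[OF B(1)])
            then show "norm (frame_coeff c l j y *\<^sub>R (dI (j # is) (f n) (chart_inv c y) - F (j # is) (chart_inv c y))) \<le> B l j * (e / BB)"
              by (simp only: norm_scaleR)
          qed
          then show "norm (h $ l *\<^sub>R (\<Sum>j\<in>UNIV. frame_coeff c l j y *\<^sub>R (dI (j # is) (f n) (chart_inv c y) - F (j # is) (chart_inv c y))))
             \<le> norm h * (\<Sum>j\<in>UNIV. B l j * (e / BB))"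
            unfolding norm_scaleR using component_le_norm_cart[of h l] by (intro mult_mono) auto
        qed
        also have "\<dots> = norm h * (BB * (e / BB))"
          by (simp only: BB_def sum_distrib_left[symmetric] sum_distrib_right[symmetric])
        also have "\<dots> = e * norm h" using BB by simp
        finally show ?thesis .
      qed
      then show "\<forall>\<^sub>F n in sequentially. \<forall>y\<in>ball x r. \<forall>h. norm (f' n y h - G c is y h) \<le> e * norm h"
        unfolding eventually_sequentially by blast
    next
      show "x \<in> ball x r" using r by simp
      show "(\<lambda>n. (dI is (f n) \<circ> chart_inv c) x) \<longlonglongrightarrow> F is (chart_inv c x)" using L by simp
    qed
    then obtain g where g: "\<And>y. y \<in> ball x r \<Longrightarrow> (\<lambda>n. (dI is (f n) \<circ> chart_inv c) y) \<longlonglongrightarrow> g y"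
      "\<And>y. y \<in> ball x r \<Longrightarrow> (g has_derivative G c is y) (at y within ball x r)" by blast
    have gF: "g y = (F is \<circ> chart_inv c) y" if "y \<in> ball x r" for y
      using LIMSEQ_unique[OF g(1)[OF that]] L by simp
    have xb: "x \<in> ball x r" using r(1) by simp
    have "(g has_derivative G c is x) (at x)"
      using g(2)[OF xb] unfolding at_within_open[OF xb open_ball] .
    then show ?thesis by (rule has_derivative_transform_within_open[OF _ open_ball xb gF])
  qed
  have pF: "partial_deriv l (F is \<circ> chart_inv c) x = (\<Sum>j\<in>UNIV. frame_coeff c l j x *\<^sub>R (F (j # is) \<circ> chart_inv c) x)"
    if "c \<in> A" "x \<in> cimage c" for c x l "is"
    unfolding partial_deriv_eq[OF D[OF that]] G_def by (simp add: axis_def if_distrib[of "\<lambda>t. t *\<^sub>R _"] cong: if_cong)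
  \<comment> \<open>The induction varies the list: a partial derivative of \<open>F is\<close> is a
    combination of the \<open>F (j # is)\<close>.\<close>
  have nd: "ndiff k (cimage c) (F is \<circ> chart_inv c)" if c: "c \<in> A" for k c "is"
  proof (induction k arbitrary: "is")
    case (Suc k)
    have "ndiff k (cimage c) (partial_deriv l (F is \<circ> chart_inv c))" for l
    proof (rule ndiff_cong_imp[OF open_cimage[OF c]])
      show "ndiff k (cimage c) (\<lambda>x. \<Sum>j\<in>UNIV. frame_coeff c l j x *\<^sub>R (F (j # is) \<circ> chart_inv c) x)"
        using smooth_frame_coeff[OF c] Suc.IH unfolding smooth_on_iff_ndiff
        by (intro ndiff_sum open_cimage c ndiff_bilinear[OF open_cimage[OF c] bounded_bilinear_scaleR]) blast+
    qed (simp only: pF[OF c])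
    moreover have "(F is \<circ> chart_inv c) differentiable at x" if "x \<in> cimage c" for x
      using differentiableI[OF D[OF c that]] .
    ultimately show ?case unfolding ndiff.simps by blast
  qed simp
  have sF: "smooth_fun A (F [])" unfolding smooth_fun_def smooth_on_iff_ndiff using nd by blast
  have "(\<lambda>n. d i (f n) p) \<longlonglongrightarrow> d i (F []) p" for i p
  proof -
    obtain c where c: "c \<in> A" "p \<in> cdom c" using charts_cover by blast
    define x where "x = coord c p"
    have x: "x \<in> cimage c" "chart_inv c x = p" using c by (auto simp: x_def)
    have "d i (F []) p = (\<Sum>l\<in>UNIV. v i c p $ l *\<^sub>R (\<Sum>j\<in>UNIV. frame_coeff c l j x *\<^sub>R F [j] p))"
      using dir_deriv_partial[OF v_smooth sF c] pF[OF c(1) x(1)] x by (simp add: x_def)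
    moreover have "d i (f n) p = (\<Sum>l\<in>UNIV. v i c p $ l *\<^sub>R (\<Sum>j\<in>UNIV. frame_coeff c l j x *\<^sub>R dI [j] (f n) p))" for n
      unfolding dir_deriv_partial[OF v_smooth[of i] f[of n] c] x_def[symmetric]
      by (simp only: partial_frame[OF c(1) x(1) f] x(2) dI.simps)
    moreover have "(\<lambda>n. \<Sum>l\<in>UNIV. v i c p $ l *\<^sub>R (\<Sum>j\<in>UNIV. frame_coeff c l j x *\<^sub>R dI [j] (f n) p))
      \<longlonglongrightarrow> (\<Sum>l\<in>UNIV. v i c p $ l *\<^sub>R (\<Sum>j\<in>UNIV. frame_coeff c l j x *\<^sub>R F [j] p))"
      by (intro tendsto_sum tendsto_scaleR tendsto_const L)
    ultimately show ?thesis by simp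
  qed
  moreover have "\<forall>e>0. \<exists>M. \<forall>n\<ge>M. \<forall>p. norm (f n p - F [] p) < e" using U[of _ "[]"] by simp
  ultimately show ?thesis using sF by blast
qed

section \<open>The kernel and the estimate on its orthogonal complement\<close>

definition ker :: "('a \<Rightarrow> quat) set" where
  "ker = {f. smooth_fun A f \<and> (\<forall>p. dirac f p = 0)}"

lemma ker_smooth: "f \<in> ker \<Longrightarrow> smooth_fun A f" and ker_dirac: "f \<in> ker \<Longrightarrow> dirac f = (\<lambda>p. 0)"
  by (auto simp: ker_def)

lemma ker_lincomb:
  fixes m :: nat
  assumes "\<And>i. i < m \<Longrightarrow> e i \<in> ker" shows "(\<lambda>p. \<Sum>i<m. c i *\<^sub>R e i p) \<in> ker"
  using assms
proof (induction m)
  case 0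
  then show ?case using dirac_const by (auto simp: ker_def)
next
  case (Suc m)
  then have IH: "smooth_fun A (\<lambda>p. \<Sum>i<m. c i *\<^sub>R e i p)" "dirac (\<lambda>p. \<Sum>i<m. c i *\<^sub>R e i p) = (\<lambda>p. 0)"
    and e: "smooth_fun A (e m)" "dirac (e m) = (\<lambda>p. 0)" by (auto simp: ker_def fun_eq_iff)
  have s: "smooth_fun A (\<lambda>p. c m *\<^sub>R e m p)" by (intro smooth_fun_scaleR smooth_fun_const e)
  show ?case unfolding ker_def sum.lessThan_Suc
    using smooth_fun_add[OF IH(1) s] dirac_add[OF IH(1) s] dirac_scale[OF e(1)] IH(2) e(2) by simp
qed

text \<open>On the kernel the elliptic estimate has no \<open>dirac\<close> term, so the norm of
  order 3, and with it the supremum, is controlled by the plain norm.\<close>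

lemma ker_sup: "\<exists>C\<ge>0. \<forall>f\<in>ker. \<forall>p. norm (f p) \<le> C * nrm f"
proof -
  obtain C where C: "C \<ge> 0" "\<And>f p. smooth_fun A f \<Longrightarrow> norm (f p) \<le> C * N 3 f" using Sobolev by blast
  obtain E where E: "E \<ge> 0" "\<And>f. smooth_fun A f \<Longrightarrow> N (Suc 2) f \<le> E * (N 2 (dirac f) + nrm f)" using elliptic by blast
  have "norm (f p) \<le> C * E * nrm f" if f: "f \<in> ker" for f p
  proof -
    have "N 3 f \<le> E * nrm f" using E(2)[OF ker_smooth[OF f]] ker_dirac[OF f] N_zero[of 2]
      by (simp add: numeral_3_eq_3 numeral_2_eq_2)
    then show ?thesis using C(2)[OF ker_smooth[OF f], of p] mult_left_mono[OF _ C(1)] by (metis mult.assoc order_trans)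
  qed
  then show ?thesis using C(1) E(1) by (intro exI[of _ "C * E"]) auto
qed

text \<open>The dimension is bounded by a trace: testing the sup bound against the combination with
  coefficients \<open>e j p $ l\<close> bounds the sum of the squares of the \<open>e j\<close> at \<open>p\<close>.\<close>

lemma ker_finite_dim:
  "\<exists>B :: nat. \<forall>m e. (\<forall>i<m. e i \<in> ker) \<longrightarrow> orthonormal e m \<longrightarrow> m \<le> B"
proof -
  obtain C where C: "C \<ge> 0" "\<And>f p. f \<in> ker \<Longrightarrow> norm (f p) \<le> C * nrm f" using ker_sup by blast
  have "real m \<le> 4 * C^2 * vint (\<lambda>p. 1)" if ek: "\<And>i. i < m \<Longrightarrow> e i \<in> ker" and on: "orthonormal e m" for m e
  proof -
    have ce: "cont (e i)" if "i < m" for i using smooth_fun_continuous[OF ker_smooth[OF ek[OF that]]] .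
    have comp: "(\<Sum>j<m. (e j p $ l)^2) \<le> C^2" for p l
    proof -
      define s where "s = (\<Sum>j<m. (e j p $ l)^2)"
      define f where "f = (\<lambda>y. \<Sum>j<m. (e j p $ l) *\<^sub>R e j y)"
      have s0: "s \<ge> 0" by (simp add: s_def sum_nonneg)
      have fk: "f \<in> ker" unfolding f_def by (rule ker_lincomb[OF ek])
      have "nrm f ^ 2 = s" unfolding f_def s_def by (rule nrm_sq_lincomb[OF on ce])
      then have nf: "nrm f = sqrt s" by (metis nrm_nonneg real_sqrt_unique)
      have "s = f p $ l" by (simp add: f_def s_def power2_eq_square)
      also have "\<dots> \<le> norm (f p)" using component_le_norm_cart[of "f p" l] by simp
      also have "\<dots> \<le> C * sqrt s" using C(2)[OF fk, of p] nf by simp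
      finally have "s \<le> C * sqrt s" .
      then have "sqrt s * sqrt s \<le> C * sqrt s" using s0 by simp
      then have "sqrt s \<le> C" using C(1) s0
        by (cases "s = 0") (auto simp only: mult_le_cancel_right real_sqrt_gt_zero real_sqrt_zero less_le real_sqrt_eq_zero_cancel_iff)
      then have "sqrt s ^ 2 \<le> C^2" using s0 by (intro power_mono) auto
      then show ?thesis using s0 by (simp add: s_def)
    qed
    have pw: "(\<Sum>j<m. e j p \<bullet> e j p) \<le> 4 * C^2" for p
    proof -
      \<comment> \<open>The factor 4 is the number of real components of a quaternion.\<close>
      have "(\<Sum>j<m. e j p \<bullet> e j p) = (\<Sum>l\<in>UNIV. \<Sum>j<m. (e j p $ l)^2)"
        by (subst sum.swap) (simp add: inner_vec_def power2_eq_square)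
      also have "\<dots> \<le> (\<Sum>l\<in>(UNIV::4 set). C^2)" by (intro sum_mono comp)
      finally show ?thesis by simp
    qed
    have "real m = (\<Sum>j<m. ip (e j) (e j))" using on by (simp add: orthonormal_def)
    also have "\<dots> = vint (\<lambda>p. \<Sum>j<m. e j p \<bullet> e j p)"
      unfolding ip_def by (rule vint_sum[symmetric]) (use ce in \<open>auto intro!: continuous_on_inner\<close>)
    also have "\<dots> \<le> vint (\<lambda>p. (4 * C^2) * 1)"
      by (rule vint_mono) (use ce pw in \<open>auto intro!: continuous_on_inner continuous_on_sum continuous_on_const\<close>)
    also have "\<dots> = 4 * C^2 * vint (\<lambda>p. 1)" by (rule vint_cmult)
    finally show ?thesis .
  qed
  then have "m \<le> nat \<lceil>4 * C^2 * vint (\<lambda>p. 1)\<rceil>" if "\<And>i. i < m \<Longrightarrow> e i \<in> ker" "orthonormal e m" for m e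
    using that real_nat_ceiling_ge[of "4 * C^2 * vint (\<lambda>p. 1)"] by (meson of_nat_le_iff order_trans)
  then show ?thesis by blast
qed

text \<open>A sequence violating the estimate more and more, with more and more derivatives, is bounded in
  every Sobolev norm, so no regularity theory for weak solutions is needed to pass to the limit.\<close>

lemma spectral_gap:
  "\<exists>k. \<exists>C\<ge>0. \<forall>f. smooth_fun A f \<longrightarrow> (\<forall>g\<in>ker. ip f g = 0) \<longrightarrow> nrm f \<le> C * N k (dirac f)"
proof (rule ccontr)
  assume neg: "\<not> ?thesis"
  \<comment> \<open>Order \<open>n\<close> and constant \<open>Suc n\<close> are violated by the
    same function, so both grow along the sequence.\<close>
  have "\<exists>g. smooth_fun A g \<and> (\<forall>h\<in>ker. ip g h = 0) \<and> nrm g = 1 \<and> N n (dirac g) < 1 / real (Suc n)" for n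
  proof -
    have "\<not> (\<forall>f. smooth_fun A f \<longrightarrow> (\<forall>g\<in>ker. ip f g = 0) \<longrightarrow> nrm f \<le> real (Suc n) * N n (dirac f))"
      using neg of_nat_0_le_iff[of "Suc n"] by blast
    then obtain f where f: "smooth_fun A f" "\<And>g. g \<in> ker \<Longrightarrow> ip f g = 0" "real (Suc n) * N n (dirac f) < nrm f"
      unfolding not_all not_imp not_le by blast
    have "0 \<le> real (Suc n) * N n (dirac f)" by simp
    then have pos: "nrm f > 0" using f(3) by linarith
    define g where "g = (\<lambda>p. inverse (nrm f) *\<^sub>R f p)"
    have g: "smooth_fun A g" unfolding g_def by (intro smooth_fun_scaleR smooth_fun_const f)
    have "nrm g = 1" unfolding g_def nrm_scale using pos by simp
    moreover have "ip g h = 0" if "h \<in> ker" for h unfolding g_def ip_scale_left using f(2)[OF that] by simp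
    moreover have "N n (dirac g) < 1 / real (Suc n)"
    proof -
      have "N n (dirac g) \<le> inverse (nrm f) * N n (dirac f)"
        unfolding g_def dirac_scale[OF f(1)] using N_scale[OF smooth_dirac[OF f(1)], of n "inverse (nrm f)"] by simp
      also have "\<dots> < 1 / real (Suc n)" using f(3) pos by (simp add: field_simps)
      finally show ?thesis .
    qed
    ultimately show ?thesis using g by blast
  qed
  then have "\<forall>n. \<exists>g. smooth_fun A g \<and> (\<forall>h\<in>ker. ip g h = 0) \<and> nrm g = 1 \<and> N n (dirac g) < 1 / real (Suc n)" by blast
  from choice[OF this] obtain g0 where g0: "\<And>n. smooth_fun A (g0 n)" "\<And>n h. h \<in> ker \<Longrightarrow> ip (g0 n) h = 0"
    "\<And>n. nrm (g0 n) = 1" "\<And>n. N n (dirac (g0 n)) < 1 / real (Suc n)" by blast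
  \<comment> \<open>The shift makes the norm of order 3 of \<open>dirac (g n)\<close> small from the
    first member on, as the uniform bounds below require.\<close>
  define g where "g n = g0 (n + 3)" for n
  have g: "smooth_fun A (g n)" "\<And>h. h \<in> ker \<Longrightarrow> ip (g n) h = 0" "nrm (g n) = 1" for n
    using g0 by (auto simp: g_def)
  have gN: "N k (dirac (g n)) \<le> 1 / real (Suc n)" if "k \<le> n + 3" for k n
  proof -
    have "N k (dirac (g n)) \<le> N (n + 3) (dirac (g n))" by (rule N_mono[OF that])
    also have "\<dots> \<le> 1 / real (Suc (n + 3))" using g0(4)[of "n + 3"] by (simp add: g_def)
    also have "\<dots> \<le> 1 / real (Suc n)" by (simp add: field_simps)
    finally show ?thesis .
  qed
  obtain E where E: "\<And>k. E k \<ge> 0" "\<And>k f. smooth_fun A f \<Longrightarrow> N (Suc k) f \<le> E k * (N k (dirac f) + nrm f)"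
  proof -
    have "\<forall>k. \<exists>C\<ge>0. \<forall>f. smooth_fun A f \<longrightarrow> N (Suc k) f \<le> C * (N k (dirac f) + nrm f)" using elliptic by blast
    from choice[OF this] show ?thesis using that by blast
  qed
  have N4: "N 4 (g n) \<le> E 3 * 2" for n
  proof -
    have "N (Suc 3) (g n) \<le> E 3 * (N 3 (dirac (g n)) + nrm (g n))" by (rule E(2)[OF g(1)])
    also have "\<dots> \<le> E 3 * 2"
    proof (rule mult_left_mono[OF _ E(1)])
      have "N 3 (dirac (g n)) \<le> 1 / real (Suc n)" by (rule gN) simp
      also have "\<dots> \<le> 1" by simp
      finally show "N 3 (dirac (g n)) + nrm (g n) \<le> 2" using g(3) by simp
    qed
    finally show ?thesis by (simp add: eval_nat_numeral)
  qed
  obtain C where C: "C \<ge> 0" "\<And>f p. smooth_fun A f \<Longrightarrow> norm (f p) \<le> C * N 3 f" using Sobolev by blast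
  have b1: "norm (g n p) \<le> C * (E 3 * 2)" for n p
  proof -
    have "N 3 (g n) \<le> N 4 (g n)" by (rule N_mono) simp
    then show ?thesis using C(2)[OF g(1), of n p] mult_left_mono[OF _ C(1)] N4[of n] by (meson order_trans)
  qed
  have b2: "norm (d i (g n) p) \<le> C * (E 3 * 2)" for n i p
  proof -
    have "N 3 (d i (g n)) \<le> N (Suc 3) (g n)" by (rule N_d)
    also have "\<dots> = N 4 (g n)" by (simp add: eval_nat_numeral)
    finally show ?thesis using C(2)[OF smooth_d[OF g(1)], of i n p] mult_left_mono[OF _ C(1)] N4[of n] by (meson order_trans)
  qed
  have "\<exists>r. strict_mono r \<and> uniformly_Cauchy (\<lambda>n. g (r n))" by (rule compactness) (rule g b1 b2)+
  then obtain r where r: "strict_mono r" "uniformly_Cauchy (\<lambda>n. g (r n))" by (elim exE conjE)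
  define h where "h n = g (r n)" for n
  have h: "smooth_fun A (h n)" "\<And>k. k \<in> ker \<Longrightarrow> ip (h n) k = 0" "nrm (h n) = 1" for n using g by (auto simp: h_def)
  have hN: "N k (dirac (h n)) \<le> 1 / real (Suc n)" if "k \<le> n" for k n
  proof -
    have le: "n \<le> r n" by (rule seq_suble[OF r(1)])
    have "N k (dirac (h n)) \<le> 1 / real (Suc (r n))" unfolding h_def by (rule gN) (use that le in simp)
    also have "\<dots> \<le> 1 / real (Suc n)" using le by (intro divide_left_mono) auto
    finally show ?thesis .
  qed
  define V where "V = sqrt (vint (\<lambda>p. 1))"
  have V: "V \<ge> 0" using vint_one_nonneg by (simp add: V_def)
  \<comment> \<open>The elliptic estimate is applied to differences: the \<open>dirac\<close> parts
    tend to 0 at each fixed order, and uniform convergence handles the plain norm.\<close>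
  have small: "\<exists>M. \<forall>m\<ge>M. \<forall>n\<ge>M. N (Suc k) (\<lambda>p. h m p - h n p) < e" if e: "e > 0" for k e
  proof -
    define e' where "e' = e / (E k * (2 + V) + 1)"
    have den: "E k * (2 + V) + 1 > 0" using E(1)[of k] V by (simp add: add_nonneg_pos)
    have e': "e' > 0" using e den by (simp add: e'_def)
    obtain M1 where M1: "\<And>m n p. m \<ge> M1 \<Longrightarrow> n \<ge> M1 \<Longrightarrow> norm (h m p - h n p) < e'"
      using r(2) e' unfolding uniformly_Cauchy_def h_def by meson
    obtain M2 where M2: "1 / real (Suc M2) < e'" using nat_approx_posE[OF e'] by blast
    have "N (Suc k) (\<lambda>p. h m p - h n p) < e" if m: "m \<ge> max M1 (max M2 k)" and n: "n \<ge> max M1 (max M2 k)" for m n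
    proof -
      have inv: "N k (dirac (h l)) \<le> e'" if "l \<ge> max M1 (max M2 k)" for l
      proof -
        have "N k (dirac (h l)) \<le> 1 / real (Suc l)" by (rule hN) (use that in simp)
        also have "\<dots> \<le> 1 / real (Suc M2)" using that by (intro divide_left_mono) auto
        finally show ?thesis using M2 by simp
      qed
      have sd: "smooth_fun A (\<lambda>p. h m p - h n p)" by (intro smooth_fun_diff h)
      have "N k (dirac (\<lambda>p. h m p - h n p)) \<le> N k (dirac (h m)) + N k (dirac (h n))"
        unfolding dirac_diff[OF h(1) h(1)] by (intro N_diff smooth_dirac h)
      moreover have "nrm (\<lambda>p. h m p - h n p) \<le> V * e'" unfolding V_def
        using M1 m n by (intro nrm_le_sup smooth_fun_continuous[OF sd] less_imp_le) auto
      ultimately have "N k (dirac (\<lambda>p. h m p - h n p)) + nrm (\<lambda>p. h m p - h n p) \<le> (2 + V) * e'"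
        using inv[OF m] inv[OF n] by (simp add: distrib_right)
      then have "N (Suc k) (\<lambda>p. h m p - h n p) \<le> E k * ((2 + V) * e')"
        using E(2)[OF sd, of k] mult_left_mono[OF _ E(1)] by (meson order_trans)
      also have "\<dots> < (E k * (2 + V) + 1) * e'" using e' by (simp add: algebra_simps)
      also have "\<dots> = e" using den by (simp add: e'_def)
      finally show ?thesis .
    qed
    then show ?thesis by blast
  qed
  have UC: "uniformly_Cauchy (\<lambda>n. dI is (h n))" for "is"
    unfolding uniformly_Cauchy_def
  proof (intro allI impI)
    fix e :: real assume e: "e > 0"
    obtain C where C: "C \<ge> 0" "\<And>f p. smooth_fun A f \<Longrightarrow> norm (dI is f p) \<le> C * N (length is + 3) f" using sup_dI by blast
    have e': "e / (C + 1) > 0" using e C(1) by simp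
    obtain M where M: "\<And>m n. m \<ge> M \<Longrightarrow> n \<ge> M \<Longrightarrow> N (Suc (length is + 2)) (\<lambda>p. h m p - h n p) < e / (C + 1)"
      using small[OF e'] by blast
    have "norm (dI is (h m) p - dI is (h n) p) < e" if "m \<ge> M" "n \<ge> M" for m n p
    proof -
      have "norm (dI is (h m) p - dI is (h n) p) = norm (dI is (\<lambda>p. h m p - h n p) p)"
        by (simp add: dI_diff[OF h(1) h(1)])
      also have "\<dots> \<le> C * N (length is + 3) (\<lambda>p. h m p - h n p)" by (intro C(2) smooth_fun_diff h)
      also have "\<dots> \<le> C * (e / (C + 1))" using M[OF that] C(1) by (intro mult_left_mono) (auto simp: eval_nat_numeral)
      also have "\<dots> < (C + 1) * (e / (C + 1))" using e' by (intro mult_strict_right_mono) auto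
      also have "\<dots> = e" using C(1) by simp
      finally show ?thesis .
    qed
    then show "\<exists>M. \<forall>m\<ge>M. \<forall>n\<ge>M. \<forall>p. norm (dI is (h m) p - dI is (h n) p) < e" by blast
  qed
  obtain f where f: "smooth_fun A f" "\<And>e. e > 0 \<Longrightarrow> \<exists>M. \<forall>n\<ge>M. \<forall>p. norm (h n p - f p) < e"
    "\<And>i p. (\<lambda>n. d i (h n) p) \<longlonglongrightarrow> d i f p" using smooth_limit[OF h(1) UC] by blast
  have cf: "cont f" by (rule smooth_fun_continuous[OF f(1)])
  have "dirac f p = 0" for p
  proof -
    have "(\<lambda>n. dirac (h n) p) \<longlonglongrightarrow> dirac f p"
      unfolding dirac_eq by (intro tendsto_sum bounded_linear.tendsto[OF bounded_linear_unit_mult] f(3))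
    moreover have "(\<lambda>n. dirac (h n) p) \<longlonglongrightarrow> 0"
    proof (rule Lim_null_comparison)
      show "\<forall>\<^sub>F n in sequentially. norm (dirac (h n) p) \<le> C * (1 / real (Suc n))"
        unfolding eventually_sequentially
      proof (intro exI[of _ 3] allI impI)
        fix n :: nat assume "3 \<le> n"
        then show "norm (dirac (h n) p) \<le> C * (1 / real (Suc n))"
          using C(2)[OF smooth_dirac[OF h(1)], of n p] mult_left_mono[OF hN[of 3 n] C(1)] by linarith
      qed
      show "(\<lambda>n. C * (1 / real (Suc n))) \<longlonglongrightarrow> 0"
        using tendsto_mult_right_zero[OF LIMSEQ_inverse_real_of_nat, of C] by (simp add: divide_inverse)
    qed
    ultimately show ?thesis by (rule LIMSEQ_unique)
  qed
  then have fk: "f \<in> ker" using f(1) by (simp add: ker_def)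
  have close: "\<exists>n. nrm (\<lambda>p. h n p - f p) \<le> e" if e: "e > 0" for e
  proof -
    have e': "e / (V + 1) > 0" using e V by simp
    obtain n where n: "\<And>p. norm (h n p - f p) < e / (V + 1)" using f(2)[OF e'] by blast
    have "nrm (\<lambda>p. h n p - f p) \<le> sqrt (vint (\<lambda>p. 1)) * (e / (V + 1))"
      by (rule nrm_le_sup[OF smooth_fun_continuous[OF smooth_fun_diff[OF h(1) f(1)]] less_imp_le[OF n]])
    also have "sqrt (vint (\<lambda>p. 1)) * (e / (V + 1)) = V * (e / (V + 1))" by (simp add: V_def)
    also have "\<dots> \<le> e" using V e by (simp add: field_simps)
    finally show ?thesis by blast
  qed
  \<comment> \<open>The limit lies in the kernel, yet it is approximated by functions orthogonal to
    the kernel; so it is orthogonal to itself.\<close>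
  have z: "nrm f = 0"
  proof (rule ccontr)
    assume "nrm f \<noteq> 0"
    then have pos: "nrm f > 0" using nrm_nonneg[of f] by linarith
    obtain n where n: "nrm (\<lambda>p. h n p - f p) \<le> nrm f / 2" using close[of "nrm f / 2"] pos by auto
    have "nrm f ^ 2 = ip (h n) f - ip (\<lambda>p. h n p - f p) f"
      using ip_diff_left[OF smooth_fun_continuous[OF h(1)] cf cf, of n] by (simp add: nrm_sq)
    also have "\<dots> \<le> nrm (\<lambda>p. h n p - f p) * nrm f"
      using h(2)[OF fk, of n] ip_Cauchy_Schwarz[OF smooth_fun_continuous[OF smooth_fun_diff[OF h(1) f(1)]] cf, of n] by linarith
    also have "\<dots> \<le> nrm f / 2 * nrm f" using n by (intro mult_right_mono) auto
    finally show False using pos by (simp add: power2_eq_square)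
  qed
  \<comment> \<open>A function of norm 1 now lies within distance \<open>1 / 2\<close> of one of
    norm 0, the final contradiction.\<close>
  obtain n where n: "nrm (\<lambda>p. h n p - f p) \<le> 1 / 2" using close[of "1/2"] by auto
  have "nrm (\<lambda>p. (h n p - f p) + f p) \<le> nrm (\<lambda>p. h n p - f p) + nrm f"
    by (intro nrm_triangle smooth_fun_continuous smooth_fun_diff h f)
  then show False using n z h(3)[of n] by simp
qed

end

section \<open>Perturbation of the kernel\<close>

context frame
begin

text \<open>The dimension of the kernel. \<open>GREATEST\<close> denotes a maximum here because
  \<open>ker_finite_dim\<close> bounds the lengths.\<close>

definition kdim :: nat where
  "kdim = (GREATEST m. \<exists>e. (\<forall>i<m. e i \<in> ker) \<and> orthonormal e m)"

lemma kdim_bound: "\<exists>B. \<forall>m. (\<exists>e. (\<forall>i<m. e i \<in> ker) \<and> orthonormal e m) \<longrightarrow> m \<le> B"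
  using ker_finite_dim by blast

lemma kdim_le: "(\<And>i. i < m \<Longrightarrow> e i \<in> ker) \<Longrightarrow> orthonormal e m \<Longrightarrow> m \<le> kdim"
proof -
  assume "\<And>i. i < m \<Longrightarrow> e i \<in> ker" "orthonormal e m"
  then have "\<exists>e. (\<forall>i<m. e i \<in> ker) \<and> orthonormal e m" by blast
  moreover obtain B where "\<forall>m. (\<exists>e. (\<forall>i<m. e i \<in> ker) \<and> orthonormal e m) \<longrightarrow> m \<le> B" using kdim_bound by blast
  ultimately show ?thesis unfolding kdim_def by (intro Greatest_le_nat) auto
qed

lemma kdim_family: "\<exists>e. (\<forall>i<kdim. e i \<in> ker) \<and> orthonormal e kdim"
proof -
  obtain B where B: "\<forall>m. (\<exists>e. (\<forall>i<m. e i \<in> ker) \<and> orthonormal e m) \<longrightarrow> m \<le> B" using kdim_bound by blast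
  have "\<exists>e. (\<forall>i<0. e i \<in> ker) \<and> orthonormal e 0" by (simp add: orthonormal_def)
  then show ?thesis unfolding kdim_def
    by (rule GreatestI_nat[of "\<lambda>m. \<exists>e. (\<forall>i<m. e i \<in> ker) \<and> orthonormal e m"]) (use B in auto)
qed

definition basis :: "nat \<Rightarrow> 'a \<Rightarrow> quat" where
  "basis = (SOME e. (\<forall>i<kdim. e i \<in> ker) \<and> orthonormal e kdim)"

lemma basis: "i < kdim \<Longrightarrow> basis i \<in> ker" "orthonormal basis kdim"
  using someI_ex[OF kdim_family] unfolding basis_def[symmetric] by blast+

lemma cont_ker: "f \<in> ker \<Longrightarrow> cont f"
  by (rule smooth_fun_continuous[OF ker_smooth])

lemma cont_basis: "i < kdim \<Longrightarrow> cont (basis i)"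
  by (rule cont_ker[OF basis(1)])

definition proj :: "('a \<Rightarrow> quat) \<Rightarrow> 'a \<Rightarrow> quat" where
  "proj f = (\<lambda>p. \<Sum>i<kdim. ip f (basis i) *\<^sub>R basis i p)"

lemma proj_ker: "proj f \<in> ker"
  unfolding proj_def by (rule ker_lincomb[OF basis(1)])

lemma ker_diff: "f \<in> ker \<Longrightarrow> g \<in> ker \<Longrightarrow> (\<lambda>p. f p - g p) \<in> ker"
  unfolding ker_def using dirac_diff[of f g] by (auto intro: smooth_fun_diff)

lemma ker_scale: "f \<in> ker \<Longrightarrow> (\<lambda>p. t *\<^sub>R f p) \<in> ker"
  unfolding ker_def using dirac_scale[of f t] by (auto intro: smooth_fun_scaleR)

lemma ip_diff_proj_basis:
  assumes "cont f" "i < kdim" shows "ip (\<lambda>p. f p - proj f p) (basis i) = 0"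
  using ip_diff_left[OF assms(1) cont_ker[OF proj_ker] cont_basis[OF assms(2)], of f]
    orthonormal_coeff[OF basis(2) cont_basis assms(2)] by (simp add: proj_def)

text \<open>By maximality of the family: a nonzero remainder, normalized, would extend it by one
  element.\<close>

lemma proj_id:
  assumes f: "f \<in> ker" shows "f = proj f"
proof -
  define r where "r = (\<lambda>p. f p - proj f p)"
  have r: "r \<in> ker" unfolding r_def by (rule ker_diff[OF f proj_ker])
  have "nrm r = 0"
  proof (rule ccontr)
    assume nz: "nrm r \<noteq> 0"
    define e where "e i = (if i < kdim then basis i else (\<lambda>p. inverse (nrm r) *\<^sub>R r p))" for i
    have ek: "e i \<in> ker" if "i < Suc kdim" for i using basis(1) ker_scale[OF r] by (auto simp: e_def)
    have o: "ip r (basis i) = 0" if "i < kdim" for i unfolding r_def by (rule ip_diff_proj_basis[OF cont_ker[OF f] that])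
    have "ip (e i) (e j) = (if i = j then 1 else 0)" if ij: "i < Suc kdim" "j < Suc kdim" for i j
    proof (cases "i < kdim"; cases "j < kdim")
      assume "i < kdim" "j < kdim"
      then show ?thesis using basis(2) by (simp add: e_def orthonormal_def)
    next
      assume "i < kdim" "\<not> j < kdim"
      then show ?thesis using o[of i] ij by (simp add: e_def ip_scale_right ip_commute[of "basis i"])
    next
      assume "\<not> i < kdim" "j < kdim"
      then show ?thesis using o[of j] ij by (simp add: e_def ip_scale_left)
    next
      assume "\<not> i < kdim" "\<not> j < kdim"
      moreover have "inverse (nrm r) * (inverse (nrm r) * ip r r) = 1"
        using nz unfolding nrm_sq[symmetric] by (simp add: power2_eq_square field_simps)
      ultimately show ?thesis using ij by (simp add: e_def ip_scale_left ip_scale_right)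
    qed
    then have "orthonormal e (Suc kdim)" by (simp add: orthonormal_def)
    with ek have "Suc kdim \<le> kdim" by (rule kdim_le[where e = e])
    then show False by simp
  qed
  then have "r p = 0" for p by (rule nrm_zero_imp[OF cont_ker[OF r]])
  then show ?thesis by (auto simp: r_def)
qed

lemma ip_diff_proj:
  assumes f: "cont f" and g: "g \<in> ker" shows "ip (\<lambda>p. f p - proj f p) g = 0"
proof -
  have cf: "cont (\<lambda>p. f p - proj f p)" by (intro continuous_on_diff f cont_ker[OF proj_ker])
  have "ip (\<lambda>p. f p - proj f p) g = ip (\<lambda>p. f p - proj f p) (\<lambda>p. \<Sum>i<kdim. ip g (basis i) *\<^sub>R basis i p)"
    using proj_id[OF g] unfolding proj_def[of g] by simp
  also have "\<dots> = (\<Sum>i<kdim. ip g (basis i) * ip (\<lambda>p. f p - proj f p) (basis i))"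
    by (rule ip_lincomb_right) (use cont_basis cf in auto)
  also have "\<dots> = 0" by (intro sum.neutral) (simp add: ip_diff_proj_basis[OF f])
  finally show ?thesis .
qed

lemma dirac_diff_proj: "smooth_fun A f \<Longrightarrow> dirac (\<lambda>p. f p - proj f p) = dirac f"
  using dirac_diff[OF _ ker_smooth[OF proj_ker[of f]]] ker_dirac[OF proj_ker[of f]] by simp

text \<open>Inserting the gap into the elliptic estimate gains a derivative. The order on the right
  is then what a first order perturbation of \<open>f - proj f\<close> can be measured in.\<close>

lemma spectral_gap_N:
  "\<exists>k. \<exists>C\<ge>0. \<forall>f. smooth_fun A f \<longrightarrow> N (Suc k) (\<lambda>p. f p - proj f p) \<le> C * N k (dirac f)"
proof -
  obtain k C where C: "C \<ge> 0" "\<And>f. smooth_fun A f \<Longrightarrow> \<forall>g\<in>ker. ip f g = 0 \<Longrightarrow> nrm f \<le> C * N k (dirac f)"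
    using spectral_gap by blast
  obtain E where E: "E \<ge> 0" "\<And>f. smooth_fun A f \<Longrightarrow> N (Suc k) f \<le> E * (N k (dirac f) + nrm f)"
    using elliptic by blast
  have "N (Suc k) (\<lambda>p. f p - proj f p) \<le> E * (1 + C) * N k (dirac f)" if f: "smooth_fun A f" for f
  proof -
    have s: "smooth_fun A (\<lambda>p. f p - proj f p)" by (intro smooth_fun_diff f ker_smooth proj_ker)
    have "nrm (\<lambda>p. f p - proj f p) \<le> C * N k (dirac f)"
      using C(2)[OF s] ip_diff_proj[OF smooth_fun_continuous[OF f]] dirac_diff_proj[OF f] by simp
    then have "N k (dirac f) + nrm (\<lambda>p. f p - proj f p) \<le> (1 + C) * N k (dirac f)" by (simp add: distrib_right)
    then have "E * (N k (dirac f) + nrm (\<lambda>p. f p - proj f p)) \<le> E * ((1 + C) * N k (dirac f))"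
      using E(1) by (rule mult_left_mono)
    moreover have "N (Suc k) (\<lambda>p. f p - proj f p) \<le> E * (N k (dirac f) + nrm (\<lambda>p. f p - proj f p))"
      using E(2)[OF s] unfolding dirac_diff_proj[OF f] .
    ultimately show ?thesis unfolding mult.assoc by linarith
  qed
  then show ?thesis using C(1) E(1) by (intro exI[of _ k] exI[of _ "E * (1 + C)"]) auto
qed

lemma N_fueter_op:
  assumes "\<And>i. w i \<in> smooth_vfields A"
  shows "\<exists>C\<ge>0. \<forall>f. smooth_fun A f \<longrightarrow> N k (fueter_op w f) \<le> C * N (Suc k) f"
proof -
  define C where "C i = (SOME C. C \<ge> 0 \<and> (\<forall>f. smooth_fun A f \<longrightarrow> N k (dir_deriv A (w i) f) \<le> C * N (Suc k) f))" for i
  have C: "C i \<ge> 0" "\<And>f. smooth_fun A f \<Longrightarrow> N k (dir_deriv A (w i) f) \<le> C i * N (Suc k) f" for i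
    using someI_ex[OF N_dir_deriv[OF assms[of i], of k]] unfolding C_def[symmetric] by blast+
  have "N k (fueter_op w f) \<le> (\<Sum>i\<in>UNIV. C i) * N (Suc k) f" if f: "smooth_fun A f" for f
  proof -
    have "N k (fueter_op w f) \<le> (\<Sum>i\<in>UNIV. N k (\<lambda>p. unit_mult i (dir_deriv A (w i) f p)))"
      unfolding fueter_op_def[abs_def] by (intro N_sum smooth_unit_mult smooth_dir_deriv assms f)
    also have "\<dots> \<le> (\<Sum>i\<in>UNIV. C i * N (Suc k) f)"
      by (intro sum_mono order_trans[OF N_unit_mult C(2)] smooth_dir_deriv assms f)
    finally show ?thesis by (simp only: sum_distrib_right)
  qed
  then show ?thesis using C(1) by (intro exI[of _ "\<Sum>i\<in>UNIV. C i"]) (auto intro: sum_nonneg)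
qed

text \<open>The quantitative version of \<open>N_fueter_op\<close>: three directions, each with the
  Leibniz factor \<open>4 ^ k\<close> and the coefficient bound \<open>e\<close>.\<close>

lemma N_fueter_op_small:
  assumes w: "\<And>i. w i \<in> smooth_vfields A" and cb: "\<And>i j. cbound k e (cof (w i) j)" and e: "e \<ge> 0" and f: "smooth_fun A f"
  shows "N k (fueter_op w f) \<le> 3 * 4 ^ k * e * N (Suc k) f"
proof -
  have i: "N k (dir_deriv A (w i) f) \<le> 4 ^ k * e * N (Suc k) f" for i
  proof -
    have "dir_deriv A (w i) f = (\<lambda>p. \<Sum>j\<in>UNIV. cof (w i) j p *\<^sub>R d j f p)"
      by (rule ext) (rule dir_deriv_cof[OF w f])
    then have "N k (dir_deriv A (w i) f) \<le> (\<Sum>j\<in>UNIV. N k (\<lambda>p. cof (w i) j p *\<^sub>R d j f p))"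
      using N_sum[of UNIV "\<lambda>j p. cof (w i) j p *\<^sub>R d j f p" k] smooth_fun_scaleR[OF smooth_cof[OF w] smooth_d[OF f]] by simp
    also have "\<dots> \<le> (\<Sum>j\<in>UNIV. 4 ^ k * e * N k (d j f))"
      by (intro sum_mono N_mult_cbound cb smooth_cof w smooth_d f e)
    also have "\<dots> = 4 ^ k * e * (\<Sum>j\<in>UNIV. N k (d j f))" by (simp only: sum_distrib_left)
    also have "\<dots> \<le> 4 ^ k * e * N (Suc k) f" using e by (intro mult_left_mono) auto
    finally show ?thesis .
  qed
  have "N k (fueter_op w f) \<le> (\<Sum>i\<in>UNIV. N k (\<lambda>p. unit_mult i (dir_deriv A (w i) f p)))"
    unfolding fueter_op_def[abs_def] by (intro N_sum smooth_unit_mult smooth_dir_deriv w f)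
  also have "\<dots> \<le> (\<Sum>i\<in>(UNIV::3 set). 4 ^ k * e * N (Suc k) f)"
    by (intro sum_mono order_trans[OF N_unit_mult i] smooth_dir_deriv w f)
  finally show ?thesis by simp
qed

text \<open>Here \<open>w\<close> is the difference between a nearby frame and \<open>v\<close>. The
  projection of a solution \<open>f\<close> is constant, so \<open>fueter_op w\<close> sees only
  \<open>g = f - proj f\<close>, and the estimate bounds \<open>N (Suc k) g\<close> by half of
  itself.\<close>

lemma regular_open:
  assumes reg: "\<And>f. f \<in> ker \<Longrightarrow> \<exists>q. f = (\<lambda>p. q)"
  shows "\<exists>k. \<exists>e>0. \<forall>w. (\<forall>i. w i \<in> smooth_vfields A) \<longrightarrow> (\<forall>i j. cbound k e (cof (w i) j)) \<longrightarrow>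
    (\<forall>f. smooth_fun A f \<longrightarrow> (\<forall>p. dirac f p + fueter_op w f p = 0) \<longrightarrow> (\<exists>q. \<forall>p. f p = q))"
proof -
  obtain k C where C: "C \<ge> 0" "\<And>f. smooth_fun A f \<Longrightarrow> N (Suc k) (\<lambda>p. f p - proj f p) \<le> C * N k (dirac f)"
    using spectral_gap_N by blast
  \<comment> \<open>Makes \<open>C * (3 * 4 ^ k * e)\<close> at most \<open>1 / 2\<close>, also for
    \<open>C = 0\<close>.\<close>
  define e where "e = inverse (2 * (C * (3 * 4 ^ k) + 1))"
  have den: "C * (3 * 4 ^ k) + 1 > 0" using C(1) by (simp add: add_nonneg_pos)
  have e: "e > 0" unfolding e_def using den by simp
  have small: "C * (3 * 4 ^ k * e) \<le> 1 / 2"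
  proof -
    have "C * (3 * 4 ^ k * e) = (C * (3 * 4 ^ k)) / (2 * (C * (3 * 4 ^ k) + 1))" by (simp add: e_def divide_inverse)
    also have "\<dots> \<le> 1 / 2" using den by (simp add: field_simps)
    finally show ?thesis .
  qed
  have "\<exists>q. \<forall>p. f p = q"
    if w: "\<And>i. w i \<in> smooth_vfields A" and cb: "\<And>i j. cbound k e (cof (w i) j)" and f: "smooth_fun A f"
      and z: "\<And>p. dirac f p + fueter_op w f p = 0" for w f
  proof -
    obtain q where q: "proj f = (\<lambda>p. q)" using reg[OF proj_ker] by blast
    define g where "g = (\<lambda>p. f p - proj f p)"
    have g: "smooth_fun A g" unfolding g_def by (intro smooth_fun_diff f ker_smooth proj_ker)
    have fg: "fueter_op w f = fueter_op w g"
      unfolding g_def q using fueter_op_diff[where w = w, OF w f smooth_fun_const[of q]] fueter_op_const[where w = w, OF w, of q] by simp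
    have "dirac f = (\<lambda>p. - fueter_op w g p)" using z unfolding fg[symmetric] by (auto simp: eq_neg_iff_add_eq_0)
    then have "N k (dirac f) \<le> N k (fueter_op w g)" using N_minus[OF smooth_fueter_op[where w = w, OF w g], of k] by simp
    also have "\<dots> \<le> 3 * 4 ^ k * e * N (Suc k) g" by (rule N_fueter_op_small[OF w cb less_imp_le[OF e] g])
    finally have "N (Suc k) g \<le> C * (3 * 4 ^ k * e * N (Suc k) g)"
      using C(2)[OF f] mult_left_mono[OF _ C(1)] unfolding g_def by (meson order_trans)
    also have "\<dots> = C * (3 * 4 ^ k * e) * N (Suc k) g" by (simp only: mult.assoc)
    also have "\<dots> \<le> 1 / 2 * N (Suc k) g" using small by (rule mult_right_mono) (rule N_nonneg)
    finally have "N (Suc k) g \<le> 0" by simp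
    then have "nrm g = 0" using nrm_le_N[of g "Suc k"] nrm_nonneg[of g] by linarith
    then have "g p = 0" for p by (rule nrm_zero_imp[OF smooth_fun_continuous[OF g]])
    then show ?thesis unfolding g_def q by (intro exI[of _ q]) simp
  qed
  then show ?thesis using e by blast
qed

text \<open>The perturbation applied to \<open>f - proj f\<close> is absorbed for small
  \<open>t\<close>. Applied to \<open>proj f\<close> it is of size \<open>t\<close>, since all norms
  are comparable on the kernel.\<close>

lemma perturbed_kernel_close:
  assumes w: "\<And>i. w i \<in> smooth_vfields A"
  shows "\<exists>c\<ge>0. \<exists>t0>0. \<forall>t f. \<bar>t\<bar> < t0 \<longrightarrow> smooth_fun A f \<longrightarrow> (\<forall>p. dirac f p + t *\<^sub>R fueter_op w f p = 0) \<longrightarrow>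
    nrm (\<lambda>p. f p - proj f p) \<le> c * \<bar>t\<bar> * nrm f"
proof -
  obtain k G where G: "G \<ge> 0" "\<And>f. smooth_fun A f \<Longrightarrow> N (Suc k) (\<lambda>p. f p - proj f p) \<le> G * N k (dirac f)"
    using spectral_gap_N by blast
  obtain M where M: "M \<ge> 0" "\<And>f. smooth_fun A f \<Longrightarrow> N k (fueter_op w f) \<le> M * N (Suc k) f"
    using N_fueter_op[where w = w and k = k, OF w] by blast
  \<comment> \<open>Comparison constant between the norm of order \<open>Suc k\<close> on the kernel
    and the plain norm.\<close>
  define H where "H = (\<Sum>i<kdim. N (Suc k) (basis i))"
  have H: "H \<ge> 0" unfolding H_def by (intro sum_nonneg N_nonneg)
  have Nproj: "N (Suc k) (proj f) \<le> H * nrm f" if f: "smooth_fun A f" for f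
  proof -
    have sb: "smooth_fun A (basis i)" if "i < kdim" for i by (rule ker_smooth[OF basis(1)[OF that]])
    have "N (Suc k) (proj f) \<le> (\<Sum>i<kdim. N (Suc k) (\<lambda>p. ip f (basis i) *\<^sub>R basis i p))"
      unfolding proj_def by (intro N_sum smooth_fun_scaleR smooth_fun_const sb) auto
    also have "\<dots> \<le> (\<Sum>i<kdim. N (Suc k) (basis i) * nrm f)"
    proof (rule sum_mono)
      fix i assume "i \<in> {..<kdim}"
      then have i: "i < kdim" by simp
      have b1: "nrm (basis i) = 1" using basis(2) i by (simp add: orthonormal_def nrm_def)
      have "N (Suc k) (\<lambda>p. ip f (basis i) *\<^sub>R basis i p) \<le> \<bar>ip f (basis i)\<bar> * N (Suc k) (basis i)"
        by (rule N_scale[OF sb[OF i]])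
      also have "\<dots> \<le> nrm f * N (Suc k) (basis i)"
        using ip_Cauchy_Schwarz[OF smooth_fun_continuous[OF f] cont_basis[OF i]] b1 by (intro mult_right_mono) (auto simp del: N.simps)
      finally show "N (Suc k) (\<lambda>p. ip f (basis i) *\<^sub>R basis i p) \<le> N (Suc k) (basis i) * nrm f" by (simp only: mult.commute)
    qed
    finally show ?thesis by (simp only: H_def sum_distrib_right)
  qed
  \<comment> \<open>Ensures \<open>G * M * \<bar>t\<bar> \<le> 1 / 2\<close>, so the term with
    \<open>x\<close> moves to the left.\<close>
  define t0 where "t0 = inverse (2 * (G * M + 1))"
  have GM: "G * M \<ge> 0" using G(1) M(1) by simp
  have t0: "t0 > 0" unfolding t0_def using GM by (simp add: add_nonneg_pos)
  have "nrm (\<lambda>p. f p - proj f p) \<le> 2 * G * M * H * \<bar>t\<bar> * nrm f"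
    if t: "\<bar>t\<bar> < t0" and f: "smooth_fun A f" and z: "\<And>p. dirac f p + t *\<^sub>R fueter_op w f p = 0" for t f
  proof -
    define x where "x = N (Suc k) (\<lambda>p. f p - proj f p)"
    have x0: "x \<ge> 0" unfolding x_def by (rule N_nonneg)
    have sw: "smooth_fun A (fueter_op w f)" by (rule smooth_fueter_op[where w = w, OF w f])
    have "dirac f = (\<lambda>p. (- t) *\<^sub>R fueter_op w f p)" using z by (auto simp: eq_neg_iff_add_eq_0)
    then have "N k (dirac f) \<le> \<bar>t\<bar> * N k (fueter_op w f)" using N_scale[OF sw, of k "- t"] by simp
    also have "\<dots> \<le> \<bar>t\<bar> * (M * N (Suc k) f)" by (intro mult_left_mono M(2) f) simp
    also have "\<dots> \<le> \<bar>t\<bar> * (M * (x + H * nrm f))"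
    proof (intro mult_left_mono M(1))
      have "N (Suc k) (\<lambda>p. (f p - proj f p) + proj f p) \<le> N (Suc k) (\<lambda>p. f p - proj f p) + N (Suc k) (proj f)"
        by (intro N_add smooth_fun_diff f ker_smooth proj_ker)
      then show "N (Suc k) f \<le> x + H * nrm f" using Nproj[OF f] unfolding x_def diff_add_cancel by linarith
    qed simp
    finally have "x \<le> G * (\<bar>t\<bar> * (M * (x + H * nrm f)))"
      using G(2)[OF f] mult_left_mono[OF _ G(1)] unfolding x_def by (meson order_trans)
    also have "\<dots> = (G * M * \<bar>t\<bar>) * x + G * M * H * \<bar>t\<bar> * nrm f" by (simp add: algebra_simps)
    finally have a: "x \<le> (G * M * \<bar>t\<bar>) * x + G * M * H * \<bar>t\<bar> * nrm f" .
    have "G * M * \<bar>t\<bar> \<le> G * M * t0" using GM t by (intro mult_left_mono) auto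
    also have "\<dots> \<le> 1 / 2" unfolding t0_def using GM by (simp add: field_simps)
    finally have "(G * M * \<bar>t\<bar>) * x \<le> 1 / 2 * x" using x0 by (rule mult_right_mono)
    then have "x \<le> 2 * G * M * H * \<bar>t\<bar> * nrm f" using a by linarith
    then show ?thesis using nrm_le_N[of "\<lambda>p. f p - proj f p" "Suc k"] unfolding x_def by linarith
  qed
  then show ?thesis using t0 G(1) M(1) H by (intro exI[of _ "2 * G * M * H"] conjI exI[of _ t0]) auto
qed

text \<open>If the perturbed kernel had dimension \<open>kdim\<close> as well, it would be so close to \<open>ker\<close> that each
  basis element \<open>h\<close> of \<open>ker\<close> is within \<open>O(t)\<close> of some \<open>f\<close> in it. The quadratic form of the perturbation
  vanishes between \<open>ker\<close> and such \<open>f\<close>, so it would be \<open>O(t)\<close> on the basis.\<close>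

lemma kernel_drops:
  assumes w: "\<And>i. w i \<in> smooth_vfields A" "\<And>i. divergence_free A dvol (w i)"
    and ij: "a < kdim" "b < kdim" "ip (basis a) (fueter_op w (basis b)) \<noteq> 0"
  shows "\<exists>t0>0. \<forall>t e m. 0 < t \<longrightarrow> t < t0 \<longrightarrow> (\<forall>i<m. smooth_fun A (e i) \<and> (\<forall>p. dirac (e i) p + t *\<^sub>R fueter_op w (e i) p = 0)) \<longrightarrow>
    orthonormal e m \<longrightarrow> m < kdim"
proof -
  obtain c t1 where c: "c \<ge> 0" "t1 > 0" "\<And>t f. \<bar>t\<bar> < t1 \<Longrightarrow> smooth_fun A f \<Longrightarrow> (\<And>p. dirac f p + t *\<^sub>R fueter_op w f p = 0) \<Longrightarrow>
    nrm (\<lambda>p. f p - proj f p) \<le> c * \<bar>t\<bar> * nrm f" using perturbed_kernel_close[where w = w, OF w(1)] by blast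
  define Q where "Q = \<bar>ip (basis a) (fueter_op w (basis b))\<bar>"
  define W where "W = nrm (fueter_op w (basis a)) * (sqrt (real kdim) * c)"
  have Q: "Q > 0" using ij(3) by (simp add: Q_def)
  have W: "W \<ge> 0" using c(1) by (simp add: W_def)
  \<comment> \<open>Below \<open>t1\<close> the two kernels are comparable; below
    \<open>Q / (W + 1)\<close> the bound \<open>Q \<le> W * t\<close> obtained at the end is
    contradictory.\<close>
  define t0 where "t0 = min t1 (Q / (W + 1))"
  have t0: "t0 > 0" using c(2) Q W by (simp add: t0_def)
  have "m < kdim" if t: "0 < t" "t < t0" and e: "\<And>i. i < m \<Longrightarrow> smooth_fun A (e i)"
    "\<And>i p. i < m \<Longrightarrow> dirac (e i) p + t *\<^sub>R fueter_op w (e i) p = 0" and on: "orthonormal e m" for t e m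
  proof (rule ccontr)
    assume "\<not> m < kdim"
    then have km: "i < kdim \<Longrightarrow> i < m" for i by simp
    have on': "orthonormal e kdim" using on km by (simp add: orthonormal_def)
    have ce: "cont (e i)" if "i < kdim" for i by (rule smooth_fun_continuous[OF e(1)[OF km[OF that]]])
    have e1: "nrm (e j) = 1" if "j < kdim" for j using on' that by (simp add: orthonormal_def nrm_def)
    have b1: "nrm (basis j) = 1" if "j < kdim" for j using basis(2) that by (simp add: orthonormal_def nrm_def)
    \<comment> \<open>Column bound for the matrix of inner products between the two families: each
      \<open>e j\<close> is close to the kernel.\<close>
    have lower: "(\<Sum>i<kdim. ip (basis i) (e j) ^ 2) \<ge> 1 - (c * t)^2" if j: "j < kdim" for j
    proof -
      have "nrm (\<lambda>p. e j p - proj (e j) p) \<le> c * t * 1"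
        using c(3)[OF _ e(1)[OF km[OF j]] e(2)[OF km[OF j]]] t e1[OF j] by (simp add: t0_def)
      then have "nrm (\<lambda>p. e j p - proj (e j) p) ^ 2 \<le> (c * t) ^ 2" by (intro power_mono) auto
      moreover have "nrm (\<lambda>p. e j p - proj (e j) p) ^ 2 = 1 - (\<Sum>i<kdim. ip (e j) (basis i) ^ 2)"
        using nrm_sq_diff_proj[where e = basis, OF basis(2) cont_basis ce[OF j]] by (simp add: proj_def e1[OF j])
      ultimately show ?thesis by (simp add: ip_commute[of "e j"])
    qed
    \<comment> \<open>Row bound by Bessel's inequality, from orthonormality of
      \<open>e\<close>.\<close>
    have upper: "(\<Sum>j<kdim. ip (basis i) (e j) ^ 2) \<le> 1" if i: "i < kdim" for i
      using nrm_sq_diff_proj[where e = e, OF on' ce cont_basis[OF i]] b1[OF i]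
      by (smt (verit, best) one_power2 zero_le_power2)
    \<comment> \<open>The sum of all squared entries is large by columns, and every row other than
      \<open>b\<close> contributes at most 1; so row \<open>b\<close> must be nearly 1. Equal size
      of the two families is decisive here.\<close>
    have near: "(\<Sum>j<kdim. ip (basis b) (e j) ^ 2) \<ge> 1 - real kdim * (c * t)^2"
    proof -
      have "real kdim * (1 - (c * t)^2) = (\<Sum>j<kdim. 1 - (c * t)^2)" by simp
      also have "\<dots> \<le> (\<Sum>j<kdim. \<Sum>i<kdim. ip (basis i) (e j) ^ 2)" by (intro sum_mono lower) simp
      also have "\<dots> = (\<Sum>i<kdim. \<Sum>j<kdim. ip (basis i) (e j) ^ 2)" by (rule sum.swap)
      also have "\<dots> = (\<Sum>j<kdim. ip (basis b) (e j) ^ 2) + (\<Sum>i\<in>{..<kdim} - {b}. \<Sum>j<kdim. ip (basis i) (e j) ^ 2)"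
        using ij(2) by (subst sum.remove[of _ b]) auto
      also have "\<dots> \<le> (\<Sum>j<kdim. ip (basis b) (e j) ^ 2) + (\<Sum>i\<in>{..<kdim} - {b}. 1)"
        by (intro add_left_mono sum_mono upper) auto
      also have "(\<Sum>i\<in>{..<kdim} - {b}. (1::real)) = real kdim - 1" using ij(2) by simp
      finally show ?thesis by (simp add: algebra_simps)
    qed
    \<comment> \<open>The projection of \<open>basis b\<close> to the span of the perturbed
      solutions.\<close>
    define f where "f = (\<lambda>p. \<Sum>j<kdim. ip (basis b) (e j) *\<^sub>R e j p)"
    have f: "smooth_fun A f" unfolding f_def by (intro smooth_fun_sum smooth_fun_scaleR smooth_fun_const e km) auto
    have "nrm (\<lambda>p. basis b p - f p) ^ 2 \<le> real kdim * (c * t)^2"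
      using nrm_sq_diff_proj[where e = e, OF on' ce cont_basis[OF ij(2)]] near b1[OF ij(2)] by (simp add: f_def)
    then have "nrm (\<lambda>p. basis b p - f p) \<le> sqrt (real kdim * (c * t)^2)" by (rule real_le_rsqrt)
    then have nf: "nrm (\<lambda>p. basis b p - f p) \<le> sqrt (real kdim) * c * t"
      using c(1) t by (simp add: real_sqrt_mult)
    have ba: "smooth_fun A (basis a)" and bb: "smooth_fun A (basis b)" by (rule ker_smooth[OF basis(1)], rule ij)+
    \<comment> \<open>On a perturbed solution, \<open>t\<close> times the perturbation is minus
      \<open>dirac\<close>, which by symmetry can be moved to \<open>basis a\<close>, where it
      vanishes.\<close>
    have "ip (basis a) (fueter_op w (e j)) = 0" if j: "j < kdim" for j
    proof -
      have "dirac (e j) = (\<lambda>p. (- t) *\<^sub>R fueter_op w (e j) p)" using e(2)[OF km[OF j]] by (auto simp: eq_neg_iff_add_eq_0)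
      then have "- t * ip (basis a) (fueter_op w (e j)) = ip (basis a) (dirac (e j))" by (simp only: ip_scale_right)
      also have "\<dots> = ip (dirac (basis a)) (e j)" by (rule dirac_symmetric[OF ba e(1)[OF km[OF j]], symmetric])
      also have "\<dots> = 0" unfolding ker_dirac[OF basis(1)[OF ij(1)]] by (simp add: ip_def)
      finally show ?thesis using t by simp
    qed
    then have 0: "ip (fueter_op w (basis a)) (e j) = 0" if "j < kdim" for j
      using fueter_op_symmetric[where w = w, OF w ba e(1)[OF km[OF that]]] that by simp
    have cw: "cont (fueter_op w (basis a))" by (rule smooth_fun_continuous[OF smooth_fueter_op[where w = w, OF w(1) ba]])
    have "ip (fueter_op w (basis a)) f = 0"
      unfolding f_def by (subst ip_lincomb_right) (use ce cw 0 in auto)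
    then have "ip (fueter_op w (basis a)) (\<lambda>p. basis b p - f p) = ip (fueter_op w (basis a)) (basis b)"
      using ip_diff_right[OF cont_basis[OF ij(2)] smooth_fun_continuous[OF f] cw] by simp
    also have "\<dots> = ip (basis a) (fueter_op w (basis b))" by (rule fueter_op_symmetric[where w = w, OF w ba bb])
    finally have "Q \<le> nrm (fueter_op w (basis a)) * nrm (\<lambda>p. basis b p - f p)"
      unfolding Q_def using ip_Cauchy_Schwarz[OF cw smooth_fun_continuous[OF smooth_fun_diff[OF bb f]]] by simp
    also have "\<dots> \<le> nrm (fueter_op w (basis a)) * (sqrt (real kdim) * c * t)" using nf by (rule mult_left_mono) simp
    also have "\<dots> = W * t" by (simp add: W_def)
    also have "\<dots> \<le> W * (Q / (W + 1))" using t W by (intro mult_left_mono) (auto simp: t0_def)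
    also have "\<dots> < (W + 1) * (Q / (W + 1))" using Q W by (intro mult_strict_right_mono) auto
    also have "\<dots> = Q" using W by simp
    finally show False by simp
  qed
  then show ?thesis using t0 by blast
qed

end

section \<open>Divergence-free fields that move a kernel element\<close>

lemma smooth_cutoff_mult:
  fixes u g :: "real^'n::finite \<Rightarrow> real"
  assumes U: "open U" and u: "smooth_on UNIV u" and K: "compact K" "K \<subseteq> U" "\<And>x. x \<notin> K \<Longrightarrow> u x = 0"
    and g: "smooth_on U g"
  shows "smooth_on UNIV (\<lambda>x. if x \<in> U then u x * g x else 0)"
proof (rule smooth_on_local)
  fix x :: "real^'n"
  show "\<exists>T. x \<in> T \<and> smooth_on T (\<lambda>x. if x \<in> U then u x * g x else 0)"
  proof (cases "x \<in> U")
    case True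
    have "smooth_on U (\<lambda>x. if x \<in> U then u x * g x else 0)"
      by (subst smooth_on_cong[OF U, of _ "\<lambda>x. u x * g x"])
        (auto intro!: smooth_on_mult U g smooth_on_subset[OF u])
    then show ?thesis using True by blast
  next
    case False
    have o: "open (- K)" using compact_imp_closed[OF K(1)] by (simp add: open_Compl)
    have "smooth_on (- K) (\<lambda>x. if x \<in> U then u x * g x else 0)"
      by (subst smooth_on_cong[OF o, of _ "\<lambda>x. 0"]) (use K(3) in auto)
    then show ?thesis using False K(2) by blast
  qed
qed

text \<open>\<open>g\<close> is smooth on the chart image \<open>U\<close> only, so integrands carry
  an explicit cutoff outside \<open>U\<close>; the compact support of \<open>u\<close> inside
  \<open>U\<close> makes them smooth everywhere.\<close>

lemma integral_by_parts_cutoff: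
  fixes u g :: "real^'n::finite \<Rightarrow> real"
  assumes U: "open U" and u: "smooth_on UNIV u" and K: "compact K" "K \<subseteq> U" "\<And>x. x \<notin> K \<Longrightarrow> u x = 0"
    and g: "smooth_on U g"
  shows "integrable lborel (\<lambda>x. if x \<in> U then partial_deriv l u x * g x else 0)"
    and "integrable lborel (\<lambda>x. if x \<in> U then u x * partial_deriv l g x else 0)"
    and "(LINT x|lborel. (if x \<in> U then partial_deriv l u x * g x else 0)) =
      - (LINT x|lborel. (if x \<in> U then u x * partial_deriv l g x else 0))"
proof -
  let ?P = "\<lambda>x. if x \<in> U then partial_deriv l u x * g x else 0"
  let ?Q = "\<lambda>x. if x \<in> U then u x * partial_deriv l g x else 0"
  let ?H = "\<lambda>x. if x \<in> U then u x * g x else 0"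
  have H: "smooth_on UNIV ?H" by (rule smooth_cutoff_mult[OF assms])
  have du: "x \<notin> K \<Longrightarrow> partial_deriv l u x = 0" for x by (rule csupp_partial[OF u K(1,3)])
  have P: "smooth_on UNIV ?P" by (rule smooth_cutoff_mult[OF U smooth_on_partial[OF u] K(1,2) du g])
  have Q: "smooth_on UNIV ?Q" by (rule smooth_cutoff_mult[OF U u K smooth_on_partial[OF g]])
  show iP: "integrable lborel ?P"
    by (rule integrable_csupp[OF cont_csuppI[OF smooth_on_continuous[OF P] K(1)]]) (use du in auto)
  show iQ: "integrable lborel ?Q"
    by (rule integrable_csupp[OF cont_csuppI[OF smooth_on_continuous[OF Q] K(1)]]) (use K(3) in auto)
  have "partial_deriv l ?H x = ?Q x + ?P x" for x
  proof (cases "x \<in> U")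
    case True
    have "partial_deriv l ?H x = partial_deriv l (\<lambda>x. u x * g x) x"
      by (rule partial_deriv_cong_open[OF U True]) simp
    also have "\<dots> = u x * partial_deriv l g x + partial_deriv l u x * g x"
      by (rule partial_deriv_bilinear[OF bounded_bilinear_mult])
        (use smooth_on_differentiable[OF u] smooth_on_differentiable[OF g True] in auto)
    finally show ?thesis using True by simp
  next
    case False
    have "partial_deriv l ?H x = 0"
      by (rule csupp_partial[OF H K(1)]) (use K False in auto)
    then show ?thesis using False by simp
  qed
  moreover have "(LINT x|lborel. partial_deriv l ?H x) = 0"
    by (rule integral_partial_zero[OF H K(1)]) (use K in auto)
  ultimately have "(LINT x|lborel. ?Q x + ?P x) = 0" by simp
  then show "(LINT x|lborel. ?P x) = - (LINT x|lborel. ?Q x)"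
    using Bochner_Integration.integral_add[OF iQ iP] by simp
qed

lemma integral_curl_cutoff:
  fixes u f g :: "real^'n::finite \<Rightarrow> real"
  assumes U: "open U" and u: "smooth_on UNIV u" and K: "compact K" "K \<subseteq> U" "\<And>x. x \<notin> K \<Longrightarrow> u x = 0"
    and f: "smooth_on U f" and g: "smooth_on U g"
  shows "(LINT x|lborel. (if x \<in> U then partial_deriv l u x * f x - partial_deriv j u x * g x else 0)) =
    (LINT x|lborel. (if x \<in> U then u x * (partial_deriv j g x - partial_deriv l f x) else 0))"
proof -
  note F = integral_by_parts_cutoff[OF U u K f, of l] and G = integral_by_parts_cutoff[OF U u K g, of j]
  have "(LINT x|lborel. (if x \<in> U then partial_deriv l u x * f x - partial_deriv j u x * g x else 0))
     = (LINT x|lborel. (if x \<in> U then partial_deriv l u x * f x else 0) - (if x \<in> U then partial_deriv j u x * g x else 0))"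
    by (intro Bochner_Integration.integral_cong) auto
  also have "\<dots> = (LINT x|lborel. (if x \<in> U then partial_deriv l u x * f x else 0)) - (LINT x|lborel. (if x \<in> U then partial_deriv j u x * g x else 0))"
    by (rule Bochner_Integration.integral_diff[OF F(1) G(1)])
  also have "\<dots> = (LINT x|lborel. (if x \<in> U then u x * partial_deriv j g x else 0)) - (LINT x|lborel. (if x \<in> U then u x * partial_deriv l f x else 0))"
    using F(3) G(3) by linarith
  also have "\<dots> = (LINT x|lborel. (if x \<in> U then u x * partial_deriv j g x else 0) - (if x \<in> U then u x * partial_deriv l f x else 0))"
    by (rule Bochner_Integration.integral_diff[OF G(2) F(2), symmetric])
  also have "\<dots> = (LINT x|lborel. (if x \<in> U then u x * (partial_deriv j g x - partial_deriv l f x) else 0))"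
    by (intro Bochner_Integration.integral_cong) (auto simp: algebra_simps)
  finally show ?thesis .
qed

context volume_manifold
begin

text \<open>In the chart \<open>a\<close>, contracting this field with the volume form gives the differential of \<open>u\<close>
  times a coordinate differential, an exact form.\<close>

definition curl_field :: "'a chart \<Rightarrow> (real^3 \<Rightarrow> real) \<Rightarrow> 3 \<Rightarrow> 3 \<Rightarrow> 'a vfield" where
  "curl_field a u j l = vfield_extend a
    (\<lambda>x. inverse (rho a (chart_inv a x)) *\<^sub>R (partial_deriv l u x *\<^sub>R axis j 1 - partial_deriv j u x *\<^sub>R axis l 1))"

context
  fixes a :: "'a chart" and u :: "real^3 \<Rightarrow> real" and K :: "(real^3) set"
  assumes a: "a \<in> A" and u: "smooth_on UNIV u" and K: "compact K" "K \<subseteq> cimage a" "\<And>x. x \<notin> K \<Longrightarrow> u x = 0"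
begin

lemma du_zero: "x \<notin> K \<Longrightarrow> partial_deriv i u x = 0"
  by (rule csupp_partial[OF u K(1,3)])

lemma curl_field_smooth: "curl_field a u j l \<in> smooth_vfields A"
  unfolding curl_field_def
proof (rule vfield_extend_smooth[OF a _ K(1,2)])
  have "rho a (chart_inv a x) \<noteq> 0" if "x \<in> cimage a" for x using rho_pos[OF a, of "chart_inv a x"] a that by simp
  then show "smooth_on (cimage a) (\<lambda>x. inverse (rho a (chart_inv a x)) *\<^sub>R (partial_deriv l u x *\<^sub>R axis j 1 - partial_deriv j u x *\<^sub>R axis l 1))"
    by (intro smooth_on_scaleR smooth_on_diff smooth_on_inverse open_cimage a smooth_rho smooth_on_const
      smooth_on_subset[OF smooth_on_partial[OF u]]) auto
qed (simp add: du_zero)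

lemma dir_deriv_curl_field:
  assumes f: "smooth_fun A f" and p: "p \<in> cdom a"
  shows "dir_deriv A (curl_field a u j l) f p = inverse (rho a p) *\<^sub>R
    (partial_deriv l u (coord a p) *\<^sub>R partial_deriv j (f \<circ> chart_inv a) (coord a p)
      - partial_deriv j u (coord a p) *\<^sub>R partial_deriv l (f \<circ> chart_inv a) (coord a p))"
proof -
  have lin: "linear (frechet_derivative (f \<circ> chart_inv a) (at (coord a p)))"
    by (rule linear_frechet_derivative[OF differentiable_chart[OF f a p]])
  have "curl_field a u j l a p = inverse (rho a p) *\<^sub>R (partial_deriv l u (coord a p) *\<^sub>R axis j 1 - partial_deriv j u (coord a p) *\<^sub>R axis l 1)"
    unfolding curl_field_def vfield_extend_self[OF a p] using a p by simp
  then show ?thesis unfolding dir_deriv_chart[OF curl_field_smooth f a p] partial_deriv_def[of _ "f \<circ> chart_inv a"]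
    by (simp add: linear_scale[OF lin] linear_diff[OF lin])
qed

text \<open>The density in the integral cancels the factor \<open>1 / rho\<close> of the field, so
  the volume form disappears and plain integration by parts applies.\<close>

lemma vint_curl:
  assumes c: "cont F" and out: "\<And>p. p \<notin> cdom a \<Longrightarrow> F p = 0"
    and f: "smooth_on (cimage a) f" and g: "smooth_on (cimage a) g"
    and F: "\<And>p. p \<in> cdom a \<Longrightarrow> F p = inverse (rho a p) * (partial_deriv l u (coord a p) * f (coord a p) - partial_deriv j u (coord a p) * g (coord a p))"
  shows "vint F = (LINT x|lborel. (if x \<in> cimage a then u x * (partial_deriv j g x - partial_deriv l f x) else 0))"
proof -
  have Z: "compact (chart_inv a ` K)" "chart_inv a ` K \<subseteq> cdom a" using compact_chart_inv_image a K by auto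
  have "F p = 0" if "p \<notin> chart_inv a ` K" for p
  proof (cases "p \<in> cdom a")
    case True
    then have "coord a p \<notin> K" using that a by (force simp: image_iff)
    then show ?thesis using F[OF True] du_zero by simp
  qed (rule out)
  then have "supported_in a F" unfolding supported_in_def using Z by blast
  then have "vint F = (LINT x|lborel. local_rep a (\<lambda>p. F p * rho a p) x)" by (rule vint_chart[OF a c])
  also have "local_rep a (\<lambda>p. F p * rho a p) = (\<lambda>x. if x \<in> cimage a then partial_deriv l u x * f x - partial_deriv j u x * g x else 0)"
  proof
    fix x
    show "local_rep a (\<lambda>p. F p * rho a p) x = (if x \<in> cimage a then partial_deriv l u x * f x - partial_deriv j u x * g x else 0)"
    proof (cases "x \<in> cimage a")
      case True
      then have p: "chart_inv a x \<in> cdom a" using a by simp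
      have "rho a (chart_inv a x) > 0" by (rule rho_pos[OF a p])
      then show ?thesis using True F[OF p] a by (simp add: local_rep_def)
    qed (simp add: local_rep_def)
  qed
  also have "(LINT x|lborel. (if x \<in> cimage a then partial_deriv l u x * f x - partial_deriv j u x * g x else 0))
    = (LINT x|lborel. (if x \<in> cimage a then u x * (partial_deriv j g x - partial_deriv l f x) else 0))"
    by (rule integral_curl_cutoff[OF open_cimage[OF a] u K f g])
  finally show ?thesis .
qed

lemma dir_deriv_curl_field_out: "smooth_fun A f \<Longrightarrow> p \<notin> cdom a \<Longrightarrow> dir_deriv A (curl_field a u j l) f p = 0"
  unfolding curl_field_def
  by (subst dir_deriv_vfield_extend[OF a curl_field_smooth[unfolded curl_field_def]]) (auto simp: extend_zero_def)

lemma partial_commute_smooth_fun: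
  fixes f :: "'a \<Rightarrow> real"
  assumes "smooth_fun A f" "x \<in> cimage a"
  shows "partial_deriv i (partial_deriv j (f \<circ> chart_inv a)) x = partial_deriv j (partial_deriv i (f \<circ> chart_inv a)) x"
  using partial_deriv_commute_real[OF open_cimage[OF a] _ assms(2)] smooth_fun_chart[OF assms(1) a] smooth_on_iff_ndiff by blast

text \<open>The weak form of the vanishing of the second exterior derivative: after integration by
  parts only a difference of mixed second derivatives is left.\<close>

lemma curl_field_div_free: "divergence_free A dvol (curl_field a u j l)"
proof (rule divergence_freeI[OF curl_field_smooth])
  fix f :: "'a \<Rightarrow> real" assume f: "smooth_fun A f"
  have s: "smooth_on (cimage a) (partial_deriv i (f \<circ> chart_inv a))" for i
    by (rule smooth_on_partial[OF smooth_fun_chart[OF f a]])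
  have "vint (dir_deriv A (curl_field a u j l) f) = (LINT x|lborel. (if x \<in> cimage a then u x * (partial_deriv j (partial_deriv l (f \<circ> chart_inv a)) x - partial_deriv l (partial_deriv j (f \<circ> chart_inv a)) x) else 0))"
    by (rule vint_curl[OF smooth_fun_continuous[OF smooth_dir_deriv[OF curl_field_smooth f]] dir_deriv_curl_field_out[OF f] s s])
      (simp_all add: dir_deriv_curl_field[OF f])
  also have "(\<lambda>x. if x \<in> cimage a then u x * (partial_deriv j (partial_deriv l (f \<circ> chart_inv a)) x - partial_deriv l (partial_deriv j (f \<circ> chart_inv a)) x) else 0) = (\<lambda>x. 0)"
    using partial_commute_smooth_fun[OF f, of _ j l] by auto
  finally show "vint (dir_deriv A (curl_field a u j l) f) = 0" by simp
qed

text \<open>After integration by parts the second derivatives of \<open>f\<close> cancel. The two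
  remaining products are equal because the unit is skew, which gives the factor 2 instead of
  cancellation.\<close>

lemma ip_unit_mult_curl:
  assumes f: "smooth_fun A f"
  shows "ip f (\<lambda>p. unit_mult i (dir_deriv A (curl_field a u j l) f p)) =
    (LINT x|lborel. (if x \<in> cimage a then
       u x * (2 * (partial_deriv j (f \<circ> chart_inv a) x \<bullet> unit_mult i (partial_deriv l (f \<circ> chart_inv a) x))) else 0))"
proof -
  define h where "h = f \<circ> chart_inv a"
  have h: "smooth_on (cimage a) h" unfolding h_def by (rule smooth_fun_chart[OF f a])
  \<comment> \<open>The components of the one-form that pairs \<open>f\<close> with the unit times
    its differential; the integrand becomes a component of its exterior derivative.\<close>
  define \<alpha> where "\<alpha> m x = h x \<bullet> unit_mult i (partial_deriv m h x)" for m x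
  have \<alpha>: "smooth_on (cimage a) (\<alpha> m)" for m unfolding \<alpha>_def
    by (intro smooth_on_inner open_cimage a h smooth_on_linear[OF _ bounded_linear_unit_mult] smooth_on_partial)
  have d\<alpha>: "partial_deriv n (\<alpha> m) x = h x \<bullet> unit_mult i (partial_deriv n (partial_deriv m h) x) + partial_deriv n h x \<bullet> unit_mult i (partial_deriv m h x)"
    if x: "x \<in> cimage a" for n m x
  proof -
    have dm: "partial_deriv m h differentiable at x" by (rule smooth_on_differentiable[OF smooth_on_partial[OF h] x])
    have "(\<lambda>x. unit_mult i (partial_deriv m h x)) differentiable at x"
      using smooth_on_differentiable[OF smooth_on_linear[OF open_cimage[OF a] bounded_linear_unit_mult smooth_on_partial[OF h]] x] .
    from partial_deriv_bilinear[OF bounded_bilinear_inner smooth_on_differentiable[OF h x] this, of n]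
    show ?thesis unfolding \<alpha>_def[abs_def] partial_deriv_bounded_linear[OF bounded_linear_unit_mult dm] .
  qed
  have "ip f (\<lambda>p. unit_mult i (dir_deriv A (curl_field a u j l) f p)) =
    (LINT x|lborel. (if x \<in> cimage a then u x * (partial_deriv j (\<alpha> l) x - partial_deriv l (\<alpha> j) x) else 0))"
    unfolding ip_def
  proof (rule vint_curl[OF _ _ \<alpha> \<alpha>])
    show "cont (\<lambda>p. f p \<bullet> unit_mult i (dir_deriv A (curl_field a u j l) f p))"
      by (intro continuous_on_inner smooth_fun_continuous f smooth_unit_mult smooth_dir_deriv curl_field_smooth)
    show "f p \<bullet> unit_mult i (dir_deriv A (curl_field a u j l) f p) = 0" if "p \<notin> cdom a" for p
      using dir_deriv_curl_field_out[OF f that] by (simp add: unit_mult_zero)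
    show "f p \<bullet> unit_mult i (dir_deriv A (curl_field a u j l) f p) =
      inverse (rho a p) * (partial_deriv l u (coord a p) * \<alpha> j (coord a p) - partial_deriv j u (coord a p) * \<alpha> l (coord a p))" if "p \<in> cdom a" for p
      unfolding dir_deriv_curl_field[OF f that] \<alpha>_def h_def[symmetric]
      using that a by (simp add: unit_mult_scaleR unit_mult_diff inner_diff_right h_def)
  qed
  also have "\<dots> = (LINT x|lborel. (if x \<in> cimage a then u x * (2 * (partial_deriv j h x \<bullet> unit_mult i (partial_deriv l h x))) else 0))"
  proof (rule Bochner_Integration.integral_cong[OF refl])
    fix x
    show "(if x \<in> cimage a then u x * (partial_deriv j (\<alpha> l) x - partial_deriv l (\<alpha> j) x) else 0) =
      (if x \<in> cimage a then u x * (2 * (partial_deriv j h x \<bullet> unit_mult i (partial_deriv l h x))) else 0)"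
      using partial_deriv_commute[OF open_cimage[OF a] h, of x j l] unit_mult_skew[of i "partial_deriv l h x" "partial_deriv j h x"]
      by (auto simp: d\<alpha> inner_commute)
  qed
  finally show ?thesis unfolding h_def .
qed

end

lemma zero_vfield: "(\<lambda>c p. 0) \<in> smooth_vfields A"
  using linear_0[OF linear_transition] by (auto simp: smooth_vfields_def comp_def)

lemma dir_deriv_zero_vfield: "smooth_fun A f \<Longrightarrow> dir_deriv A (\<lambda>c p. 0) f p = 0"
  using charts_cover[of p] dir_deriv_partial[OF zero_vfield, of f _ p] by auto

lemma zero_vfield_div_free: "divergence_free A dvol (\<lambda>c p. 0)"
proof (rule divergence_freeI[OF zero_vfield])
  fix f :: "'a \<Rightarrow> real" assume "smooth_fun A f"
  then have "dir_deriv A (\<lambda>c p. 0) f = (\<lambda>p. 0)" using dir_deriv_zero_vfield by auto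
  then show "vint (dir_deriv A (\<lambda>c p. 0) f) = 0" by simp
qed

lemma exists_detecting_field:
  assumes f: "smooth_fun A f" and a: "a \<in> A" and p: "p \<in> cdom a"
    and nz: "partial_deriv j (f \<circ> chart_inv a) (coord a p) \<bullet> unit_mult i (partial_deriv l (f \<circ> chart_inv a) (coord a p)) \<noteq> 0"
  shows "\<exists>w. (\<forall>i. w i \<in> smooth_vfields A \<and> divergence_free A dvol (w i)) \<and> ip f (fueter_op w f) \<noteq> 0"
proof -
  \<comment> \<open>Twice \<open>s\<close> is the factor against which \<open>u\<close> is
    integrated in \<open>ip_unit_mult_curl\<close>.\<close>
  define s where "s x = partial_deriv j (f \<circ> chart_inv a) x \<bullet> unit_mult i (partial_deriv l (f \<circ> chart_inv a) x)" for x
  have s: "smooth_on (cimage a) s" unfolding s_def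
    by (intro smooth_on_inner open_cimage a smooth_fun_chart f smooth_on_linear[OF _ bounded_linear_unit_mult] smooth_on_partial)
  obtain b :: "'a \<Rightarrow> real" where b: "smooth_fun A b" "\<And>q. b q \<ge> 0" "b p > 0" "supported_in a b"
    using bump_exists[OF a p] by blast
  define b' where "b' = local_rep a b"
  have b': "smooth_on UNIV b'" unfolding b'_def by (rule smooth_local_rep(1)[OF a smooth_fun_chart[OF b(1) a] b(4)])
  obtain K where K: "compact K" "K \<subseteq> cimage a" "\<And>x. x \<notin> K \<Longrightarrow> b' x = 0"
    using smooth_local_rep(2)[OF a smooth_fun_chart[OF b(1) a] b(4)] unfolding b'_def by blast
  \<comment> \<open>Taking \<open>s\<close> itself, cut off by a bump, turns the integrand into a
    nonnegative function that is positive at \<open>p\<close>.\<close>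
  define u where "u x = (if x \<in> cimage a then b' x * s x else 0)" for x
  have u: "smooth_on UNIV u" unfolding u_def by (rule smooth_cutoff_mult[OF open_cimage[OF a] b' K s])
  have uK: "x \<notin> K \<Longrightarrow> u x = 0" for x using K(3) by (simp add: u_def)
  define w where "w k = (if k = i then curl_field a u j l else (\<lambda>c p. 0))" for k
  have w: "w k \<in> smooth_vfields A \<and> divergence_free A dvol (w k)" for k
    using curl_field_smooth[OF a u K(1,2) uK] curl_field_div_free[OF a u K(1,2) uK] zero_vfield zero_vfield_div_free
    by (simp add: w_def)
  have "fueter_op w f q = unit_mult i (dir_deriv A (curl_field a u j l) f q)" for q
  proof -
    have "fueter_op w f q = (\<Sum>k\<in>UNIV. if k = i then unit_mult i (dir_deriv A (curl_field a u j l) f q) else 0)"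
      unfolding fueter_op_def by (intro sum.cong refl) (simp add: w_def dir_deriv_zero_vfield[OF f] unit_mult_zero)
    then show ?thesis by simp
  qed
  then have fw: "fueter_op w f = (\<lambda>q. unit_mult i (dir_deriv A (curl_field a u j l) f q))" by auto
  define G where "G x = (if x \<in> cimage a then u x * (2 * s x) else 0)" for x
  have G: "smooth_on UNIV G" unfolding G_def
    by (rule smooth_cutoff_mult[OF open_cimage[OF a] u K(1,2) uK], assumption)
      (intro smooth_on_mult open_cimage a s smooth_on_const)
  have "ip f (fueter_op w f) \<noteq> 0"
  proof
    assume "ip f (fueter_op w f) = 0"
    moreover have "ip f (fueter_op w f) = (LINT x|lborel. G x)"
      unfolding fw G_def s_def by (rule ip_unit_mult_curl[OF a u K(1,2) uK f])
    ultimately have "(LINT x|lborel. G x) = 0" by simp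
    moreover have "G x \<ge> 0" for x
    proof -
      have "b' x \<ge> 0" using b(2) by (simp add: b'_def local_rep_def)
      then have "b' x * (s x * s x) \<ge> 0" by simp
      then show ?thesis by (simp add: G_def u_def mult_ac)
    qed
    moreover have "cont_csupp G" by (rule cont_csuppI[OF smooth_on_continuous[OF G] K(1)]) (simp add: G_def uK)
    ultimately have "G (coord a p) = 0" using integral_nonneg_zero_imp by blast
    then show False using nz b(3) a p by (simp add: G_def u_def b'_def local_rep_def s_def[symmetric])
  qed
  then show ?thesis using w by blast
qed

end

context frame
begin

text \<open>The contrapositive of the pointwise argument: vanishing of all mixed products of
  coordinate derivatives passes by bilinearity to frame derivatives, and then
  \<open>norm_sq_sum_unit_mult\<close> with \<open>dirac f p = 0\<close> leaves a sum of
  squares.\<close>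

lemma ker_detected:
  assumes f: "f \<in> ker" and nz: "d k f p \<noteq> 0"
  shows "\<exists>w. (\<forall>i. w i \<in> smooth_vfields A \<and> divergence_free A dvol (w i)) \<and> ip f (fueter_op w f) \<noteq> 0"
proof -
  obtain a where a: "a \<in> A" "p \<in> cdom a" using charts_cover by blast
  have sf: "smooth_fun A f" by (rule ker_smooth[OF f])
  define D where "D l = partial_deriv l (f \<circ> chart_inv a) (coord a p)" for l
  have "\<exists>i j l. D j \<bullet> unit_mult i (D l) \<noteq> 0"
  proof (rule ccontr)
    assume "\<not> ?thesis"
    then have z: "D j \<bullet> unit_mult i (D l) = 0" for i j l by blast
    have dD: "d m f p = (\<Sum>l\<in>UNIV. v m a p $ l *\<^sub>R D l)" for m
      using dir_deriv_partial[OF v_smooth sf a] by (simp add: D_def)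
    have lin: "unit_mult i (\<Sum>l\<in>UNIV. c l *\<^sub>R D l) = (\<Sum>l\<in>UNIV. c l *\<^sub>R unit_mult i (D l))" for i and c :: "3 \<Rightarrow> real"
      using bounded_linear.linear[OF bounded_linear_unit_mult[of i]] by (simp add: linear_sum linear_scale)
    have zz: "d m f p \<bullet> unit_mult i (d n f p) = 0" for m n i
      unfolding dD lin by (simp add: inner_sum_left inner_sum_right z)
    have "dirac f p = 0" using ker_dirac[OF f] by simp
    then have "(unit_mult 1 (d 1 f p) + unit_mult 2 (d 2 f p) + unit_mult 3 (d 3 f p)) \<bullet> (unit_mult 1 (d 1 f p) + unit_mult 2 (d 2 f p) + unit_mult 3 (d 3 f p)) = 0"
      by (simp add: dirac_eq sum_3)
    then have "d 1 f p \<bullet> d 1 f p + d 2 f p \<bullet> d 2 f p + d 3 f p \<bullet> d 3 f p = 0"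
      unfolding norm_sq_sum_unit_mult by (simp add: zz)
    then have "d 1 f p = 0 \<and> d 2 f p = 0 \<and> d 3 f p = 0"
      using inner_ge_zero[of "d 1 f p"] inner_ge_zero[of "d 2 f p"] inner_ge_zero[of "d 3 f p"]
      by (metis add_nonneg_eq_0_iff add_nonneg_nonneg inner_eq_zero_iff)
    then show False using nz exhaust_3[of k] by auto
  qed
  then show ?thesis using exists_detecting_field[OF sf a] unfolding D_def by blast
qed

text \<open>Expanding \<open>f\<close> in the basis twice, with symmetry in between.
  \<open>kernel_drops\<close> needs a nonzero matrix entry rather than a nonzero value of the
  quadratic form.\<close>

lemma detected_basis:
  assumes w: "\<And>i. w i \<in> smooth_vfields A" "\<And>i. divergence_free A dvol (w i)"
    and f: "f \<in> ker" and nz: "ip f (fueter_op w f) \<noteq> 0"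
  shows "\<exists>i<kdim. \<exists>j<kdim. ip (basis i) (fueter_op w (basis j)) \<noteq> 0"
proof (rule ccontr)
  assume "\<not> ?thesis"
  then have z: "ip (basis i) (fueter_op w (basis j)) = 0" if "i < kdim" "j < kdim" for i j using that by blast
  have sf: "smooth_fun A f" by (rule ker_smooth[OF f])
  have sb: "smooth_fun A (basis i)" if "i < kdim" for i by (rule ker_smooth[OF basis(1)[OF that]])
  have cw: "cont (fueter_op w g)" if "smooth_fun A g" for g
    by (rule smooth_fun_continuous[OF smooth_fueter_op[where w = w, OF w(1) that]])
  have right: "ip g f = (\<Sum>j<kdim. ip f (basis j) * ip g (basis j))" if g: "cont g" for g
  proof -
    have "ip g (proj f) = (\<Sum>j<kdim. ip f (basis j) * ip g (basis j))"
      unfolding proj_def by (rule ip_lincomb_right) (use cont_basis g in auto)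
    then show ?thesis using proj_id[OF f] by simp
  qed
  have "ip (fueter_op w f) f = (\<Sum>j<kdim. ip f (basis j) * ip (fueter_op w f) (basis j))"
    by (rule right[OF cw[OF sf]])
  also have "\<dots> = 0"
  proof (intro sum.neutral ballI)
    fix j assume "j \<in> {..<kdim}"
    then have j: "j < kdim" by simp
    have "ip (fueter_op w f) (basis j) = ip (fueter_op w (basis j)) f"
      using fueter_op_symmetric[where w = w, OF w sf sb[OF j]] by (simp add: ip_commute)
    also have "\<dots> = (\<Sum>i<kdim. ip f (basis i) * ip (fueter_op w (basis j)) (basis i))"
      by (rule right[OF cw[OF sb[OF j]]])
    also have "\<dots> = 0" using z j by (intro sum.neutral) (auto simp: ip_commute[of "fueter_op w (basis j)"])
    finally show "ip f (basis j) * ip (fueter_op w f) (basis j) = 0" by simp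
  qed
  finally show False using nz by (simp add: ip_commute[of "fueter_op w f"])
qed

text \<open>The frame spans, so \<open>f\<close> is constant on small coordinate balls; hence its
  level set is open as well as closed, and connectedness finishes.\<close>

lemma constant_if_d_zero:
  assumes conn: "connected (UNIV :: 'a set)" and f: "smooth_fun A (f :: 'a \<Rightarrow> quat)" and z: "\<And>i p. d i f p = 0"
  shows "\<exists>q. \<forall>p. f p = q"
proof -
  have loc: "\<exists>U. open U \<and> p \<in> U \<and> (\<forall>q\<in>U. f q = f p)" for p
  proof -
    obtain c where c: "c \<in> A" "p \<in> cdom c" using charts_cover by blast
    define x where "x = coord c p"
    have x: "x \<in> cimage c" "chart_inv c x = p" using c by (auto simp: x_def)
    obtain r where r: "r > 0" "ball x r \<subseteq> cimage c" using open_cimage[OF c(1)] x(1) open_contains_ball by blast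
    define h where "h = f \<circ> chart_inv c"
    have "(h has_derivative (\<lambda>h. 0)) (at y within ball x r)" if y: "y \<in> ball x r" for y
    proof -
      have yc: "y \<in> cimage c" using r(2) y by blast
      have "partial_deriv l h y = 0" for l unfolding h_def partial_frame[OF c(1) yc f] using z by simp
      then show ?thesis
        using has_derivative_partial[OF smooth_on_differentiable[OF smooth_fun_chart[OF f c(1)] yc]]
        unfolding h_def[symmetric] by (simp add: has_derivative_at_withinI)
    qed
    then obtain k where k: "\<And>y. y \<in> ball x r \<Longrightarrow> h y = k"
      using has_derivative_zero_constant[OF convex_ball[of x r]] by blast
    define U where "U = cdom c \<inter> coord c -` ball x r"
    have "open U" unfolding U_def
      by (rule continuous_open_preimage[OF continuous_coord[OF c(1)] open_cdom[OF c(1)] open_ball])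
    moreover have "p \<in> U" using c r(1) by (simp add: U_def x_def)
    moreover have "f q = k" if "q \<in> U" for q using k[of "coord c q"] that c(1) by (simp add: U_def h_def)
    ultimately show ?thesis by blast
  qed
  obtain p0 :: 'a where True by simp
  define S where "S = {p. f p = f p0}"
  have "open S"
    unfolding open_subopen[of S]
  proof
    fix p assume p: "p \<in> S"
    obtain U where U: "open U" "p \<in> U" "\<forall>q\<in>U. f q = f p" using loc by blast
    moreover have "q \<in> S" if "q \<in> U" for q
    proof -
      have "f q = f p" using U(3) that by blast
      also have "\<dots> = f p0" using p by (simp add: S_def)
      finally show ?thesis by (simp add: S_def)
    qed
    ultimately show "\<exists>T. open T \<and> p \<in> T \<and> T \<subseteq> S" by blast
  qed
  moreover have "closed S" unfolding S_def
    by (rule closed_Collect_eq[OF smooth_fun_continuous[OF f] continuous_on_const])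
  ultimately have "S = {} \<or> S = UNIV" using conn by (simp add: connected_clopen)
  moreover have "p0 \<in> S" by (simp add: S_def)
  ultimately have "S = UNIV" by auto
  then show ?thesis unfolding S_def by blast
qed

lemma kernel_can_drop:
  assumes conn: "connected (UNIV :: 'a set)" and f: "f \<in> ker" and nc: "\<not> (\<exists>q. \<forall>p. f p = q)"
  shows "\<exists>w t0. (\<forall>i. w i \<in> smooth_vfields A \<and> divergence_free A dvol (w i)) \<and> t0 > 0 \<and>
    (\<forall>t e m. 0 < t \<longrightarrow> t < t0 \<longrightarrow> (\<forall>i<m. smooth_fun A (e i) \<and> (\<forall>p. dirac (e i) p + t *\<^sub>R fueter_op w (e i) p = 0)) \<longrightarrow>
    orthonormal e m \<longrightarrow> m < kdim)"
proof -
  obtain i p where "d i f p \<noteq> 0" using constant_if_d_zero[OF conn ker_smooth[OF f]] nc by blast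
  then obtain w where w: "\<And>i. w i \<in> smooth_vfields A" "\<And>i. divergence_free A dvol (w i)" "ip f (fueter_op w f) \<noteq> 0"
    using ker_detected[OF f] by blast
  obtain a b where "a < kdim" "b < kdim" "ip (basis a) (fueter_op w (basis b)) \<noteq> 0"
    using detected_basis[where w = w, OF w(1,2) f w(3)] by blast
  from kernel_drops[where w = w, OF w(1,2) this] w(1,2) show ?thesis by blast
qed

end

section \<open>Regular frames in the smooth topology\<close>

text \<open>The chart counterpart of \<open>cbound\<close>. It mediates between the seminorms of the
  smooth topology, which use coordinate derivatives, and bounds along the frame.\<close>

primrec sbound :: "nat \<Rightarrow> real \<Rightarrow> (real^'n::finite) set \<Rightarrow> (real^'n \<Rightarrow> 'b::real_normed_vector) \<Rightarrow> bool" where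
  "sbound 0 e K g = (\<forall>x\<in>K. norm (g x) \<le> e)"
| "sbound (Suc k) e K g = (sbound k e K g \<and> (\<forall>i. sbound k e K (partial_deriv i g)))"

lemma sbound_mono: "sbound k e K g \<Longrightarrow> e \<le> e' \<Longrightarrow> sbound k e' K g"
  by (induction k arbitrary: g) (auto intro: order_trans)

lemma sbound_cong:
  assumes "open U" "K \<subseteq> U" "\<And>x. x \<in> U \<Longrightarrow> g x = h x" "sbound k e K g"
  shows "sbound k e K h"
  using assms(3,4)
proof (induction k arbitrary: g h)
  case 0
  then show ?case using assms(2) by (auto simp: subset_iff)
next
  case (Suc k)
  have "partial_deriv i g x = partial_deriv i h x" if "x \<in> U" for i x
    by (rule partial_deriv_cong_open[OF assms(1) that Suc.prems(1)])
  then have "sbound k e K (partial_deriv i h)" for i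
    using Suc.IH[of "partial_deriv i g" "partial_deriv i h"] Suc.prems(2) by auto
  moreover have "sbound k e K h" using Suc.IH[of g h] Suc.prems by auto
  ultimately show ?case by simp
qed

lemma sbound_zero [simp]: "0 \<le> e \<Longrightarrow> sbound k e K (\<lambda>x. 0)"
  by (induction k) auto

lemma sbound_add:
  assumes U: "open U" "K \<subseteq> U" and "smooth_on U g" "smooth_on U h" "sbound k a K g" "sbound k b K h"
  shows "sbound k (a + b) K (\<lambda>x. g x + h x)"
  using assms(3-)
proof (induction k arbitrary: g h)
  case 0
  then show ?case by (auto intro: norm_triangle_mono)
next
  case (Suc k)
  have "sbound k (a + b) K (partial_deriv i (\<lambda>x. g x + h x))" for i
  proof (rule sbound_cong[OF U])
    show "sbound k (a + b) K (\<lambda>x. partial_deriv i g x + partial_deriv i h x)"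
      using Suc.prems by (intro Suc.IH smooth_on_partial) auto
    show "partial_deriv i g x + partial_deriv i h x = partial_deriv i (\<lambda>x. g x + h x) x" if "x \<in> U" for x
      using Suc.prems that by (intro partial_deriv_add[symmetric] smooth_on_differentiable[of U])
  qed
  then show ?case using Suc by simp
qed

lemma sbound_sum:
  assumes U: "open U" "K \<subseteq> U" and "finite I" "\<And>i. i \<in> I \<Longrightarrow> smooth_on U (g i)" "\<And>i. i \<in> I \<Longrightarrow> sbound k (a i) K (g i)"
  shows "sbound k (\<Sum>i\<in>I. a i) K (\<lambda>x. \<Sum>i\<in>I. g i x)"
  using assms(3-)
proof (induction I)
  case (insert i I)
  then have "sbound k (a i + (\<Sum>i\<in>I. a i)) K (\<lambda>x. g i x + (\<Sum>i\<in>I. g i x))"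
    by (intro sbound_add[OF U] smooth_on_sum[OF U(1)]) auto
  then show ?case using insert by simp
qed simp

text \<open>Compactness of \<open>K\<close> bounds \<open>h\<close> and its derivatives. The
  constant is the same for all \<open>g\<close> and \<open>e\<close>, so smallness of
  \<open>g\<close> is preserved.\<close>

lemma sbound_mult:
  fixes h :: "real^'n::finite \<Rightarrow> real"
  assumes U: "open U" and K: "compact K" "K \<subseteq> U" and h: "smooth_on U h"
  shows "\<exists>C\<ge>0. \<forall>g e. smooth_on U g \<longrightarrow> sbound k e K g \<longrightarrow> e \<ge> 0 \<longrightarrow> sbound k (C * e) K (\<lambda>x. h x * g x)"
  using h
proof (induction k arbitrary: h)
  case 0
  have "compact (h ` K)"
    by (rule compact_continuous_image[OF continuous_on_subset[OF smooth_on_continuous[OF 0] K(2)] K(1)])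
  then obtain C where C: "\<And>x. x \<in> K \<Longrightarrow> norm (h x) \<le> C" using compact_imp_bounded bounded_iff by (metis imageI)
  have "\<bar>h x\<bar> * \<bar>g x\<bar> \<le> max C 0 * e" if "\<forall>x\<in>K. \<bar>g x\<bar> \<le> e" "x \<in> K" for g e x
    using C[of x] that by (intro mult_mono) auto
  then show ?case by (intro exI[of _ "max C 0"]) (auto simp: abs_mult)
next
  case (Suc k)
  obtain C where C: "C \<ge> 0" "\<And>g e. smooth_on U g \<Longrightarrow> sbound k e K g \<Longrightarrow> e \<ge> 0 \<Longrightarrow> sbound k (C * e) K (\<lambda>x. h x * g x)"
    using Suc.IH[OF Suc.prems] by blast
  have "\<forall>i. \<exists>D\<ge>0. \<forall>g e. smooth_on U g \<longrightarrow> sbound k e K g \<longrightarrow> e \<ge> 0 \<longrightarrow> sbound k (D * e) K (\<lambda>x. partial_deriv i h x * g x)"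
    using Suc.IH[OF smooth_on_partial[OF Suc.prems]] by blast
  then obtain D where D: "\<And>i. D i \<ge> 0"
    "\<And>i g e. smooth_on U g \<Longrightarrow> sbound k e K g \<Longrightarrow> e \<ge> 0 \<Longrightarrow> sbound k (D i * e) K (\<lambda>x. partial_deriv i h x * g x)"
    by metis
  define B where "B = C + (\<Sum>i\<in>UNIV. D i)"
  have Di: "D i \<le> (\<Sum>i\<in>UNIV. D i)" for i by (rule member_le_sum) (use D(1) in auto)
  have CB: "C \<le> B" "0 \<le> B" using C(1) D(1) by (auto simp: B_def intro!: sum_nonneg add_nonneg_nonneg)
  have "sbound (Suc k) (B * e) K (\<lambda>x. h x * g x)" if g: "smooth_on U g" "sbound (Suc k) e K g" "e \<ge> 0" for g e
  proof -
    have "sbound k (B * e) K (partial_deriv i (\<lambda>x. h x * g x))" for i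
    proof (rule sbound_cong[OF U K(2)])
      have "sbound k (C * e + D i * e) K (\<lambda>x. h x * partial_deriv i g x + partial_deriv i h x * g x)"
        using g by (intro sbound_add[OF U K(2)] smooth_on_mult U Suc.prems smooth_on_partial C D) auto
      moreover have "C * e + D i * e \<le> B * e"
        unfolding B_def distrib_right[symmetric] by (intro mult_right_mono add_left_mono Di g)
      ultimately show "sbound k (B * e) K (\<lambda>x. h x * partial_deriv i g x + partial_deriv i h x * g x)"
        by (rule sbound_mono)
      show "h x * partial_deriv i g x + partial_deriv i h x * g x = partial_deriv i (\<lambda>x. h x * g x) x" if "x \<in> U" for x
        by (rule partial_deriv_bilinear[OF bounded_bilinear_mult, symmetric];
            rule smooth_on_differentiable[of U]) (use Suc.prems g that in auto)
    qed
    moreover have "sbound k (B * e) K (\<lambda>x. h x * g x)"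
      by (rule sbound_mono[OF C(2)[OF g(1) _ g(3)] mult_right_mono[OF CB(1) g(3)]]) (use g(2) in simp)
    ultimately show ?thesis by simp
  qed
  then show ?case using CB(2) by blast
qed

lemma sbound_lincomb:
  fixes h :: "'i::finite \<Rightarrow> real^'n::finite \<Rightarrow> real"
  assumes U: "open U" and K: "compact K" "K \<subseteq> U" and h: "\<And>l. smooth_on U (h l)"
  shows "\<exists>C\<ge>0. \<forall>g e. (\<forall>l. smooth_on U (g l)) \<longrightarrow> (\<forall>l. sbound k e K (g l)) \<longrightarrow> e \<ge> 0 \<longrightarrow>
    sbound k (C * e) K (\<lambda>x. \<Sum>l\<in>UNIV. h l x * g l x)"
proof -
  have "\<forall>l. \<exists>D\<ge>0. \<forall>g e. smooth_on U g \<longrightarrow> sbound k e K g \<longrightarrow> e \<ge> 0 \<longrightarrow> sbound k (D * e) K (\<lambda>x. h l x * g x)"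
    using sbound_mult[OF U K h] by blast
  then obtain D where D: "\<And>l. D l \<ge> 0"
    "\<And>l g e. smooth_on U g \<Longrightarrow> sbound k e K g \<Longrightarrow> e \<ge> 0 \<Longrightarrow> sbound k (D l * e) K (\<lambda>x. h l x * g x)"
    by metis
  have "sbound k (\<Sum>l\<in>UNIV. D l * e) K (\<lambda>x. \<Sum>l\<in>UNIV. h l x * g l x)"
    if "\<forall>l. smooth_on U (g l)" "\<forall>l. sbound k e K (g l)" "e \<ge> 0" for g e
    using that by (intro sbound_sum[OF U K(2)] smooth_on_mult U h D) auto
  then show ?thesis using D(1) by (intro exI[of _ "\<Sum>l\<in>UNIV. D l"]) (auto simp: sum_distrib_right intro!: sum_nonneg)
qed

lemma sbound_nth:
  fixes g :: "real^'n::finite \<Rightarrow> real^'m::finite"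
  assumes U: "open U" "K \<subseteq> U" and "smooth_on U g" "sbound k e K g"
  shows "sbound k e K (\<lambda>x. g x $ l)"
  using assms(3-)
proof (induction k arbitrary: g)
  case 0
  then show ?case using component_le_norm_cart order_trans by (fastforce simp: real_norm_def)
next
  case (Suc k)
  have "sbound k e K (partial_deriv i (\<lambda>x. g x $ l))" for i
  proof (rule sbound_cong[OF U])
    show "sbound k e K (\<lambda>x. partial_deriv i g x $ l)"
      using Suc.prems by (intro Suc.IH smooth_on_partial) auto
    show "partial_deriv i g x $ l = partial_deriv i (\<lambda>x. g x $ l) x" if "x \<in> U" for x
      by (rule partial_deriv_bounded_linear[OF bounded_linear_vec_nth smooth_on_differentiable[OF Suc.prems(1) that], symmetric])
  qed
  then show ?case using Suc by simp
qed

lemma sbound_if_iter_partial: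
  assumes "\<And>(is :: 'n::finite list) x. length is \<le> k \<Longrightarrow> x \<in> K \<Longrightarrow> norm (iter_partial is g x) \<le> e"
  shows "sbound k e K g"
  using assms
proof (induction k arbitrary: g)
  case 0
  show ?case using 0[of "[]"] by simp
next
  case (Suc k)
  have "sbound k e K (partial_deriv i g)" for i
  proof (rule Suc.IH)
    fix "is" :: "'n list" and x assume "length is \<le> k" "x \<in> K"
    then show "norm (iter_partial is (partial_deriv i g) x) \<le> e"
      using Suc.prems[of "is @ [i]" x] by (simp add: iter_partial_append)
  qed
  moreover have "sbound k e K g" by (rule Suc.IH) (rule Suc.prems, auto)
  ultimately show ?case by simp
qed

context frame
begin

lemma sbound_d:
  assumes c: "c \<in> A" and K: "compact K" "K \<subseteq> cimage c"
  shows "\<exists>C\<ge>0. \<forall>b e. smooth_fun A (b :: 'a \<Rightarrow> real) \<longrightarrow> e \<ge> 0 \<longrightarrow> sbound (Suc k) e K (b \<circ> chart_inv c) \<longrightarrow>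
    sbound k (C * e) K (d i b \<circ> chart_inv c)"
proof -
  have "smooth_on (cimage c) (\<lambda>x. v i c (chart_inv c x) $ l)" for l
    by (rule smooth_on_nth[OF open_cimage[OF c] vfield_smooth[OF v_smooth c]])
  from sbound_lincomb[where h = "\<lambda>l x. v i c (chart_inv c x) $ l", OF open_cimage[OF c] K this, of k]
  obtain C where C: "C \<ge> 0" "\<And>g e. (\<forall>l. smooth_on (cimage c) (g l)) \<Longrightarrow> (\<forall>l. sbound k e K (g l)) \<Longrightarrow> e \<ge> 0 \<Longrightarrow>
    sbound k (C * e) K (\<lambda>x. \<Sum>l\<in>UNIV. v i c (chart_inv c x) $ l * g l x)" by blast
  have "sbound k (C * e) K (d i b \<circ> chart_inv c)"
    if b: "smooth_fun A b" "e \<ge> 0" "sbound (Suc k) e K (b \<circ> chart_inv c)" for b :: "'a \<Rightarrow> real" and e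
  proof (rule sbound_cong[OF open_cimage[OF c] K(2)])
    show "sbound k (C * e) K (\<lambda>x. \<Sum>l\<in>UNIV. v i c (chart_inv c x) $ l * partial_deriv l (b \<circ> chart_inv c) x)"
      using b by (intro C) (auto intro!: smooth_on_partial smooth_fun_chart c)
    show "(\<Sum>l\<in>UNIV. v i c (chart_inv c x) $ l * partial_deriv l (b \<circ> chart_inv c) x) = (d i b \<circ> chart_inv c) x"
      if "x \<in> cimage c" for x
      using dir_deriv_partial[OF v_smooth b(1) c, of "chart_inv c x" i] c that by simp
  qed
  then show ?thesis using C(1) by blast
qed

text \<open>The Cramer quotient is linear in the replaced column; so bounds on the components of
  \<open>X\<close> turn into bounds on its frame coefficients.\<close>

lemma cof_chart:
  assumes X: "X \<in> smooth_vfields A" and c: "c \<in> A" "x \<in> cimage c"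
  shows "cof X j (chart_inv c x) = (\<Sum>l\<in>UNIV. frame_coeff c l j x * X c (chart_inv c x) $ l)"
proof -
  define p where "p = chart_inv c x"
  have p: "p \<in> cdom c" using c by (simp add: p_def)
  have r: "rho c p > 0" using rho_pos c p by blast
  have k: "rho c p * a * inverse (rho c p * b) = a * inverse b" for a b
    using r by (cases "b = 0") (simp_all add: field_simps)
  have cof: "cof X j p = det3 (if j = 1 then X c p else v 1 c p) (if j = 2 then X c p else v 2 c p)
      (if j = 3 then X c p else v 3 c p) * inverse (det3 (v 1 c p) (v 2 c p) (v 3 c p))"
    using exhaust_3[of j]
    by (elim disjE) (simp_all add: cof_def vol3_rho[OF X v_smooth v_smooth c(1) p] vol3_rho[OF v_smooth X v_smooth c(1) p]
        vol3_rho[OF v_smooth v_smooth X c(1) p] vol3_rho[OF v_smooth v_smooth v_smooth c(1) p] k del: inverse_mult_distrib)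
  have e: "det3 (X c p) b z = X c p $ 1 * det3 (axis 1 1) b z + X c p $ 2 * det3 (axis 2 1) b z + X c p $ 3 * det3 (axis 3 1) b z"
    "det3 a (X c p) z = X c p $ 1 * det3 a (axis 1 1) z + X c p $ 2 * det3 a (axis 2 1) z + X c p $ 3 * det3 a (axis 3 1) z"
    "det3 a b (X c p) = X c p $ 1 * det3 a b (axis 1 1) + X c p $ 2 * det3 a b (axis 2 1) + X c p $ 3 * det3 a b (axis 3 1)" for a b z
    by (simp_all add: det3_def algebra_simps)
  define D where "D = inverse (det3 (v 1 c p) (v 2 c p) (v 3 c p))"
  have "cof X j p = (\<Sum>l\<in>UNIV. (det3 (if j = 1 then axis l 1 else v 1 c p) (if j = 2 then axis l 1 else v 2 c p)
      (if j = 3 then axis l 1 else v 3 c p) * D) * X c p $ l)"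
    unfolding cof D_def[symmetric] using exhaust_3[of j]
    by (elim disjE) (simp_all add: sum_3 e algebra_simps)
  then show ?thesis unfolding frame_coeff_def p_def D_def .
qed

lemma sbound_cof:
  assumes c: "c \<in> A" and K: "compact K" "K \<subseteq> cimage c"
  shows "\<exists>C\<ge>0. \<forall>X e. X \<in> smooth_vfields A \<longrightarrow> e \<ge> 0 \<longrightarrow> sbound k e K (\<lambda>x. X c (chart_inv c x)) \<longrightarrow>
    sbound k (C * e) K (cof X j \<circ> chart_inv c)"
proof -
  from sbound_lincomb[where h = "\<lambda>l. frame_coeff c l j", OF open_cimage[OF c] K smooth_frame_coeff[OF c], of k]
  obtain C where C: "C \<ge> 0" "\<And>g e. (\<forall>l. smooth_on (cimage c) (g l)) \<Longrightarrow> (\<forall>l. sbound k e K (g l)) \<Longrightarrow> e \<ge> 0 \<Longrightarrow>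
    sbound k (C * e) K (\<lambda>x. \<Sum>l\<in>UNIV. frame_coeff c l j x * g l x)" by blast
  have "sbound k (C * e) K (cof X j \<circ> chart_inv c)"
    if X: "X \<in> smooth_vfields A" "e \<ge> 0" "sbound k e K (\<lambda>x. X c (chart_inv c x))" for X e
  proof (rule sbound_cong[OF open_cimage[OF c] K(2)])
    show "sbound k (C * e) K (\<lambda>x. \<Sum>l\<in>UNIV. frame_coeff c l j x * X c (chart_inv c x) $ l)"
      by (intro C allI smooth_on_nth open_cimage c vfield_smooth X sbound_nth[OF open_cimage[OF c] K(2)])
    show "(\<Sum>l\<in>UNIV. frame_coeff c l j x * X c (chart_inv c x) $ l) = (cof X j \<circ> chart_inv c) x" if "x \<in> cimage c" for x
      using cof_chart[OF X(1) c that] by simp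
  qed
  then show ?thesis using C(1) by blast
qed

text \<open>The compact sets carrying the weights cover the manifold, as the weights sum to 1. So
  finitely many seminorms see every point.\<close>

lemma pou_compacts:
  "\<exists>K :: 'a chart \<times> ('a \<Rightarrow> real) \<Rightarrow> (real^3) set. (\<forall>q\<in>pou. compact (K q) \<and> K q \<subseteq> cimage (fst q)) \<and>
    (\<forall>p. \<exists>q\<in>pou. p \<in> cdom (fst q) \<and> coord (fst q) p \<in> K q)"
proof -
  have "\<forall>q\<in>pou. \<exists>Z. compact Z \<and> Z \<subseteq> cdom (fst q) \<and> (\<forall>p. p \<notin> Z \<longrightarrow> snd q p = 0)"
    using pou(5) unfolding supported_in_def by blast
  then obtain Z where Z: "\<And>q. q \<in> pou \<Longrightarrow> compact (Z q)" "\<And>q. q \<in> pou \<Longrightarrow> Z q \<subseteq> cdom (fst q)"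
    "\<And>q p. q \<in> pou \<Longrightarrow> p \<notin> Z q \<Longrightarrow> snd q p = 0" by metis
  have "\<exists>q\<in>pou. p \<in> Z q" for p
  proof (rule ccontr)
    assume "\<not> (\<exists>q\<in>pou. p \<in> Z q)"
    then have "(\<Sum>q\<in>pou. snd q p) = 0" using Z(3) by (intro sum.neutral) auto
    then show False using pou(6)[of p] by simp
  qed
  moreover have "compact (coord (fst q) ` Z q)" "coord (fst q) ` Z q \<subseteq> cimage (fst q)" if "q \<in> pou" for q
    using compact_coord_image[OF pou(2)[OF that] Z(1,2)[OF that]] Z(2)[OF that] by (auto simp: cimage_def)
  ultimately show ?thesis
    using Z(2) by (intro exI[of _ "\<lambda>q. coord (fst q) ` Z q"]) (meson image_eqI subsetD)
qed

text \<open>Each frame derivative is a combination of coordinate derivatives with coefficients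
  bounded on \<open>K q\<close>; the induction uses up one order of \<open>sbound\<close> per frame
  derivative.\<close>

lemma cbound_sbound:
  fixes K :: "'a chart \<times> ('a \<Rightarrow> real) \<Rightarrow> (real^3) set"
  assumes K: "\<And>q. q \<in> pou \<Longrightarrow> compact (K q)" "\<And>q. q \<in> pou \<Longrightarrow> K q \<subseteq> cimage (fst q)"
    and cover: "\<And>p. \<exists>q\<in>pou. p \<in> cdom (fst q) \<and> coord (fst q) p \<in> K q"
  shows "\<exists>C\<ge>0. \<forall>b e. smooth_fun A b \<longrightarrow> e \<ge> 0 \<longrightarrow> (\<forall>q\<in>pou. sbound k e (K q) (b \<circ> chart_inv (fst q))) \<longrightarrow> cbound k (C * e) b"
proof (induction k)
  case 0
  have "\<bar>b p\<bar> \<le> e" if b: "\<forall>q\<in>pou. sbound 0 e (K q) (b \<circ> chart_inv (fst q))" for b :: "'a \<Rightarrow> real" and p e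
  proof -
    obtain q where q: "q \<in> pou" "p \<in> cdom (fst q)" "coord (fst q) p \<in> K q" using cover by blast
    then show ?thesis using b pou(2)[OF q(1)] by fastforce
  qed
  then show ?case by (intro exI[of _ 1]) auto
next
  case (Suc k)
  obtain C where C: "C \<ge> 0" "\<And>b e. smooth_fun A b \<Longrightarrow> e \<ge> 0 \<Longrightarrow> (\<forall>q\<in>pou. sbound k e (K q) (b \<circ> chart_inv (fst q))) \<Longrightarrow> cbound k (C * e) b"
    using Suc by blast
  have "\<forall>i. \<forall>q\<in>pou. \<exists>D\<ge>0. \<forall>b e. smooth_fun A (b :: 'a \<Rightarrow> real) \<longrightarrow> e \<ge> 0 \<longrightarrow> sbound (Suc k) e (K q) (b \<circ> chart_inv (fst q)) \<longrightarrow>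
    sbound k (D * e) (K q) (d i b \<circ> chart_inv (fst q))"
    using sbound_d[OF pou(2) K] by blast
  then obtain D where D: "\<And>i q. q \<in> pou \<Longrightarrow> D i q \<ge> 0" "\<And>i q b e. q \<in> pou \<Longrightarrow> smooth_fun A (b :: 'a \<Rightarrow> real) \<Longrightarrow> e \<ge> 0 \<Longrightarrow>
    sbound (Suc k) e (K q) (b \<circ> chart_inv (fst q)) \<Longrightarrow> sbound k (D i q * e) (K q) (d i b \<circ> chart_inv (fst q))"
    by metis
  define B where "B = 1 + (\<Sum>i\<in>UNIV. \<Sum>q\<in>pou. D i q)"
  have DB: "D i q \<le> B" if "q \<in> pou" for i q
  proof -
    have "D i q \<le> (\<Sum>q\<in>pou. D i q)" by (rule member_le_sum) (use D(1) pou(1) that in auto)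
    also have "\<dots> \<le> (\<Sum>i\<in>UNIV. \<Sum>q\<in>pou. D i q)"
      by (rule member_le_sum[of i UNIV "\<lambda>i. \<Sum>q\<in>pou. D i q"]) (use D(1) in \<open>auto intro!: sum_nonneg\<close>)
    finally show ?thesis by (simp add: B_def)
  qed
  have B1: "1 \<le> B" using D(1) by (auto simp: B_def intro!: sum_nonneg)
  have "cbound (Suc k) (C * B * e) b"
    if b: "smooth_fun A b" "e \<ge> 0" "\<forall>q\<in>pou. sbound (Suc k) e (K q) (b \<circ> chart_inv (fst q))" for b e
  proof -
    have "cbound k (C * e) b" using b by (intro C) auto
    moreover have "C * e \<le> C * (B * e)" using C(1) B1 b(2) mult_right_mono[OF B1 b(2)] by (intro mult_left_mono) auto
    moreover have "cbound k (C * (B * e)) (d i b)" for i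
    proof (rule C(2)[OF smooth_d[OF b(1)]])
      show "\<forall>q\<in>pou. sbound k (B * e) (K q) (d i b \<circ> chart_inv (fst q))"
        using sbound_mono[OF D(2)] DB b by (meson mult_right_mono)
    qed (use B1 b in auto)
    ultimately show ?thesis using cbound_mono[of k "C * e" b "C * (B * e)"] by (simp add: mult.assoc)
  qed
  moreover have "0 \<le> C * B" using C(1) B1 by simp
  ultimately show ?case by blast
qed

end

section \<open>Neighbourhoods and lines in the smooth topology\<close>

lemma openin_vfield_nhd:
  "X \<in> smooth_vfields A \<Longrightarrow> c \<in> A \<Longrightarrow> compact K \<Longrightarrow> K \<subseteq> cimage c \<Longrightarrow> e > 0 \<Longrightarrow>
    openin (vfield_topology A) (vfield_nhd A X c K is e)"
  unfolding vfield_topology_def by (rule topology_generated_by_Basis) blast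

lemma self_in_vfield_nhd: "X \<in> smooth_vfields A \<Longrightarrow> 0 < e \<Longrightarrow> X \<in> vfield_nhd A X c K is e"
proof -
  have "iter_partial is (\<lambda>y. 0 :: real^3) = (\<lambda>y. 0)" by (induction "is") auto
  then show "X \<in> smooth_vfields A \<Longrightarrow> 0 < e \<Longrightarrow> ?thesis" by (simp add: vfield_nhd_def)
qed

lemma vfield_nhd_subset: "vfield_nhd A X c K is e \<subseteq> smooth_vfields A"
  by (auto simp: vfield_nhd_def)

lemma (in atlas) topspace_vfield_topology: "topspace (vfield_topology A) = smooth_vfields A"
proof (rule antisym)
  show "topspace (vfield_topology A) \<subseteq> smooth_vfields A"
    using vfield_nhd_subset by (fastforce simp: vfield_topology_def topology_generated_by_topspace)
  show "smooth_vfields A \<subseteq> topspace (vfield_topology A)"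
  proof
    fix X assume X: "X \<in> smooth_vfields A"
    obtain c where c: "c \<in> A" using charts_cover by blast
    \<comment> \<open>With an empty compact set the bound is void, so this basic set is the whole
      space.\<close>
    have "X \<in> vfield_nhd A X c {} [] 1" using X by (rule self_in_vfield_nhd) simp
    moreover have "openin (vfield_topology A) (vfield_nhd A X c {} [] 1)" using X c by (intro openin_vfield_nhd) auto
    ultimately show "X \<in> topspace (vfield_topology A)" using openin_subset by blast
  qed
qed

context frame
begin

text \<open>Smallness of all derivatives up to order \<open>k\<close> on the finitely many compact
  sets of \<open>pou_compacts\<close> is an open condition, and it bounds the frame coefficients of
  \<open>Y - X\<close>.\<close>

lemma cof_nhd:
  assumes X: "X \<in> smooth_vfields A" and e: "e > 0"
  shows "\<exists>T. openin (vfield_topology A) T \<and> X \<in> T \<and> (\<forall>Y\<in>T. \<forall>j. cbound k e (cof (\<lambda>c p. Y c p + (-1) *\<^sub>R X c p) j))"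
proof -
  obtain K where K: "\<And>q. q \<in> pou \<Longrightarrow> compact (K q)" "\<And>q. q \<in> pou \<Longrightarrow> K q \<subseteq> cimage (fst q)"
    and cover: "\<And>p. \<exists>q\<in>pou. p \<in> cdom (fst q) \<and> coord (fst q) p \<in> K q" using pou_compacts by metis
  obtain C where C: "C \<ge> 0" "\<And>b e. smooth_fun A b \<Longrightarrow> e \<ge> 0 \<Longrightarrow> (\<forall>q\<in>pou. sbound k e (K q) (b \<circ> chart_inv (fst q))) \<Longrightarrow> cbound k (C * e) b"
    using cbound_sbound[OF K cover, of k] by blast
  have "\<forall>j. \<forall>q\<in>pou. \<exists>D\<ge>0. \<forall>W e. W \<in> smooth_vfields A \<longrightarrow> e \<ge> 0 \<longrightarrow> sbound k e (K q) (\<lambda>x. W (fst q) (chart_inv (fst q) x)) \<longrightarrow>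
    sbound k (D * e) (K q) (cof W j \<circ> chart_inv (fst q))"
    using sbound_cof[OF pou(2) K] by blast
  then obtain D where D: "\<And>j q. q \<in> pou \<Longrightarrow> D j q \<ge> 0" "\<And>j q W e. q \<in> pou \<Longrightarrow> W \<in> smooth_vfields A \<Longrightarrow> e \<ge> 0 \<Longrightarrow>
    sbound k e (K q) (\<lambda>x. W (fst q) (chart_inv (fst q) x)) \<Longrightarrow> sbound k (D j q * e) (K q) (cof W j \<circ> chart_inv (fst q))"
    by metis
  define B where "B = 1 + (\<Sum>i\<in>UNIV. \<Sum>q\<in>pou. D i q)"
  have DB: "D i q \<le> B" if "q \<in> pou" for i q
  proof -
    have "D i q \<le> (\<Sum>q\<in>pou. D i q)" by (rule member_le_sum) (use D(1) pou(1) that in auto)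
    also have "\<dots> \<le> (\<Sum>i\<in>UNIV. \<Sum>q\<in>pou. D i q)"
      by (rule member_le_sum[of i UNIV "\<lambda>i. \<Sum>q\<in>pou. D i q"]) (use D(1) in \<open>auto intro!: sum_nonneg\<close>)
    finally show ?thesis by (simp add: B_def)
  qed
  have B1: "1 \<le> B" using D(1) by (auto simp: B_def intro!: sum_nonneg)
  \<comment> \<open>\<open>B\<close> converts component bounds into coefficient bounds in each
    chart, and \<open>C\<close> chart bounds into bounds along the frame.\<close>
  define s where "s = e / ((C + 1) * B)"
  have s: "s > 0" "C * (B * s) \<le> e"
  proof -
    have CB: "(C + 1) * B > 0" using B1 C(1) by (intro mult_pos_pos) auto
    then show "s > 0" using e by (simp add: s_def)
    have "C * (B * s) \<le> (C + 1) * B * s" using B1 C(1) \<open>s > 0\<close> by (simp add: distrib_right)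
    also have "\<dots> = e" unfolding s_def using B1 C(1) by (simp add: add_nonneg_eq_0_iff)
    finally show "C * (B * s) \<le> e" .
  qed
  define L where "L = {is :: 3 list. length is \<le> k}"
  have L: "finite L" using finite_lists_length_le[of "UNIV :: 3 set" k] by (simp add: L_def)
  \<comment> \<open>A finite intersection over partition members and index lists; the factor
    \<open>smooth_vfields A\<close> gives the empty intersection its right value in the induction
    below.\<close>
  define V where "V = smooth_vfields A \<inter> (\<Inter>(q, is) \<in> pou \<times> L. vfield_nhd A X (fst q) (K q) is s)"
  have "openin (vfield_topology A) (smooth_vfields A \<inter> (\<Inter>(q, is) \<in> J. vfield_nhd A X (fst q) (K q) is s))"
    if "finite J" "J \<subseteq> pou \<times> L" for J
    using that
  proof (induction J)
    case empty
    show ?case using openin_topspace[of "vfield_topology A"] by (simp add: topspace_vfield_topology)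
  next
    case (insert r J)
    then have "fst r \<in> pou" by auto
    then have "openin (vfield_topology A) (vfield_nhd A X (fst (fst r)) (K (fst r)) (snd r) s)"
      by (intro openin_vfield_nhd X s(1) pou(2) K)
    moreover have "smooth_vfields A \<inter> (\<Inter>(q, is) \<in> insert r J. vfield_nhd A X (fst q) (K q) is s)
      = vfield_nhd A X (fst (fst r)) (K (fst r)) (snd r) s \<inter> (smooth_vfields A \<inter> (\<Inter>(q, is) \<in> J. vfield_nhd A X (fst q) (K q) is s))"
      by (simp add: case_prod_beta) blast
    ultimately show ?case using insert by auto
  qed
  from this[of "pou \<times> L"] have "openin (vfield_topology A) V" using pou(1) L by (simp add: V_def)
  moreover have "X \<in> V" using X s(1) by (auto simp: V_def self_in_vfield_nhd)
  moreover have "cbound k e (cof (\<lambda>c p. Y c p + (-1) *\<^sub>R X c p) j)" if Y: "Y \<in> V" for Y j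
  proof -
    define W where "W = (\<lambda>c p. Y c p + (-1) *\<^sub>R X c p)"
    have W: "W \<in> smooth_vfields A" unfolding W_def using Y by (intro vfield_lincomb X) (auto simp: V_def)
    have "sbound k s (K q) (\<lambda>x. W (fst q) (chart_inv (fst q) x))" if q: "q \<in> pou" for q
    proof (rule sbound_if_iter_partial)
      fix "is" :: "3 list" and x assume "length is \<le> k" "x \<in> K q"
      then have "Y \<in> vfield_nhd A X (fst q) (K q) is s" using Y q by (auto simp: V_def L_def)
      then show "norm (iter_partial is (\<lambda>x. W (fst q) (chart_inv (fst q) x)) x) \<le> s"
        using \<open>x \<in> K q\<close> by (auto simp: vfield_nhd_def W_def intro: less_imp_le)
    qed
    then have "sbound k (D j q * s) (K q) (cof W j \<circ> chart_inv (fst q))" if "q \<in> pou" for q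
      using D(2)[OF that W] s(1) that by simp
    then have "sbound k (B * s) (K q) (cof W j \<circ> chart_inv (fst q))" if "q \<in> pou" for q
      using sbound_mono mult_right_mono[OF DB[OF that]] s(1) that by (meson less_imp_le)
    then have "cbound k (C * (B * s)) (cof W j)"
      using B1 s(1) by (intro C(2) smooth_cof W) auto
    then show ?thesis using s(2) unfolding W_def[symmetric] by (rule cbound_mono)
  qed
  ultimately show ?thesis by blast
qed

end

lemma iter_partial_lincomb:
  assumes U: "open U" and "smooth_on U g" "smooth_on U h" "x \<in> U"
  shows "iter_partial is (\<lambda>x. g x + t *\<^sub>R h x) x = iter_partial is g x + t *\<^sub>R iter_partial is h x"
  using assms(4)
proof (induction "is" arbitrary: x)
  case (Cons i "is")
  have dg: "iter_partial is g differentiable at x" and dh: "iter_partial is h differentiable at x"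
    using assms(2,3) Cons.prems by (auto simp: smooth_on_def)
  have "partial_deriv i (iter_partial is (\<lambda>x. g x + t *\<^sub>R h x)) x
    = partial_deriv i (\<lambda>x. iter_partial is g x + t *\<^sub>R iter_partial is h x) x"
    by (rule partial_deriv_cong_open[OF U Cons.prems Cons.IH])
  also have "\<dots> = partial_deriv i (iter_partial is g) x + partial_deriv i (\<lambda>x. t *\<^sub>R iter_partial is h x) x"
    by (rule partial_deriv_add[OF dg]) (use dh in simp)
  also have "partial_deriv i (\<lambda>x. t *\<^sub>R iter_partial is h x) x = t *\<^sub>R partial_deriv i (iter_partial is h) x"
    by (rule partial_deriv_bounded_linear[OF bounded_linear_scaleR_right dh])
  finally show ?case by simp
qed simp

text \<open>Continuity of straight lines at parameter 0, by induction over the generated topology.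
  On a generator the strict inequality leaves room, because the supremum over a compact set is
  attained.\<close>

lemma (in atlas) vfield_line_nhd:
  assumes "openin (vfield_topology A) T" and X: "X \<in> T" and W: "W \<in> smooth_vfields A"
  shows "\<exists>s>0. \<forall>t. \<bar>t\<bar> < s \<longrightarrow> (\<lambda>c p. X c p + t *\<^sub>R W c p) \<in> T"
proof -
  have XA: "X \<in> smooth_vfields A" using openin_subset[OF assms(1)] X topspace_vfield_topology by blast
  have "generate_topology_on {vfield_nhd A Z c K is e | Z c K is e.
        Z \<in> smooth_vfields A \<and> c \<in> A \<and> compact K \<and> K \<subseteq> cimage c \<and> e > 0} T"
    using assms(1) unfolding vfield_topology_def openin_topology_generated_by_iff .
  then show ?thesis using X
  proof induction
    case (Int a b)
    then obtain s r where "s > 0" "\<And>t. \<bar>t\<bar> < s \<Longrightarrow> (\<lambda>c p. X c p + t *\<^sub>R W c p) \<in> a"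
      "r > 0" "\<And>t. \<bar>t\<bar> < r \<Longrightarrow> (\<lambda>c p. X c p + t *\<^sub>R W c p) \<in> b" by blast
    then show ?case by (intro exI[of _ "min s r"]) simp
  next
    case (UN F)
    then obtain k where k: "k \<in> F" "X \<in> k" by blast
    from UN.IH[OF this] k(1) show ?case by blast
  next
    case (Basis B)
    then obtain Z c K "is" e where B: "B = vfield_nhd A Z c K is e" and Z: "Z \<in> smooth_vfields A" and c: "c \<in> A"
      and K: "compact K" "K \<subseteq> cimage c" by blast
    let ?g = "\<lambda>x. X c (chart_inv c x) - Z c (chart_inv c x)" and ?h = "\<lambda>x. W c (chart_inv c x)"
    have g: "smooth_on (cimage c) ?g" and h: "smooth_on (cimage c) ?h"
      by (intro smooth_on_diff open_cimage c vfield_smooth XA Z W)+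
    have lt: "norm (iter_partial is ?g x) < e" if "x \<in> K" for x using Basis.prems that by (simp add: B vfield_nhd_def)
    have split: "(\<lambda>x. X c (chart_inv c x) + t *\<^sub>R W c (chart_inv c x) - Z c (chart_inv c x)) = (\<lambda>x. ?g x + t *\<^sub>R ?h x)" for t
      by (simp add: algebra_simps)
    have sm: "(\<lambda>c p. X c p + t *\<^sub>R W c p) \<in> smooth_vfields A" for t by (rule vfield_lincomb[OF XA W])
    show ?case
    proof (cases "K = {}")
      case True
      then show ?thesis using sm by (intro exI[of _ 1]) (simp add: B vfield_nhd_def)
    next
      case False
      have cont: "continuous_on K (\<lambda>x. norm (iter_partial is ?g x))" "continuous_on K (\<lambda>x. norm (iter_partial is ?h x))"
        using smooth_on_continuous[OF smooth_on_iter_partial[OF g]] smooth_on_continuous[OF smooth_on_iter_partial[OF h]] K(2)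
        by (auto intro!: continuous_on_norm intro: continuous_on_subset)
      obtain x0 where x0: "x0 \<in> K" "\<And>x. x \<in> K \<Longrightarrow> norm (iter_partial is ?g x) \<le> norm (iter_partial is ?g x0)"
        using continuous_attains_sup[OF K(1) False cont(1)] by blast
      obtain x1 where x1: "\<And>x. x \<in> K \<Longrightarrow> norm (iter_partial is ?h x) \<le> norm (iter_partial is ?h x1)"
        using continuous_attains_sup[OF K(1) False cont(2)] by blast
      define a b where "a = norm (iter_partial is ?g x0)" and "b = norm (iter_partial is ?h x1)"
      have ab: "a < e" "b \<ge> 0" using lt[OF x0(1)] by (auto simp: a_def b_def)
      \<comment> \<open>\<open>e - a\<close> is the room left by the field itself, and
        \<open>b\<close> bounds the derivative of the direction.\<close>
      define s where "s = (e - a) / (b + 1)"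
      have s: "s > 0" using ab by (simp add: s_def)
      have "norm (iter_partial is (\<lambda>x. ?g x + t *\<^sub>R ?h x) x) < e" if t: "\<bar>t\<bar> < s" and x: "x \<in> K" for t x
      proof -
        have "iter_partial is (\<lambda>x. ?g x + t *\<^sub>R ?h x) x = iter_partial is ?g x + t *\<^sub>R iter_partial is ?h x"
          by (rule iter_partial_lincomb[OF open_cimage[OF c] g h]) (use x K in blast)
        also have "norm \<dots> \<le> norm (iter_partial is ?g x) + \<bar>t\<bar> * norm (iter_partial is ?h x)"
          using norm_triangle_ineq[of "iter_partial is ?g x" "t *\<^sub>R iter_partial is ?h x"] by simp
        also have "\<dots> \<le> a + \<bar>t\<bar> * b"
          using x0(2)[OF x] x1[OF x] by (intro add_mono mult_left_mono) (simp_all add: a_def b_def)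
        also have "\<dots> \<le> a + \<bar>t\<bar> * (b + 1)" by (simp add: algebra_simps)
        also have "\<dots> < e" using t ab by (simp add: s_def pos_less_divide_eq)
        finally show ?thesis .
      qed
      then show ?thesis using s sm by (intro exI[of _ s]) (auto simp: B vfield_nhd_def split)
    qed
  qed simp
qed

section \<open>Openness and density of the regular frames\<close>

lemma triple_cases:
  obtains w :: "3 \<Rightarrow> 'b" where "V = (w 1, w 2, w 3)"
  by (rule that[of "\<lambda>i. if i = 1 then fst V else if i = 2 then fst (snd V) else snd (snd V)"]) simp

context volume_manifold
begin

lemma divergence_free_lincomb:
  assumes X: "X \<in> smooth_vfields A" "divergence_free A dvol X" and Y: "Y \<in> smooth_vfields A" "divergence_free A dvol Y"
  shows "divergence_free A dvol (\<lambda>c p. X c p + t *\<^sub>R Y c p)"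
proof (rule divergence_freeI[OF vfield_lincomb[OF X(1) Y(1)]])
  fix f :: "'a \<Rightarrow> real" assume f: "smooth_fun A f"
  have cX: "continuous_on UNIV (dir_deriv A X f)" and cY: "continuous_on UNIV (dir_deriv A Y f)"
    by (intro smooth_fun_continuous smooth_dir_deriv X Y f)+
  have "dir_deriv A (\<lambda>c p. X c p + t *\<^sub>R Y c p) f = (\<lambda>p. dir_deriv A X f p + t * dir_deriv A Y f p)"
    using dir_deriv_lincomb[OF X(1) Y(1) f] by (simp add: fun_eq_iff)
  moreover have "vint (\<lambda>p. dir_deriv A X f p + t * dir_deriv A Y f p) = vint (dir_deriv A X f) + t * vint (dir_deriv A Y f)"
    by (simp add: vint_add vint_cmult cX cY continuous_on_mult_left)
  ultimately show "vint (dir_deriv A (\<lambda>c p. X c p + t *\<^sub>R Y c p) f) = 0"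
    using vint_dir_deriv_zero[OF X f] vint_dir_deriv_zero[OF Y f] by simp
qed

lemma div_free_frames_iff: "(w 1, w 2, w 3) \<in> div_free_frames A dvol \<longleftrightarrow> frame A dvol w"
proof
  assume V: "(w 1, w 2, w 3) \<in> div_free_frames A dvol"
  have "w i \<in> smooth_vfields A" "divergence_free A dvol (w i)" for i
    using V exhaust_3[of i] by (auto simp: div_free_frames_def)
  then show "frame A dvol w" using V by unfold_locales (auto simp: div_free_frames_def)
next
  assume "frame A dvol w"
  then interpret F: frame A dvol w .
  show "(w 1, w 2, w 3) \<in> div_free_frames A dvol"
    using F.v_smooth F.v_div F.v_pos by (simp add: div_free_frames_def)
qed

lemma fueter_op_lincomb:
  assumes "\<And>i. u i \<in> smooth_vfields A" "\<And>i. w i \<in> smooth_vfields A" "smooth_fun A f"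
  shows "fueter_op (\<lambda>i c p. u i c p + t *\<^sub>R w i c p) f p = fueter_op u f p + t *\<^sub>R fueter_op w f p"
  using assms by (simp add: fueter_op_def dir_deriv_lincomb unit_mult_add unit_mult_scaleR sum.distrib scaleR_sum_right)

end

context frame
begin

lemma regular_frame_iff: "regular_frame A (v 1, v 2, v 3) \<longleftrightarrow> (\<forall>f\<in>ker. \<exists>q. \<forall>p. f p = q)"
  unfolding regular_frame_def ker_def fueter_eq_fueter_op dirac_def by blast

text \<open>Along the line the volume of the triple is a cubic polynomial in \<open>t\<close> with
  bounded coefficients, whose constant term is bounded below by compactness.\<close>

lemma frame_line:
  assumes w: "\<And>i. w i \<in> smooth_vfields A" "\<And>i. divergence_free A dvol (w i)"
  shows "\<exists>s>0. \<forall>t. \<bar>t\<bar> < s \<longrightarrow> frame A dvol (\<lambda>i c p. v i c p + t *\<^sub>R w i c p)"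
proof -
  \<comment> \<open>\<open>P1\<close>, \<open>P2\<close> and \<open>P3\<close> are the coefficients
    of \<open>t\<close>, \<open>t^2\<close> and \<open>t^3\<close> in the volume of the perturbed
    triple.\<close>
  define P1 where "P1 p = vol3 (w 1) (v 2) (v 3) p + vol3 (v 1) (w 2) (v 3) p + vol3 (v 1) (v 2) (w 3) p" for p
  define P2 where "P2 p = vol3 (w 1) (w 2) (v 3) p + vol3 (v 1) (w 2) (w 3) p + vol3 (w 1) (v 2) (w 3) p" for p
  define P3 where "P3 = vol3 (w 1) (w 2) (w 3)"
  have "smooth_fun A P1" "smooth_fun A P2" "smooth_fun A P3"
    unfolding P1_def P2_def P3_def by (intro smooth_fun_add smooth_vol3 v_smooth w)+
  then obtain C1 C2 C3 where C: "C1 > 0" "\<And>p. \<bar>P1 p\<bar> \<le> C1" "C2 > 0" "\<And>p. \<bar>P2 p\<bar> \<le> C2" "C3 > 0" "\<And>p. \<bar>P3 p\<bar> \<le> C3"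
    using smooth_fun_bounded[of P1] smooth_fun_bounded[of P2] smooth_fun_bounded[of P3] by auto
  have "smooth_fun A (\<lambda>p. inverse (vol3 (v 1) (v 2) (v 3) p))"
    using vol3_frame_pos by (intro smooth_fun_inverse smooth_vol3) (auto simp: less_imp_neq[symmetric])
  then obtain B where B: "B > 0" "\<And>p. \<bar>inverse (vol3 (v 1) (v 2) (v 3) p)\<bar> \<le> B"
    using smooth_fun_bounded by (metis real_norm_def)
  have low: "inverse B \<le> vol3 (v 1) (v 2) (v 3) p" for p
    using B(2)[of p] vol3_frame_pos[of p] B(1) by (simp add: field_simps)
  \<comment> \<open>The bound 1 lets \<open>\<bar>t\<bar>\<close> dominate the higher
    powers.\<close>
  define s where "s = min 1 (inverse B / (C1 + C2 + C3))"
  have s: "s > 0" using B C by (simp add: s_def)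
  have "frame A dvol (\<lambda>i c p. v i c p + t *\<^sub>R w i c p)" if t: "\<bar>t\<bar> < s" for t
  proof
    show sm: "(\<lambda>c p. v i c p + t *\<^sub>R w i c p) \<in> smooth_vfields A" for i
      by (intro vfield_lincomb v_smooth w)
    show "divergence_free A dvol (\<lambda>c p. v i c p + t *\<^sub>R w i c p)" for i
      by (intro divergence_free_lincomb v_smooth v_div w)
    fix c p assume c: "c \<in> A" "p \<in> cdom c"
    have t1: "\<bar>t\<bar> \<le> 1" "\<bar>t\<bar> * (C1 + C2 + C3) < inverse B"
      using t C by (simp_all add: s_def pos_less_divide_eq)
    have t23: "\<bar>t\<^sup>2\<bar> \<le> \<bar>t\<bar>" "\<bar>t^3\<bar> \<le> \<bar>t\<bar>"
      using t1(1) power_decreasing[of 1 2 "\<bar>t\<bar>"] power_decreasing[of 1 3 "\<bar>t\<bar>"] by (simp_all add: power_abs)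
    have "\<bar>t * P1 p + t\<^sup>2 * P2 p + t^3 * P3 p\<bar> \<le> \<bar>t\<bar> * \<bar>P1 p\<bar> + \<bar>t\<^sup>2\<bar> * \<bar>P2 p\<bar> + \<bar>t^3\<bar> * \<bar>P3 p\<bar>"
      unfolding abs_mult[symmetric] by linarith
    also have "\<dots> \<le> \<bar>t\<bar> * C1 + \<bar>t\<bar> * C2 + \<bar>t\<bar> * C3"
      using t23 C by (intro add_mono mult_mono) auto
    also have "\<dots> < vol3 (v 1) (v 2) (v 3) p" using t1(2) low[of p] by (simp add: algebra_simps)
    finally have "0 < vol3 (v 1) (v 2) (v 3) p + t * P1 p + t\<^sup>2 * P2 p + t^3 * P3 p" by linarith
    also have "\<dots> = dvol c p (v 1 c p + t *\<^sub>R w 1 c p) (v 2 c p + t *\<^sub>R w 2 c p) (v 3 c p + t *\<^sub>R w 3 c p)"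
      unfolding dvol_rho[OF c] P1_def P2_def P3_def
      by (simp add: vol3_rho[OF _ _ _ c] w det3_def algebra_simps power2_eq_square power3_eq_cube)
    finally show "0 < dvol c p (v 1 c p + t *\<^sub>R w 1 c p) (v 2 c p + t *\<^sub>R w 2 c p) (v 3 c p + t *\<^sub>R w 3 c p)" .
  qed
  then show ?thesis using s by blast
qed

lemma regular_nhd:
  assumes reg: "regular_frame A (v 1, v 2, v 3)"
  shows "\<exists>T. openin (prod_topology (vfield_topology A) (prod_topology (vfield_topology A) (vfield_topology A))) T \<and>
    (v 1, v 2, v 3) \<in> T \<and> (\<forall>W \<in> T \<inter> div_free_frames A dvol. regular_frame A W)"
proof -
  have const: "\<exists>q. f = (\<lambda>p. q)" if "f \<in> ker" for f
  proof -
    from reg that have "\<exists>q. \<forall>p. f p = q" by (simp only: regular_frame_iff)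
    then show ?thesis by (simp only: fun_eq_iff)
  qed
  have "\<exists>k. \<exists>e>0. \<forall>w. (\<forall>i. w i \<in> smooth_vfields A) \<longrightarrow> (\<forall>i j. cbound k e (cof (w i) j)) \<longrightarrow>
    (\<forall>f. smooth_fun A f \<longrightarrow> (\<forall>p. dirac f p + fueter_op w f p = 0) \<longrightarrow> (\<exists>q. \<forall>p. f p = q))"
    by (rule regular_open[OF const])
  then obtain k e where e: "e > 0" and reg': "\<forall>w. (\<forall>i. w i \<in> smooth_vfields A) \<longrightarrow> (\<forall>i j. cbound k e (cof (w i) j)) \<longrightarrow>
    (\<forall>f. smooth_fun A f \<longrightarrow> (\<forall>p. dirac f p + fueter_op w f p = 0) \<longrightarrow> (\<exists>q. \<forall>p. f p = q))"
    by (elim exE conjE)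
  define T where "T i = (SOME T. openin (vfield_topology A) T \<and> v i \<in> T \<and>
    (\<forall>Y\<in>T. \<forall>j. cbound k e (cof (\<lambda>c p. Y c p + (-1) *\<^sub>R v i c p) j)))" for i
  have T': "openin (vfield_topology A) (T i) \<and> v i \<in> T i \<and>
    (\<forall>Y\<in>T i. \<forall>j. cbound k e (cof (\<lambda>c p. Y c p + (-1) *\<^sub>R v i c p) j))" for i
    unfolding T_def by (rule someI_ex) (rule cof_nhd[OF v_smooth e])
  then have T: "\<And>i. openin (vfield_topology A) (T i)" "\<And>i. v i \<in> T i"
    "\<And>i Y j. Y \<in> T i \<Longrightarrow> cbound k e (cof (\<lambda>c p. Y c p + (-1) *\<^sub>R v i c p) j)" by (rule conjunct1, simp, simp)
  let ?T = "T 1 \<times> T 2 \<times> T 3"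
  have "regular_frame A W" if W: "W \<in> ?T \<inter> div_free_frames A dvol" for W
  proof -
    obtain u :: "3 \<Rightarrow> 'a vfield" where u: "W = (u 1, u 2, u 3)" by (rule triple_cases[of W])
    interpret F: frame A dvol u using W u div_free_frames_iff by blast
    \<comment> \<open>The difference of the two frames; its Fueter operator is the difference of the
      two operators, so a solution for \<open>u\<close> solves the perturbed equation for
      \<open>v\<close>.\<close>
    define w where "w i = (\<lambda>c p. u i c p + (-1) *\<^sub>R v i c p)" for i
    have ui: "u i \<in> T i" for i using W exhaust_3[of i] by (auto simp: u)
    have w: "\<forall>i. w i \<in> smooth_vfields A" "\<forall>i j. cbound k e (cof (w i) j)"
      unfolding w_def by (intro allI vfield_lincomb F.v_smooth v_smooth T(3) ui)+
    have "\<exists>q. \<forall>p. f p = q" if f: "f \<in> F.ker" for f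
    proof (rule reg'[rule_format, OF w(1)[rule_format] w(2)[rule_format]])
      show sf: "smooth_fun A f" by (rule F.ker_smooth[OF f])
      have "fueter_op w f p = fueter_op u f p + (-1) *\<^sub>R fueter_op v f p" for p
        unfolding w_def by (rule fueter_op_lincomb[OF F.v_smooth v_smooth sf])
      moreover have "fueter_op u f p = 0" for p using F.ker_dirac[OF f] by (simp add: F.dirac_def fun_eq_iff)
      ultimately show "dirac f p + fueter_op w f p = 0" for p by (simp add: dirac_def)
    qed
    then show ?thesis unfolding u F.regular_frame_iff by blast
  qed
  moreover have "openin (prod_topology (vfield_topology A) (prod_topology (vfield_topology A) (vfield_topology A))) ?T"
    by (intro openin_prod_Times_iff[THEN iffD2] disjI2 conjI T)
  ultimately show ?thesis using T(2) by blast
qed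

lemma nonregular_improves:
  assumes conn: "connected (UNIV :: 'a set)" and nreg: "\<not> regular_frame A (v 1, v 2, v 3)"
    and T: "openin (prod_topology (vfield_topology A) (prod_topology (vfield_topology A) (vfield_topology A))) T"
    and v: "(v 1, v 2, v 3) \<in> T"
  shows "\<exists>u. frame A dvol u \<and> (u 1, u 2, u 3) \<in> T \<and> frame.kdim A dvol u < kdim"
proof -
  obtain f where "f \<in> ker" "\<not> (\<exists>q. \<forall>p. f p = q)" using nreg unfolding regular_frame_iff by blast
  from kernel_can_drop[OF conn this] obtain w t0 where w': "\<forall>i. w i \<in> smooth_vfields A \<and> divergence_free A dvol (w i)" and t0: "t0 > 0"
    and drop: "\<forall>t e m. 0 < t \<longrightarrow> t < t0 \<longrightarrow> (\<forall>i<m. smooth_fun A (e i) \<and> (\<forall>p. dirac (e i) p + t *\<^sub>R fueter_op w (e i) p = 0)) \<longrightarrow>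
      orthonormal e m \<longrightarrow> m < kdim" by (elim exE conjE)
  have w: "w i \<in> smooth_vfields A" "divergence_free A dvol (w i)" for i using w' by simp_all
  obtain s where s: "s > 0" "\<And>t. \<bar>t\<bar> < s \<Longrightarrow> frame A dvol (\<lambda>i c p. v i c p + t *\<^sub>R w i c p)"
    using frame_line[where w = w, OF w] by (elim exE conjE) simp
  obtain T1 T' where T1: "openin (vfield_topology A) T1" "openin (prod_topology (vfield_topology A) (vfield_topology A)) T'"
    "v 1 \<in> T1" "(v 2, v 3) \<in> T'" "T1 \<times> T' \<subseteq> T"
    using T v unfolding openin_prod_topology_alt by meson
  obtain T2 T3 where T2: "openin (vfield_topology A) T2" "openin (vfield_topology A) T3" "v 2 \<in> T2" "v 3 \<in> T3" "T2 \<times> T3 \<subseteq> T'"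
    using T1(2,4) unfolding openin_prod_topology_alt by meson
  obtain s1 where s1: "s1 > 0" "\<And>t. \<bar>t\<bar> < s1 \<Longrightarrow> (\<lambda>c p. v 1 c p + t *\<^sub>R w 1 c p) \<in> T1"
    using vfield_line_nhd[OF T1(1,3) w(1)] by blast
  obtain s2 where s2: "s2 > 0" "\<And>t. \<bar>t\<bar> < s2 \<Longrightarrow> (\<lambda>c p. v 2 c p + t *\<^sub>R w 2 c p) \<in> T2"
    using vfield_line_nhd[OF T2(1,3) w(1)] by blast
  obtain s3 where s3: "s3 > 0" "\<And>t. \<bar>t\<bar> < s3 \<Longrightarrow> (\<lambda>c p. v 3 c p + t *\<^sub>R w 3 c p) \<in> T3"
    using vfield_line_nhd[OF T2(2,4) w(1)] by blast
  \<comment> \<open>Half of the least bound: small enough for a frame, for membership in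
    \<open>T\<close> and for the drop of the dimension.\<close>
  define t where "t = min t0 (min s (min s1 (min s2 s3))) / 2"
  have t: "0 < t" "t < t0" "\<bar>t\<bar> < s" "\<bar>t\<bar> < s1" "\<bar>t\<bar> < s2" "\<bar>t\<bar> < s3"
    using t0 s(1) s1(1) s2(1) s3(1) unfolding t_def by (auto simp: min_def)
  define u where "u = (\<lambda>i c p. v i c p + t *\<^sub>R w i c p)"
  interpret F: frame A dvol u unfolding u_def by (rule s(2)[OF t(3)])
  \<comment> \<open>A maximal orthonormal family of the new kernel consists of solutions of the
    perturbed equation, so the drop applies to its length.\<close>
  obtain e where e: "\<forall>i<F.kdim. e i \<in> F.ker" "orthonormal e F.kdim" using F.kdim_family by blast
  have z: "dirac (e i) p + t *\<^sub>R fueter_op w (e i) p = 0" if "i < F.kdim" for i p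
  proof -
    have ei: "e i \<in> F.ker" using e(1) that by blast
    have "fueter_op u (e i) p = fueter_op v (e i) p + t *\<^sub>R fueter_op w (e i) p"
      unfolding u_def by (rule fueter_op_lincomb[OF v_smooth w(1) F.ker_smooth[OF ei]])
    moreover have "fueter_op u (e i) p = 0" using F.ker_dirac[OF ei] by (simp add: F.dirac_def fun_eq_iff)
    ultimately show ?thesis by (simp add: dirac_def)
  qed
  have "F.kdim < kdim"
    by (rule drop[rule_format, OF t(1,2) _ e(2)]) (use z e(1) F.ker_smooth in auto)
  moreover have "(u 1, u 2, u 3) \<in> T"
    using s1(2)[OF t(4)] s2(2)[OF t(5)] s3(2)[OF t(6)] T1(5) T2(5) by (auto simp: u_def)
  ultimately show ?thesis using F.frame_axioms by blast
qed

end

theorem lemma2p3: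
  fixes A :: "'a::{t2_space, second_countable_topology} chart set"
    and dvol :: "'a form3"
  assumes "compact (UNIV :: 'a set)"
    and "connected (UNIV :: 'a set)"
    and "oriented_smooth_atlas A"
    and "positive_volume_form A dvol"
  shows "openin (frame_topology A dvol) (regular_div_free_frames A dvol) \<and>
         frame_topology A dvol closure_of regular_div_free_frames A dvol = div_free_frames A dvol"
proof -
  interpret volume_manifold A dvol using assms by unfold_locales
  let ?P = "prod_topology (vfield_topology A) (prod_topology (vfield_topology A) (vfield_topology A))"
  let ?F = "div_free_frames A dvol" and ?R = "regular_div_free_frames A dvol"
  have top: "topspace (frame_topology A dvol) = ?F"
    by (auto simp: frame_topology_def topspace_vfield_topology div_free_frames_def)
  have "\<exists>T. openin (frame_topology A dvol) T \<and> V \<in> T \<and> T \<subseteq> ?R" if V: "V \<in> ?R" for V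
  proof -
    obtain v :: "3 \<Rightarrow> 'a vfield" where v: "V = (v 1, v 2, v 3)" by (rule triple_cases[of V])
    have VF: "V \<in> ?F" and reg: "regular_frame A V" using V by (auto simp: regular_div_free_frames_def)
    interpret frame A dvol v using VF unfolding v div_free_frames_iff .
    obtain T where T: "openin ?P T" "V \<in> T" "\<forall>W \<in> T \<inter> ?F. regular_frame A W"
      using regular_nhd[OF reg[unfolded v]] unfolding v by blast
    have "openin (frame_topology A dvol) (T \<inter> ?F)"
      unfolding frame_topology_def using T(1) by (auto simp: openin_subtopology)
    then show ?thesis using T(2,3) VF by (auto simp: regular_div_free_frames_def)
  qed
  then have "openin (frame_topology A dvol) ?R" by (subst openin_subopen) blast
  moreover have "\<exists>W\<in>?R. W \<in> T" if V: "V \<in> ?F" "V \<in> T" and T: "openin (frame_topology A dvol) T" for V T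
  proof -
    obtain T' where T': "openin ?P T'" "T = T' \<inter> ?F" using T unfolding frame_topology_def openin_subtopology by blast
    obtain v0 :: "3 \<Rightarrow> 'a vfield" where v0: "V = (v0 1, v0 2, v0 3)" by (rule triple_cases[of V])
    have "frame A dvol v0 \<and> (v0 1, v0 2, v0 3) \<in> T'" using V T'(2) unfolding v0 by (auto simp: div_free_frames_iff)
    \<comment> \<open>The set is nonempty, as it contains the given frame; a dimension is a natural
      number, so a least one is attained.\<close>
    then obtain v where v: "frame A dvol v" "(v 1, v 2, v 3) \<in> T'"
      and least: "\<And>u. frame A dvol u \<and> (u 1, u 2, u 3) \<in> T' \<Longrightarrow> frame.kdim A dvol v \<le> frame.kdim A dvol u"
      using ex_has_least_nat[of "\<lambda>v. frame A dvol v \<and> (v 1, v 2, v 3) \<in> T'" v0 "frame.kdim A dvol"] by blast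
    interpret frame A dvol v by (rule v)
    have "regular_frame A (v 1, v 2, v 3)"
    proof (rule ccontr)
      assume "\<not> regular_frame A (v 1, v 2, v 3)"
      then obtain u where "frame A dvol u" "(u 1, u 2, u 3) \<in> T'" "frame.kdim A dvol u < kdim"
        using nonregular_improves[OF assms(2) _ T'(1) v(2)] by blast
      then show False using least[of u] by simp
    qed
    then show ?thesis using v T'(2) by (intro bexI[of _ "(v 1, v 2, v 3)"]) (auto simp: regular_div_free_frames_def div_free_frames_iff)
  qed
  then have "frame_topology A dvol closure_of ?R = ?F"
    unfolding closure_of_def top by blast
  ultimately show ?thesis by blast
qed

end
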